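(* Let $R$ be a commutative coherent ring, let $M$ be a finitely presented $R$-module, let $\boldsymbol a=(a_1,\ldots,a_r)$ be a finite sequence generating the ideal $\mathrm{Ann}_R M$, and choose a finite free presentation $R^p\xrightarrow{d}R^q\to M\to 0$ (with $p,q$ finite). Then the bounded complex of finite free modules $$X_M=[R^p\xrightarrow{d}R^q]\otimes_R \mathrm K_R(\boldsymbol a),$$ with the presentation complex $[R^p\xrightarrow{d}R^q]$ placed in degrees $1,0$, satisfies $$H_0(X_M)\cong M,\qquad H_j(X_M)\in\mathrm{ab}_R(M)\ \text{ for all } j\in\mathbb Z,\qquad \mathrm{Supp}_R X_M=\mathrm{Supp}_R M.$$ For $M=0$, one may instead take $X_M=0$.
   Context: All rings are commutative with identity. A ring is coherent if each of its finitely generated ideals is finitely presented as a module. $\mathrm{mod}\,R$ is the category of finitely presented $R$-modules (abelian for coherent $R$). $\mathrm{Ann}_R M=\{r\in R:rM=0\}$; it is a finitely generated ideal when $R$ is coherent and $M$ finitely presented. Complexes are homologically indexed and $H_j$ is homology in degree $j$. $\mathrm K_R(\boldsymbol a)$ is the homological Koszul complex on $\boldsymbol a$: the total tensor product $\bigotimes_{j=1}^r[R\xrightarrow{a_j}R]$, each factor in degrees $1,0$, with the usual tensor differential; it lies in degrees $0,\ldots,r$, and $\mathrm K_R(\varnothing)=R[0]$ ($R$ in degree $0$). $\mathrm{ab}_R(M)$ is the smallest full, isomorphism-closed subcategory of $\mathrm{mod}\,R$ containing $M$ and closed under finite direct sums, kernels and cokernels. $\mathrm{Supp}_R M=\{\mathfrak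 p\in\mathrm{Spec}\,R:M_{\mathfrak p}\ne0\}$ for a module $M$, and $\mathrm{Supp}_R P=\{\mathfrak p\in\mathrm{Spec}\,R:P_{\mathfrak p}\not\simeq0\}$ for a perfect complex $P$, where $\not\simeq 0$ means nonzero in the derived category. *)

theory Defs
  imports "HOL-Algebra.Module" "HOL-Algebra.Ideal"
begin

section \<open>Modules and their homomorphisms\<close>

text \<open>
  A module is a record that satisfies the locale predicate \<^locale>\<open>module\<close>. That locale ignores
  the fields \<^const>\<open>mult\<close> and \<^const>\<open>one\<close> of the record, which are therefore left
  unspecified below.
\<close>

definition mk_module :: "'m set \<Rightarrow> 'm \<Rightarrow> ('m \<Rightarrow> 'm \<Rightarrow> 'm) \<Rightarrow> ('a \<Rightarrow> 'm \<Rightarrow> 'm) \<Rightarrow> ('a, 'm) module" where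
  "mk_module A z p s =
     \<lparr>carrier = A, mult = undefined, one = undefined, zero = z, add = p, smult = s\<rparr>"

definition module_hom ::
  "('a, 'c) ring_scheme \<Rightarrow> ('a, 'm, 'd) module_scheme \<Rightarrow> ('a, 'n, 'e) module_scheme \<Rightarrow> ('m \<Rightarrow> 'n) set"
where
  "module_hom R M N =
     {f \<in> carrier M \<rightarrow> carrier N.
        (\<forall>x\<in>carrier M. \<forall>y\<in>carrier M. f (x \<oplus>\<^bsub>M\<^esub> y) = f x \<oplus>\<^bsub>N\<^esub> f y) \<and>
        (\<forall>r\<in>carrier R. \<forall>x\<in>carrier M. f (r \<odot>\<^bsub>M\<^esub> x) = r \<odot>\<^bsub>N\<^esub> f x)}"

definition module_iso ::
  "('a, 'c) ring_scheme \<Rightarrow> ('a, 'm, 'd) module_scheme \<Rightarrow> ('a, 'n, 'e) module_scheme \<Rightarrow> bool"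
where
  "module_iso R M N \<longleftrightarrow> (\<exists>f\<in>module_hom R M N. bij_betw f (carrier M) (carrier N))"

definition zero_module :: "('a, unit) module" where
  "zero_module = mk_module {()} () (\<lambda>_ _. ()) (\<lambda>_ _. ())"

definition is_zero_module :: "('a, 'm, 'd) module_scheme \<Rightarrow> bool" where
  "is_zero_module M \<longleftrightarrow> carrier M = {\<zero>\<^bsub>M\<^esub>}"

definition regular_module :: "('a, 'c) ring_scheme \<Rightarrow> ('a, 'a) module" where
  "regular_module R = mk_module (carrier R) \<zero>\<^bsub>R\<^esub> (\<lambda>x y. x \<oplus>\<^bsub>R\<^esub> y) (\<lambda>r x. r \<otimes>\<^bsub>R\<^esub> x)"

text \<open>
  The free module with basis \<open>B\<close>, for finite \<open>B\<close>: all functions from \<open>B\<close> to \<open>R\<close>, extended by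
  \<^const>\<open>undefined\<close> outside \<open>B\<close>.
\<close>

definition free_module :: "('a, 'c) ring_scheme \<Rightarrow> 'b set \<Rightarrow> ('a, 'b \<Rightarrow> 'a) module" where
  "free_module R B =
     mk_module (B \<rightarrow>\<^sub>E carrier R) (\<lambda>b\<in>B. \<zero>\<^bsub>R\<^esub>) (\<lambda>x y. \<lambda>b\<in>B. x b \<oplus>\<^bsub>R\<^esub> y b) (\<lambda>r x. \<lambda>b\<in>B. r \<otimes>\<^bsub>R\<^esub> x b)"

definition basis_vector :: "('a, 'c) ring_scheme \<Rightarrow> 'b set \<Rightarrow> 'b \<Rightarrow> 'b \<Rightarrow> 'a" where
  "basis_vector R B b = (\<lambda>c\<in>B. if c = b then \<one>\<^bsub>R\<^esub> else \<zero>\<^bsub>R\<^esub>)"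

definition direct_sum :: "('a, 'm, 'd) module_scheme \<Rightarrow> ('a, 'n, 'e) module_scheme \<Rightarrow> ('a, 'm \<times> 'n) module" where
  "direct_sum M N = mk_module (carrier M \<times> carrier N) (\<zero>\<^bsub>M\<^esub>, \<zero>\<^bsub>N\<^esub>)
     (\<lambda>(x, y) (x', y'). (x \<oplus>\<^bsub>M\<^esub> x', y \<oplus>\<^bsub>N\<^esub> y')) (\<lambda>r (x, y). (r \<odot>\<^bsub>M\<^esub> x, r \<odot>\<^bsub>N\<^esub> y))"

text \<open>
  The quotient by a submodule \<open>N\<close>. For a coset \<open>X = N + x\<close> the union in the scalar multiplication
  is the single coset \<open>N + r x\<close>.
\<close>

definition quotient_module :: "('a, 'm, 'd) module_scheme \<Rightarrow> 'm set \<Rightarrow> ('a, 'm set) module" where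
  "quotient_module M N = mk_module (a_rcosets\<^bsub>M\<^esub> N) N (\<lambda>X Y. X <+>\<^bsub>M\<^esub> Y)
     (\<lambda>r X. \<Union>x\<in>X. N +>\<^bsub>M\<^esub> (r \<odot>\<^bsub>M\<^esub> x))"

definition annihilator :: "('a, 'c) ring_scheme \<Rightarrow> ('a, 'm, 'd) module_scheme \<Rightarrow> 'a set" where
  "annihilator R M = {r \<in> carrier R. \<forall>x\<in>carrier M. r \<odot>\<^bsub>M\<^esub> x = \<zero>\<^bsub>M\<^esub>}"


section \<open>Finite presentation and coherence\<close>

definition is_presentation ::
  "('a, 'c) ring_scheme \<Rightarrow> ('a, 'm, 'd) module_scheme \<Rightarrow> nat \<Rightarrow> nat \<Rightarrow>
    ((nat \<Rightarrow> 'a) \<Rightarrow> (nat \<Rightarrow> 'a)) \<Rightarrow> ((nat \<Rightarrow> 'a) \<Rightarrow> 'm) \<Rightarrow> bool"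
where
  "is_presentation R M p q d \<pi> \<longleftrightarrow>
     d \<in> module_hom R (free_module R {..<p}) (free_module R {..<q}) \<and>
     \<pi> \<in> module_hom R (free_module R {..<q}) M \<and>
     \<pi> ` carrier (free_module R {..<q}) = carrier M \<and>
     a_kernel (free_module R {..<q}) M \<pi> = d ` carrier (free_module R {..<p})"

definition finitely_presented :: "('a, 'c) ring_scheme \<Rightarrow> ('a, 'm, 'd) module_scheme \<Rightarrow> bool" where
  "finitely_presented R M \<longleftrightarrow> module R M \<and> (\<exists>p q d \<pi>. is_presentation R M p q d \<pi>)"

definition coherent_ring :: "('a, 'c) ring_scheme \<Rightarrow> bool" where
  "coherent_ring R \<longleftrightarrow> cring R \<and>
     (\<forall>A. finite A \<and> A \<subseteq> carrier R \<longrightarrow>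
        finitely_presented R ((regular_module R)\<lparr>carrier := Idl\<^bsub>R\<^esub> A\<rparr>))"


section \<open>The abelian subcategory generated by a module\<close>

text \<open>
  The object class of the subcategory is first defined within one fixed type,
  \<open>(nat \<Rightarrow> 'a) set\<close>. Every finitely presented module is isomorphic to some
  \<open>quotient_module (free_module R {..<q}) N\<close> and so has a copy in this type; membership for modules
  over other types is then given by closure under isomorphism. All clauses produce objects of
  \<open>mod R\<close>; the subcategory is full, so only its objects matter. Since \<open>R\<close> is coherent, kernels and
  cokernels in \<open>mod R\<close> are those of the underlying modules.
\<close>

inductive ab_representative ::
  "('a, 'c) ring_scheme \<Rightarrow> ('a, 'm, 'd) module_scheme \<Rightarrow> ('a, (nat \<Rightarrow> 'a) set) module \<Rightarrow> bool"
  for R M where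
  generator: "finitely_presented R Y \<Longrightarrow> module_iso R M Y \<Longrightarrow> ab_representative R M Y"
| iso: "ab_representative R M X \<Longrightarrow> finitely_presented R Y \<Longrightarrow> module_iso R X Y \<Longrightarrow>
    ab_representative R M Y"
| zero: "finitely_presented R Y \<Longrightarrow> is_zero_module Y \<Longrightarrow> ab_representative R M Y"
| sum: "ab_representative R M A \<Longrightarrow> ab_representative R M B \<Longrightarrow>
    finitely_presented R Y \<Longrightarrow> module_iso R (direct_sum A B) Y \<Longrightarrow> ab_representative R M Y"
| kernel: "ab_representative R M A \<Longrightarrow> ab_representative R M B \<Longrightarrow> f \<in> module_hom R A B \<Longrightarrow>
    finitely_presented R Y \<Longrightarrow> module_iso R (A\<lparr>carrier := a_kernel A B f\<rparr>) Y \<Longrightarrow>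
    ab_representative R M Y"
| cokernel: "ab_representative R M A \<Longrightarrow> ab_representative R M B \<Longrightarrow> f \<in> module_hom R A B \<Longrightarrow>
    finitely_presented R Y \<Longrightarrow> module_iso R (quotient_module B (f ` carrier A)) Y \<Longrightarrow>
    ab_representative R M Y"

definition in_ab ::
  "('a, 'c) ring_scheme \<Rightarrow> ('a, 'm, 'd) module_scheme \<Rightarrow> ('a, 'n, 'e) module_scheme \<Rightarrow> bool"
where
  "in_ab R M X \<longleftrightarrow> finitely_presented R X \<and> (\<exists>Y. ab_representative R M Y \<and> module_iso R X Y)"


section \<open>Complexes and homology\<close>

text \<open>Homological indexing: \<open>dif C n\<close> maps \<open>obj C n\<close> to \<open>obj C (n - 1)\<close>.\<close>

record ('a, 'm) cplx =
  obj :: "int \<Rightarrow> ('a, 'm) module"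
  dif :: "int \<Rightarrow> 'm \<Rightarrow> 'm"

definition is_complex :: "('a, 'c) ring_scheme \<Rightarrow> ('a, 'm) cplx \<Rightarrow> bool" where
  "is_complex R C \<longleftrightarrow>
     (\<forall>n. module R (obj C n) \<and> dif C n \<in> module_hom R (obj C n) (obj C (n - 1)) \<and>
        (\<forall>x\<in>carrier (obj C n). dif C (n - 1) (dif C n x) = \<zero>\<^bsub>obj C (n - 1 - 1)\<^esub>))"

definition is_bounded_finite_free :: "('a, 'c) ring_scheme \<Rightarrow> ('a, 'm) cplx \<Rightarrow> bool" where
  "is_bounded_finite_free R C \<longleftrightarrow>
     is_complex R C \<and>
     (\<forall>n. \<exists>k. module_iso R (free_module R {..<k::nat}) (obj C n)) \<and>
     (\<exists>l u. \<forall>n. n < l \<or> u < n \<longrightarrow> is_zero_module (obj C n))"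

definition cycles :: "('a, 'm) cplx \<Rightarrow> int \<Rightarrow> 'm set" where
  "cycles C n = a_kernel (obj C n) (obj C (n - 1)) (dif C n)"

definition boundaries :: "('a, 'm) cplx \<Rightarrow> int \<Rightarrow> 'm set" where
  "boundaries C n = dif C (n + 1) ` carrier (obj C (n + 1))"

definition homology :: "('a, 'm) cplx \<Rightarrow> int \<Rightarrow> ('a, 'm set) module" where
  "homology C n = quotient_module ((obj C n)\<lparr>carrier := cycles C n\<rparr>) (boundaries C n)"

definition zero_cplx :: "('a, unit) cplx" where
  "zero_cplx = \<lparr>obj = (\<lambda>_. zero_module), dif = (\<lambda>_ _. ())\<rparr>"

definition chain_map ::
  "('a, 'c) ring_scheme \<Rightarrow> ('a, 'm) cplx \<Rightarrow> ('a, 'n) cplx \<Rightarrow> (int \<Rightarrow> 'm \<Rightarrow> 'n) \<Rightarrow> bool"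
where
  "chain_map R C D f \<longleftrightarrow>
     (\<forall>n. f n \<in> module_hom R (obj C n) (obj D n) \<and>
        (\<forall>x\<in>carrier (obj C n). f (n - 1) (dif C n x) = dif D n (f n x)))"

definition homology_map :: "('a, 'n) cplx \<Rightarrow> (int \<Rightarrow> 'm \<Rightarrow> 'n) \<Rightarrow> int \<Rightarrow> 'm set \<Rightarrow> 'n set" where
  "homology_map D f n X = (\<Union>x\<in>X. boundaries D n +>\<^bsub>obj D n\<^esub> f n x)"

definition quasi_isomorphism ::
  "('a, 'c) ring_scheme \<Rightarrow> ('a, 'm) cplx \<Rightarrow> ('a, 'n) cplx \<Rightarrow> (int \<Rightarrow> 'm \<Rightarrow> 'n) \<Rightarrow> bool"
where
  "quasi_isomorphism R C D f \<longleftrightarrow> chain_map R C D f \<and>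
     (\<forall>n. bij_betw (homology_map D f n) (carrier (homology C n)) (carrier (homology D n)))"

text \<open>
  An object of the derived category is zero iff its unique chain map to the zero complex becomes
  invertible there, i.e. is a quasi-isomorphism.
\<close>

definition derived_zero :: "('a, 'c) ring_scheme \<Rightarrow> ('a, 'm) cplx \<Rightarrow> bool" where
  "derived_zero R C \<longleftrightarrow> quasi_isomorphism R C zero_cplx (\<lambda>_ _. ())"


section \<open>Localization and support\<close>

text \<open>
  Fractions \<open>m / s\<close> with \<open>m\<close> in \<open>M\<close> and \<open>s\<close> in a multiplicative set \<open>S\<close>. In the operations on
  classes below, all representatives give the same class, so each union is a single class.
\<close>

definition frac_rel ::
  "'a set \<Rightarrow> ('a, 'm, 'd) module_scheme \<Rightarrow> (('m \<times> 'a) \<times> ('m \<times> 'a)) set"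
where
  "frac_rel S M =
     {((m, s), (n, t)). m \<in> carrier M \<and> n \<in> carrier M \<and> s \<in> S \<and> t \<in> S \<and>
        (\<exists>u\<in>S. u \<odot>\<^bsub>M\<^esub> (t \<odot>\<^bsub>M\<^esub> m) = u \<odot>\<^bsub>M\<^esub> (s \<odot>\<^bsub>M\<^esub> n))}"

definition frac :: "'a set \<Rightarrow> ('a, 'm, 'd) module_scheme \<Rightarrow> 'm \<Rightarrow> 'a \<Rightarrow> ('m \<times> 'a) set" where
  "frac S M m s = frac_rel S M `` {(m, s)}"

definition frac_add ::
  "('a, 'c) ring_scheme \<Rightarrow> 'a set \<Rightarrow> ('a, 'm, 'd) module_scheme \<Rightarrow>
    ('m \<times> 'a) set \<Rightarrow> ('m \<times> 'a) set \<Rightarrow> ('m \<times> 'a) set"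
where
  "frac_add R S M X Y =
     (\<Union>(m, s)\<in>X. \<Union>(n, t)\<in>Y. frac S M (t \<odot>\<^bsub>M\<^esub> m \<oplus>\<^bsub>M\<^esub> s \<odot>\<^bsub>M\<^esub> n) (s \<otimes>\<^bsub>R\<^esub> t))"

definition frac_smult ::
  "('a, 'c) ring_scheme \<Rightarrow> 'a set \<Rightarrow> ('a, 'm, 'd) module_scheme \<Rightarrow>
    ('a \<times> 'a) set \<Rightarrow> ('m \<times> 'a) set \<Rightarrow> ('m \<times> 'a) set"
where
  "frac_smult R S M X Y = (\<Union>(r, s)\<in>X. \<Union>(m, t)\<in>Y. frac S M (r \<odot>\<^bsub>M\<^esub> m) (s \<otimes>\<^bsub>R\<^esub> t))"

definition localized_ring :: "('a, 'c) ring_scheme \<Rightarrow> 'a set \<Rightarrow> ('a \<times> 'a) set ring" where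
  "localized_ring R S =
     \<lparr>carrier = (carrier R \<times> S) // frac_rel S (regular_module R),
      mult = frac_smult R S (regular_module R),
      one = frac S (regular_module R) \<one>\<^bsub>R\<^esub> \<one>\<^bsub>R\<^esub>,
      zero = frac S (regular_module R) \<zero>\<^bsub>R\<^esub> \<one>\<^bsub>R\<^esub>,
      add = frac_add R S (regular_module R)\<rparr>"

text \<open>A module over \<^const>\<open>localized_ring\<close>.\<close>

definition localized_module ::
  "('a, 'c) ring_scheme \<Rightarrow> 'a set \<Rightarrow> ('a, 'm, 'd) module_scheme \<Rightarrow>
    (('a \<times> 'a) set, ('m \<times> 'a) set) module"
where
  "localized_module R S M =
     mk_module ((carrier M \<times> S) // frac_rel S M) (frac S M \<zero>\<^bsub>M\<^esub> \<one>\<^bsub>R\<^esub>)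
       (frac_add R S M) (frac_smult R S M)"

definition localized_map ::
  "'a set \<Rightarrow> ('a, 'n, 'd) module_scheme \<Rightarrow> ('m \<Rightarrow> 'n) \<Rightarrow> ('m \<times> 'a) set \<Rightarrow> ('n \<times> 'a) set"
where
  "localized_map S N f X = (\<Union>(m, s)\<in>X. frac S N (f m) s)"

definition localized_cplx ::
  "('a, 'c) ring_scheme \<Rightarrow> 'a set \<Rightarrow> ('a, 'm) cplx \<Rightarrow> (('a \<times> 'a) set, ('m \<times> 'a) set) cplx"
where
  "localized_cplx R S C =
     \<lparr>obj = (\<lambda>n. localized_module R S (obj C n)),
      dif = (\<lambda>n. localized_map S (obj C (n - 1)) (dif C n))\<rparr>"

definition module_support :: "('a, 'c) ring_scheme \<Rightarrow> ('a, 'm, 'd) module_scheme \<Rightarrow> 'a set set" where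
  "module_support R M =
     {P. primeideal P R \<and> \<not> is_zero_module (localized_module R (carrier R - P) M)}"

definition cplx_support :: "('a, 'c) ring_scheme \<Rightarrow> ('a, 'm) cplx \<Rightarrow> 'a set set" where
  "cplx_support R C =
     {P. primeideal P R \<and>
        \<not> derived_zero (localized_ring R (carrier R - P)) (localized_cplx R (carrier R - P) C)}"


section \<open>Tensor products of complexes of finite free modules\<close>

text \<open>
  A complex of finite free modules with chosen bases: a finite set of homogeneous basis elements,
  their degrees, and the matrix of the differential. The differential of \<open>b\<close> is the sum of
  \<open>entry b c\<close> times \<open>c\<close> over the basis elements \<open>c\<close> of degree \<open>deg b - 1\<close>; all other values of
  \<open>entry\<close> are irrelevant.
\<close>

record ('a, 'b) based_cplx =
  basis :: "'b set"
  deg :: "'b \<Rightarrow> int"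
  entry :: "'b \<Rightarrow> 'b \<Rightarrow> 'a"

definition basis_in :: "('a, 'b) based_cplx \<Rightarrow> int \<Rightarrow> 'b set" where
  "basis_in F n = {b \<in> basis F. deg F b = n}"

definition cplx_of :: "('a, 'c) ring_scheme \<Rightarrow> ('a, 'b) based_cplx \<Rightarrow> ('a, 'b \<Rightarrow> 'a) cplx" where
  "cplx_of R F =
     \<lparr>obj = (\<lambda>n. free_module R (basis_in F n)),
      dif = (\<lambda>n x. \<lambda>c\<in>basis_in F (n - 1). \<Oplus>\<^bsub>R\<^esub>b\<in>basis_in F n. x b \<otimes>\<^bsub>R\<^esub> entry F b c)\<rparr>"

text \<open>
  The tensor product of free modules is free on the pairs \<open>(b, c)\<close>, standing for \<open>b \<otimes> c\<close>. The
  entries express \<open>\<partial>(b \<otimes> c) = \<partial>b \<otimes> c + (-1)^(deg b) b \<otimes> \<partial>c\<close>.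
\<close>

definition tensor_cplx ::
  "('a, 'r) ring_scheme \<Rightarrow> ('a, 'b) based_cplx \<Rightarrow> ('a, 'c) based_cplx \<Rightarrow> ('a, 'b \<times> 'c) based_cplx"
where
  "tensor_cplx R F G =
     \<lparr>basis = basis F \<times> basis G,
      deg = (\<lambda>(b, c). deg F b + deg G c),
      entry = (\<lambda>(b, c) (b', c').
        (if c = c' then entry F b b' else \<zero>\<^bsub>R\<^esub>) \<oplus>\<^bsub>R\<^esub>
        (if b = b' then (if even (deg F b) then entry G c c' else \<ominus>\<^bsub>R\<^esub> entry G c c')
         else \<zero>\<^bsub>R\<^esub>))\<rparr>"

text \<open>
  The tensor product of a list of based complexes, where the list \<open>[b\<^sub>1, \<dots>, b\<^sub>r]\<close> stands for
  \<open>b\<^sub>1 \<otimes> \<dots> \<otimes> b\<^sub>r\<close>. The empty product is the ring in degree 0.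
\<close>

fun tensor_list :: "('a, 'r) ring_scheme \<Rightarrow> ('a, 'b) based_cplx list \<Rightarrow> ('a, 'b list) based_cplx" where
  "tensor_list R [] = \<lparr>basis = {[]}, deg = (\<lambda>_. 0), entry = (\<lambda>_ _. \<zero>\<^bsub>R\<^esub>)\<rparr>"
| "tensor_list R (F # Fs) =
     (let T = tensor_cplx R F (tensor_list R Fs) in
      \<lparr>basis = (\<lambda>(b, bs). b # bs) ` basis T,
       deg = (\<lambda>bs. deg T (hd bs, tl bs)),
       entry = (\<lambda>bs cs. entry T (hd bs, tl bs) (hd cs, tl cs))\<rparr>)"

text \<open>\<open>R \<rightarrow> R\<close>, multiplication by \<open>a\<close>, in degrees 1 and 0; each basis element is its own degree.\<close>

definition koszul_factor :: "('a, 'c) ring_scheme \<Rightarrow> 'a \<Rightarrow> ('a, int) based_cplx" where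
  "koszul_factor R a =
     \<lparr>basis = {0, 1}, deg = (\<lambda>i. i), entry = (\<lambda>i j. if i = 1 \<and> j = 0 then a else \<zero>\<^bsub>R\<^esub>)\<rparr>"

definition koszul :: "('a, 'c) ring_scheme \<Rightarrow> 'a list \<Rightarrow> ('a, int list) based_cplx" where
  "koszul R as = tensor_list R (map (koszul_factor R) as)"

text \<open>
  The complex of a homomorphism \<open>d\<close> from \<open>R\<^sup>p\<close> to \<open>R\<^sup>q\<close> in degrees 1 and 0; the pair \<open>(n, i)\<close> is
  the \<open>i\<close>-th standard basis vector in degree \<open>n\<close>.
\<close>

definition two_term_cplx ::
  "('a, 'c) ring_scheme \<Rightarrow> nat \<Rightarrow> nat \<Rightarrow> ((nat \<Rightarrow> 'a) \<Rightarrow> (nat \<Rightarrow> 'a)) \<Rightarrow> ('a, int \<times> nat) based_cplx"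
where
  "two_term_cplx R p q d =
     \<lparr>basis = {1} \<times> {..<p} \<union> {0} \<times> {..<q},
      deg = fst,
      entry = (\<lambda>(m, i) (n, j).
        if m = 1 \<and> n = 0 then d (basis_vector R {..<p} i) j else \<zero>\<^bsub>R\<^esub>)\<rparr>"

definition X_cplx ::
  "('a, 'c) ring_scheme \<Rightarrow> nat \<Rightarrow> nat \<Rightarrow> ((nat \<Rightarrow> 'a) \<Rightarrow> (nat \<Rightarrow> 'a)) \<Rightarrow> 'a list \<Rightarrow>
    ('a, (int \<times> nat) \<times> int list \<Rightarrow> 'a) cplx"
where
  "X_cplx R p q d as = cplx_of R (tensor_cplx R (two_term_cplx R p q d) (koszul R as))"

end

theory Submission
  imports Defs
begin

text \<open>
  Let \<open>I = Ann M\<close>. Each generator \<open>a\<close> of \<open>I\<close> acts on the Koszul complex by a null-homotopic map,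
  and so it does on the tensor product \<open>X\<^sub>M\<close>. Hence \<open>I\<close> kills all homology of \<open>X\<^sub>M\<close>. As \<open>R\<close> is
  coherent, this homology is finitely presented, and the theorem comes down to the claim that
  every finitely presented module killed by \<open>I\<close> lies in \<open>ab(M)\<close>. Such a module is the
  cokernel of a map \<open>(R/I)\<^sup>p \<rightarrow> (R/I)\<^sup>q\<close> (\<open>killed_in_class\<close>), so it is enough to place \<open>R/I\<close>
  itself in \<open>ab(M)\<close>.

  This is \<open>cyclic_in_annihilator\<close>. It is proved for every class \<open>C\<close> of finitely presented modules
  that is closed under finite sums, kernels and cokernels and contains \<open>M\<close>, because the induction
  changes the class. The induction is on the number of generators of \<open>M\<close>. If all coefficients of
  relations between the generators kill \<open>M\<close>, then \<open>M\<close> is a free \<open>R/I\<close>-module and the claim is clear.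
  Otherwise let \<open>t\<close> be a coefficient that does not kill \<open>M\<close>.
  \<^item> The module \<open>M/tM\<close> has fewer coefficients that do not kill it, so \<open>R/J \<in> C\<close> for
    \<open>J = Ann (M/tM)\<close>.
  \<^item> Once \<open>t\<close> is inverted, one generator of \<open>M\<close> becomes superfluous. So \<open>R/I\<close> lies in the class of
    those modules that agree with members of \<open>C\<close> up to inverting \<open>t\<close>.

  The two facts are glued in \<open>cyclic_in_glue\<close>. By Nakayama's lemma, applied to \<open>J M \<subseteq> t M\<close>, the
  generators of \<open>J\<close> have powers in \<open>(t) + I\<close>. So they are nilpotent on every module killed by \<open>I\<close>
  and a power of \<open>t\<close>, and such a module is built from modules killed by \<open>J\<close>, which lie in \<open>C\<close>.
  This puts enough submodules of a power of \<open>M\<close> into \<open>C\<close> to reach the submodule generated by the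
  tuple of generators of \<open>M\<close>, which is isomorphic to \<open>R/I\<close>.

  For the remaining claims, the degree 0 part of \<open>X\<^sub>M\<close> is \<open>R\<^sup>q\<close> and its boundaries are the image
  of \<open>d\<close> plus \<open>I R\<^sup>q\<close>. The latter is part of the image of \<open>d\<close> because \<open>I\<close> kills \<open>M\<close>, whence
  \<open>H\<^sub>0(X\<^sub>M) \<cong> M\<close>. If \<open>M\<close> vanishes at a prime \<open>P\<close>, then \<open>I\<close> contains an element outside \<open>P\<close>, which
  kills the homology of \<open>X\<^sub>M\<close> at \<open>P\<close>; the converse inclusion of supports follows from \<open>H\<^sub>0\<close>.
\<close>

section \<open>Homomorphisms, submodules and quotients\<close>

lemma module_homD:
  assumes "f \<in> module_hom R M N"
  shows "\<And>x. x \<in> carrier M \<Longrightarrow> f x \<in> carrier N"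
    and "\<And>x y. x \<in> carrier M \<Longrightarrow> y \<in> carrier M \<Longrightarrow> f (x \<oplus>\<^bsub>M\<^esub> y) = f x \<oplus>\<^bsub>N\<^esub> f y"
    and "\<And>r x. r \<in> carrier R \<Longrightarrow> x \<in> carrier M \<Longrightarrow> f (r \<odot>\<^bsub>M\<^esub> x) = r \<odot>\<^bsub>N\<^esub> f x"
  using assms unfolding module_hom_def by auto

lemma module_homI:
  assumes "\<And>x. x \<in> carrier M \<Longrightarrow> f x \<in> carrier N"
    and "\<And>x y. x \<in> carrier M \<Longrightarrow> y \<in> carrier M \<Longrightarrow> f (x \<oplus>\<^bsub>M\<^esub> y) = f x \<oplus>\<^bsub>N\<^esub> f y"
    and "\<And>r x. r \<in> carrier R \<Longrightarrow> x \<in> carrier M \<Longrightarrow> f (r \<odot>\<^bsub>M\<^esub> x) = r \<odot>\<^bsub>N\<^esub> f x"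
  shows "f \<in> module_hom R M N"
  using assms unfolding module_hom_def by auto

lemma module_hom_comp:
  assumes "f \<in> module_hom R M N" "g \<in> module_hom R N P"
  shows "(\<lambda>x. g (f x)) \<in> module_hom R M P"
  using assms unfolding module_hom_def by (auto simp: Pi_iff)

lemma module_hom_id: "(\<lambda>x. x) \<in> module_hom R M M"
  unfolding module_hom_def by auto

lemma module_hom_restrict:
  assumes "f \<in> module_hom R M N" "K \<subseteq> carrier M"
  shows "f \<in> module_hom R (M\<lparr>carrier := K\<rparr>) N"
  using assms unfolding module_hom_def by (auto simp: Pi_iff subset_iff)

lemma module_hom_corestrict:
  assumes "f \<in> module_hom R M N" "f ` carrier M \<subseteq> L"
  shows "f \<in> module_hom R M (N\<lparr>carrier := L\<rparr>)"
  using assms unfolding module_hom_def by auto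

lemma module_hom_extend:
  assumes "f \<in> module_hom R M (N\<lparr>carrier := L\<rparr>)" "L \<subseteq> carrier N"
  shows "f \<in> module_hom R M N"
  using assms unfolding module_hom_def by (auto simp: Pi_iff)

lemma mem_a_kernel: "x \<in> a_kernel M N f \<longleftrightarrow> x \<in> carrier M \<and> f x = \<zero>\<^bsub>N\<^esub>"
  by (simp add: a_kernel_def kernel_def)

lemma mk_module_simps [simp]:
  "carrier (mk_module A z p s) = A" "zero (mk_module A z p s) = z"
  "add (mk_module A z p s) = p" "smult (mk_module A z p s) = s"
  by (simp_all add: mk_module_def)

context cring
begin

lemma module_hom_zero:
  assumes "module R M" "module R N" "f \<in> module_hom R M N"
  shows "f \<zero>\<^bsub>M\<^esub> = \<zero>\<^bsub>N\<^esub>"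
proof -
  interpret M: module R M by fact
  interpret N: module R N by fact
  have "f \<zero>\<^bsub>M\<^esub> = f (\<zero> \<odot>\<^bsub>M\<^esub> \<zero>\<^bsub>M\<^esub>)" by simp
  also have "\<dots> = \<zero> \<odot>\<^bsub>N\<^esub> f \<zero>\<^bsub>M\<^esub>" using module_homD[OF assms(3)] by blast
  also have "\<dots> = \<zero>\<^bsub>N\<^esub>" using module_homD(1)[OF assms(3)] by simp
  finally show ?thesis .
qed

lemma module_neg_smult:
  assumes "module R M" "x \<in> carrier M"
  shows "\<ominus>\<^bsub>M\<^esub> x = (\<ominus> \<one>) \<odot>\<^bsub>M\<^esub> x"
proof -
  interpret M: module R M by fact
  show ?thesis using assms(2) by (simp add: M.smult_l_minus)
qed

lemma module_hom_minus:
  assumes "module R M" "module R N" "f \<in> module_hom R M N" "x \<in> carrier M" "y \<in> carrier M"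
  shows "f (x \<ominus>\<^bsub>M\<^esub> y) = f x \<ominus>\<^bsub>N\<^esub> f y"
proof -
  interpret M: module R M by fact
  interpret N: module R N by fact
  have "f (\<ominus>\<^bsub>M\<^esub> y) = \<ominus>\<^bsub>N\<^esub> f y"
    using assms module_homD[OF assms(3)] by (simp add: module_neg_smult)
  then show ?thesis
    using assms module_homD[OF assms(3)] by (simp add: a_minus_def)
qed

lemma module_minus_zero_iff:
  assumes "module R M" "x \<in> carrier M" "y \<in> carrier M"
  shows "x \<ominus>\<^bsub>M\<^esub> y = \<zero>\<^bsub>M\<^esub> \<longleftrightarrow> x = y"
proof -
  interpret M: module R M by fact
  show ?thesis
    using assms M.minus_equality[of x "\<ominus>\<^bsub>M\<^esub> y"] by (auto simp: a_minus_def M.r_neg)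
qed

lemma module_minus_add:
  assumes "module R M" "x \<in> carrier M" "y \<in> carrier M"
  shows "(x \<ominus>\<^bsub>M\<^esub> y) \<oplus>\<^bsub>M\<^esub> y = x"
proof -
  interpret M: module R M by fact
  show ?thesis using assms by (simp add: a_minus_def M.a_assoc M.l_neg)
qed

lemma module_minus_zero:
  assumes "module R M" "x \<in> carrier M"
  shows "x \<ominus>\<^bsub>M\<^esub> \<zero>\<^bsub>M\<^esub> = x"
proof -
  interpret M: module R M by fact
  show ?thesis using assms by (metis M.minus_closed M.r_zero M.zero_closed module_minus_add)
qed

lemma module_hom_inj_iff:
  assumes "module R M" "module R N" "f \<in> module_hom R M N"
  shows "inj_on f (carrier M) \<longleftrightarrow> (\<forall>x\<in>carrier M. f x = \<zero>\<^bsub>N\<^esub> \<longrightarrow> x = \<zero>\<^bsub>M\<^esub>)"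
proof
  interpret M: module R M by fact
  assume "inj_on f (carrier M)"
  then show "\<forall>x\<in>carrier M. f x = \<zero>\<^bsub>N\<^esub> \<longrightarrow> x = \<zero>\<^bsub>M\<^esub>"
    using module_hom_zero[OF assms] by (metis M.zero_closed inj_onD)
next
  interpret M: module R M by fact
  interpret N: module R N by fact
  assume *: "\<forall>x\<in>carrier M. f x = \<zero>\<^bsub>N\<^esub> \<longrightarrow> x = \<zero>\<^bsub>M\<^esub>"
  show "inj_on f (carrier M)"
  proof (rule inj_onI)
    fix x y assume x: "x \<in> carrier M" and y: "y \<in> carrier M" and e: "f x = f y"
    have "f (x \<ominus>\<^bsub>M\<^esub> y) = \<zero>\<^bsub>N\<^esub>"
      using module_hom_minus[OF assms x y] e module_homD(1)[OF assms(3) y] by (simp add: N.r_neg a_minus_def)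
    then have "x \<ominus>\<^bsub>M\<^esub> y = \<zero>\<^bsub>M\<^esub>" using * x y by simp
    then show "x = y" using x y module_minus_zero_iff[OF assms(1)] by simp
  qed
qed

subsection \<open>Submodules\<close>

lemma submodI:
  assumes "module R M" "N \<subseteq> carrier M" "\<zero>\<^bsub>M\<^esub> \<in> N"
    and "\<And>x y. x \<in> N \<Longrightarrow> y \<in> N \<Longrightarrow> x \<oplus>\<^bsub>M\<^esub> y \<in> N"
    and "\<And>r x. r \<in> carrier R \<Longrightarrow> x \<in> N \<Longrightarrow> r \<odot>\<^bsub>M\<^esub> x \<in> N"
  shows "submodule N R M"
proof -
  interpret M: module R M by fact
  show ?thesis
  proof (rule M.submoduleI)
    fix x assume "x \<in> N"
    then show "\<ominus>\<^bsub>M\<^esub> x \<in> N" using assms module_neg_smult[of M x] by auto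
  qed (use assms in auto)
qed

lemma submodD:
  assumes "module R M" "submodule N R M"
  shows "N \<subseteq> carrier M" "\<zero>\<^bsub>M\<^esub> \<in> N"
    and "\<And>x y. x \<in> N \<Longrightarrow> y \<in> N \<Longrightarrow> x \<oplus>\<^bsub>M\<^esub> y \<in> N"
    and "\<And>r x. r \<in> carrier R \<Longrightarrow> x \<in> N \<Longrightarrow> r \<odot>\<^bsub>M\<^esub> x \<in> N"
    and "\<And>x. x \<in> N \<Longrightarrow> \<ominus>\<^bsub>M\<^esub> x \<in> N"
    and "\<And>x y. x \<in> N \<Longrightarrow> y \<in> N \<Longrightarrow> x \<ominus>\<^bsub>M\<^esub> y \<in> N"
proof -
  interpret M: module R M by fact
  show 1: "N \<subseteq> carrier M" using M.submoduleE(1)[OF assms(2)] .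
  show 2: "\<And>x y. x \<in> N \<Longrightarrow> y \<in> N \<Longrightarrow> x \<oplus>\<^bsub>M\<^esub> y \<in> N" using M.submoduleE(5)[OF assms(2)] .
  show 3: "\<And>r x. r \<in> carrier R \<Longrightarrow> x \<in> N \<Longrightarrow> r \<odot>\<^bsub>M\<^esub> x \<in> N" using M.submoduleE(4)[OF assms(2)] .
  show 4: "\<And>x. x \<in> N \<Longrightarrow> \<ominus>\<^bsub>M\<^esub> x \<in> N" using M.submoduleE(3)[OF assms(2)] .
  show "\<And>x y. x \<in> N \<Longrightarrow> y \<in> N \<Longrightarrow> x \<ominus>\<^bsub>M\<^esub> y \<in> N" using 2 4 by (auto simp: a_minus_def)
  obtain x where "x \<in> N" using M.submoduleE(2)[OF assms(2)] by auto
  then show "\<zero>\<^bsub>M\<^esub> \<in> N" using 3[of \<zero> x] 1 by auto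
qed

lemma submod_module:
  assumes "module R M" "submodule N R M"
  shows "module R (M\<lparr>carrier := N\<rparr>)"
  using submodule.submodule_is_module assms by blast

lemma submod_restrict:
  assumes "module R M" "submodule N R M" "submodule L R M" "L \<subseteq> N"
  shows "submodule L R (M\<lparr>carrier := N\<rparr>)"
  by (rule submodI[OF submod_module[OF assms(1,2)]])
    (use assms submodD[OF assms(1,3)] in auto)

lemma submod_trans:
  assumes "module R M" "submodule N R M" "submodule L R (M\<lparr>carrier := N\<rparr>)"
  shows "submodule L R M"
proof (rule submodI[OF assms(1)])
  note D = submodD[OF submod_module[OF assms(1,2)] assms(3)]
  show "L \<subseteq> carrier M" using D(1) submodD(1)[OF assms(1,2)] by simp
qed (use submodD[OF submod_module[OF assms(1,2)] assms(3)] in auto)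

lemma submod_carrier: "module R M \<Longrightarrow> submodule (carrier M) R M"
  by (rule module.carrier_is_submodule)

lemma submod_zero:
  assumes "module R M" shows "submodule {\<zero>\<^bsub>M\<^esub>} R M"
proof -
  interpret M: module R M by fact
  show ?thesis by (rule submodI[OF assms]) auto
qed

lemma submod_preimage:
  assumes "module R M" "module R N" "f \<in> module_hom R M N" "submodule L R N"
  shows "submodule {x \<in> carrier M. f x \<in> L} R M"
proof -
  interpret M: module R M by fact
  interpret N: module R N by fact
  show ?thesis
    by (rule submodI[OF assms(1)])
      (use module_homD[OF assms(3)] submodD[OF assms(2,4)] module_hom_zero[OF assms(1-3)] in auto)
qed

lemma submod_kernel:
  assumes "module R M" "module R N" "f \<in> module_hom R M N"
  shows "submodule (a_kernel M N f) R M"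
proof -
  have "a_kernel M N f = {x \<in> carrier M. f x \<in> {\<zero>\<^bsub>N\<^esub>}}" by (auto simp: mem_a_kernel)
  then show ?thesis using submod_preimage[OF assms submod_zero[OF assms(2)]] by simp
qed

lemma submod_image:
  assumes "module R M" "module R N" "f \<in> module_hom R M N" "submodule K R M"
  shows "submodule (f ` K) R N"
proof -
  interpret M: module R M by fact
  interpret N: module R N by fact
  note K = submodD[OF assms(1,4)] and f = module_homD[OF assms(3)]
  show ?thesis
  proof (rule submodI[OF assms(2)])
    show "f ` K \<subseteq> carrier N" using K(1) f(1) by auto
    show "\<zero>\<^bsub>N\<^esub> \<in> f ` K" using K(2) module_hom_zero[OF assms(1-3)] by (metis imageI)
  next
    fix x y assume "x \<in> f ` K" "y \<in> f ` K"
    then obtain a b where "a \<in> K" "b \<in> K" "x = f a" "y = f b" by auto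
    then have "x \<oplus>\<^bsub>N\<^esub> y = f (a \<oplus>\<^bsub>M\<^esub> b)" "a \<oplus>\<^bsub>M\<^esub> b \<in> K" using f(2) K(1,3) by (auto simp: subset_iff)
    then show "x \<oplus>\<^bsub>N\<^esub> y \<in> f ` K" by simp
  next
    fix r x assume "r \<in> carrier R" "x \<in> f ` K"
    then obtain a where a: "a \<in> K" "x = f a" by auto
    then have "r \<odot>\<^bsub>N\<^esub> x = f (r \<odot>\<^bsub>M\<^esub> a)" "r \<odot>\<^bsub>M\<^esub> a \<in> K" using f(3) K(1,4) \<open>r \<in> carrier R\<close> by (auto simp: subset_iff)
    then show "r \<odot>\<^bsub>N\<^esub> x \<in> f ` K" by simp
  qed
qed

subsection \<open>Factoring through a surjection\<close>

text \<open>
  A choice of preimages under \<open>\<rho>\<close> gives the factorization, since \<open>\<phi>\<close> cannot tell preimages of one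
  element apart.
\<close>

lemma hom_factor:
  assumes "module R A" "module R Y" "module R X"
    and r: "\<rho> \<in> module_hom R A Y" "\<rho> ` carrier A = carrier Y"
    and p: "\<phi> \<in> module_hom R A X"
    and k: "\<And>a. a \<in> carrier A \<Longrightarrow> \<rho> a = \<zero>\<^bsub>Y\<^esub> \<Longrightarrow> \<phi> a = \<zero>\<^bsub>X\<^esub>"
  obtains \<psi> where "\<psi> \<in> module_hom R Y X" "\<And>a. a \<in> carrier A \<Longrightarrow> \<psi> (\<rho> a) = \<phi> a"
proof -
  interpret A: module R A by fact
  interpret Y: module R Y by fact
  interpret X: module R X by fact
  define s where "s = inv_into (carrier A) \<rho>"
  have s: "s y \<in> carrier A" "\<rho> (s y) = y" if "y \<in> carrier Y" for y
    using that r(2) unfolding s_def by (auto intro: inv_into_into f_inv_into_f)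
  have eq: "\<phi> a = \<phi> b" if "a \<in> carrier A" "b \<in> carrier A" "\<rho> a = \<rho> b" for a b
  proof -
    have "\<rho> (a \<ominus>\<^bsub>A\<^esub> b) = \<zero>\<^bsub>Y\<^esub>"
      using that module_hom_minus[OF assms(1,2) r(1)] module_homD(1)[OF r(1)]
      by (simp add: Y.r_neg a_minus_def)
    then have "\<phi> (a \<ominus>\<^bsub>A\<^esub> b) = \<zero>\<^bsub>X\<^esub>" using k that by simp
    then have "\<phi> a \<ominus>\<^bsub>X\<^esub> \<phi> b = \<zero>\<^bsub>X\<^esub>" using module_hom_minus[OF assms(1,3) p] that by simp
    then show ?thesis using that module_homD(1)[OF p] module_minus_zero_iff[OF assms(3)] by simp
  qed
  have 1: "\<phi> (s (\<rho> a)) = \<phi> a" if "a \<in> carrier A" for a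
    using that s module_homD(1)[OF r(1)] by (intro eq) auto
  have "(\<lambda>y. \<phi> (s y)) \<in> module_hom R Y X"
  proof (rule module_homI)
    fix x assume "x \<in> carrier Y"
    then show "\<phi> (s x) \<in> carrier X" using s module_homD[OF p] by auto
  next
    fix x y assume xy: "x \<in> carrier Y" "y \<in> carrier Y"
    then have "\<phi> (s (x \<oplus>\<^bsub>Y\<^esub> y)) = \<phi> (s x \<oplus>\<^bsub>A\<^esub> s y)"
      using s module_homD[OF r(1)] by (intro eq) auto
    then show "\<phi> (s (x \<oplus>\<^bsub>Y\<^esub> y)) = \<phi> (s x) \<oplus>\<^bsub>X\<^esub> \<phi> (s y)" using s xy module_homD[OF p] by auto
  next
    fix a x assume ax: "a \<in> carrier R" "x \<in> carrier Y"
    then have "\<phi> (s (a \<odot>\<^bsub>Y\<^esub> x)) = \<phi> (a \<odot>\<^bsub>A\<^esub> s x)"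
      using s module_homD[OF r(1)] by (intro eq) auto
    then show "\<phi> (s (a \<odot>\<^bsub>Y\<^esub> x)) = a \<odot>\<^bsub>X\<^esub> \<phi> (s x)" using s ax module_homD[OF p] by auto
  qed
  then show thesis using that[of "\<lambda>y. \<phi> (s y)"] 1 by blast
qed

subsection \<open>Isomorphisms\<close>

lemma bij_hom_inverse:
  assumes "module R M" "module R N" "f \<in> module_hom R M N" "bij_betw f (carrier M) (carrier N)"
  obtains g where "g \<in> module_hom R N M" "\<And>x. x \<in> carrier M \<Longrightarrow> g (f x) = x"
    "\<And>y. y \<in> carrier N \<Longrightarrow> f (g y) = y"
proof -
  have inj: "inj_on f (carrier M)" and im: "f ` carrier M = carrier N"
    using assms(4) by (auto simp: bij_betw_def)
  obtain g where g: "g \<in> module_hom R N M" "\<And>a. a \<in> carrier M \<Longrightarrow> g (f a) = a"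
  proof (rule hom_factor[OF assms(1,2,1) assms(3) im module_hom_id])
    fix a assume "a \<in> carrier M" "f a = \<zero>\<^bsub>N\<^esub>"
    then show "a = \<zero>\<^bsub>M\<^esub>" using inj module_hom_inj_iff[OF assms(1-3)] by blast
  qed blast
  have "f (g y) = y" if "y \<in> carrier N" for y using that g(2) unfolding im[symmetric] by auto
  then show thesis using that[OF g] by simp
qed

lemma module_isoE:
  assumes "module R M" "module R N" "module_iso R M N"
  obtains f g where "f \<in> module_hom R M N" "g \<in> module_hom R N M"
    "\<And>x. x \<in> carrier M \<Longrightarrow> g (f x) = x" "\<And>y. y \<in> carrier N \<Longrightarrow> f (g y) = y"
proof -
  obtain f where f: "f \<in> module_hom R M N" "bij_betw f (carrier M) (carrier N)"
    using assms(3) unfolding module_iso_def by auto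
  from bij_hom_inverse[OF assms(1,2) f] show thesis using that[OF f(1)] by blast
qed

lemma module_isoI:
  assumes "f \<in> module_hom R M N" "g \<in> module_hom R N M"
    "\<And>x. x \<in> carrier M \<Longrightarrow> g (f x) = x" "\<And>y. y \<in> carrier N \<Longrightarrow> f (g y) = y"
  shows "module_iso R M N"
  unfolding module_iso_def
proof
  show "bij_betw f (carrier M) (carrier N)"
    by (rule bij_betwI[of _ _ _ g]) (use assms module_homD(1)[OF assms(1)] module_homD(1)[OF assms(2)] in auto)
qed fact

lemma module_iso_sym:
  assumes "module R M" "module R N" "module_iso R M N"
  shows "module_iso R N M"
proof -
  obtain f g where "f \<in> module_hom R M N" "g \<in> module_hom R N M"
    "\<And>x. x \<in> carrier M \<Longrightarrow> g (f x) = x" "\<And>y. y \<in> carrier N \<Longrightarrow> f (g y) = y"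
    using module_isoE[OF assms] by blast
  then show ?thesis using module_isoI[of g N M f] by blast
qed

lemma module_iso_trans:
  assumes "module_iso R M N" "module_iso R N P"
  shows "module_iso R M P"
proof -
  obtain f g where f: "f \<in> module_hom R M N" "bij_betw f (carrier M) (carrier N)"
    and g: "g \<in> module_hom R N P" "bij_betw g (carrier N) (carrier P)"
    using assms unfolding module_iso_def by blast
  have "bij_betw (\<lambda>x. g (f x)) (carrier M) (carrier P)"
    using bij_betw_trans[OF f(2) g(2)] by (simp add: comp_def)
  then show ?thesis unfolding module_iso_def using module_hom_comp[OF f(1) g(1)] by blast
qed

lemma module_iso_refl: "module_iso R M M"
  using module_isoI[OF module_hom_id module_hom_id] by simp

lemma iso_of_surj_same_kernel:
  assumes "module R A" "module R X" "module R Y"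
    and f: "f \<in> module_hom R A X" "f ` carrier A = carrier X"
    and g: "g \<in> module_hom R A Y" "g ` carrier A = carrier Y"
    and k: "\<And>a. a \<in> carrier A \<Longrightarrow> f a = \<zero>\<^bsub>X\<^esub> \<longleftrightarrow> g a = \<zero>\<^bsub>Y\<^esub>"
  shows "module_iso R X Y"
proof -
  obtain h where h: "h \<in> module_hom R X Y" "\<And>a. a \<in> carrier A \<Longrightarrow> h (f a) = g a"
    by (rule hom_factor[OF assms(1,2,3) f g(1)]) (use k in auto)
  obtain h' where h': "h' \<in> module_hom R Y X" "\<And>a. a \<in> carrier A \<Longrightarrow> h' (g a) = f a"
    by (rule hom_factor[OF assms(1,3,2) g f(1)]) (use k in auto)
  show ?thesis
  proof (rule module_isoI[OF h(1) h'(1)])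
    show "h' (h x) = x" if "x \<in> carrier X" for x using that h(2) h'(2) unfolding f(2)[symmetric] by auto
    show "h (h' x) = x" if "x \<in> carrier Y" for x using that h(2) h'(2) unfolding g(2)[symmetric] by auto
  qed
qed

subsection \<open>Quotient modules\<close>

lemma mem_coset: "x \<in> N +>\<^bsub>M\<^esub> y \<longleftrightarrow> (\<exists>n\<in>N. x = n \<oplus>\<^bsub>M\<^esub> y)"
  unfolding a_r_coset_def' by blast

lemma coset_refl:
  assumes "module R M" "submodule N R M" "x \<in> carrier M"
  shows "x \<in> N +>\<^bsub>M\<^esub> x"
proof -
  interpret M: module R M by fact
  have "x = \<zero>\<^bsub>M\<^esub> \<oplus>\<^bsub>M\<^esub> x" using assms by simp
  then show ?thesis unfolding mem_coset using submodD(2)[OF assms(1,2)] by blast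
qed

lemma coset_eq_iff:
  assumes "module R M" "submodule N R M" "x \<in> carrier M" "y \<in> carrier M"
  shows "N +>\<^bsub>M\<^esub> x = N +>\<^bsub>M\<^esub> y \<longleftrightarrow> x \<ominus>\<^bsub>M\<^esub> y \<in> N"
proof -
  interpret M: module R M by fact
  have sg: "subgroup N (add_monoid M)" using assms(2) by (rule submodule.axioms(1))
  note N = submodD[OF assms(1,2)]
  show ?thesis
  proof
    assume e: "N +>\<^bsub>M\<^esub> x = N +>\<^bsub>M\<^esub> y"
    then obtain n where n: "n \<in> N" "x = n \<oplus>\<^bsub>M\<^esub> y"
      using coset_refl[OF assms(1-3)] mem_coset by metis
    then have "n \<in> carrier M" using N(1) by auto
    then have "x \<ominus>\<^bsub>M\<^esub> y = n" using n assms(4) by (simp add: a_minus_def M.a_assoc M.r_neg)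
    then show "x \<ominus>\<^bsub>M\<^esub> y \<in> N" using n by simp
  next
    assume n: "x \<ominus>\<^bsub>M\<^esub> y \<in> N"
    have "x \<in> N +>\<^bsub>M\<^esub> y"
      unfolding mem_coset using n module_minus_add[OF assms(1,3,4)] by metis
    then show "N +>\<^bsub>M\<^esub> x = N +>\<^bsub>M\<^esub> y" using M.a_repr_independence[OF _ assms(4) sg] by simp
  qed
qed

lemma quotient_add:
  assumes "module R M" "submodule N R M" "x \<in> carrier M" "y \<in> carrier M"
  shows "(N +>\<^bsub>M\<^esub> x) \<oplus>\<^bsub>quotient_module M N\<^esub> (N +>\<^bsub>M\<^esub> y) = N +>\<^bsub>M\<^esub> (x \<oplus>\<^bsub>M\<^esub> y)"
proof -
  interpret M: module R M by fact
  have "abelian_subgroup N M"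
    by (intro abelian_subgroupI3 additive_subgroupI submodule.axioms(1)[OF assms(2)] M.abelian_group_axioms)
  then show ?thesis using assms abelian_subgroup.a_rcos_sum[of N M x y] by (simp add: quotient_module_def)
qed

lemma quotient_smult:
  assumes "module R M" "submodule N R M" "r \<in> carrier R" "x \<in> carrier M"
  shows "r \<odot>\<^bsub>quotient_module M N\<^esub> (N +>\<^bsub>M\<^esub> x) = N +>\<^bsub>M\<^esub> (r \<odot>\<^bsub>M\<^esub> x)"
proof -
  interpret M: module R M by fact
  note N = submodD[OF assms(1,2)]
  have "N +>\<^bsub>M\<^esub> (r \<odot>\<^bsub>M\<^esub> y) = N +>\<^bsub>M\<^esub> (r \<odot>\<^bsub>M\<^esub> x)" if yc: "y \<in> N +>\<^bsub>M\<^esub> x" for y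
  proof -
    obtain n where n: "n \<in> N" "y = n \<oplus>\<^bsub>M\<^esub> x" using yc unfolding mem_coset by blast
    then have nM: "n \<in> carrier M" using N(1) by auto
    then have y: "y \<in> carrier M" using n assms by simp
    have "r \<odot>\<^bsub>M\<^esub> y \<ominus>\<^bsub>M\<^esub> r \<odot>\<^bsub>M\<^esub> x = r \<odot>\<^bsub>M\<^esub> n"
      using n nM assms by (simp add: M.smult_r_distr a_minus_def M.a_assoc M.r_neg)
    then show ?thesis
      using assms y n N(4) by (subst coset_eq_iff) auto
  qed
  moreover have "x \<in> N +>\<^bsub>M\<^esub> x" by (rule coset_refl[OF assms(1,2,4)])
  ultimately show ?thesis unfolding quotient_module_def mk_module_simps by blast
qed

lemma quotient_carrier: "carrier (quotient_module M N) = (\<lambda>x. N +>\<^bsub>M\<^esub> x) ` carrier M"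
  by (auto simp: quotient_module_def A_RCOSETS_def')

lemma quotient_zero:
  assumes "module R M" "submodule N R M"
  shows "\<zero>\<^bsub>quotient_module M N\<^esub> = N +>\<^bsub>M\<^esub> \<zero>\<^bsub>M\<^esub>"
proof -
  interpret M: module R M by fact
  show ?thesis using submodD(1)[OF assms] by (simp add: quotient_module_def)
qed

text \<open>
  All laws are inherited, because every element is a coset and cosets are added and multiplied
  through representatives.
\<close>

lemma quotient_is_module:
  assumes "module R M" "submodule N R M"
  shows "module R (quotient_module M N)"
proof -
  interpret M: module R M by fact
  note simps = quotient_add[OF assms] quotient_smult[OF assms] quotient_zero[OF assms]
  let ?Q = "quotient_module M N"
  have el: "\<exists>x\<in>carrier M. X = N +>\<^bsub>M\<^esub> x" if "X \<in> carrier ?Q" for X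
    using that by (auto simp: quotient_carrier)
  have cl: "N +>\<^bsub>M\<^esub> x \<in> carrier ?Q" if "x \<in> carrier M" for x using that by (simp add: quotient_carrier)
  show ?thesis
  proof (rule moduleI)
    show "cring R" by (rule is_cring)
    show "abelian_group ?Q"
    proof (rule abelian_groupI)
      fix x y assume "x \<in> carrier ?Q" "y \<in> carrier ?Q"
      then obtain a b where "a \<in> carrier M" "b \<in> carrier M" "x = N +>\<^bsub>M\<^esub> a" "y = N +>\<^bsub>M\<^esub> b" using el by blast
      then show "x \<oplus>\<^bsub>?Q\<^esub> y \<in> carrier ?Q" "x \<oplus>\<^bsub>?Q\<^esub> y = y \<oplus>\<^bsub>?Q\<^esub> x"
        using simps cl by (auto simp: M.a_comm)
    next
      show "\<zero>\<^bsub>?Q\<^esub> \<in> carrier ?Q" using simps cl by simp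
    next
      fix x y z assume "x \<in> carrier ?Q" "y \<in> carrier ?Q" "z \<in> carrier ?Q"
      then obtain a b c where "a \<in> carrier M" "b \<in> carrier M" "x = N +>\<^bsub>M\<^esub> a" "y = N +>\<^bsub>M\<^esub> b"
         "c \<in> carrier M" "z = N +>\<^bsub>M\<^esub> c" using el by metis
      then show "x \<oplus>\<^bsub>?Q\<^esub> y \<oplus>\<^bsub>?Q\<^esub> z = x \<oplus>\<^bsub>?Q\<^esub> (y \<oplus>\<^bsub>?Q\<^esub> z)" using simps by (simp add: M.a_assoc)
    next
      fix x assume "x \<in> carrier ?Q"
      then obtain a where a: "a \<in> carrier M" "x = N +>\<^bsub>M\<^esub> a" using el by blast
      then show "\<zero>\<^bsub>?Q\<^esub> \<oplus>\<^bsub>?Q\<^esub> x = x" using simps by simp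
      show "\<exists>y\<in>carrier ?Q. y \<oplus>\<^bsub>?Q\<^esub> x = \<zero>\<^bsub>?Q\<^esub>"
        using a simps cl by (intro bexI[of _ "N +>\<^bsub>M\<^esub> (\<ominus>\<^bsub>M\<^esub> a)"]) (auto simp: M.l_neg)
    qed
  next
    fix r x assume r: "r \<in> carrier R" and "x \<in> carrier ?Q"
    then obtain a where a: "a \<in> carrier M" "x = N +>\<^bsub>M\<^esub> a" using el by blast
    then show "r \<odot>\<^bsub>?Q\<^esub> x \<in> carrier ?Q" using simps cl r by simp
  next
    fix r s x assume r: "r \<in> carrier R" "s \<in> carrier R" and "x \<in> carrier ?Q"
    then obtain a where a: "a \<in> carrier M" "x = N +>\<^bsub>M\<^esub> a" using el by blast
    then show "(r \<oplus> s) \<odot>\<^bsub>?Q\<^esub> x = r \<odot>\<^bsub>?Q\<^esub> x \<oplus>\<^bsub>?Q\<^esub> s \<odot>\<^bsub>?Q\<^esub> x"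
      "r \<otimes> s \<odot>\<^bsub>?Q\<^esub> x = r \<odot>\<^bsub>?Q\<^esub> (s \<odot>\<^bsub>?Q\<^esub> x)"
      using simps r by (simp_all add: M.smult_l_distr M.smult_assoc1)
  next
    fix r x y assume r: "r \<in> carrier R" and "x \<in> carrier ?Q" "y \<in> carrier ?Q"
    then obtain a b where "a \<in> carrier M" "b \<in> carrier M" "x = N +>\<^bsub>M\<^esub> a" "y = N +>\<^bsub>M\<^esub> b" using el by blast
    then show "r \<odot>\<^bsub>?Q\<^esub> (x \<oplus>\<^bsub>?Q\<^esub> y) = r \<odot>\<^bsub>?Q\<^esub> x \<oplus>\<^bsub>?Q\<^esub> r \<odot>\<^bsub>?Q\<^esub> y"
      using simps r by (simp add: M.smult_r_distr)
  next
    fix x assume "x \<in> carrier ?Q"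
    then obtain a where "a \<in> carrier M" "x = N +>\<^bsub>M\<^esub> a" using el by blast
    then show "\<one> \<odot>\<^bsub>?Q\<^esub> x = x" using simps by simp
  qed
qed

lemma quotient_hom:
  assumes "module R M" "submodule N R M"
  shows "(\<lambda>x. N +>\<^bsub>M\<^esub> x) \<in> module_hom R M (quotient_module M N)"
  by (rule module_homI) (auto simp: quotient_carrier quotient_add[OF assms] quotient_smult[OF assms])

lemma quotient_eq_zero_iff:
  assumes "module R M" "submodule N R M" "x \<in> carrier M"
  shows "N +>\<^bsub>M\<^esub> x = \<zero>\<^bsub>quotient_module M N\<^esub> \<longleftrightarrow> x \<in> N"
proof -
  interpret M: module R M by fact
  show ?thesis
    using coset_eq_iff[OF assms(1,2,3) M.zero_closed] assms(3)
    by (simp add: quotient_zero[OF assms(1,2)] module_minus_zero[OF assms(1)])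
qed

end

section \<open>Finitely generated and finitely presented modules\<close>

definition module_span :: "('a, 'c) ring_scheme \<Rightarrow> ('a, 'm, 'd) module_scheme \<Rightarrow> 'm set \<Rightarrow> 'm set" where
  "module_span R M S = \<Inter>{N. submodule N R M \<and> S \<subseteq> N}"

definition fin_gen :: "('a, 'c) ring_scheme \<Rightarrow> ('a, 'm, 'd) module_scheme \<Rightarrow> 'm set \<Rightarrow> bool" where
  "fin_gen R M N \<longleftrightarrow> (\<exists>S. finite S \<and> S \<subseteq> carrier M \<and> N = module_span R M S)"

context cring
begin

lemma span_superset: "S \<subseteq> module_span R M S"
  unfolding module_span_def by blast

lemma span_least: "submodule N R M \<Longrightarrow> S \<subseteq> N \<Longrightarrow> module_span R M S \<subseteq> N"
  unfolding module_span_def by blast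

lemma span_submod:
  assumes "module R M" "S \<subseteq> carrier M"
  shows "submodule (module_span R M S) R M"
proof (rule submodI[OF assms(1)])
  show "module_span R M S \<subseteq> carrier M"
    by (rule span_least[OF submod_carrier[OF assms(1)] assms(2)])
  show "\<zero>\<^bsub>M\<^esub> \<in> module_span R M S"
    unfolding module_span_def using submodD(2)[OF assms(1)] by blast
  fix x assume x: "x \<in> module_span R M S"
  {
    fix y assume "y \<in> module_span R M S"
    then show "x \<oplus>\<^bsub>M\<^esub> y \<in> module_span R M S"
      using x submodD(3)[OF assms(1)] unfolding module_span_def by blast
  }
  fix r assume "r \<in> carrier R"
  then show "r \<odot>\<^bsub>M\<^esub> x \<in> module_span R M S"
    using x submodD(4)[OF assms(1)] unfolding module_span_def by blast
qed

lemma span_mono: "S \<subseteq> T \<Longrightarrow> module_span R M S \<subseteq> module_span R M T"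
  unfolding module_span_def by blast

lemma span_image:
  assumes "module R M" "module R N" "f \<in> module_hom R M N" "S \<subseteq> carrier M"
  shows "f ` module_span R M S = module_span R N (f ` S)"
proof
  have fS: "f ` S \<subseteq> carrier N" using assms(4) module_homD(1)[OF assms(3)] by auto
  have "module_span R M S \<subseteq> {x \<in> carrier M. f x \<in> module_span R N (f ` S)}"
    using assms(4) span_superset[of "f ` S" N]
    by (intro span_least submod_preimage[OF assms(1-3) span_submod[OF assms(2) fS]]) auto
  then show "f ` module_span R M S \<subseteq> module_span R N (f ` S)" by auto
  show "module_span R N (f ` S) \<subseteq> f ` module_span R M S"
    using span_superset[of S M]
    by (intro span_least submod_image[OF assms(1-3) span_submod[OF assms(1,4)]]) auto
qed

lemma span_restrict:
  assumes "module R M" "submodule N R M" "S \<subseteq> N"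
  shows "module_span R (M\<lparr>carrier := N\<rparr>) S = module_span R M S"
proof
  have S: "S \<subseteq> carrier M" using assms submodD(1) by blast
  note m = submod_module[OF assms(1,2)]
  show "module_span R (M\<lparr>carrier := N\<rparr>) S \<subseteq> module_span R M S"
    by (intro span_least span_superset submod_restrict[OF assms(1,2)] span_submod assms S)
  have "submodule (module_span R (M\<lparr>carrier := N\<rparr>) S) R (M\<lparr>carrier := N\<rparr>)"
    using span_submod[OF m] assms(3) by simp
  then show "module_span R M S \<subseteq> module_span R (M\<lparr>carrier := N\<rparr>) S"
    by (intro span_least span_superset submod_trans[OF assms(1,2)])
qed

lemma fin_gen_submod:
  assumes "module R M" "fin_gen R M N" shows "submodule N R M"
  using assms span_submod unfolding fin_gen_def by blast

lemma fin_gen_image: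
  assumes "module R M" "module R N" "f \<in> module_hom R M N" "fin_gen R M K"
  shows "fin_gen R N (f ` K)"
proof -
  obtain S where S: "finite S" "S \<subseteq> carrier M" "K = module_span R M S"
    using assms(4) unfolding fin_gen_def by auto
  then show ?thesis
    unfolding fin_gen_def using span_image[OF assms(1-3)] module_homD(1)[OF assms(3)]
    by (intro exI[of _ "f ` S"]) auto
qed

text \<open>Generators of a submodule do not depend on the module in which they are taken.\<close>

lemma fin_gen_restrict:
  assumes "module R M" "submodule N R M" "K \<subseteq> N"
  shows "fin_gen R (M\<lparr>carrier := N\<rparr>) K \<longleftrightarrow> fin_gen R M K"
proof
  assume "fin_gen R (M\<lparr>carrier := N\<rparr>) K"
  then obtain S where S: "finite S" "S \<subseteq> N" "K = module_span R (M\<lparr>carrier := N\<rparr>) S"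
    unfolding fin_gen_def by auto
  then show "fin_gen R M K"
    unfolding fin_gen_def using span_restrict[OF assms(1,2) S(2)] submodD(1)[OF assms(1,2)]
    by (intro exI[of _ S]) auto
next
  assume "fin_gen R M K"
  then obtain S where S: "finite S" "S \<subseteq> carrier M" "K = module_span R M S"
    unfolding fin_gen_def by auto
  then have "S \<subseteq> N" using span_superset[of S M] assms(3) by auto
  then show "fin_gen R (M\<lparr>carrier := N\<rparr>) K"
    unfolding fin_gen_def using S span_restrict[OF assms(1,2)] by (intro exI[of _ S]) auto
qed

subsection \<open>Sums of submodules\<close>

lemma mem_set_add: "z \<in> A <+>\<^bsub>M\<^esub> B \<longleftrightarrow> (\<exists>a\<in>A. \<exists>b\<in>B. z = a \<oplus>\<^bsub>M\<^esub> b)"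
  unfolding set_add_def' by blast

lemma set_addI: "a \<in> A \<Longrightarrow> b \<in> B \<Longrightarrow> z = a \<oplus>\<^bsub>M\<^esub> b \<Longrightarrow> z \<in> A <+>\<^bsub>M\<^esub> B"
  unfolding mem_set_add by blast

lemma submod_sum:
  assumes "module R M" "submodule A R M" "submodule B R M"
  shows "submodule (A <+>\<^bsub>M\<^esub> B) R M" "A \<subseteq> A <+>\<^bsub>M\<^esub> B" "B \<subseteq> A <+>\<^bsub>M\<^esub> B"
proof -
  interpret M: module R M by fact
  note A = submodD[OF assms(1,2)] and B = submodD[OF assms(1,3)]
  have Ac: "a \<in> carrier M" if "a \<in> A" for a using that A(1) by blast
  have Bc: "a \<in> carrier M" if "a \<in> B" for a using that B(1) by blast
  show 1: "A \<subseteq> A <+>\<^bsub>M\<^esub> B"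
  proof
    fix x assume "x \<in> A"
    then show "x \<in> A <+>\<^bsub>M\<^esub> B" unfolding mem_set_add using B(2) Ac by (metis M.r_zero)
  qed
  show "B \<subseteq> A <+>\<^bsub>M\<^esub> B"
  proof
    fix x assume "x \<in> B"
    then show "x \<in> A <+>\<^bsub>M\<^esub> B" unfolding mem_set_add using A(2) Bc by (metis M.l_zero)
  qed
  show "submodule (A <+>\<^bsub>M\<^esub> B) R M"
  proof (rule submodI[OF assms(1)])
    show "A <+>\<^bsub>M\<^esub> B \<subseteq> carrier M" using Ac Bc by (auto simp: mem_set_add)
    show "\<zero>\<^bsub>M\<^esub> \<in> A <+>\<^bsub>M\<^esub> B" using 1 A(2) by auto
  next
    fix x y assume "x \<in> A <+>\<^bsub>M\<^esub> B" "y \<in> A <+>\<^bsub>M\<^esub> B"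
    then obtain a b a' b' where h: "a \<in> A" "b \<in> B" "a' \<in> A" "b' \<in> B" "x = a \<oplus>\<^bsub>M\<^esub> b" "y = a' \<oplus>\<^bsub>M\<^esub> b'"
      unfolding mem_set_add by blast
    then have "x \<oplus>\<^bsub>M\<^esub> y = (a \<oplus>\<^bsub>M\<^esub> a') \<oplus>\<^bsub>M\<^esub> (b \<oplus>\<^bsub>M\<^esub> b')"
      using Ac Bc by (simp add: M.a_ac)
    then show "x \<oplus>\<^bsub>M\<^esub> y \<in> A <+>\<^bsub>M\<^esub> B" unfolding mem_set_add using h A(3) B(3) by blast
  next
    fix r x assume r: "r \<in> carrier R" and "x \<in> A <+>\<^bsub>M\<^esub> B"
    then obtain a b where h: "a \<in> A" "b \<in> B" "x = a \<oplus>\<^bsub>M\<^esub> b" unfolding mem_set_add by blast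
    then have "r \<odot>\<^bsub>M\<^esub> x = r \<odot>\<^bsub>M\<^esub> a \<oplus>\<^bsub>M\<^esub> r \<odot>\<^bsub>M\<^esub> b" using Ac Bc r by (simp add: M.smult_r_distr)
    then show "r \<odot>\<^bsub>M\<^esub> x \<in> A <+>\<^bsub>M\<^esub> B" unfolding mem_set_add using h A(4) B(4) r by blast
  qed
qed

lemma submod_sum_least:
  assumes "module R M" "submodule K R M" "A \<subseteq> K" "B \<subseteq> K"
  shows "A <+>\<^bsub>M\<^esub> B \<subseteq> K"
proof
  fix z assume "z \<in> A <+>\<^bsub>M\<^esub> B"
  then obtain a b where "a \<in> A" "b \<in> B" "z = a \<oplus>\<^bsub>M\<^esub> b" unfolding mem_set_add by blast
  then show "z \<in> K" using submodD(3)[OF assms(1,2)] assms(3,4) by blast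
qed

lemma span_un:
  assumes "module R M" "S \<subseteq> carrier M" "T \<subseteq> carrier M"
  shows "module_span R M (S \<union> T) = module_span R M S <+>\<^bsub>M\<^esub> module_span R M T"
proof
  note s = span_submod[OF assms(1,2)] and t = span_submod[OF assms(1,3)]
  note st = submod_sum[OF assms(1) s t]
  show "module_span R M (S \<union> T) \<subseteq> module_span R M S <+>\<^bsub>M\<^esub> module_span R M T"
    by (rule span_least[OF st(1)]) (use st(2,3) span_superset[of S M] span_superset[of T M] in auto)
  have u: "submodule (module_span R M (S \<union> T)) R M" using assms by (intro span_submod) auto
  show "module_span R M S <+>\<^bsub>M\<^esub> module_span R M T \<subseteq> module_span R M (S \<union> T)"
    by (intro submod_sum_least[OF assms(1) u] span_mono) auto
qed

lemma fin_gen_sum: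
  assumes "module R M" "fin_gen R M A" "fin_gen R M B"
  shows "fin_gen R M (A <+>\<^bsub>M\<^esub> B)"
proof -
  obtain S T where "finite S" "S \<subseteq> carrier M" "A = module_span R M S"
     "finite T" "T \<subseteq> carrier M" "B = module_span R M T"
    using assms(2,3) unfolding fin_gen_def by auto
  then show ?thesis unfolding fin_gen_def using span_un[OF assms(1)]
    by (intro exI[of _ "S \<union> T"]) auto
qed

subsection \<open>Free modules\<close>

lemma regular_simps [simp]:
  "carrier (regular_module R) = carrier R" "\<zero>\<^bsub>regular_module R\<^esub> = \<zero>"
  "x \<oplus>\<^bsub>regular_module R\<^esub> y = x \<oplus> y" "x \<odot>\<^bsub>regular_module R\<^esub> y = x \<otimes> y"
  by (simp_all add: regular_module_def)

lemma regular_is_module: "module R (regular_module R)"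
proof (rule moduleI)
  show "abelian_group (regular_module R)"
  proof (rule abelian_groupI)
    fix x assume "x \<in> carrier (regular_module R)"
    then show "\<exists>y\<in>carrier (regular_module R). y \<oplus>\<^bsub>regular_module R\<^esub> x = \<zero>\<^bsub>regular_module R\<^esub>"
      by (auto intro!: bexI[of _ "\<ominus> x"] simp: l_neg)
  qed (auto simp: a_ac)
qed (auto simp: l_distr r_distr m_ac is_cring)

lemma free_simps [simp]:
  "carrier (free_module R B) = B \<rightarrow>\<^sub>E carrier R" "\<zero>\<^bsub>free_module R B\<^esub> = (\<lambda>b\<in>B. \<zero>)"
  "x \<oplus>\<^bsub>free_module R B\<^esub> y = (\<lambda>b\<in>B. x b \<oplus> y b)" "r \<odot>\<^bsub>free_module R B\<^esub> x = (\<lambda>b\<in>B. r \<otimes> x b)"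
  by (simp_all add: free_module_def)

lemma free_is_module: "module R (free_module R B)"
proof (rule moduleI)
  show "abelian_group (free_module R B)"
  proof (rule abelian_groupI)
    fix x assume "x \<in> carrier (free_module R B)"
    then have x: "x \<in> B \<rightarrow>\<^sub>E carrier R" by simp
    show "\<zero>\<^bsub>free_module R B\<^esub> \<oplus>\<^bsub>free_module R B\<^esub> x = x"
      using x by (auto simp: fun_eq_iff PiE_iff extensional_def)
    show "\<exists>y\<in>carrier (free_module R B). y \<oplus>\<^bsub>free_module R B\<^esub> x = \<zero>\<^bsub>free_module R B\<^esub>"
      using x by (intro bexI[of _ "\<lambda>b\<in>B. \<ominus> x b"]) (auto simp: fun_eq_iff PiE_iff l_neg)
  qed (auto simp: fun_eq_iff PiE_iff a_ac)
next
  fix x assume "x \<in> carrier (free_module R B)"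
  then show "\<one> \<odot>\<^bsub>free_module R B\<^esub> x = x"
    by (auto simp: fun_eq_iff PiE_iff extensional_def)
qed (auto simp: fun_eq_iff PiE_iff l_distr r_distr m_ac is_cring)

lemma free_coord_hom: "b \<in> B \<Longrightarrow> (\<lambda>c. c b) \<in> module_hom R (free_module R B) (regular_module R)"
  by (rule module_homI) auto

lemma hom_finsum:
  assumes "module R M" "module R N" "f \<in> module_hom R M N" "finite A" "g \<in> A \<rightarrow> carrier M"
  shows "f (\<Oplus>\<^bsub>M\<^esub>a\<in>A. g a) = (\<Oplus>\<^bsub>N\<^esub>a\<in>A. f (g a))"
proof -
  interpret M: module R M by fact
  interpret N: module R N by fact
  show ?thesis using assms(4,5)
  proof (induction A rule: finite_induct)
    case empty then show ?case using module_hom_zero[OF assms(1-3)] by simp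
  next
    case (insert a A)
    then show ?case using module_homD[OF assms(3)]
      by (simp add: Pi_iff)
  qed
qed

lemma submod_finsum:
  assumes "module R M" "submodule N R M" "finite A" "\<And>a. a \<in> A \<Longrightarrow> g a \<in> N"
  shows "(\<Oplus>\<^bsub>M\<^esub>a\<in>A. g a) \<in> N"
proof -
  interpret M: module R M by fact
  note N = submodD[OF assms(1,2)]
  show ?thesis using assms(3,4)
  proof (induction A rule: finite_induct)
    case empty then show ?case using N(2) by simp
  next
    case (insert a A)
    then have "g \<in> A \<rightarrow> carrier M" "g a \<in> carrier M" using N(1) by auto
    then show ?case using insert N(3) by simp
  qed
qed

lemma finsum_regular: "finite A \<Longrightarrow> g \<in> A \<rightarrow> carrier R \<Longrightarrow> finsum (regular_module R) g A = finsum R g A"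
proof (induction A rule: finite_induct)
  case empty
  interpret M: module R "regular_module R" by (rule regular_is_module)
  show ?case by simp
next
  case (insert a A)
  interpret M: module R "regular_module R" by (rule regular_is_module)
  show ?case using insert by simp
qed

lemma basis_vector_closed [simp]: "basis_vector R B b \<in> B \<rightarrow>\<^sub>E carrier R"
  by (auto simp: basis_vector_def)

lemma free_expand:
  assumes "finite B" "c \<in> B \<rightarrow>\<^sub>E carrier R"
  shows "c = (\<Oplus>\<^bsub>free_module R B\<^esub>b\<in>B. c b \<odot>\<^bsub>free_module R B\<^esub> basis_vector R B b)" (is "_ = ?s")
proof -
  interpret F: module R "free_module R B" by (rule free_is_module)
  have cl: "(\<lambda>b. c b \<odot>\<^bsub>free_module R B\<^esub> basis_vector R B b) \<in> B \<rightarrow> carrier (free_module R B)"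
    using assms(2) by (intro funcsetI F.smult_closed) auto
  have sc: "?s \<in> B \<rightarrow>\<^sub>E carrier R" using F.finsum_closed[OF cl] by simp
  show ?thesis
  proof (rule PiE_ext[OF assms(2) sc])
    fix i assume i: "i \<in> B"
    have "?s i = (\<Oplus>\<^bsub>regular_module R\<^esub>b\<in>B. (c b \<odot>\<^bsub>free_module R B\<^esub> basis_vector R B b) i)"
      by (rule hom_finsum[OF free_is_module regular_is_module free_coord_hom[OF i] assms(1) cl])
    also have "\<dots> = (\<Oplus>\<^bsub>regular_module R\<^esub>b\<in>B. if i = b then c b else \<zero>)"
    proof -
      interpret RR: module R "regular_module R" by (rule regular_is_module)
      have "(c b \<odot>\<^bsub>free_module R B\<^esub> basis_vector R B b) i = (if i = b then c b else \<zero>)" if "b \<in> B" for b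
        using i that assms(2) by (auto simp: basis_vector_def PiE_iff)
      then show ?thesis using assms(2) by (intro RR.finsum_cong') auto
    qed
    also have "\<dots> = (\<Oplus>b\<in>B. if i = b then c b else \<zero>)"
      using assms by (intro finsum_regular) auto
    also have "\<dots> = c i" using assms i by (intro finsum_singleton) auto
    finally show "c i = ?s i" by simp
  qed
qed

lemma free_hom_expand:
  assumes "module R M" "finite B" "f \<in> module_hom R (free_module R B) M" "c \<in> B \<rightarrow>\<^sub>E carrier R"
  shows "f c = (\<Oplus>\<^bsub>M\<^esub>b\<in>B. c b \<odot>\<^bsub>M\<^esub> f (basis_vector R B b))"
proof -
  interpret F: module R "free_module R B" by (rule free_is_module)
  interpret M: module R M by fact
  have cl: "(\<lambda>b. c b \<odot>\<^bsub>free_module R B\<^esub> basis_vector R B b) \<in> B \<rightarrow> carrier (free_module R B)"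
    using assms(4) by (intro funcsetI F.smult_closed) auto
  have "f c = (\<Oplus>\<^bsub>M\<^esub>b\<in>B. f (c b \<odot>\<^bsub>free_module R B\<^esub> basis_vector R B b))"
    using hom_finsum[OF free_is_module assms(1,3,2) cl] free_expand[OF assms(2,4)] by simp
  also have "\<dots> = (\<Oplus>\<^bsub>M\<^esub>b\<in>B. c b \<odot>\<^bsub>M\<^esub> f (basis_vector R B b))"
  proof (rule M.finsum_cong'[OF refl])
    show "(\<lambda>b. c b \<odot>\<^bsub>M\<^esub> f (basis_vector R B b)) \<in> B \<rightarrow> carrier M"
      using assms(4) module_homD(1)[OF assms(3)] by auto
    show "f (c b \<odot>\<^bsub>free_module R B\<^esub> basis_vector R B b) = c b \<odot>\<^bsub>M\<^esub> f (basis_vector R B b)" if "b \<in> B" for b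
      using assms(4) that by (intro module_homD(3)[OF assms(3)]) auto
  qed
  finally show ?thesis .
qed

lemma free_hom_of_basis:
  assumes "module R M" "finite B" "y \<in> B \<rightarrow> carrier M"
  obtains f where "f \<in> module_hom R (free_module R B) M" "\<And>b. b \<in> B \<Longrightarrow> f (basis_vector R B b) = y b"
    "f ` (B \<rightarrow>\<^sub>E carrier R) = module_span R M (y ` B)"
proof -
  interpret M: module R M by fact
  define f where "f c = (\<Oplus>\<^bsub>M\<^esub>b\<in>B. c b \<odot>\<^bsub>M\<^esub> y b)" for c
  have cl: "(\<lambda>b. c b \<odot>\<^bsub>M\<^esub> y b) \<in> B \<rightarrow> carrier M" if "c \<in> B \<rightarrow>\<^sub>E carrier R" for c
    using that assms(3) by auto
  have f: "f \<in> module_hom R (free_module R B) M"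
  proof (rule module_homI)
    fix c assume "c \<in> carrier (free_module R B)"
    then show "f c \<in> carrier M" unfolding f_def using cl by (intro M.finsum_closed) auto
  next
    fix c d assume "c \<in> carrier (free_module R B)" "d \<in> carrier (free_module R B)"
    then have cd: "c \<in> B \<rightarrow>\<^sub>E carrier R" "d \<in> B \<rightarrow>\<^sub>E carrier R" by auto
    have "f (c \<oplus>\<^bsub>free_module R B\<^esub> d) = (\<Oplus>\<^bsub>M\<^esub>b\<in>B. c b \<odot>\<^bsub>M\<^esub> y b \<oplus>\<^bsub>M\<^esub> d b \<odot>\<^bsub>M\<^esub> y b)"
      unfolding f_def using cd assms(3) cl[OF cd(1)] cl[OF cd(2)]
      by (intro M.finsum_cong') (auto simp: M.smult_l_distr PiE_iff Pi_iff)
    then show "f (c \<oplus>\<^bsub>free_module R B\<^esub> d) = f c \<oplus>\<^bsub>M\<^esub> f d"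
      unfolding f_def using cl[OF cd(1)] cl[OF cd(2)] by (simp add: M.finsum_addf)
  next
    fix r c assume r: "r \<in> carrier R" and "c \<in> carrier (free_module R B)"
    then have c: "c \<in> B \<rightarrow>\<^sub>E carrier R" by auto
    have "f (r \<odot>\<^bsub>free_module R B\<^esub> c) = (\<Oplus>\<^bsub>M\<^esub>b\<in>B. r \<odot>\<^bsub>M\<^esub> (c b \<odot>\<^bsub>M\<^esub> y b))"
      unfolding f_def using c r assms(3) cl[OF c]
      by (intro M.finsum_cong') (auto simp: M.smult_assoc1 PiE_iff Pi_iff)
    then show "f (r \<odot>\<^bsub>free_module R B\<^esub> c) = r \<odot>\<^bsub>M\<^esub> f c"
      unfolding f_def using M.finsum_smult_ldistr[OF assms(2) r cl[OF c]] by simp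
  qed
  have b: "f (basis_vector R B i) = y i" if i: "i \<in> B" for i
  proof -
    have "f (basis_vector R B i) = (\<Oplus>\<^bsub>M\<^esub>b\<in>B. if i = b then y b else \<zero>\<^bsub>M\<^esub>)"
      unfolding f_def using assms(3) by (intro M.finsum_cong') (auto simp: basis_vector_def Pi_iff)
    also have "\<dots> = y i" using assms i by (intro M.finsum_singleton) auto
    finally show ?thesis .
  qed
  have yB: "y ` B \<subseteq> carrier M" using assms(3) by auto
  have "f ` (B \<rightarrow>\<^sub>E carrier R) = module_span R M (y ` B)"
  proof
    note sp = span_submod[OF assms(1) yB]
    show "f ` (B \<rightarrow>\<^sub>E carrier R) \<subseteq> module_span R M (y ` B)"
    proof
      fix z assume "z \<in> f ` (B \<rightarrow>\<^sub>E carrier R)"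
      then obtain c where c: "c \<in> B \<rightarrow>\<^sub>E carrier R" "z = f c" by auto
      have "c b \<odot>\<^bsub>M\<^esub> y b \<in> module_span R M (y ` B)" if "b \<in> B" for b
        using c that span_superset[of "y ` B" M] by (intro submodD(4)[OF assms(1) sp]) auto
      then show "z \<in> module_span R M (y ` B)"
        unfolding c(2) f_def by (intro submod_finsum[OF assms(1) sp assms(2)])
    qed
    have "submodule (f ` (B \<rightarrow>\<^sub>E carrier R)) R M"
      using submod_image[OF free_is_module assms(1) f submod_carrier[OF free_is_module]] by simp
    then show "module_span R M (y ` B) \<subseteq> f ` (B \<rightarrow>\<^sub>E carrier R)"
    proof (rule span_least, intro subsetI)
      fix z assume "z \<in> y ` B"
      then obtain i where "i \<in> B" "z = y i" by auto
      then have "z = f (basis_vector R B i)" using b by simp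
      then show "z \<in> f ` (B \<rightarrow>\<^sub>E carrier R)" by (simp only: imageI[OF basis_vector_closed])
    qed
  qed
  then show thesis using that[OF f b] by simp
qed

lemma free_hom_image:
  assumes "module R M" "finite B" "f \<in> module_hom R (free_module R B) M"
  shows "f ` (B \<rightarrow>\<^sub>E carrier R) = module_span R M ((\<lambda>b. f (basis_vector R B b)) ` B)"
proof -
  obtain g where g: "g \<in> module_hom R (free_module R B) M"
    "\<And>b. b \<in> B \<Longrightarrow> g (basis_vector R B b) = f (basis_vector R B b)"
    "g ` (B \<rightarrow>\<^sub>E carrier R) = module_span R M ((\<lambda>b. f (basis_vector R B b)) ` B)"
    by (rule free_hom_of_basis[OF assms(1,2), of "\<lambda>b. f (basis_vector R B b)"])
      (use module_homD(1)[OF assms(3)] in auto)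
  interpret M: module R M by fact
  have "f c = g c" if "c \<in> B \<rightarrow>\<^sub>E carrier R" for c
    unfolding free_hom_expand[OF assms that] free_hom_expand[OF assms(1,2) g(1) that]
    using that module_homD(1)[OF assms(3) basis_vector_closed[folded free_simps(1)]] g(2)
    by (intro M.finsum_cong') auto
  then show ?thesis using g(3) by auto
qed

lemma free_hom_fin_gen:
  assumes "module R M" "finite B" "f \<in> module_hom R (free_module R B) M"
  shows "fin_gen R M (f ` (B \<rightarrow>\<^sub>E carrier R))"
proof -
  have "(\<lambda>b. f (basis_vector R B b)) ` B \<subseteq> carrier M"
    using module_homD(1)[OF assms(3) basis_vector_closed[folded free_simps(1)]] by blast
  then show ?thesis unfolding free_hom_image[OF assms] fin_gen_def using assms(2) by blast
qed

lemma free_fin_gen: "finite B \<Longrightarrow> fin_gen R (free_module R B) (B \<rightarrow>\<^sub>E carrier R)"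
  using free_hom_fin_gen[OF free_is_module _ module_hom_id] by simp

lemma fin_gen_surj:
  assumes "module R M" "fin_gen R M N"
  obtains n f where "f \<in> module_hom R (free_module R {..<n::nat}) M" "f ` ({..<n} \<rightarrow>\<^sub>E carrier R) = N"
proof -
  obtain S where S: "finite S" "S \<subseteq> carrier M" "N = module_span R M S"
    using assms(2) unfolding fin_gen_def by auto
  obtain y where "bij_betw y {0..<card S} S" using ex_bij_betw_nat_finite[OF S(1)] by blast
  then obtain n where y: "y ` {..<n} = S" by (auto simp: bij_betw_def lessThan_atLeast0)
  then have yM: "y \<in> {..<n} \<rightarrow> carrier M" using S(2) by auto
  obtain f where "f \<in> module_hom R (free_module R {..<n}) M"
    "f ` ({..<n} \<rightarrow>\<^sub>E carrier R) = module_span R M (y ` {..<n})"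
    by (rule free_hom_of_basis[OF assms(1) finite_lessThan yM])
  then have "f \<in> module_hom R (free_module R {..<n}) M" "f ` ({..<n} \<rightarrow>\<^sub>E carrier R) = N"
    using y S(3) by (simp_all only:)
  then show thesis by (rule that[of f n])
qed

text \<open>A free module is projective: choose preimages of the images of the basis vectors.\<close>

lemma free_lift:
  assumes "module R M" "module R N" "finite B" "f \<in> module_hom R (free_module R B) M"
    "g \<in> module_hom R N M" "f ` (B \<rightarrow>\<^sub>E carrier R) \<subseteq> g ` carrier N"
  obtains h where "h \<in> module_hom R (free_module R B) N" "\<And>c. c \<in> B \<rightarrow>\<^sub>E carrier R \<Longrightarrow> g (h c) = f c"
proof -
  interpret M: module R M by fact
  have "\<forall>b. \<exists>y\<in>carrier N. g y = f (basis_vector R B b)" 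
  proof
    fix b
    have "f (basis_vector R B b) \<in> g ` carrier N" 
      by (rule subsetD[OF assms(6) imageI[OF basis_vector_closed]])
    then show "\<exists>y\<in>carrier N. g y = f (basis_vector R B b)" by auto
  qed
  then obtain y where y: "\<And>b. y b \<in> carrier N" "\<And>b. g (y b) = f (basis_vector R B b)" by metis
  obtain h where h: "h \<in> module_hom R (free_module R B) N" "\<And>b. b \<in> B \<Longrightarrow> h (basis_vector R B b) = y b"
    by (rule free_hom_of_basis[OF assms(2,3), of y]) (use y in auto)
  have gh: "(\<lambda>x. g (h x)) \<in> module_hom R (free_module R B) M" using module_hom_comp[OF h(1) assms(5)] .
  have "g (h c) = f c" if "c \<in> B \<rightarrow>\<^sub>E carrier R" for c
    unfolding free_hom_expand[OF assms(1,3,4) that] free_hom_expand[OF assms(1,3) gh that]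
    using that module_homD(1)[OF assms(4) basis_vector_closed[folded free_simps(1)]] y h(2)
    by (intro M.finsum_cong') auto
  then show thesis using that h by blast
qed

subsection \<open>Finite presentation\<close>

lemma fp_module: "finitely_presented R M \<Longrightarrow> module R M"
  unfolding finitely_presented_def by simp

lemma fpE:
  assumes "finitely_presented R M"
  obtains q \<pi> where "\<pi> \<in> module_hom R (free_module R {..<q::nat}) M" "\<pi> ` ({..<q} \<rightarrow>\<^sub>E carrier R) = carrier M"
    "fin_gen R (free_module R {..<q}) (a_kernel (free_module R {..<q}) M \<pi>)"
proof -
  obtain p q d \<pi> where "is_presentation R M p q d \<pi>" using assms unfolding finitely_presented_def by auto
  then have "\<pi> \<in> module_hom R (free_module R {..<q::nat}) M" "\<pi> ` ({..<q} \<rightarrow>\<^sub>E carrier R) = carrier M"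
    "a_kernel (free_module R {..<q}) M \<pi> = d ` ({..<p} \<rightarrow>\<^sub>E carrier R)"
    "d \<in> module_hom R (free_module R {..<p}) (free_module R {..<q})"
    unfolding is_presentation_def by auto
  then show thesis using that free_hom_fin_gen[OF free_is_module finite_lessThan] by metis
qed

text \<open>
  The kernel of \<open>\<pi>\<close> is generated by finitely many elements, so it is the image of a second
  finite free module.
\<close>

lemma fpI:
  assumes "module R M" "\<pi> \<in> module_hom R (free_module R {..<q::nat}) M" "\<pi> ` ({..<q} \<rightarrow>\<^sub>E carrier R) = carrier M"
    "fin_gen R (free_module R {..<q}) (a_kernel (free_module R {..<q}) M \<pi>)"
  shows "finitely_presented R M"
proof -
  obtain p d where d: "d \<in> module_hom R (free_module R {..<p::nat}) (free_module R {..<q})"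
    "d ` ({..<p} \<rightarrow>\<^sub>E carrier R) = a_kernel (free_module R {..<q}) M \<pi>"
    by (rule fin_gen_surj[OF free_is_module assms(4)])
  then have "is_presentation R M p q d \<pi>" unfolding is_presentation_def using assms by simp
  then show ?thesis unfolding finitely_presented_def using assms(1) by blast
qed

lemma fp_fin_gen:
  assumes "finitely_presented R M" shows "fin_gen R M (carrier M)"
proof -
  obtain q \<pi> where "\<pi> \<in> module_hom R (free_module R {..<q::nat}) M" "\<pi> ` ({..<q} \<rightarrow>\<^sub>E carrier R) = carrier M"
    by (rule fpE[OF assms])
  then show ?thesis using free_hom_fin_gen[OF fp_module[OF assms], of "{..<q}" \<pi>] by simp
qed

text \<open>
  Schanuel's argument. A lift \<open>h\<close> of a presentation \<open>\<pi>\<close> of \<open>M\<close> along \<open>g\<close> maps the relations of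
  \<open>M\<close> into the kernel of \<open>g\<close>. The rest of the kernel is generated by the differences between
  the generators \<open>s\<close> of \<open>N\<close> and the elements \<open>h c\<close> with \<open>\<pi> c = g s\<close>.
\<close>

lemma fp_kernel_fin_gen:
  assumes "finitely_presented R M" "module R N" "fin_gen R N (carrier N)"
    "g \<in> module_hom R N M" "g ` carrier N = carrier M"
  shows "fin_gen R N (a_kernel N M g)"
proof -
  have M: "module R M" using fp_module assms(1) .
  interpret M: module R M by fact
  interpret N: module R N by fact
  obtain q \<pi> where p: "\<pi> \<in> module_hom R (free_module R {..<q::nat}) M" "\<pi> ` ({..<q} \<rightarrow>\<^sub>E carrier R) = carrier M"
    "fin_gen R (free_module R {..<q}) (a_kernel (free_module R {..<q}) M \<pi>)"
    by (rule fpE[OF assms(1)])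
  let ?F = "free_module R {..<q}"
  interpret F: module R ?F by (rule free_is_module)
  obtain h where h: "h \<in> module_hom R ?F N" "\<And>c. c \<in> carrier ?F \<Longrightarrow> g (h c) = \<pi> c"
  proof (rule free_lift[OF M assms(2) finite_lessThan p(1) assms(4)])
    show "\<pi> ` ({..<q} \<rightarrow>\<^sub>E carrier R) \<subseteq> g ` carrier N" unfolding p(2) assms(5) by simp
  qed auto
  obtain S where S: "finite S" "S \<subseteq> carrier N" "carrier N = module_span R N S"
    using assms(3) unfolding fin_gen_def by auto
  have "\<forall>s\<in>S. \<exists>c\<in>carrier ?F. \<pi> c = g s"
  proof
    fix s assume "s \<in> S"
    then have "g s \<in> carrier M" using S(2) module_homD(1)[OF assms(4)] by blast
    then show "\<exists>c\<in>carrier ?F. \<pi> c = g s" unfolding p(2)[symmetric] by auto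
  qed
  then obtain \<sigma> where s: "\<And>s. s \<in> S \<Longrightarrow> \<sigma> s \<in> carrier ?F" "\<And>s. s \<in> S \<Longrightarrow> \<pi> (\<sigma> s) = g s" by metis
  let ?K = "a_kernel ?F M \<pi>"
  have K: "submodule ?K R ?F" by (rule fin_gen_submod[OF F.module_axioms p(3)])
  let ?T = "(\<lambda>s. s \<ominus>\<^bsub>N\<^esub> h (\<sigma> s)) ` S"
  have Tk: "?T \<subseteq> a_kernel N M g"
  proof
    fix x assume "x \<in> ?T"
    then obtain t where t: "t \<in> S" "x = t \<ominus>\<^bsub>N\<^esub> h (\<sigma> t)" by auto
    have tN: "t \<in> carrier N" "h (\<sigma> t) \<in> carrier N"
      using S(2) t(1) module_homD(1)[OF h(1) s(1)] by auto
    have "g x = g t \<ominus>\<^bsub>M\<^esub> g (h (\<sigma> t))" unfolding t(2) by (rule module_hom_minus[OF assms(2) M assms(4) tN])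
    also have "\<dots> = \<zero>\<^bsub>M\<^esub>"
      using h(2)[OF s(1)[OF t(1)]] s(2)[OF t(1)] module_homD(1)[OF assms(4) tN(1)]
        module_minus_zero_iff[OF M] by simp
    finally show "x \<in> a_kernel N M g" using tN t(2) N.minus_closed unfolding mem_a_kernel by blast
  qed
  have kk: "submodule (a_kernel N M g) R N" by (rule submod_kernel[OF assms(2) M assms(4)])
  have TN: "?T \<subseteq> carrier N" using Tk submodD(1)[OF assms(2) kk] by blast
  let ?W = "module_span R N ?T"
  have W: "submodule ?W R N" by (rule span_submod[OF assms(2) TN])
  have Wk: "?W \<subseteq> a_kernel N M g" by (rule span_least[OF kk Tk])
  have hK: "submodule (h ` ?K) R N" "submodule (h ` carrier ?F) R N"
    by (rule submod_image[OF F.module_axioms assms(2) h(1) K], rule submod_image[OF F.module_axioms assms(2) h(1) submod_carrier[OF F.module_axioms]])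
  have "a_kernel N M g = ?W <+>\<^bsub>N\<^esub> h ` ?K"
  proof
    have "h ` ?K \<subseteq> a_kernel N M g"
    proof
      fix x assume "x \<in> h ` ?K"
      then obtain c where c: "x = h c" "c \<in> ?K" by (rule imageE)
      then have c': "c \<in> carrier ?F" "\<pi> c = \<zero>\<^bsub>M\<^esub>" by (simp_all only: mem_a_kernel)
      show "x \<in> a_kernel N M g"
        using module_homD(1)[OF h(1) c'(1)] h(2)[OF c'(1)] c'(2) by (simp add: mem_a_kernel c(1))
    qed
    then show "?W <+>\<^bsub>N\<^esub> h ` ?K \<subseteq> a_kernel N M g"
      using Wk by (intro submod_sum_least[OF assms(2) kk])
    have all: "module_span R N S \<subseteq> ?W <+>\<^bsub>N\<^esub> h ` carrier ?F"
    proof (rule span_least[OF submod_sum(1)[OF assms(2) W hK(2)]], rule subsetI)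
      fix x assume x: "x \<in> S"
      then have xN: "x \<in> carrier N" "h (\<sigma> x) \<in> carrier N" using S(2) module_homD(1)[OF h(1) s(1)] by auto
      have "x \<ominus>\<^bsub>N\<^esub> h (\<sigma> x) \<in> ?W" using x span_superset[of ?T N] by auto
      then show "x \<in> ?W <+>\<^bsub>N\<^esub> h ` carrier ?F"
        using imageI[OF s(1)[OF x]] by (rule set_addI) (rule module_minus_add[OF assms(2) xN, symmetric])
    qed
    show "a_kernel N M g \<subseteq> ?W <+>\<^bsub>N\<^esub> h ` ?K"
    proof
      fix x assume x: "x \<in> a_kernel N M g"
      then obtain w c where wc: "w \<in> ?W" "c \<in> carrier ?F" "x = w \<oplus>\<^bsub>N\<^esub> h c"
      proof -
        have "x \<in> ?W <+>\<^bsub>N\<^esub> h ` carrier ?F" using x all S(3) by (auto simp: mem_a_kernel)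
        then show thesis using that by (auto simp: mem_set_add)
      qed
      have w: "w \<in> carrier N" "g w = \<zero>\<^bsub>M\<^esub>" using wc(1) Wk by (auto simp: mem_a_kernel)
      have "g x = g w \<oplus>\<^bsub>M\<^esub> g (h c)"
        unfolding wc(3) by (rule module_homD(2)[OF assms(4) w(1) module_homD(1)[OF h(1) wc(2)]])
      then have "\<pi> c = \<zero>\<^bsub>M\<^esub>"
        using x w(2) h(2)[OF wc(2)] module_homD(1)[OF p(1) wc(2)] by (simp add: mem_a_kernel)
      then have "c \<in> ?K" using wc(2) by (simp add: mem_a_kernel)
      then show "x \<in> ?W <+>\<^bsub>N\<^esub> h ` ?K" by (intro set_addI[OF wc(1) _ wc(3)] imageI)
    qed
  qed
  moreover have "fin_gen R N ?W" unfolding fin_gen_def using S(1) TN by blast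
  ultimately show ?thesis
    using fin_gen_sum[OF assms(2)] fin_gen_image[OF F.module_axioms assms(2) h(1) p(3)] by simp
qed

text \<open>
  The relations of \<open>X\<close> are those of \<open>M\<close> together with lifts of generators of the kernel of \<open>g\<close>.
\<close>

lemma fp_quotient:
  assumes "finitely_presented R M" "module R X" "g \<in> module_hom R M X" "g ` carrier M = carrier X"
    "fin_gen R M (a_kernel M X g)"
  shows "finitely_presented R X"
proof -
  have M: "module R M" using fp_module assms(1) .
  interpret M: module R M by fact
  interpret X: module R X by fact
  obtain q \<pi> where p: "\<pi> \<in> module_hom R (free_module R {..<q::nat}) M" "\<pi> ` ({..<q} \<rightarrow>\<^sub>E carrier R) = carrier M"
    "fin_gen R (free_module R {..<q}) (a_kernel (free_module R {..<q}) M \<pi>)"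
    by (rule fpE[OF assms(1)])
  let ?F = "free_module R {..<q}"
  interpret F: module R ?F by (rule free_is_module)
  obtain n f where f: "f \<in> module_hom R (free_module R {..<n::nat}) M" "f ` ({..<n} \<rightarrow>\<^sub>E carrier R) = a_kernel M X g"
    by (rule fin_gen_surj[OF M assms(5)])
  obtain h where h: "h \<in> module_hom R (free_module R {..<n}) ?F" "\<And>c. c \<in> {..<n} \<rightarrow>\<^sub>E carrier R \<Longrightarrow> \<pi> (h c) = f c"
  proof (rule free_lift[OF M F.module_axioms finite_lessThan f(1) p(1)])
    show "f ` ({..<n} \<rightarrow>\<^sub>E carrier R) \<subseteq> \<pi> ` carrier ?F" using f(2) p(2) by (auto simp: mem_a_kernel)
  qed blast
  let ?H = "h ` ({..<n} \<rightarrow>\<^sub>E carrier R)" and ?K = "a_kernel ?F M \<pi>"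
  have gp: "(\<lambda>x. g (\<pi> x)) \<in> module_hom R ?F X" by (rule module_hom_comp[OF p(1) assms(3)])
  have kk: "submodule (a_kernel ?F X (\<lambda>x. g (\<pi> x))) R ?F" by (rule submod_kernel[OF F.module_axioms assms(2) gp])
  have fH: "fin_gen R ?F ?H" by (rule free_hom_fin_gen[OF F.module_axioms finite_lessThan h(1)])
  have "a_kernel ?F X (\<lambda>x. g (\<pi> x)) = ?K <+>\<^bsub>?F\<^esub> ?H"
  proof
    have "?H \<subseteq> a_kernel ?F X (\<lambda>x. g (\<pi> x))"
    proof
      fix x assume "x \<in> ?H"
      then obtain c where c: "c \<in> {..<n} \<rightarrow>\<^sub>E carrier R" "x = h c" by auto
      then have "f c \<in> a_kernel M X g" using f(2) by blast
      then show "x \<in> a_kernel ?F X (\<lambda>x. g (\<pi> x))"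
        using c h(2)[OF c(1)] module_homD(1)[OF h(1), of c] by (simp add: mem_a_kernel)
    qed
    moreover have "?K \<subseteq> a_kernel ?F X (\<lambda>x. g (\<pi> x))"
      using module_hom_zero[OF M assms(2,3)] by (auto simp: mem_a_kernel)
    ultimately show "?K <+>\<^bsub>?F\<^esub> ?H \<subseteq> a_kernel ?F X (\<lambda>x. g (\<pi> x))"
      by (intro submod_sum_least[OF F.module_axioms kk])
    show "a_kernel ?F X (\<lambda>x. g (\<pi> x)) \<subseteq> ?K <+>\<^bsub>?F\<^esub> ?H"
    proof
      fix x assume "x \<in> a_kernel ?F X (\<lambda>x. g (\<pi> x))"
      then have x: "x \<in> carrier ?F" "g (\<pi> x) = \<zero>\<^bsub>X\<^esub>" unfolding mem_a_kernel by auto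
      have "\<pi> x \<in> a_kernel M X g" unfolding mem_a_kernel using x module_homD(1)[OF p(1)] by blast
      then obtain c where c: "c \<in> {..<n} \<rightarrow>\<^sub>E carrier R" "f c = \<pi> x" using f(2) by (metis imageE)
      have hc: "h c \<in> carrier ?F" using c module_homD(1)[OF h(1)] by simp
      have "\<pi> (x \<ominus>\<^bsub>?F\<^esub> h c) = \<zero>\<^bsub>M\<^esub>"
        unfolding module_hom_minus[OF F.module_axioms M p(1) x(1) hc]
        using h(2)[OF c(1)] c(2) module_minus_zero_iff[OF M] module_homD(1)[OF p(1) x(1)] by simp
      then have "x \<ominus>\<^bsub>?F\<^esub> h c \<in> ?K" unfolding mem_a_kernel using x(1) hc F.minus_closed by blast
      then show "x \<in> ?K <+>\<^bsub>?F\<^esub> ?H"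
        using imageI[OF c(1)] by (rule set_addI) (rule module_minus_add[OF F.module_axioms x(1) hc, symmetric])
    qed
  qed
  then have "fin_gen R ?F (a_kernel ?F X (\<lambda>x. g (\<pi> x)))"
    using fin_gen_sum[OF F.module_axioms p(3) fH] by simp
  moreover have "(\<lambda>x. g (\<pi> x)) ` ({..<q} \<rightarrow>\<^sub>E carrier R) = carrier X"
    unfolding assms(4)[symmetric] p(2)[symmetric] by (rule image_image[symmetric])
  ultimately show ?thesis using fpI[OF assms(2) gp] by blast
qed

lemma fp_iso:
  assumes "finitely_presented R M" "module R X" "module_iso R M X"
  shows "finitely_presented R X"
proof -
  have M: "module R M" using fp_module assms(1) .
  interpret M: module R M by fact
  obtain f where f: "f \<in> module_hom R M X" "bij_betw f (carrier M) (carrier X)"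
    using assms(3) unfolding module_iso_def by auto
  have "a_kernel M X f = module_span R M {}"
  proof -
    have "a_kernel M X f \<subseteq> {\<zero>\<^bsub>M\<^esub>}"
      using f(2) module_hom_inj_iff[OF M assms(2) f(1)] by (auto simp: mem_a_kernel bij_betw_def)
    moreover have "\<zero>\<^bsub>M\<^esub> \<in> a_kernel M X f" using module_hom_zero[OF M assms(2) f(1)] by (simp add: mem_a_kernel)
    moreover have "\<zero>\<^bsub>M\<^esub> \<in> module_span R M {}" "module_span R M {} \<subseteq> {\<zero>\<^bsub>M\<^esub>}"
      using submodD(2)[OF M span_submod[OF M]] span_least[OF submod_zero[OF M]] by auto
    ultimately show ?thesis by blast
  qed
  then have "fin_gen R M (a_kernel M X f)" unfolding fin_gen_def by blast
  then show ?thesis using fp_quotient[OF assms(1,2) f(1)] f(2) by (auto simp: bij_betw_def)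
qed

text \<open>
  The copy is a quotient of \<open>R\<^sup>q\<close>, so its type depends on the ring only.
\<close>

lemma fp_copy:
  assumes "finitely_presented R M"
  obtains Y :: "('a, (nat \<Rightarrow> 'a) set) module" where "finitely_presented R Y" "module_iso R M Y"
proof -
  have M: "module R M" using fp_module assms(1) .
  obtain q \<pi> where p: "\<pi> \<in> module_hom R (free_module R {..<q::nat}) M" "\<pi> ` ({..<q} \<rightarrow>\<^sub>E carrier R) = carrier M"
    by (rule fpE[OF assms])
  let ?F = "free_module R {..<q}" and ?Y = "quotient_module (free_module R {..<q}) (a_kernel (free_module R {..<q}) M \<pi>)"
  have k: "submodule (a_kernel ?F M \<pi>) R ?F" by (rule submod_kernel[OF free_is_module M p(1)])
  have Y: "module R ?Y" by (rule quotient_is_module[OF free_is_module k])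
  have "module_iso R M ?Y"
    by (rule iso_of_surj_same_kernel[OF free_is_module M Y p(1) _ quotient_hom[OF free_is_module k]])
      (use p(2) quotient_eq_zero_iff[OF free_is_module k] in \<open>auto simp: quotient_carrier mem_a_kernel\<close>)
  then show thesis using that fp_iso[OF assms Y] by blast
qed

end

section \<open>Modules over a coherent ring\<close>

locale coherent = cring R for R (structure) +
  assumes coherent: "coherent_ring R"

context cring
begin

lemma ideal_iff_submodule: "ideal I R \<longleftrightarrow> submodule I R (regular_module R)"
proof
  assume "ideal I R"
  then interpret ideal I R .
  show "submodule I R (regular_module R)"
    by (rule submodI[OF regular_is_module]) (use a_subset I_l_closed in auto)
next
  assume s: "submodule I R (regular_module R)"
  note D = submodD[OF regular_is_module s]
  interpret M: module R "regular_module R" by (rule regular_is_module)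
  show "ideal I R"
  proof (rule idealI[OF ring_axioms])
    have inv: "\<ominus> x \<in> I" if "x \<in> I" for x
      using that D(1) D(4)[of "\<ominus> \<one>" x] by (auto simp: l_minus)
    show "subgroup I (add_monoid R)"
      by (rule add.subgroupI) (use D inv in auto)
  next
    fix a x assume ax: "a \<in> I" "x \<in> carrier R"
    then have "a \<in> carrier R" using D(1) by auto
    then show "x \<otimes> a \<in> I" "a \<otimes> x \<in> I" using D(4)[of x a] ax by (auto simp: m_comm)
  qed
qed

lemma genideal_eq_span: "Idl A = module_span R (regular_module R) A"
  unfolding genideal_def module_span_def ideal_iff_submodule by simp

lemma direct_sum_simps [simp]:
  "carrier (direct_sum M N) = carrier M \<times> carrier N" "\<zero>\<^bsub>direct_sum M N\<^esub> = (\<zero>\<^bsub>M\<^esub>, \<zero>\<^bsub>N\<^esub>)"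
  "(x, y) \<oplus>\<^bsub>direct_sum M N\<^esub> (x', y') = (x \<oplus>\<^bsub>M\<^esub> x', y \<oplus>\<^bsub>N\<^esub> y')"
  "r \<odot>\<^bsub>direct_sum M N\<^esub> (x, y) = (r \<odot>\<^bsub>M\<^esub> x, r \<odot>\<^bsub>N\<^esub> y)"
  by (simp_all add: direct_sum_def)

lemma direct_sum_is_module:
  assumes "module R M" "module R N"
  shows "module R (direct_sum M N)"
proof -
  interpret M: module R M by fact
  interpret N: module R N by fact
  show ?thesis
  proof (rule moduleI)
    show "abelian_group (direct_sum M N)"
    proof (rule abelian_groupI)
      fix z assume "z \<in> carrier (direct_sum M N)"
      then obtain x y where "z = (x, y)" "x \<in> carrier M" "y \<in> carrier N" by auto
      then show "\<exists>w\<in>carrier (direct_sum M N). w \<oplus>\<^bsub>direct_sum M N\<^esub> z = \<zero>\<^bsub>direct_sum M N\<^esub>"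
        by (intro bexI[of _ "(\<ominus>\<^bsub>M\<^esub> x, \<ominus>\<^bsub>N\<^esub> y)"]) (auto simp: M.l_neg N.l_neg)
    qed (auto simp: M.a_ac N.a_ac)
  qed (auto simp: is_cring M.smult_l_distr N.smult_l_distr M.smult_r_distr N.smult_r_distr
      M.smult_assoc1 N.smult_assoc1)
qed

lemma fst_hom: "fst \<in> module_hom R (direct_sum M N) M"
  by (rule module_homI) auto

lemma snd_hom: "snd \<in> module_hom R (direct_sum M N) N"
  by (rule module_homI) auto

lemma hom_into_direct_sum:
  assumes "f \<in> module_hom R X M" "g \<in> module_hom R X N"
  shows "(\<lambda>x. (f x, g x)) \<in> module_hom R X (direct_sum M N)"
  by (rule module_homI) (use module_homD[OF assms(1)] module_homD[OF assms(2)] in auto)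

lemma fin_gen_subset: "module R M \<Longrightarrow> fin_gen R M N \<Longrightarrow> N \<subseteq> carrier M"
  using fin_gen_submod submodD(1) by blast

lemma fin_gen_self:
  assumes "module R M" "fin_gen R M K"
  shows "module R (M\<lparr>carrier := K\<rparr>)" "fin_gen R (M\<lparr>carrier := K\<rparr>) K"
  using submod_module[OF assms(1) fin_gen_submod[OF assms]]
    fin_gen_restrict[OF assms(1) fin_gen_submod[OF assms] order_refl] assms(2) by auto

end

context coherent
begin

lemma fin_gen_ideal_fp:
  assumes "fin_gen R (regular_module R) I"
  shows "finitely_presented R ((regular_module R)\<lparr>carrier := I\<rparr>)"
proof -
  obtain A where "finite A" "A \<subseteq> carrier R" "I = Idl A"
    using assms unfolding fin_gen_def genideal_eq_span by auto
  then show ?thesis using coherent unfolding coherent_ring_def by simp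
qed

text \<open>
  Coherence enters here: the image of \<open>K\<close> under \<open>\<phi>\<close> is a finitely generated
  ideal, hence finitely presented, so the kernel of the map onto it is finitely generated.
\<close>

lemma fin_gen_functional_kernel:
  assumes "module R N" "fin_gen R N K" "\<phi> \<in> module_hom R N (regular_module R)"
  shows "fin_gen R N {x \<in> K. \<phi> x = \<zero>}"
proof -
  let ?N = "N\<lparr>carrier := K\<rparr>" and ?I = "(regular_module R)\<lparr>carrier := \<phi> ` K\<rparr>"
  note sub = fin_gen_subset[OF assms(1,2)] and self = fin_gen_self[OF assms(1,2)]
  have hom: "\<phi> \<in> module_hom R ?N ?I"
    using module_hom_corestrict[OF module_hom_restrict[OF assms(3) sub], of "\<phi> ` K"] by simp
  have "finitely_presented R ?I"
    by (rule fin_gen_ideal_fp[OF fin_gen_image[OF assms(1) regular_is_module assms(3,2)]])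
  then have "fin_gen R ?N (a_kernel ?N ?I \<phi>)"
    by (rule fp_kernel_fin_gen[OF _ self(1) _ hom]) (use self(2) in simp_all)
  moreover have "a_kernel ?N ?I \<phi> = {x \<in> K. \<phi> x = \<zero>}" by (simp add: set_eq_iff mem_a_kernel)
  ultimately have "fin_gen R ?N {x \<in> K. \<phi> x = \<zero>}" by simp
  then show ?thesis
    using fin_gen_restrict[OF assms(1) fin_gen_submod[OF assms(1,2)], of "{x \<in> K. \<phi> x = \<zero>}"] by auto
qed

text \<open>One coordinate at a time: a vector vanishes iff all its coordinates do.\<close>

lemma fin_gen_free_kernel:
  assumes "module R N" "fin_gen R N K" "finite B" "\<phi> \<in> module_hom R N (free_module R B)"
  shows "fin_gen R N {x \<in> K. \<phi> x = \<zero>\<^bsub>free_module R B\<^esub>}"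
proof -
  have "fin_gen R N {x \<in> K. \<forall>b\<in>B'. \<phi> x b = \<zero>}" if "finite B'" "B' \<subseteq> B" for B'
    using that
  proof (induction B' rule: finite_induct)
    case empty then show ?case using assms(2) by simp
  next
    case (insert b B')
    have "(\<lambda>x. \<phi> x b) \<in> module_hom R N (regular_module R)"
      using module_hom_comp[OF assms(4) free_coord_hom] insert.prems by blast
    then have "fin_gen R N {x \<in> {x \<in> K. \<forall>b\<in>B'. \<phi> x b = \<zero>}. \<phi> x b = \<zero>}"
      using insert by (intro fin_gen_functional_kernel[OF assms(1)]) auto
    moreover have "{x \<in> {x \<in> K. \<forall>b\<in>B'. \<phi> x b = \<zero>}. \<phi> x b = \<zero>} = {x \<in> K. \<forall>b\<in>insert b B'. \<phi> x b = \<zero>}"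
      by auto
    ultimately show ?case by simp
  qed
  then have "fin_gen R N {x \<in> K. \<forall>b\<in>B. \<phi> x b = \<zero>}" using assms(3) by simp
  moreover have "(\<forall>b\<in>B. \<phi> x b = \<zero>) \<longleftrightarrow> \<phi> x = (\<lambda>b\<in>B. \<zero>)" if "x \<in> K" for x
  proof -
    have "\<phi> x \<in> B \<rightarrow>\<^sub>E carrier R"
      using that fin_gen_subset[OF assms(1,2)] module_homD(1)[OF assms(4)] by auto
    then show ?thesis by (auto simp: fun_eq_iff PiE_iff extensional_def)
  qed
  then have "{x \<in> K. \<forall>b\<in>B. \<phi> x b = \<zero>} = {x \<in> K. \<phi> x = \<zero>\<^bsub>free_module R B\<^esub>}" by auto
  ultimately show ?thesis by simp
qed

text \<open>
  A finite presentation \<open>\<pi> : R\<^sup>q \<rightarrow> M\<close> turns the kernel of \<open>\<phi> : K \<rightarrow> M\<close> into the kernel of the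
  projection of the fibre product \<open>K \<times>\<^sub>M R\<^sup>q\<close> to \<open>R\<^sup>q\<close>. The fibre product is generated by lifts
  of generators of \<open>K\<close> together with the relations of \<open>M\<close>.
\<close>

lemma fin_gen_kernel:
  assumes "finitely_presented R M" "module R N" "fin_gen R N K" "\<phi> \<in> module_hom R N M"
  shows "fin_gen R N {x \<in> K. \<phi> x = \<zero>\<^bsub>M\<^esub>}"
proof -
  have M: "module R M" using fp_module assms(1) .
  interpret M: module R M by fact
  interpret N: module R N by fact
  obtain q \<pi> where p: "\<pi> \<in> module_hom R (free_module R {..<q::nat}) M" "\<pi> ` ({..<q} \<rightarrow>\<^sub>E carrier R) = carrier M"
    "fin_gen R (free_module R {..<q}) (a_kernel (free_module R {..<q}) M \<pi>)"
    by (rule fpE[OF assms(1)])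
  let ?F = "free_module R {..<q}" and ?D = "direct_sum N (free_module R {..<q})"
  interpret F: module R ?F by (rule free_is_module)
  have D: "module R ?D" by (rule direct_sum_is_module[OF assms(2) F.module_axioms])
  interpret D: module R ?D by (rule D)
  obtain S where S: "finite S" "S \<subseteq> carrier N" "K = module_span R N S"
    using assms(3) unfolding fin_gen_def by auto
  have SK: "S \<subseteq> K" using span_superset[of S N] S(3) by simp
  have KN: "K \<subseteq> carrier N" by (rule fin_gen_subset[OF assms(2,3)])
  have "\<forall>s\<in>S. \<exists>c\<in>carrier ?F. \<pi> c = \<phi> s"
  proof
    fix s assume "s \<in> S"
    then have "\<phi> s \<in> carrier M" using S(2) module_homD(1)[OF assms(4)] by blast
    then show "\<exists>c\<in>carrier ?F. \<pi> c = \<phi> s" unfolding p(2)[symmetric] by auto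
  qed
  then obtain \<sigma> where s: "\<And>s. s \<in> S \<Longrightarrow> \<sigma> s \<in> carrier ?F" "\<And>s. s \<in> S \<Longrightarrow> \<pi> (\<sigma> s) = \<phi> s" by metis
  define T where "T = (\<lambda>s. (s, \<sigma> s)) ` S"
  define Z where "Z = (\<lambda>c. (\<zero>\<^bsub>N\<^esub>, c)) ` a_kernel ?F M \<pi>"
  define P where "P = {z \<in> carrier ?D. fst z \<in> K \<and> \<phi> (fst z) = \<pi> (snd z)}"
  have TD: "T \<subseteq> carrier ?D" using S(2) s(1) unfolding T_def by auto
  have fgT: "fin_gen R ?D (module_span R ?D T)" unfolding fin_gen_def using S(1) TD unfolding T_def by blast
  have inj: "(\<lambda>c. (\<zero>\<^bsub>N\<^esub>, c)) \<in> module_hom R ?F ?D"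
    by (rule module_homI) auto
  have fgZ: "fin_gen R ?D Z" unfolding Z_def by (rule fin_gen_image[OF F.module_axioms D inj p(3)])
  have K: "submodule K R N" by (rule fin_gen_submod[OF assms(2,3)])
  have P: "submodule P R ?D"
  proof (rule submodI[OF D])
    show "\<zero>\<^bsub>?D\<^esub> \<in> P"
      unfolding P_def using submodD(2)[OF assms(2) K] module_hom_zero[OF assms(2) M assms(4)]
        module_hom_zero[OF F.module_axioms M p(1)] by simp
  next
    fix z w assume "z \<in> P" "w \<in> P"
    then obtain a b a' b' where z: "z = (a, b)" "a \<in> K" "b \<in> carrier ?F" "\<phi> a = \<pi> b"
      and w: "w = (a', b')" "a' \<in> K" "b' \<in> carrier ?F" "\<phi> a' = \<pi> b'" unfolding P_def by auto
    have N: "a \<in> carrier N" "a' \<in> carrier N" using z(2) w(2) KN by auto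
    have "\<phi> (a \<oplus>\<^bsub>N\<^esub> a') = \<pi> (b \<oplus>\<^bsub>?F\<^esub> b')"
      using module_homD(2)[OF assms(4) N] module_homD(2)[OF p(1) z(3) w(3)] z(4) w(4) by simp
    then show "z \<oplus>\<^bsub>?D\<^esub> w \<in> P"
      using F.a_closed[OF z(3) w(3)] submodD(3)[OF assms(2) K z(2) w(2)] N
      unfolding z(1) w(1) P_def by (simp del: free_simps)
  next
    fix r z assume r: "r \<in> carrier R" and "z \<in> P"
    then obtain a b where z: "z = (a, b)" "a \<in> K" "b \<in> carrier ?F" "\<phi> a = \<pi> b" unfolding P_def by auto
    have N: "a \<in> carrier N" using z(2) KN by auto
    have "\<phi> (r \<odot>\<^bsub>N\<^esub> a) = \<pi> (r \<odot>\<^bsub>?F\<^esub> b)"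
      using module_homD(3)[OF assms(4) r N] module_homD(3)[OF p(1) r z(3)] z(4) by simp
    then show "r \<odot>\<^bsub>?D\<^esub> z \<in> P"
      using F.smult_closed[OF r z(3)] submodD(4)[OF assms(2) K r z(2)] N r
      unfolding z(1) P_def by (simp del: free_simps)
  qed (auto simp: P_def)
  have "P = module_span R ?D T <+>\<^bsub>?D\<^esub> Z"
  proof
    have "module_span R ?D T \<subseteq> P"
      by (rule span_least[OF P]) (use TD SK s in \<open>auto simp: P_def T_def\<close>)
    moreover have "Z \<subseteq> P"
      unfolding Z_def P_def using submodD(2)[OF assms(2) K] module_hom_zero[OF assms(2) M assms(4)]
      by (auto simp: mem_a_kernel)
    ultimately show "module_span R ?D T <+>\<^bsub>?D\<^esub> Z \<subseteq> P" by (rule submod_sum_least[OF D P])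
    show "P \<subseteq> module_span R ?D T <+>\<^bsub>?D\<^esub> Z"
    proof
      fix z assume z: "z \<in> P"
      then obtain x y where xy: "z = (x, y)" "x \<in> K" "y \<in> carrier ?F" "\<phi> x = \<pi> y" unfolding P_def by auto
      have "fst ` module_span R ?D T = module_span R N (fst ` T)" by (rule span_image[OF D assms(2) fst_hom TD])
      moreover have "fst ` T = S" unfolding T_def by force
      ultimately have "x \<in> fst ` module_span R ?D T" using xy(2) S(3) by simp
      then obtain y' where y': "(x, y') \<in> module_span R ?D T" by auto
      then have "(x, y') \<in> P" using \<open>module_span R ?D T \<subseteq> P\<close> by auto
      then have y'F: "y' \<in> carrier ?F" "\<phi> x = \<pi> y'" unfolding P_def by auto
      have "y \<ominus>\<^bsub>?F\<^esub> y' \<in> a_kernel ?F M \<pi>"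
        using module_hom_minus[OF F.module_axioms M p(1) xy(3) y'F(1)] xy(4) y'F(2)
          module_minus_zero_iff[OF M] module_homD(1)[OF p(1) y'F(1)] F.minus_closed[OF xy(3) y'F(1)]
        by (simp only: mem_a_kernel)
      then have "(\<zero>\<^bsub>N\<^esub>, y \<ominus>\<^bsub>?F\<^esub> y') \<in> Z" unfolding Z_def by (rule imageI)
      with y' show "z \<in> module_span R ?D T <+>\<^bsub>?D\<^esub> Z"
      proof (rule set_addI)
        have "x \<in> carrier N" using xy(2) KN by auto
        then show "z = (x, y') \<oplus>\<^bsub>?D\<^esub> (\<zero>\<^bsub>N\<^esub>, y \<ominus>\<^bsub>?F\<^esub> y')"
          using module_minus_add[OF F.module_axioms xy(3) y'F(1)] F.a_comm[OF y'F(1) F.minus_closed[OF xy(3) y'F(1)]] xy(1)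
          by (simp only: direct_sum_simps N.r_zero)
      qed
    qed
  qed
  then have "fin_gen R ?D P" using fin_gen_sum[OF D fgT fgZ] by simp
  then have "fin_gen R ?D {z \<in> P. snd z = \<zero>\<^bsub>?F\<^esub>}"
    by (rule fin_gen_free_kernel[OF D _ finite_lessThan snd_hom])
  then have "fin_gen R N (fst ` {z \<in> P. snd z = \<zero>\<^bsub>?F\<^esub>})" by (rule fin_gen_image[OF D assms(2) fst_hom])
  moreover have "fst ` {z \<in> P. snd z = \<zero>\<^bsub>?F\<^esub>} = {x \<in> K. \<phi> x = \<zero>\<^bsub>M\<^esub>}"
  proof -
    have z: "\<pi> \<zero>\<^bsub>?F\<^esub> = \<zero>\<^bsub>M\<^esub>" by (rule module_hom_zero[OF F.module_axioms M p(1)])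
    have "x \<in> fst ` {z \<in> P. snd z = \<zero>\<^bsub>?F\<^esub>}" if "x \<in> K" "\<phi> x = \<zero>\<^bsub>M\<^esub>" for x
    proof (rule image_eqI[of _ _ "(x, \<zero>\<^bsub>?F\<^esub>)"])
      show "(x, \<zero>\<^bsub>?F\<^esub>) \<in> {z \<in> P. snd z = \<zero>\<^bsub>?F\<^esub>}"
        unfolding P_def using that z KN F.zero_closed by (auto simp del: free_simps)
    qed simp
    moreover have "x \<in> K \<and> \<phi> x = \<zero>\<^bsub>M\<^esub>" if "x \<in> fst ` {z \<in> P. snd z = \<zero>\<^bsub>?F\<^esub>}" for x
      using that z unfolding P_def by (auto simp del: free_simps)
    ultimately show ?thesis by auto
  qed
  ultimately show ?thesis by simp
qed

lemma fp_submodule: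
  assumes "finitely_presented R M" "fin_gen R M K"
  shows "finitely_presented R (M\<lparr>carrier := K\<rparr>)"
proof -
  have M: "module R M" using fp_module assms(1) .
  obtain n f where f: "f \<in> module_hom R (free_module R {..<n::nat}) M" "f ` ({..<n} \<rightarrow>\<^sub>E carrier R) = K"
    by (rule fin_gen_surj[OF M assms(2)])
  have hom: "f \<in> module_hom R (free_module R {..<n}) (M\<lparr>carrier := K\<rparr>)"
    using module_hom_corestrict[OF f(1)] f(2) by simp
  have "fin_gen R (free_module R {..<n}) {x \<in> {..<n} \<rightarrow>\<^sub>E carrier R. f x = \<zero>\<^bsub>M\<^esub>}"
    by (rule fin_gen_kernel[OF assms(1) free_is_module free_fin_gen[OF finite_lessThan] f(1)])
  moreover have "{x \<in> {..<n} \<rightarrow>\<^sub>E carrier R. f x = \<zero>\<^bsub>M\<^esub>} = a_kernel (free_module R {..<n}) (M\<lparr>carrier := K\<rparr>) f"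
    by (simp add: set_eq_iff mem_a_kernel)
  ultimately show ?thesis
    using f(2) by (intro fpI[OF fin_gen_self(1)[OF M assms(2)] hom]) auto
qed

lemma fp_kernel:
  assumes "finitely_presented R M" "finitely_presented R N" "f \<in> module_hom R M N"
  shows "finitely_presented R (M\<lparr>carrier := a_kernel M N f\<rparr>)" "fin_gen R M (a_kernel M N f)"
proof -
  show 1: "fin_gen R M (a_kernel M N f)"
    using fin_gen_kernel[OF assms(2) fp_module[OF assms(1)] fp_fin_gen[OF assms(1)] assms(3)]
    by (simp add: a_kernel_def kernel_def)
  show "finitely_presented R (M\<lparr>carrier := a_kernel M N f\<rparr>)" by (rule fp_submodule[OF assms(1) 1])
qed

text \<open>
  The relations of \<open>X\<close> form the intersection of two kernels of maps to finitely presented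
  modules.
\<close>

lemma fp_jointly_injective:
  assumes "finitely_presented R A" "finitely_presented R B" "module R X" "fin_gen R X (carrier X)"
    "f \<in> module_hom R X A" "g \<in> module_hom R X B"
    "\<And>x. x \<in> carrier X \<Longrightarrow> f x = \<zero>\<^bsub>A\<^esub> \<Longrightarrow> g x = \<zero>\<^bsub>B\<^esub> \<Longrightarrow> x = \<zero>\<^bsub>X\<^esub>"
  shows "finitely_presented R X"
proof -
  interpret X: module R X by fact
  obtain n h where h: "h \<in> module_hom R (free_module R {..<n::nat}) X" "h ` ({..<n} \<rightarrow>\<^sub>E carrier R) = carrier X"
    by (rule fin_gen_surj[OF assms(3,4)])
  let ?F = "free_module R {..<n}"
  have "fin_gen R ?F {c \<in> {c \<in> {..<n} \<rightarrow>\<^sub>E carrier R. f (h c) = \<zero>\<^bsub>A\<^esub>}. g (h c) = \<zero>\<^bsub>B\<^esub>}"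
    by (intro fin_gen_kernel[OF assms(2) free_is_module] fin_gen_kernel[OF assms(1) free_is_module]
        free_fin_gen finite_lessThan module_hom_comp[OF h(1)] assms(5,6))
  moreover have "{c \<in> {c \<in> {..<n} \<rightarrow>\<^sub>E carrier R. f (h c) = \<zero>\<^bsub>A\<^esub>}. g (h c) = \<zero>\<^bsub>B\<^esub>} = a_kernel ?F X h"
    using module_hom_zero[OF assms(3) fp_module[OF assms(1)] assms(5)]
      module_hom_zero[OF assms(3) fp_module[OF assms(2)] assms(6)] assms(7) module_homD(1)[OF h(1)]
    by (auto simp: mem_a_kernel)
  ultimately show ?thesis using h(2) by (intro fpI[OF assms(3) h(1)]) auto
qed

lemma fp_regular: "finitely_presented R (regular_module R)"
proof -
  have "\<one> \<in> Idl {\<one>}" using genideal_self'[of \<one>] by simp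
  moreover have "ideal (Idl {\<one>}) R" by (intro genideal_ideal) auto
  ultimately have "Idl {\<one>} = carrier R" using ideal.one_imp_carrier by blast
  then have "fin_gen R (regular_module R) (carrier R)"
    unfolding fin_gen_def genideal_eq_span by (intro exI[of _ "{\<one>}"]) auto
  moreover have "(regular_module R)\<lparr>carrier := carrier R\<rparr> = regular_module R"
    by (simp add: regular_module_def mk_module_def)
  ultimately show ?thesis using fin_gen_ideal_fp by metis
qed

lemma fp_free:
  assumes "finite B" shows "finitely_presented R (free_module R B)"
proof -
  obtain n h where h: "h \<in> module_hom R (free_module R {..<n::nat}) (free_module R B)"
    "h ` ({..<n} \<rightarrow>\<^sub>E carrier R) = B \<rightarrow>\<^sub>E carrier R"
    by (rule fin_gen_surj[OF free_is_module free_fin_gen[OF assms]])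
  have "fin_gen R (free_module R {..<n}) (a_kernel (free_module R {..<n}) (free_module R B) h)"
    using fin_gen_free_kernel[OF free_is_module free_fin_gen[OF finite_lessThan] assms h(1)]
    by (simp add: a_kernel_def kernel_def del: free_simps(2))
  then show ?thesis using h by (intro fpI[OF free_is_module]) auto
qed

lemma fp_direct_sum:
  assumes "finitely_presented R A" "finitely_presented R B"
  shows "finitely_presented R (direct_sum A B)"
proof -
  have A: "module R A" and B: "module R B" using assms fp_module by auto
  interpret A: module R A by fact
  interpret B: module R B by fact
  let ?D = "direct_sum A B"
  have D: "module R ?D" by (rule direct_sum_is_module[OF A B])
  have i: "(\<lambda>a. (a, \<zero>\<^bsub>B\<^esub>)) \<in> module_hom R A ?D" "(\<lambda>b. (\<zero>\<^bsub>A\<^esub>, b)) \<in> module_hom R B ?D"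
    by (rule module_homI; auto)+
  have "fin_gen R ?D ((\<lambda>a. (a, \<zero>\<^bsub>B\<^esub>)) ` carrier A <+>\<^bsub>?D\<^esub> (\<lambda>b. (\<zero>\<^bsub>A\<^esub>, b)) ` carrier B)"
    by (intro fin_gen_sum[OF D] fin_gen_image[OF A D i(1)] fin_gen_image[OF B D i(2)] fp_fin_gen assms)
  moreover have "(\<lambda>a. (a, \<zero>\<^bsub>B\<^esub>)) ` carrier A <+>\<^bsub>?D\<^esub> (\<lambda>b. (\<zero>\<^bsub>A\<^esub>, b)) ` carrier B = carrier ?D"
  proof -
    have "(a, b) \<in> (\<lambda>a. (a, \<zero>\<^bsub>B\<^esub>)) ` carrier A <+>\<^bsub>?D\<^esub> (\<lambda>b. (\<zero>\<^bsub>A\<^esub>, b)) ` carrier B"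
      if "a \<in> carrier A" "b \<in> carrier B" for a b
      using that by (intro set_addI[of "(a, \<zero>\<^bsub>B\<^esub>)" _ "(\<zero>\<^bsub>A\<^esub>, b)"]) auto
    moreover have "(\<lambda>a. (a, \<zero>\<^bsub>B\<^esub>)) ` carrier A <+>\<^bsub>?D\<^esub> (\<lambda>b. (\<zero>\<^bsub>A\<^esub>, b)) ` carrier B \<subseteq> carrier ?D"
      by (rule submod_sum_least[OF D submod_carrier[OF D]]) auto
    ultimately show ?thesis by auto
  qed
  ultimately have "fin_gen R ?D (carrier ?D)" by simp
  then show ?thesis by (rule fp_jointly_injective[OF assms D _ fst_hom snd_hom]) auto
qed

text \<open>
  The annihilator is a finite intersection of kernels of maps \<open>r \<mapsto> r s\<close> from \<open>R\<close> to \<open>M\<close>.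
\<close>

lemma fp_annihilator_fin_gen:
  assumes "finitely_presented R M"
  shows "fin_gen R (regular_module R) (annihilator R M)"
proof -
  have M: "module R M" using fp_module assms .
  interpret M: module R M by fact
  obtain S where S: "finite S" "S \<subseteq> carrier M" "carrier M = module_span R M S"
    using fp_fin_gen[OF assms] unfolding fin_gen_def by auto
  have "fin_gen R (regular_module R) {r \<in> carrier R. \<forall>s\<in>S'. r \<odot>\<^bsub>M\<^esub> s = \<zero>\<^bsub>M\<^esub>}" if "finite S'" "S' \<subseteq> carrier M" for S'
    using that
  proof (induction S' rule: finite_induct)
    case empty then show ?case using fp_fin_gen[OF fp_regular] by simp
  next
    case (insert s S')
    have "(\<lambda>r. r \<odot>\<^bsub>M\<^esub> s) \<in> module_hom R (regular_module R) M"
      using insert by (intro module_homI) (auto simp: M.smult_l_distr M.smult_assoc1)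
    then have "fin_gen R (regular_module R)
      {r \<in> {r \<in> carrier R. \<forall>s\<in>S'. r \<odot>\<^bsub>M\<^esub> s = \<zero>\<^bsub>M\<^esub>}. r \<odot>\<^bsub>M\<^esub> s = \<zero>\<^bsub>M\<^esub>}"
      using insert by (intro fin_gen_kernel[OF assms regular_is_module]) auto
    moreover have "{r \<in> {r \<in> carrier R. \<forall>s\<in>S'. r \<odot>\<^bsub>M\<^esub> s = \<zero>\<^bsub>M\<^esub>}. r \<odot>\<^bsub>M\<^esub> s = \<zero>\<^bsub>M\<^esub>}
      = {r \<in> carrier R. \<forall>s\<in>insert s S'. r \<odot>\<^bsub>M\<^esub> s = \<zero>\<^bsub>M\<^esub>}" by auto
    ultimately show ?case by simp
  qed
  then have 1: "fin_gen R (regular_module R) {r \<in> carrier R. \<forall>s\<in>S. r \<odot>\<^bsub>M\<^esub> s = \<zero>\<^bsub>M\<^esub>}" using S by simp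
  have "r \<odot>\<^bsub>M\<^esub> x = \<zero>\<^bsub>M\<^esub>" if r: "r \<in> carrier R" "\<forall>s\<in>S. r \<odot>\<^bsub>M\<^esub> s = \<zero>\<^bsub>M\<^esub>" and x: "x \<in> carrier M" for r x
  proof -
    have h: "(\<lambda>x. r \<odot>\<^bsub>M\<^esub> x) \<in> module_hom R M M"
      using r(1) by (intro module_homI) (auto simp: M.smult_r_distr M.smult_assoc1[symmetric] m_comm)
    have "module_span R M S \<subseteq> a_kernel M M (\<lambda>x. r \<odot>\<^bsub>M\<^esub> x)"
      by (rule span_least[OF submod_kernel[OF M M h]]) (use r S(2) in \<open>auto simp: mem_a_kernel\<close>)
    then show ?thesis using x S(3) by (auto simp: mem_a_kernel)
  qed
  then have "{r \<in> carrier R. \<forall>s\<in>S. r \<odot>\<^bsub>M\<^esub> s = \<zero>\<^bsub>M\<^esub>} = annihilator R M"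
    using S(2) unfolding annihilator_def by auto
  then show ?thesis using 1 by simp
qed

end

section \<open>Abelian classes of finitely presented modules\<close>

text \<open>
  The classes of finitely presented modules that are closed under zero objects, sums, kernels and
  cokernels. A sum, kernel or cokernel is any module with suitable maps, so such a class is also
  closed under isomorphism. One predicate cannot range over modules of different types; the type
  used here contains a copy of every finitely presented module.
\<close>

definition abelian_class ::
  "('a, 'c) ring_scheme \<Rightarrow> (('a, (nat \<Rightarrow> 'a) set) module \<Rightarrow> bool) \<Rightarrow> bool"
where
  "abelian_class R C \<longleftrightarrow>
     (\<forall>Y. C Y \<longrightarrow> finitely_presented R Y) \<and>
     (\<forall>Y. finitely_presented R Y \<longrightarrow> is_zero_module Y \<longrightarrow> C Y) \<and>
     (\<forall>A B X f g. C A \<longrightarrow> C B \<longrightarrow> module R X \<longrightarrow> f \<in> module_hom R X A \<longrightarrow> g \<in> module_hom R X B \<longrightarrow>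
        bij_betw (\<lambda>x. (f x, g x)) (carrier X) (carrier A \<times> carrier B) \<longrightarrow> C X) \<and>
     (\<forall>A B X f g. C A \<longrightarrow> C B \<longrightarrow> module R X \<longrightarrow> f \<in> module_hom R A B \<longrightarrow> g \<in> module_hom R X A \<longrightarrow>
        inj_on g (carrier X) \<longrightarrow> g ` carrier X = a_kernel A B f \<longrightarrow> C X) \<and>
     (\<forall>A B X f g. C A \<longrightarrow> C B \<longrightarrow> module R X \<longrightarrow> f \<in> module_hom R A B \<longrightarrow> g \<in> module_hom R B X \<longrightarrow>
        g ` carrier B = carrier X \<longrightarrow> a_kernel B X g = f ` carrier A \<longrightarrow> C X)"

definition in_class ::
  "('a, 'c) ring_scheme \<Rightarrow> (('a, (nat \<Rightarrow> 'a) set) module \<Rightarrow> bool) \<Rightarrow> ('a, 'm, 'd) module_scheme \<Rightarrow> bool"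
where
  "in_class R C X \<longleftrightarrow> module R X \<and> (\<exists>Y. C Y \<and> module_iso R X Y)"

definition cyclic_in ::
  "('a, 'c) ring_scheme \<Rightarrow> (('a, (nat \<Rightarrow> 'a) set) module \<Rightarrow> bool) \<Rightarrow> 'a set \<Rightarrow> bool"
where
  "cyclic_in R C I \<longleftrightarrow> in_class R C (quotient_module (regular_module R) I)"

lemma abelian_classD:
  fixes C :: "('a, (nat \<Rightarrow> 'a) set) module \<Rightarrow> bool"
  assumes "abelian_class R C"
  shows "\<And>Y. C Y \<Longrightarrow> finitely_presented R Y"
    and "\<And>Y. finitely_presented R Y \<Longrightarrow> is_zero_module Y \<Longrightarrow> C Y"
    and "\<And>A B X f g. C A \<Longrightarrow> C B \<Longrightarrow> module R X \<Longrightarrow> f \<in> module_hom R X A \<Longrightarrow> g \<in> module_hom R X B \<Longrightarrow>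
        bij_betw (\<lambda>x. (f x, g x)) (carrier X) (carrier A \<times> carrier B) \<Longrightarrow> C X"
    and "\<And>A B X f g. C A \<Longrightarrow> C B \<Longrightarrow> module R X \<Longrightarrow> f \<in> module_hom R A B \<Longrightarrow> g \<in> module_hom R X A \<Longrightarrow>
        inj_on g (carrier X) \<Longrightarrow> g ` carrier X = a_kernel A B f \<Longrightarrow> C X"
    and "\<And>A B X f g. C A \<Longrightarrow> C B \<Longrightarrow> module R X \<Longrightarrow> f \<in> module_hom R A B \<Longrightarrow> g \<in> module_hom R B X \<Longrightarrow>
        g ` carrier B = carrier X \<Longrightarrow> a_kernel B X g = f ` carrier A \<Longrightarrow> C X"
proof -
  note d = assms[unfolded abelian_class_def]
  show "\<And>Y. C Y \<Longrightarrow> finitely_presented R Y" using d[THEN conjunct1] by auto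
  show "\<And>Y. finitely_presented R Y \<Longrightarrow> is_zero_module Y \<Longrightarrow> C Y"
    using d[THEN conjunct2, THEN conjunct1] by auto
  fix A B X :: "('a, (nat \<Rightarrow> 'a) set) module" and f g assume C: "C A" "C B" "module R X"
  show "f \<in> module_hom R X A \<Longrightarrow> g \<in> module_hom R X B \<Longrightarrow>
        bij_betw (\<lambda>x. (f x, g x)) (carrier X) (carrier A \<times> carrier B) \<Longrightarrow> C X"
    using d[THEN conjunct2, THEN conjunct2, THEN conjunct1, rule_format, OF C] .
  show "f \<in> module_hom R A B \<Longrightarrow> g \<in> module_hom R X A \<Longrightarrow>
        inj_on g (carrier X) \<Longrightarrow> g ` carrier X = a_kernel A B f \<Longrightarrow> C X"
    using d[THEN conjunct2, THEN conjunct2, THEN conjunct2, THEN conjunct1, rule_format, OF C] .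
  show "f \<in> module_hom R A B \<Longrightarrow> g \<in> module_hom R B X \<Longrightarrow>
        g ` carrier B = carrier X \<Longrightarrow> a_kernel B X g = f ` carrier A \<Longrightarrow> C X"
    using d[THEN conjunct2, THEN conjunct2, THEN conjunct2, THEN conjunct2, rule_format, OF C] .
qed

context coherent
begin

text \<open>Closure under kernels is where coherence matters.\<close>

lemma abelian_class_fp: "abelian_class R (\<lambda>Y. finitely_presented R Y)"
proof -
  have sum: "finitely_presented R X" if c: "finitely_presented R A" "finitely_presented R B" "module R X"
    "f \<in> module_hom R X A" "g \<in> module_hom R X B" "bij_betw (\<lambda>x. (f x, g x)) (carrier X) (carrier A \<times> carrier B)"
    for A B X :: "('a, (nat \<Rightarrow> 'a) set) module" and f g
  proof -
    note md = fp_module[OF c(1)] fp_module[OF c(2)]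
    have "module_iso R X (direct_sum A B)"
      unfolding module_iso_def using hom_into_direct_sum[OF c(4,5)] c(6) by auto
    then show ?thesis
      using fp_iso[OF fp_direct_sum[OF c(1,2)] c(3)] module_iso_sym[OF c(3) direct_sum_is_module[OF md]] by blast
  qed
  have ker: "finitely_presented R X" if c: "finitely_presented R A" "finitely_presented R B" "module R X"
    "f \<in> module_hom R A B" "g \<in> module_hom R X A" "inj_on g (carrier X)" "g ` carrier X = a_kernel A B f"
    for A B X :: "('a, (nat \<Rightarrow> 'a) set) module" and f g
  proof -
    note fk = fp_kernel(1)[OF c(1,2,4)]
    have "module_iso R X (A\<lparr>carrier := a_kernel A B f\<rparr>)"
      unfolding module_iso_def using module_hom_corestrict[OF c(5), of "a_kernel A B f"] c(6,7)
      by (intro bexI[of _ g]) (auto simp: bij_betw_def)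
    then show ?thesis using fp_iso[OF fk c(3)] module_iso_sym[OF c(3) fp_module[OF fk]] by blast
  qed
  have coker: "finitely_presented R X" if c: "finitely_presented R A" "finitely_presented R B" "module R X"
    "f \<in> module_hom R A B" "g \<in> module_hom R B X" "g ` carrier B = carrier X" "a_kernel B X g = f ` carrier A"
    for A B X :: "('a, (nat \<Rightarrow> 'a) set) module" and f g
  proof (rule fp_quotient[OF c(2,3,5,6)])
    show "fin_gen R B (a_kernel B X g)"
      unfolding c(7) by (rule fin_gen_image[OF fp_module[OF c(1)] fp_module[OF c(2)] c(4) fp_fin_gen[OF c(1)]])
  qed
  show ?thesis
    unfolding abelian_class_def using sum ker coker by blast
qed

context
  fixes C :: "('a, (nat \<Rightarrow> 'a) set) module \<Rightarrow> bool"
  assumes AC: "abelian_class R C"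
begin

lemma in_class_module: "in_class R C X \<Longrightarrow> module R X"
  unfolding in_class_def by simp

lemma class_module: "C Y \<Longrightarrow> module R Y"
  using abelian_classD(1)[OF AC] fp_module by blast

lemma in_classE:
  assumes "in_class R C X"
  obtains Y f g where "C Y" "module R Y" "f \<in> module_hom R X Y" "g \<in> module_hom R Y X"
    "\<And>x. x \<in> carrier X \<Longrightarrow> g (f x) = x" "\<And>y. y \<in> carrier Y \<Longrightarrow> f (g y) = y"
proof -
  obtain Y where Y: "C Y" "module_iso R X Y" using assms unfolding in_class_def by auto
  then show thesis using module_isoE[OF in_class_module[OF assms] class_module[OF Y(1)] Y(2)]
    that[OF Y(1) class_module[OF Y(1)]] by metis
qed

text \<open>Often a surjection with trivial kernel is all that is used of an isomorphism.\<close>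

lemma class_representativeE:
  assumes "in_class R C X"
  obtains Y \<kappa> where "C Y" "module R Y" "\<kappa> \<in> module_hom R X Y" "\<kappa> ` carrier X = carrier Y"
    "\<And>x. x \<in> carrier X \<Longrightarrow> \<kappa> x = \<zero>\<^bsub>Y\<^esub> \<longleftrightarrow> x = \<zero>\<^bsub>X\<^esub>"
proof -
  obtain Y f where Y: "C Y" "f \<in> module_hom R X Y" "bij_betw f (carrier X) (carrier Y)"
    using assms unfolding in_class_def module_iso_def by auto
  note X = in_class_module[OF assms] and Ym = class_module[OF Y(1)]
  have "f x = \<zero>\<^bsub>Y\<^esub> \<longleftrightarrow> x = \<zero>\<^bsub>X\<^esub>" if "x \<in> carrier X" for x
    using module_hom_inj_iff[OF X Ym Y(2)] module_hom_zero[OF X Ym Y(2)] Y(3) that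
    unfolding bij_betw_def by blast
  then show thesis using that[OF Y(1) Ym Y(2)] Y(3) unfolding bij_betw_def by blast
qed

lemma in_class_self: "C Y \<Longrightarrow> in_class R C Y"
  unfolding in_class_def using class_module module_iso_refl by blast

lemma in_class_fp:
  assumes "in_class R C X" shows "finitely_presented R X"
proof -
  obtain Y where Y: "C Y" "module_iso R X Y" using assms unfolding in_class_def by auto
  note X = in_class_module[OF assms]
  show ?thesis
    by (rule fp_iso[OF abelian_classD(1)[OF AC Y(1)] X module_iso_sym[OF X class_module[OF Y(1)] Y(2)]])
qed

lemma in_class_zero:
  assumes "finitely_presented R X" "is_zero_module X"
  shows "in_class R C X"
proof -
  obtain Y :: "('a, (nat \<Rightarrow> 'a) set) module" where Y: "finitely_presented R Y" "module_iso R X Y"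
    by (rule fp_copy[OF assms(1)])
  note m = fp_module[OF assms(1)] fp_module[OF Y(1)]
  obtain f where f: "f \<in> module_hom R X Y" "bij_betw f (carrier X) (carrier Y)"
    using Y(2) unfolding module_iso_def by auto
  have "is_zero_module Y"
    using assms(2) module_hom_zero[OF m f(1)] bij_betw_imp_surj_on[OF f(2)]
    unfolding is_zero_module_def by auto
  then show ?thesis unfolding in_class_def using abelian_classD(2)[OF AC Y(1)] Y(2) m by blast
qed

lemma in_class_iso:
  assumes "in_class R C X" "module R Y" "module_iso R X Y"
  shows "in_class R C Y"
proof -
  note X = in_class_module[OF assms(1)]
  show ?thesis using assms module_iso_trans[OF module_iso_sym[OF X assms(2,3)]] unfolding in_class_def by blast
qed

text \<open>
  The closure properties extend to modules over arbitrary types: pass to members of the class and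
  transport the maps along the isomorphisms.
\<close>

lemma in_class_sum:
  assumes "in_class R C A" "in_class R C B" "module R X" "f \<in> module_hom R X A" "g \<in> module_hom R X B"
    "bij_betw (\<lambda>x. (f x, g x)) (carrier X) (carrier A \<times> carrier B)"
  shows "in_class R C X"
proof -
  note A = in_class_module[OF assms(1)] and B = in_class_module[OF assms(2)]
  have "bij_betw (\<lambda>x. (f x, g x)) (carrier X) (carrier (direct_sum A B))"
    using assms(6) by simp
  then have "module_iso R X (direct_sum A B)"
    unfolding module_iso_def using hom_into_direct_sum[OF assms(4,5)] by blast
  then have fp: "finitely_presented R X"
    using fp_iso[OF fp_direct_sum[OF in_class_fp[OF assms(1)] in_class_fp[OF assms(2)]] assms(3)]
      module_iso_sym[OF assms(3) direct_sum_is_module[OF A B]] by blast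
  obtain Y :: "('a, (nat \<Rightarrow> 'a) set) module" where Y: "finitely_presented R Y" "module_iso R X Y"
    by (rule fp_copy[OF fp])
  have Ym: "module R Y" using fp_module Y(1) .
  obtain i j where ij: "i \<in> module_hom R X Y" "j \<in> module_hom R Y X"
    "\<And>x. x \<in> carrier X \<Longrightarrow> j (i x) = x" "\<And>y. y \<in> carrier Y \<Longrightarrow> i (j y) = y"
    using module_isoE[OF assms(3) Ym Y(2)] by blast
  obtain A' a a' where A': "C A'" "module R A'" "a \<in> module_hom R A A'" "a' \<in> module_hom R A' A"
    "\<And>x. x \<in> carrier A \<Longrightarrow> a' (a x) = x" "\<And>y. y \<in> carrier A' \<Longrightarrow> a (a' y) = y"
    using in_classE[OF assms(1)] by blast
  obtain B' b b' where B': "C B'" "module R B'" "b \<in> module_hom R B B'" "b' \<in> module_hom R B' B"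
    "\<And>x. x \<in> carrier B \<Longrightarrow> b' (b x) = x" "\<And>y. y \<in> carrier B' \<Longrightarrow> b (b' y) = y"
    using in_classE[OF assms(2)] by blast
  have j: "bij_betw j (carrier Y) (carrier X)"
    by (rule bij_betwI[of _ _ _ i]) (use ij module_homD(1)[OF ij(1)] module_homD(1)[OF ij(2)] in auto)
  have ab: "bij_betw (\<lambda>(x, y). (a x, b y)) (carrier A \<times> carrier B) (carrier A' \<times> carrier B')"
    by (rule bij_betwI[of _ _ _ "\<lambda>(x, y). (a' x, b' y)"])
      (use A' B' module_homD(1)[OF A'(3)] module_homD(1)[OF A'(4)] module_homD(1)[OF B'(3)] module_homD(1)[OF B'(4)] in auto)
  have "bij_betw (\<lambda>y. (a (f (j y)), b (g (j y)))) (carrier Y) (carrier A' \<times> carrier B')"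
    using bij_betw_trans[OF j bij_betw_trans[OF assms(6) ab]] by (simp add: comp_def)
  then have "C Y"
    by (rule abelian_classD(3)[OF AC A'(1) B'(1) Ym module_hom_comp[OF module_hom_comp[OF ij(2) assms(4)] A'(3)]
          module_hom_comp[OF module_hom_comp[OF ij(2) assms(5)] B'(3)]])
  then show ?thesis unfolding in_class_def using assms(3) Y(2) by blast
qed

lemma in_class_kernel:
  assumes "in_class R C A" "in_class R C B" "f \<in> module_hom R A B"
  shows "in_class R C (A\<lparr>carrier := a_kernel A B f\<rparr>)"
proof -
  note A = in_class_module[OF assms(1)] and B = in_class_module[OF assms(2)]
  let ?X = "A\<lparr>carrier := a_kernel A B f\<rparr>"
  have fp: "finitely_presented R ?X" by (rule fp_kernel[OF in_class_fp[OF assms(1)] in_class_fp[OF assms(2)] assms(3)])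
  have X: "module R ?X" using fp_module fp .
  have kA: "a_kernel A B f \<subseteq> carrier A" by (auto simp: mem_a_kernel)
  obtain Y :: "('a, (nat \<Rightarrow> 'a) set) module" where Y: "finitely_presented R Y" "module_iso R ?X Y"
    by (rule fp_copy[OF fp])
  have Ym: "module R Y" using fp_module Y(1) .
  obtain i j where ij: "i \<in> module_hom R ?X Y" "j \<in> module_hom R Y ?X"
    "\<And>x. x \<in> carrier ?X \<Longrightarrow> j (i x) = x" "\<And>y. y \<in> carrier Y \<Longrightarrow> i (j y) = y"
    using module_isoE[OF X Ym Y(2)] by blast
  obtain A' a a' where A': "C A'" "module R A'" "a \<in> module_hom R A A'" "a' \<in> module_hom R A' A"
    "\<And>x. x \<in> carrier A \<Longrightarrow> a' (a x) = x" "\<And>y. y \<in> carrier A' \<Longrightarrow> a (a' y) = y"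
    using in_classE[OF assms(1)] by blast
  obtain B' b b' where B': "C B'" "module R B'" "b \<in> module_hom R B B'" "b' \<in> module_hom R B' B"
    "\<And>x. x \<in> carrier B \<Longrightarrow> b' (b x) = x" "\<And>y. y \<in> carrier B' \<Longrightarrow> b (b' y) = y"
    using in_classE[OF assms(2)] by blast
  have jA: "j \<in> module_hom R Y A" by (rule module_hom_extend[OF ij(2) kA])
  have jk: "j y \<in> carrier A" "f (j y) = \<zero>\<^bsub>B\<^esub>" if "y \<in> carrier Y" for y
    using module_homD(1)[OF ij(2) that] by (simp_all add: mem_a_kernel)
  have "C Y"
  proof (rule abelian_classD(4)[OF AC A'(1) B'(1) Ym])
    show "(\<lambda>x. b (f (a' x))) \<in> module_hom R A' B'"
      by (rule module_hom_comp[OF module_hom_comp[OF A'(4) assms(3)] B'(3)])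
    show "(\<lambda>y. a (j y)) \<in> module_hom R Y A'" by (rule module_hom_comp[OF jA A'(3)])
    show "inj_on (\<lambda>y. a (j y)) (carrier Y)"
      by (rule inj_on_inverseI[of _ "\<lambda>x. i (a' x)"]) (use ij(4) A'(5) jk in auto)
    show "(\<lambda>y. a (j y)) ` carrier Y = a_kernel A' B' (\<lambda>x. b (f (a' x)))"
    proof (intro equalityI subsetI)
      fix z assume "z \<in> (\<lambda>y. a (j y)) ` carrier Y"
      then obtain y where y: "y \<in> carrier Y" "z = a (j y)" by auto
      then show "z \<in> a_kernel A' B' (\<lambda>x. b (f (a' x)))"
        using jk[OF y(1)] A'(5) module_homD(1)[OF A'(3)] module_hom_zero[OF B B'(2,3)]
        by (simp add: mem_a_kernel)
    next
      fix z assume "z \<in> a_kernel A' B' (\<lambda>x. b (f (a' x)))"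
      then have z: "z \<in> carrier A'" "b (f (a' z)) = \<zero>\<^bsub>B'\<^esub>" by (simp_all add: mem_a_kernel)
      have az: "a' z \<in> carrier A" by (rule module_homD(1)[OF A'(4) z(1)])
      have "f (a' z) = b' (b (f (a' z)))" using B'(5) module_homD(1)[OF assms(3) az] by simp
      then have "f (a' z) = \<zero>\<^bsub>B\<^esub>" using z(2) module_hom_zero[OF B'(2) B B'(4)] by simp
      then have x: "a' z \<in> carrier ?X" using az by (simp add: mem_a_kernel)
      then have "z = a (j (i (a' z)))" using ij(3) A'(6) z(1) by simp
      then show "z \<in> (\<lambda>y. a (j y)) ` carrier Y" using module_homD(1)[OF ij(1) x] by (rule image_eqI)
    qed
  qed
  then show ?thesis unfolding in_class_def using X Y(2) by blast
qed

lemma in_class_cokernel: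
  assumes "in_class R C A" "in_class R C B" "module R X" "f \<in> module_hom R A B" "g \<in> module_hom R B X"
    "g ` carrier B = carrier X" "a_kernel B X g = f ` carrier A"
  shows "in_class R C X"
proof -
  note A = in_class_module[OF assms(1)] and B = in_class_module[OF assms(2)]
  have "fin_gen R B (f ` carrier A)"
    by (rule fin_gen_image[OF A B assms(4) fp_fin_gen[OF in_class_fp[OF assms(1)]]])
  then have fp: "finitely_presented R X"
    using fp_quotient[OF in_class_fp[OF assms(2)] assms(3,5,6)] assms(7) by simp
  obtain Y :: "('a, (nat \<Rightarrow> 'a) set) module" where Y: "finitely_presented R Y" "module_iso R X Y"
    by (rule fp_copy[OF fp])
  have Ym: "module R Y" using fp_module Y(1) .
  obtain i j where ij: "i \<in> module_hom R X Y" "j \<in> module_hom R Y X"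
    "\<And>x. x \<in> carrier X \<Longrightarrow> j (i x) = x" "\<And>y. y \<in> carrier Y \<Longrightarrow> i (j y) = y"
    using module_isoE[OF assms(3) Ym Y(2)] by blast
  obtain A' a a' where A': "C A'" "module R A'" "a \<in> module_hom R A A'" "a' \<in> module_hom R A' A"
    "\<And>x. x \<in> carrier A \<Longrightarrow> a' (a x) = x" "\<And>y. y \<in> carrier A' \<Longrightarrow> a (a' y) = y"
    using in_classE[OF assms(1)] by blast
  obtain B' b b' where B': "C B'" "module R B'" "b \<in> module_hom R B B'" "b' \<in> module_hom R B' B"
    "\<And>x. x \<in> carrier B \<Longrightarrow> b' (b x) = x" "\<And>y. y \<in> carrier B' \<Longrightarrow> b (b' y) = y"
    using in_classE[OF assms(2)] by blast
  have "C Y"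
  proof (rule abelian_classD(5)[OF AC A'(1) B'(1) Ym])
    show "(\<lambda>x. b (f (a' x))) \<in> module_hom R A' B'"
      by (rule module_hom_comp[OF module_hom_comp[OF A'(4) assms(4)] B'(3)])
    show "(\<lambda>x. i (g (b' x))) \<in> module_hom R B' Y"
      by (rule module_hom_comp[OF module_hom_comp[OF B'(4) assms(5)] ij(1)])
    show "(\<lambda>x. i (g (b' x))) ` carrier B' = carrier Y"
    proof (intro equalityI subsetI)
      fix y assume y: "y \<in> carrier Y"
      then have "j y \<in> g ` carrier B" using module_homD(1)[OF ij(2)] assms(6) by simp
      then obtain x where x: "x \<in> carrier B" "j y = g x" by auto
      then have "y = i (g (b' (b x)))" using B'(5) ij(4)[OF y] by simp
      then show "y \<in> (\<lambda>x. i (g (b' x))) ` carrier B'" using module_homD(1)[OF B'(3) x(1)] by (rule image_eqI)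
    qed (use module_homD(1)[OF ij(1)] module_homD(1)[OF assms(5)] module_homD(1)[OF B'(4)] in auto)
    show "a_kernel B' Y (\<lambda>x. i (g (b' x))) = (\<lambda>x. b (f (a' x))) ` carrier A'"
    proof (intro equalityI subsetI)
      fix z assume "z \<in> a_kernel B' Y (\<lambda>x. i (g (b' x)))"
      then have z: "z \<in> carrier B'" "i (g (b' z)) = \<zero>\<^bsub>Y\<^esub>" by (simp_all add: mem_a_kernel)
      have bz: "b' z \<in> carrier B" by (rule module_homD(1)[OF B'(4) z(1)])
      have "g (b' z) = j (i (g (b' z)))" using ij(3) module_homD(1)[OF assms(5) bz] by simp
      then have "g (b' z) = \<zero>\<^bsub>X\<^esub>" using z(2) module_hom_zero[OF Ym assms(3) ij(2)] by simp
      then have "b' z \<in> f ` carrier A" using bz assms(7) by (auto simp: mem_a_kernel)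
      then obtain x where x: "x \<in> carrier A" "b' z = f x" by auto
      then have "z = b (f (a' (a x)))" using A'(5) B'(6)[OF z(1)] by simp
      then show "z \<in> (\<lambda>x. b (f (a' x))) ` carrier A'" using module_homD(1)[OF A'(3) x(1)] by (rule image_eqI)
    next
      fix z assume "z \<in> (\<lambda>x. b (f (a' x))) ` carrier A'"
      then obtain x where x: "x \<in> carrier A'" "z = b (f (a' x))" by auto
      have fx: "f (a' x) \<in> a_kernel B X g" using assms(7) module_homD(1)[OF A'(4) x(1)] by simp
      then have "g (f (a' x)) = \<zero>\<^bsub>X\<^esub>" "f (a' x) \<in> carrier B" by (simp_all add: mem_a_kernel)
      then show "z \<in> a_kernel B' Y (\<lambda>x. i (g (b' x)))"
        using x(2) B'(5) module_homD(1)[OF B'(3)] module_hom_zero[OF assms(3) Ym ij(1)]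
        by (simp add: mem_a_kernel)
    qed
  qed
  then show ?thesis unfolding in_class_def using assms(3) Y(2) by blast
qed

text \<open>The two directions are closure under kernels and cokernels.\<close>

lemma in_class_surj_iff:
  assumes "in_class R C A" "module R D" "g \<in> module_hom R A D" "g ` carrier A = carrier D"
  shows "in_class R C D \<longleftrightarrow> in_class R C (A\<lparr>carrier := a_kernel A D g\<rparr>)"
proof
  assume "in_class R C D"
  then show "in_class R C (A\<lparr>carrier := a_kernel A D g\<rparr>)" using in_class_kernel[OF assms(1) _ assms(3)] by simp
next
  assume k: "in_class R C (A\<lparr>carrier := a_kernel A D g\<rparr>)"
  have "(\<lambda>x. x) \<in> module_hom R (A\<lparr>carrier := a_kernel A D g\<rparr>) A"
    by (rule module_hom_restrict[OF module_hom_id]) (auto simp: mem_a_kernel)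
  then show "in_class R C D"
    by (rule in_class_cokernel[OF k assms(1,2) _ assms(3,4)]) simp
qed

lemma in_class_quotient_iff:
  assumes "in_class R C A" "submodule N R A"
  shows "in_class R C (quotient_module A N) \<longleftrightarrow> in_class R C (A\<lparr>carrier := N\<rparr>)"
proof -
  note A = in_class_module[OF assms(1)]
  have "a_kernel A (quotient_module A N) (\<lambda>x. N +>\<^bsub>A\<^esub> x) = N"
    using submodD(1)[OF A assms(2)] quotient_eq_zero_iff[OF A assms(2)] by (auto simp: mem_a_kernel)
  then show ?thesis
    using in_class_surj_iff[OF assms(1) quotient_is_module[OF A assms(2)] quotient_hom[OF A assms(2)]]
    by (simp add: quotient_carrier)
qed

lemma in_class_image:
  assumes "in_class R C A" "in_class R C B" "f \<in> module_hom R A B"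
  shows "in_class R C (B\<lparr>carrier := f ` carrier A\<rparr>)"
proof -
  note A = in_class_module[OF assms(1)] and B = in_class_module[OF assms(2)]
  let ?I = "B\<lparr>carrier := f ` carrier A\<rparr>"
  have I: "module R ?I" by (rule submod_module[OF B submod_image[OF A B assms(3) submod_carrier[OF A]]])
  have "a_kernel A ?I f = a_kernel A B f" by (simp add: set_eq_iff mem_a_kernel)
  then show ?thesis
    using in_class_surj_iff[OF assms(1) I module_hom_corestrict[OF assms(3) order_refl]]
      in_class_kernel[OF assms] by simp
qed

lemma class_quotientE:
  assumes "in_class R C A" "submodule N R A" "in_class R C (A\<lparr>carrier := N\<rparr>)"
  obtains Y \<kappa> where "C Y" "module R Y" "\<kappa> \<in> module_hom R A Y" "\<kappa> ` carrier A = carrier Y"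
    "\<And>x. x \<in> carrier A \<Longrightarrow> \<kappa> x = \<zero>\<^bsub>Y\<^esub> \<longleftrightarrow> x \<in> N"
proof -
  note A = in_class_module[OF assms(1)]
  have "in_class R C (quotient_module A N)" using in_class_quotient_iff[OF assms(1,2)] assms(3) by simp
  then obtain Y k where Y: "C Y" "module R Y" "k \<in> module_hom R (quotient_module A N) Y"
    "k ` carrier (quotient_module A N) = carrier Y"
    "\<And>x. x \<in> carrier (quotient_module A N) \<Longrightarrow> k x = \<zero>\<^bsub>Y\<^esub> \<longleftrightarrow> x = \<zero>\<^bsub>quotient_module A N\<^esub>"
    using class_representativeE by blast
  show thesis
  proof (rule that[OF Y(1,2) module_hom_comp[OF quotient_hom[OF A assms(2)] Y(3)]])
    show "(\<lambda>x. k (N +>\<^bsub>A\<^esub> x)) ` carrier A = carrier Y"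
      using Y(4) by (simp add: quotient_carrier image_image)
    show "k (N +>\<^bsub>A\<^esub> x) = \<zero>\<^bsub>Y\<^esub> \<longleftrightarrow> x \<in> N" if "x \<in> carrier A" for x
      using Y(5)[of "N +>\<^bsub>A\<^esub> x"] quotient_eq_zero_iff[OF A assms(2) that] that by (simp add: quotient_carrier)
  qed
qed

lemma in_class_preimage:
  assumes "in_class R C A" "in_class R C B" "f \<in> module_hom R A B" "submodule N R B"
    "in_class R C (B\<lparr>carrier := N\<rparr>)"
  shows "in_class R C (A\<lparr>carrier := {x \<in> carrier A. f x \<in> N}\<rparr>)"
proof -
  note A = in_class_module[OF assms(1)] and B = in_class_module[OF assms(2)]
  have q: "in_class R C (quotient_module B N)" using in_class_quotient_iff[OF assms(2,4)] assms(5) by simp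
  have "a_kernel A (quotient_module B N) (\<lambda>x. N +>\<^bsub>B\<^esub> f x) = {x \<in> carrier A. f x \<in> N}"
    using quotient_eq_zero_iff[OF B assms(4)] module_homD(1)[OF assms(3)] by (auto simp: mem_a_kernel)
  then show ?thesis
    using in_class_kernel[OF assms(1) q module_hom_comp[OF assms(3) quotient_hom[OF B assms(4)]]] by simp
qed

end

text \<open>A module is the kernel of a zero map out of any module isomorphic to it.\<close>

lemma class_iff_in_class:
  assumes "abelian_class R C"
  shows "C Y \<longleftrightarrow> in_class R C Y"
proof
  assume "C Y" then show "in_class R C Y" using in_class_self[OF assms] by simp
next
  assume Y: "in_class R C Y"
  have Ym: "module R Y" using in_class_module[OF assms Y] .
  interpret Y: module R Y by fact
  obtain A f g where A: "C A" "module R A" "f \<in> module_hom R Y A" "g \<in> module_hom R A Y"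
    "\<And>x. x \<in> carrier Y \<Longrightarrow> g (f x) = x" "\<And>y. y \<in> carrier A \<Longrightarrow> f (g y) = y"
    using in_classE[OF assms Y] by blast
  interpret A: module R A by fact
  show "C Y"
  proof (rule abelian_classD(4)[OF assms A(1,1) Ym _ A(3)])
    show "(\<lambda>_. \<zero>\<^bsub>A\<^esub>) \<in> module_hom R A A" by (rule module_homI) auto
    show "inj_on f (carrier Y)" using A(5) by (rule inj_on_inverseI)
    show "f ` carrier Y = a_kernel A A (\<lambda>_. \<zero>\<^bsub>A\<^esub>)"
    proof (intro equalityI subsetI)
      fix a assume "a \<in> a_kernel A A (\<lambda>_. \<zero>\<^bsub>A\<^esub>)"
      then have a: "a \<in> carrier A" by (simp add: mem_a_kernel)
      show "a \<in> f ` carrier Y" using A(6)[OF a] module_homD(1)[OF A(4) a] by (metis imageI)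
    qed (use module_homD(1)[OF A(3)] in \<open>auto simp: mem_a_kernel\<close>)
  qed
qed

subsection \<open>Cyclic modules\<close>

lemma ideal_quotient_module:
  assumes "submodule I R (regular_module R)"
  shows "module R (quotient_module (regular_module R) I)"
  by (rule quotient_is_module[OF regular_is_module assms])

lemma orbit_hom:
  assumes "module R X" "e \<in> carrier X"
  shows "(\<lambda>r. r \<odot>\<^bsub>X\<^esub> e) \<in> module_hom R (regular_module R) X"
proof -
  interpret X: module R X by fact
  show ?thesis using assms(2) by (intro module_homI) (auto simp: X.smult_l_distr X.smult_assoc1)
qed

lemma submod_orbit:
  assumes "module R X" "e \<in> carrier X"
  shows "submodule ((\<lambda>r. r \<odot>\<^bsub>X\<^esub> e) ` carrier R) R X"
  using submod_image[OF regular_is_module assms(1) orbit_hom[OF assms] submod_carrier[OF regular_is_module]] by simp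

lemma submod_element_annihilator:
  assumes "module R X" "e \<in> carrier X"
  shows "submodule {r \<in> carrier R. r \<odot>\<^bsub>X\<^esub> e = \<zero>\<^bsub>X\<^esub>} R (regular_module R)"
  using submod_kernel[OF regular_is_module assms(1) orbit_hom[OF assms]]
  by (simp add: a_kernel_def kernel_def)

lemma fin_gen_orbit:
  assumes "module R X" "e \<in> carrier X"
  shows "fin_gen R X ((\<lambda>r. r \<odot>\<^bsub>X\<^esub> e) ` carrier R)"
  using fin_gen_image[OF regular_is_module assms(1) orbit_hom[OF assms] fp_fin_gen[OF fp_regular]] by simp

text \<open>By the isomorphism \<open>R / Ann e \<cong> R e\<close>.\<close>

lemma cyclic_in_iff:
  assumes "abelian_class R C" "module R X" "e \<in> carrier X" "(\<lambda>r. r \<odot>\<^bsub>X\<^esub> e) ` carrier R = carrier X"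
  shows "cyclic_in R C {r \<in> carrier R. r \<odot>\<^bsub>X\<^esub> e = \<zero>\<^bsub>X\<^esub>} \<longleftrightarrow> in_class R C X"
proof -
  let ?I = "{r \<in> carrier R. r \<odot>\<^bsub>X\<^esub> e = \<zero>\<^bsub>X\<^esub>}"
  note I = submod_element_annihilator[OF assms(2,3)] and rm = regular_is_module
  have Q: "module R (quotient_module (regular_module R) ?I)" by (rule ideal_quotient_module[OF I])
  have iso: "module_iso R (quotient_module (regular_module R) ?I) X"
    by (rule iso_of_surj_same_kernel[OF rm Q assms(2) quotient_hom[OF rm I] _ orbit_hom[OF assms(2,3)]])
      (use assms(4) quotient_eq_zero_iff[OF rm I] in \<open>auto simp: quotient_carrier\<close>)
  show ?thesis unfolding cyclic_in_def
    using in_class_iso[OF assms(1) _ assms(2) iso] in_class_iso[OF assms(1) _ Q module_iso_sym[OF Q assms(2) iso]] by blast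
qed

lemma cyclic_in_orbit_iff:
  assumes "abelian_class R C" "module R X" "e \<in> carrier X"
  shows "cyclic_in R C {r \<in> carrier R. r \<odot>\<^bsub>X\<^esub> e = \<zero>\<^bsub>X\<^esub>} \<longleftrightarrow>
    in_class R C (X\<lparr>carrier := (\<lambda>r. r \<odot>\<^bsub>X\<^esub> e) ` carrier R\<rparr>)"
proof -
  interpret X: module R X by fact
  have "e \<in> (\<lambda>r. r \<odot>\<^bsub>X\<^esub> e) ` carrier R" using assms(3) by (intro image_eqI[of _ _ \<one>]) auto
  then show ?thesis
    using cyclic_in_iff[OF assms(1) submod_module[OF assms(2) submod_orbit[OF assms(2,3)]], of e] by simp
qed

lemma cyclic_in_fin_gen:
  assumes "abelian_class R C" "submodule I R (regular_module R)" "cyclic_in R C I"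
  shows "fin_gen R (regular_module R) I"
proof -
  note rm = regular_is_module
  have "fin_gen R (regular_module R) (a_kernel (regular_module R) (quotient_module (regular_module R) I)
      (\<lambda>x. I +>\<^bsub>regular_module R\<^esub> x))"
    by (rule fp_kernel_fin_gen[OF in_class_fp[OF assms(1) assms(3)[unfolded cyclic_in_def]] rm
          fp_fin_gen[OF fp_regular] quotient_hom[OF rm assms(2)]]) (simp add: quotient_carrier)
  moreover have "a_kernel (regular_module R) (quotient_module (regular_module R) I)
      (\<lambda>x. I +>\<^bsub>regular_module R\<^esub> x) = I"
    using submodD(1)[OF rm assms(2)] quotient_eq_zero_iff[OF rm assms(2)] by (auto simp: mem_a_kernel)
  ultimately show ?thesis by simp
qed

end

lemma surjD: "f ` A = B \<Longrightarrow> y \<in> B \<Longrightarrow> \<exists>x\<in>A. y = f x"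
  by blast

lemma hom_onto:
  assumes "f \<in> module_hom R M N" "\<And>y. y \<in> carrier N \<Longrightarrow> \<exists>x\<in>carrier M. f x = y"
  shows "f ` carrier M = carrier N"
  using module_homD(1)[OF assms(1)] assms(2) by fast

context cring
begin

lemma hom_vanishes_on_killed_vectors:
  assumes "module R Z" "finite B" "\<phi> \<in> module_hom R (free_module R B) Z" "c \<in> B \<rightarrow>\<^sub>E carrier R"
    "\<And>b z. b \<in> B \<Longrightarrow> z \<in> carrier Z \<Longrightarrow> c b \<odot>\<^bsub>Z\<^esub> z = \<zero>\<^bsub>Z\<^esub>"
  shows "\<phi> c = \<zero>\<^bsub>Z\<^esub>"
proof -
  interpret Z: module R Z by fact
  have "\<phi> c = (\<Oplus>\<^bsub>Z\<^esub>b\<in>B. c b \<odot>\<^bsub>Z\<^esub> \<phi> (basis_vector R B b))" by (rule free_hom_expand[OF assms(1-4)])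
  also have "\<dots> = (\<Oplus>\<^bsub>Z\<^esub>b\<in>B. \<zero>\<^bsub>Z\<^esub>)"
    using assms(5) module_homD(1)[OF assms(3) basis_vector_closed[folded free_simps(1)]]
    by (intro Z.finsum_cong') auto
  finally show ?thesis by simp
qed

lemma free_restrict_hom:
  assumes "B' \<subseteq> B"
  shows "(\<lambda>c. restrict c B') \<in> module_hom R (free_module R B) (free_module R B')"
  by (rule module_homI) (use assms in \<open>auto simp: fun_eq_iff PiE_iff subset_iff\<close>)

lemma free_extend_hom:
  assumes "B' \<subseteq> B"
  shows "(\<lambda>c. \<lambda>b\<in>B. if b \<in> B' then c b else \<zero>) \<in> module_hom R (free_module R B') (free_module R B)"
  by (rule module_homI) (use assms in \<open>auto simp: fun_eq_iff PiE_iff subset_iff\<close>)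

lemma coset_zero_iff_mem:
  assumes "submodule I R (regular_module R)" "r \<in> carrier R"
  shows "I +>\<^bsub>regular_module R\<^esub> r = \<zero>\<^bsub>quotient_module (regular_module R) I\<^esub> \<longleftrightarrow> r \<in> I"
  using quotient_eq_zero_iff[OF regular_is_module assms(1)] assms(2) by simp

lemma smult_hom:
  assumes "module R M" "r \<in> carrier R"
  shows "(\<lambda>x. r \<odot>\<^bsub>M\<^esub> x) \<in> module_hom R M M"
proof -
  interpret M: module R M by fact
  show ?thesis using assms(2)
    by (intro module_homI) (auto simp: M.smult_r_distr M.smult_assoc1[symmetric] m_comm)
qed

lemma submod_smult_image:
  assumes "module R M" "r \<in> carrier R" "submodule N R M"
  shows "submodule ((\<lambda>x. r \<odot>\<^bsub>M\<^esub> x) ` N) R M" "(\<lambda>x. r \<odot>\<^bsub>M\<^esub> x) ` N \<subseteq> N"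
proof -
  show "submodule ((\<lambda>x. r \<odot>\<^bsub>M\<^esub> x) ` N) R M" by (rule submod_image[OF assms(1,1) smult_hom[OF assms(1,2)] assms(3)])
  show "(\<lambda>x. r \<odot>\<^bsub>M\<^esub> x) ` N \<subseteq> N" using submodD(4)[OF assms(1,3,2)] by auto
qed

end

context coherent
begin

text \<open>
  The module \<open>Y\<close> is \<open>(R/I)\<^sup>p\<close>. The surjection from \<open>R\<^sup>p\<close> that describes it hides the iterated sums
  and the passage to a copy in the class.
\<close>

lemma cyclic_power_in_class:
  assumes AC: "abelian_class R C" and I: "submodule I R (regular_module R)" and c: "cyclic_in R C I"
  shows "\<exists>Y \<rho>. C Y \<and> \<rho> \<in> module_hom R (free_module R {..<p::nat}) Y \<and>
    \<rho> ` ({..<p} \<rightarrow>\<^sub>E carrier R) = carrier Y \<and>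
    (\<forall>x\<in>{..<p} \<rightarrow>\<^sub>E carrier R. \<rho> x = \<zero>\<^bsub>Y\<^esub> \<longleftrightarrow> (\<forall>i<p. x i \<in> I))" (is "\<exists>Y \<rho>. ?P p Y \<rho>")
proof (induction p)
  case 0
  let ?F = "free_module R {..<0::nat}"
  have z: "is_zero_module ?F" unfolding is_zero_module_def by (auto simp: fun_eq_iff)
  have icF: "in_class R C ?F" by (rule in_class_zero[OF AC fp_free[OF finite_lessThan] z])
  obtain Y f where Y: "C Y" "f \<in> module_hom R ?F Y" "f ` carrier ?F = carrier Y"
    "\<And>x. x \<in> carrier ?F \<Longrightarrow> f x = \<zero>\<^bsub>Y\<^esub> \<longleftrightarrow> x = \<zero>\<^bsub>?F\<^esub>"
    by (rule class_representativeE[OF AC icF]) (rule that, assumption+)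
  have "f x = \<zero>\<^bsub>Y\<^esub>" if x: "x \<in> {..<0} \<rightarrow>\<^sub>E carrier R" for x
  proof -
    have "x = \<zero>\<^bsub>?F\<^esub>" using x by (auto simp: fun_eq_iff)
    then show ?thesis using Y(4)[of x] x by simp
  qed
  then have "?P 0 Y f" using Y(1-3) by (intro conjI ballI) simp_all
  then show ?case by (intro exI)
next
  case (Suc p)
  obtain Y \<rho> where P: "?P p Y \<rho>" using Suc.IH by (elim exE)
  have Y: "C Y" "\<rho> \<in> module_hom R (free_module R {..<p}) Y"
    "\<rho> ` ({..<p} \<rightarrow>\<^sub>E carrier R) = carrier Y"
    "\<And>x. x \<in> {..<p} \<rightarrow>\<^sub>E carrier R \<Longrightarrow> \<rho> x = \<zero>\<^bsub>Y\<^esub> \<longleftrightarrow> (\<forall>i<p. x i \<in> I)"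
    using P by simp_all
  have Ym: "module R Y" by (rule class_module[OF AC Y(1)])
  let ?Q = "quotient_module (regular_module R) I"
  let ?D = "direct_sum Y ?Q" and ?F = "free_module R {..<Suc p}"
  have Qm: "module R ?Q" by (rule ideal_quotient_module[OF I])
  have Dm: "module R ?D" by (rule direct_sum_is_module[OF Ym Qm])
  have icD: "in_class R C ?D"
    by (rule in_class_sum[OF AC in_class_self[OF AC Y(1)] c[unfolded cyclic_in_def] Dm fst_hom snd_hom]) (simp add: bij_betw_def)
  obtain Z f where Z: "C Z" "f \<in> module_hom R ?D Z" "f ` carrier ?D = carrier Z"
    "\<And>x. x \<in> carrier ?D \<Longrightarrow> f x = \<zero>\<^bsub>Z\<^esub> \<longleftrightarrow> x = \<zero>\<^bsub>?D\<^esub>"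
    by (rule class_representativeE[OF AC icD]) (rule that, assumption+)
  define \<sigma> where "\<sigma> x = (\<rho> (restrict x {..<p}), I +>\<^bsub>regular_module R\<^esub> (x p))" for x
  have s: "\<sigma> \<in> module_hom R ?F ?D"
    unfolding \<sigma>_def
    by (intro hom_into_direct_sum module_hom_comp[OF free_restrict_hom Y(2)]
        module_hom_comp[OF free_coord_hom quotient_hom[OF regular_is_module I]]) auto
  have "\<sigma> ` carrier ?F = carrier ?D"
  proof (rule hom_onto[OF s])
    fix z assume "z \<in> carrier ?D"
    then obtain y r where z: "z = (y, I +>\<^bsub>regular_module R\<^esub> r)" "y \<in> carrier Y" "r \<in> carrier R"
      by (auto simp: quotient_carrier)
    then obtain x where x: "x \<in> {..<p} \<rightarrow>\<^sub>E carrier R" "y = \<rho> x" using surjD[OF Y(3) z(2)] by blast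
    let ?x = "\<lambda>i\<in>{..<Suc p}. if i < p then x i else r"
    have "restrict ?x {..<p} = x" using x(1) by (auto simp: fun_eq_iff PiE_iff extensional_def)
    then have "\<sigma> ?x = z" unfolding \<sigma>_def z(1) x(2) by simp
    moreover have "?x \<in> carrier ?F" using PiE_mem[OF x(1)] z(3) by simp
    ultimately show "\<exists>x\<in>carrier ?F. \<sigma> x = z" by (intro bexI[of _ ?x])
  qed
  then have onto: "(\<lambda>x. f (\<sigma> x)) ` ({..<Suc p} \<rightarrow>\<^sub>E carrier R) = carrier Z"
    by (simp only: free_simps(1) image_image[symmetric, of f \<sigma>] Z(3))
  have "f (\<sigma> x) = \<zero>\<^bsub>Z\<^esub> \<longleftrightarrow> (\<forall>i<Suc p. x i \<in> I)" if x: "x \<in> {..<Suc p} \<rightarrow>\<^sub>E carrier R" for x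
  proof -
    have m1: "restrict x {..<p} \<in> {..<p} \<rightarrow>\<^sub>E carrier R" using PiE_mem[OF x] by auto
    have m2: "x p \<in> carrier R" using PiE_mem[OF x] by simp
    have sx: "\<sigma> x \<in> carrier ?D" using module_homD(1)[OF s] x by simp
    have "f (\<sigma> x) = \<zero>\<^bsub>Z\<^esub> \<longleftrightarrow> \<sigma> x = \<zero>\<^bsub>?D\<^esub>" by (rule Z(4)[OF sx])
    also have "\<dots> \<longleftrightarrow> (\<forall>i<p. restrict x {..<p} i \<in> I) \<and> x p \<in> I"
      by (simp only: \<sigma>_def direct_sum_simps prod.inject Y(4)[OF m1] coset_zero_iff_mem[OF I m2])
    also have "\<dots> \<longleftrightarrow> (\<forall>i<Suc p. x i \<in> I)" by (auto simp: less_Suc_eq)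
    finally show ?thesis .
  qed
  then have "?P (Suc p) Z (\<lambda>x. f (\<sigma> x))"
    using Z(1) onto module_hom_comp[OF s Z(2)] by (intro conjI ballI)
  then show ?case by (intro exI)
qed

lemma cyclic_powerE:
  assumes "abelian_class R C" and "submodule I R (regular_module R)" and "cyclic_in R C I"
  obtains Y \<rho> where "C Y" "\<rho> \<in> module_hom R (free_module R {..<p::nat}) Y"
    "\<rho> ` ({..<p} \<rightarrow>\<^sub>E carrier R) = carrier Y"
    "\<And>x. x \<in> {..<p} \<rightarrow>\<^sub>E carrier R \<Longrightarrow> \<rho> x = \<zero>\<^bsub>Y\<^esub> \<longleftrightarrow> (\<forall>i<p. x i \<in> I)"
proof -
  show thesis
    using cyclic_power_in_class[OF assms, of p] by (elim exE conjE, intro that) (assumption+, simp)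
qed

text \<open>
  If \<open>X\<close> is the cokernel of \<open>d : R\<^sup>p \<rightarrow> R\<^sup>q\<close>, then it is also the cokernel of the map
  \<open>(R/I)\<^sup>p \<rightarrow> (R/I)\<^sup>q\<close> induced by \<open>d\<close>.
\<close>

lemma killed_in_class:
  assumes AC: "abelian_class R C" and I: "submodule I R (regular_module R)" and c: "cyclic_in R C I"
    and X: "finitely_presented R X" and k: "\<And>i x. i \<in> I \<Longrightarrow> x \<in> carrier X \<Longrightarrow> i \<odot>\<^bsub>X\<^esub> x = \<zero>\<^bsub>X\<^esub>"
  shows "in_class R C X"
proof -
  have Xm: "module R X" by (rule fp_module[OF X])
  obtain p q d \<pi> where "is_presentation R X p q d \<pi>" using X unfolding finitely_presented_def by blast
  then have d: "d \<in> module_hom R (free_module R {..<p}) (free_module R {..<q})"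
    and \<pi>: "\<pi> \<in> module_hom R (free_module R {..<q}) X" "\<pi> ` ({..<q} \<rightarrow>\<^sub>E carrier R) = carrier X"
    "a_kernel (free_module R {..<q}) X \<pi> = d ` ({..<p} \<rightarrow>\<^sub>E carrier R)"
    unfolding is_presentation_def by simp_all
  let ?P = "free_module R {..<p}" and ?Q = "free_module R {..<q}"
  interpret Q: module R ?Q by (rule free_is_module)
  obtain Y \<rho> where Y: "C Y" "\<rho> \<in> module_hom R ?P Y" "\<rho> ` ({..<p} \<rightarrow>\<^sub>E carrier R) = carrier Y"
    "\<And>x. x \<in> {..<p} \<rightarrow>\<^sub>E carrier R \<Longrightarrow> \<rho> x = \<zero>\<^bsub>Y\<^esub> \<longleftrightarrow> (\<forall>i<p. x i \<in> I)"
    by (rule cyclic_powerE[OF AC I c, of p]) (rule that, assumption+)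
  obtain Z \<sigma> where Z: "C Z" "\<sigma> \<in> module_hom R ?Q Z" "\<sigma> ` ({..<q} \<rightarrow>\<^sub>E carrier R) = carrier Z"
    "\<And>x. x \<in> {..<q} \<rightarrow>\<^sub>E carrier R \<Longrightarrow> \<sigma> x = \<zero>\<^bsub>Z\<^esub> \<longleftrightarrow> (\<forall>i<q. x i \<in> I)"
    by (rule cyclic_powerE[OF AC I c, of q]) (rule that, assumption+)
  have Ym: "module R Y" and Zm: "module R Z" using class_module[OF AC] Y(1) Z(1) by auto
  have IR: "I \<subseteq> carrier R" using submodD(1)[OF regular_is_module I] by simp
  have Zk: "i \<odot>\<^bsub>Z\<^esub> z = \<zero>\<^bsub>Z\<^esub>" if i: "i \<in> I" and z: "z \<in> carrier Z" for i z
  proof -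
    have iR: "i \<in> carrier R" using i IR by auto
    obtain x where x: "x \<in> {..<q} \<rightarrow>\<^sub>E carrier R" "z = \<sigma> x" using surjD[OF Z(3) z] by blast
    have "\<forall>j<q. (i \<odot>\<^bsub>?Q\<^esub> x) j \<in> I"
    proof (intro allI impI)
      fix j assume j: "j < q"
      then have "x j \<otimes> i \<in> I" using submodD(4)[OF regular_is_module I, of "x j" i] i x(1) by auto
      then show "(i \<odot>\<^bsub>?Q\<^esub> x) j \<in> I" using j x(1) iR by (auto simp: m_comm[of i "x j"] PiE_iff)
    qed
    moreover have "i \<odot>\<^bsub>?Q\<^esub> x \<in> {..<q} \<rightarrow>\<^sub>E carrier R" using Q.smult_closed[OF iR, of x] x(1) by simp
    ultimately have "\<sigma> (i \<odot>\<^bsub>?Q\<^esub> x) = \<zero>\<^bsub>Z\<^esub>" using Z(4) by blast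
    then show ?thesis using module_homD(3)[OF Z(2) iR, of x] x by simp
  qed
  obtain \<psi> where psi: "\<psi> \<in> module_hom R Y Z" "\<And>x. x \<in> carrier ?P \<Longrightarrow> \<psi> (\<rho> x) = \<sigma> (d x)"
  proof (rule hom_factor[OF free_is_module Ym Zm Y(2) _ module_hom_comp[OF d Z(2)]])
    fix x assume x: "x \<in> carrier ?P" "\<rho> x = \<zero>\<^bsub>Y\<^esub>"
    then have xi: "x i \<in> I" if "i < p" for i using Y(4)[of x] that by simp
    show "\<sigma> (d x) = \<zero>\<^bsub>Z\<^esub>"
    proof (rule hom_vanishes_on_killed_vectors[OF Zm finite_lessThan module_hom_comp[OF d Z(2)]])
      show "x b \<odot>\<^bsub>Z\<^esub> z = \<zero>\<^bsub>Z\<^esub>" if "b \<in> {..<p}" "z \<in> carrier Z" for b z using Zk[OF xi that(2)] that(1) by simp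
    qed (use x(1) in simp)
  qed (use Y(3) in \<open>simp, blast\<close>)
  obtain \<chi> where chi: "\<chi> \<in> module_hom R Z X" "\<And>x. x \<in> carrier ?Q \<Longrightarrow> \<chi> (\<sigma> x) = \<pi> x"
  proof (rule hom_factor[OF free_is_module Zm Xm Z(2) _ \<pi>(1)])
    fix x assume x: "x \<in> carrier ?Q" "\<sigma> x = \<zero>\<^bsub>Z\<^esub>"
    then have xi: "x i \<in> I" if "i < q" for i using Z(4)[of x] that by simp
    show "\<pi> x = \<zero>\<^bsub>X\<^esub>"
    proof (rule hom_vanishes_on_killed_vectors[OF Xm finite_lessThan \<pi>(1)])
      show "x b \<odot>\<^bsub>X\<^esub> z = \<zero>\<^bsub>X\<^esub>" if "b \<in> {..<q}" "z \<in> carrier X" for b z using k[OF xi that(2)] that(1) by simp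
    qed (use x(1) in simp)
  qed (use Z(3) in \<open>simp, blast\<close>)
  show ?thesis
  proof (rule in_class_cokernel[OF AC in_class_self[OF AC Y(1)] in_class_self[OF AC Z(1)] Xm psi(1) chi(1)])
    show "\<chi> ` carrier Z = carrier X"
    proof -
      have "\<chi> ` carrier Z = (\<lambda>x. \<chi> (\<sigma> x)) ` carrier ?Q" 
        by (simp only: free_simps(1) image_image[symmetric, of \<chi> \<sigma>] Z(3))
      also have "\<dots> = \<pi> ` carrier ?Q" using chi(2) by (intro image_cong) auto
      finally show ?thesis using \<pi>(2) by simp
    qed
    show "a_kernel Z X \<chi> = \<psi> ` carrier Y"
    proof (intro equalityI subsetI)
      fix z assume "z \<in> a_kernel Z X \<chi>"
      then have z: "z \<in> carrier Z" "\<chi> z = \<zero>\<^bsub>X\<^esub>" by (simp_all add: mem_a_kernel)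
      then obtain x where x: "x \<in> carrier ?Q" "z = \<sigma> x" using surjD[OF Z(3) z(1)] by auto
      then have "x \<in> a_kernel ?Q X \<pi>" using chi(2)[OF x(1)] z(2) unfolding mem_a_kernel by (simp only:)
      then obtain y where y: "y \<in> carrier ?P" "x = d y" using \<pi>(3) by auto
      have "\<rho> y \<in> carrier Y" by (rule module_homD(1)[OF Y(2) y(1)])
      then show "z \<in> \<psi> ` carrier Y" using psi(2)[OF y(1)] x(2) y(2) by (metis imageI)
    next
      fix z assume "z \<in> \<psi> ` carrier Y"
      then obtain y where y: "y \<in> carrier Y" "z = \<psi> y" by auto
      then obtain x where x: "x \<in> carrier ?P" "z = \<psi> (\<rho> x)" using surjD[OF Y(3) y(1)] by auto
      have dx: "d x \<in> a_kernel ?Q X \<pi>" using \<pi>(3) x(1) by simp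
      then have "d x \<in> carrier ?Q" "\<pi> (d x) = \<zero>\<^bsub>X\<^esub>" unfolding mem_a_kernel by blast+
      then show "z \<in> a_kernel Z X \<chi>"
        using psi(2)[OF x(1)] x(2) chi(2) module_homD(1)[OF Z(2)] unfolding mem_a_kernel by simp
    qed
  qed
qed

subsection \<open>Nilpotent quotients\<close>

text \<open>
  Induction on the sum of the exponents. If all of them are at most 1, then \<open>N/L\<close> is killed by the
  ideal \<open>(G)\<close>. Otherwise some \<open>e r > 1\<close>, and the submodule \<open>L + r^(e r - 1) N\<close> cuts the step from \<open>N\<close>
  to \<open>L\<close> into two steps with a smaller exponent at \<open>r\<close>.
\<close>

lemma nilpotent_quotient_in_class:
  fixes e :: "'a \<Rightarrow> nat"
  assumes AC: "abelian_class R C" and A: "module R A"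
    and G: "finite G" "G \<subseteq> carrier R" and c: "cyclic_in R C (module_span R (regular_module R) G)"
  shows "in_class R C (A\<lparr>carrier := N\<rparr>) \<Longrightarrow> submodule N R A \<Longrightarrow> fin_gen R A L \<Longrightarrow> L \<subseteq> N \<Longrightarrow>
    (\<And>r x. r \<in> G \<Longrightarrow> x \<in> N \<Longrightarrow> (r [^] e r) \<odot>\<^bsub>A\<^esub> x \<in> L) \<Longrightarrow> in_class R C (A\<lparr>carrier := L\<rparr>)"
proof (induction "\<Sum>r\<in>G. e r" arbitrary: e N L rule: less_induct)
  case less
  interpret A: module R A by fact
  have Ns: "submodule N R A" by fact
  have Nm: "module R (A\<lparr>carrier := N\<rparr>)" by (rule submod_module[OF A Ns])
  have Ls: "submodule L R A" by (rule fin_gen_submod[OF A less.prems(3)])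
  have NA: "N \<subseteq> carrier A" by (rule submodD(1)[OF A Ns])
  note LN = less.prems(4)
  have LsN: "submodule L R (A\<lparr>carrier := N\<rparr>)" by (rule submod_restrict[OF A Ns Ls LN])
  show ?case
  proof (cases "\<exists>r\<in>G. e r > 1")
    case False
    have kill: "r \<odot>\<^bsub>A\<^esub> x \<in> L" if r: "r \<in> G" and x: "x \<in> N" for r x
    proof -
      have "e r = 0 \<or> e r = 1" using False r by force
      then show ?thesis
        using less.prems(5)[OF r x] r G(2) x NA submodD(4)[OF A Ls, of r x] by (auto simp: subset_iff)
    qed
    let ?J = "module_span R (regular_module R) G"
    have J: "submodule ?J R (regular_module R)" using span_submod[OF regular_is_module] G(2) by simp
    have "in_class R C (quotient_module (A\<lparr>carrier := N\<rparr>) L)"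
    proof (rule killed_in_class[OF AC J c])
      note q = quotient_is_module[OF Nm LsN] and qh = quotient_hom[OF Nm LsN]
      have "fin_gen R (A\<lparr>carrier := N\<rparr>) L" using fin_gen_restrict[OF A Ns LN] less.prems(3) by simp
      moreover have "a_kernel (A\<lparr>carrier := N\<rparr>) (quotient_module (A\<lparr>carrier := N\<rparr>) L)
         (\<lambda>x. L +>\<^bsub>A\<lparr>carrier := N\<rparr>\<^esub> x) = L"
        using quotient_eq_zero_iff[OF Nm LsN] LN by (auto simp: mem_a_kernel)
      ultimately show "finitely_presented R (quotient_module (A\<lparr>carrier := N\<rparr>) L)"
        using fp_quotient[OF in_class_fp[OF AC less.prems(1)] q qh] by (simp add: quotient_carrier)
      fix i X assume i: "i \<in> ?J" and "X \<in> carrier (quotient_module (A\<lparr>carrier := N\<rparr>) L)"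
      then obtain x where x: "x \<in> N" "X = L +>\<^bsub>A\<lparr>carrier := N\<rparr>\<^esub> x" by (auto simp: quotient_carrier)
      have "?J \<subseteq> {r \<in> carrier (regular_module R). r \<odot>\<^bsub>A\<^esub> x \<in> L}"
        using kill x(1) NA G(2)
        by (intro span_least submod_preimage[OF regular_is_module A orbit_hom[OF A] Ls]) auto
      then have "i \<in> carrier R" "i \<odot>\<^bsub>A\<^esub> x \<in> L" using i by auto
      then show "i \<odot>\<^bsub>quotient_module (A\<lparr>carrier := N\<rparr>) L\<^esub> X = \<zero>\<^bsub>quotient_module (A\<lparr>carrier := N\<rparr>) L\<^esub>"
        using quotient_smult[OF Nm LsN, of i x] quotient_eq_zero_iff[OF Nm LsN, of "i \<odot>\<^bsub>A\<^esub> x"] x LN by auto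
    qed
    then show ?thesis using in_class_quotient_iff[OF AC less.prems(1) LsN] by simp
  next
    case True
    then obtain r where r: "r \<in> G" "e r > 1" by blast
    then have rR: "r \<in> carrier R" using G(2) by auto
    let ?s = "r [^] (e r - 1)"
    have sR: "?s \<in> carrier R" using rR by simp
    let ?L = "L <+>\<^bsub>A\<^esub> (\<lambda>x. ?s \<odot>\<^bsub>A\<^esub> x) ` N"
    note sN = submod_smult_image[OF A sR Ns]
    note sum = submod_sum[OF A Ls sN(1)]
    have "fin_gen R A N"
      using fp_fin_gen[OF in_class_fp[OF AC less.prems(1)]] fin_gen_restrict[OF A Ns order_refl] by simp
    then have fg: "fin_gen R A ?L"
      by (intro fin_gen_sum[OF A less.prems(3)] fin_gen_image[OF A A smult_hom[OF A sR]])
    have L'N: "?L \<subseteq> N" by (rule submod_sum_least[OF A Ns LN sN(2)])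
    have small: "(\<Sum>x\<in>G. (e(r := k)) x) < (\<Sum>x\<in>G. e x)" if "k < e r" for k
    proof -
      have "(\<Sum>x\<in>G - {r}. (e(r := k)) x) = (\<Sum>x\<in>G - {r}. e x)" by (rule sum.cong) auto
      then show ?thesis using that by (simp only: sum.remove[OF G(1) r(1)] fun_upd_same)
    qed
    have 1: "in_class R C (A\<lparr>carrier := ?L\<rparr>)"
    proof (rule less.hyps[OF small[of "e r - 1"] less.prems(1,2) fg L'N])
      fix r' x assume "r' \<in> G" "x \<in> N"
      then show "(r' [^] (e(r := e r - 1)) r') \<odot>\<^bsub>A\<^esub> x \<in> ?L"
        using sum(2,3) less.prems(5) by (cases "r' = r") auto
    qed (use r in simp)
    show ?thesis
    proof (rule less.hyps[OF small[of 1] 1 sum(1) less.prems(3) sum(2)])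
      fix r' x assume r': "r' \<in> G" and x: "x \<in> ?L"
      show "(r' [^] (e(r := 1)) r') \<odot>\<^bsub>A\<^esub> x \<in> L"
      proof (cases "r' = r")
        case True
        obtain a b where ab: "a \<in> L" "b \<in> N" "x = a \<oplus>\<^bsub>A\<^esub> ?s \<odot>\<^bsub>A\<^esub> b" using x by (auto simp: mem_set_add)
        have A': "a \<in> carrier A" "b \<in> carrier A" using ab LN NA by auto
        have "r \<otimes> ?s = r [^] e r"
          using r(2) rR nat_pow_Suc2[OF rR, of "e r - 1"] by simp
        then have "r \<odot>\<^bsub>A\<^esub> (?s \<odot>\<^bsub>A\<^esub> b) = (r [^] e r) \<odot>\<^bsub>A\<^esub> b"
          using A.smult_assoc1[OF rR sR A'(2)] by simp
        then have "r \<odot>\<^bsub>A\<^esub> x = r \<odot>\<^bsub>A\<^esub> a \<oplus>\<^bsub>A\<^esub> (r [^] e r) \<odot>\<^bsub>A\<^esub> b"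
          using A' rR sR ab(3) by (simp add: A.smult_r_distr)
        then have "r \<odot>\<^bsub>A\<^esub> x \<in> L"
          using submodD(3)[OF A Ls] submodD(4)[OF A Ls rR ab(1)] less.prems(5)[OF r(1) ab(2)] by simp
        then show ?thesis using True rR by simp
      next
        case False
        then show ?thesis using less.prems(5)[OF r'] x L'N by auto
      qed
    qed (use r in simp)
  qed
qed

end

context cring
begin

text \<open>
  Nakayama's lemma in an elementary form, by induction on the number of generators modulo a
  submodule \<open>P\<close>.
\<close>

lemma nakayama_modulo:
  assumes M: "module R M" and r: "r \<in> carrier R" and t: "t \<in> carrier R"
    and d: "\<And>x. x \<in> carrier M \<Longrightarrow> \<exists>y\<in>carrier M. r \<odot>\<^bsub>M\<^esub> x = t \<odot>\<^bsub>M\<^esub> y"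
    and "finite S"
  shows "S \<subseteq> carrier M \<Longrightarrow> submodule P R M \<Longrightarrow> carrier M \<subseteq> P <+>\<^bsub>M\<^esub> module_span R M S \<Longrightarrow>
    \<exists>n. \<exists>z\<in>carrier R. \<exists>c\<in>carrier R. r [^] (n::nat) = z \<oplus> t \<otimes> c \<and> (\<forall>x\<in>carrier M. z \<odot>\<^bsub>M\<^esub> x \<in> P)"
  using \<open>finite S\<close>
proof (induction S arbitrary: P rule: finite_induct)
  case empty
  interpret M: module R M by fact
  have "module_span R M {} \<subseteq> P" by (rule span_least[OF empty.prems(2)]) simp
  then have "P <+>\<^bsub>M\<^esub> module_span R M {} \<subseteq> P" by (intro submod_sum_least[OF M empty.prems(2)]) auto
  then have "\<forall>x\<in>carrier M. \<one> \<odot>\<^bsub>M\<^esub> x \<in> P" using empty.prems(3) by auto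
  moreover have "r [^] (0::nat) = \<one> \<oplus> t \<otimes> \<zero>" using t by simp
  ultimately show ?case by blast
next
  case (insert s S)
  interpret M: module R M by fact
  have s: "s \<in> carrier M" and S: "S \<subseteq> carrier M" using insert.prems(1) by auto
  let ?O = "(\<lambda>r. r \<odot>\<^bsub>M\<^esub> s) ` carrier R"
  have O: "submodule ?O R M"
    using submod_image[OF regular_is_module M _ submod_carrier[OF regular_is_module], of "\<lambda>r. r \<odot>\<^bsub>M\<^esub> s"] s
    by (simp add: module_hom_def M.smult_l_distr M.smult_assoc1)
  note P = insert.prems(2)
  note P' = submod_sum[OF M P O]
  note PS = submod_sum[OF M P'(1) span_submod[OF M S]]
  have "s \<in> ?O" using s by (intro image_eqI[of _ _ \<one>]) auto
  then have "insert s S \<subseteq> (P <+>\<^bsub>M\<^esub> ?O) <+>\<^bsub>M\<^esub> module_span R M S"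
    using PS(2,3) P'(3) span_superset[of S M] by blast
  then have "P <+>\<^bsub>M\<^esub> module_span R M (insert s S) \<subseteq> (P <+>\<^bsub>M\<^esub> ?O) <+>\<^bsub>M\<^esub> module_span R M S"
    using PS(2) P'(2) by (intro submod_sum_least[OF M PS(1)] span_least[OF PS(1)]) auto
  then have "carrier M \<subseteq> (P <+>\<^bsub>M\<^esub> ?O) <+>\<^bsub>M\<^esub> module_span R M S" using insert.prems(3) by simp
  then obtain n z c where z: "z \<in> carrier R" "c \<in> carrier R" "r [^] (n::nat) = z \<oplus> t \<otimes> c"
    "\<And>x. x \<in> carrier M \<Longrightarrow> z \<odot>\<^bsub>M\<^esub> x \<in> P <+>\<^bsub>M\<^esub> ?O"
    using insert.IH[OF S P'(1)] by auto
  obtain y where y: "y \<in> carrier M" "r \<odot>\<^bsub>M\<^esub> s = t \<odot>\<^bsub>M\<^esub> y" using d[OF s] by blast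
  obtain p b where pb: "p \<in> P" "b \<in> carrier R" "z \<odot>\<^bsub>M\<^esub> y = p \<oplus>\<^bsub>M\<^esub> b \<odot>\<^bsub>M\<^esub> s"
    using z(4)[OF y(1)] by (auto simp: mem_set_add)
  have pM: "p \<in> carrier M" using pb(1) submodD(1)[OF M P] by auto
  \<comment> \<open>The element \<open>w\<close> moves \<open>s\<close> into \<open>P\<close>; it agrees with \<open>z r\<close> modulo \<open>t\<close>.\<close>
  define w where "w = z \<otimes> r \<ominus> t \<otimes> b"
  have w: "w \<in> carrier R" "z \<otimes> r = w \<oplus> t \<otimes> b"
    using z(1) r t pb(2) by (simp_all add: w_def a_minus_def a_assoc l_neg)
  have "w \<odot>\<^bsub>M\<^esub> s \<oplus>\<^bsub>M\<^esub> (t \<otimes> b) \<odot>\<^bsub>M\<^esub> s = (z \<otimes> r) \<odot>\<^bsub>M\<^esub> s"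
    unfolding w(2) using w(1) t pb(2) s by (simp add: M.smult_l_distr)
  also have "\<dots> = z \<odot>\<^bsub>M\<^esub> (t \<odot>\<^bsub>M\<^esub> y)" using M.smult_assoc1[OF z(1) r s] y(2) by simp
  also have "\<dots> = t \<odot>\<^bsub>M\<^esub> (z \<odot>\<^bsub>M\<^esub> y)"
    using z(1) t y(1) by (simp add: M.smult_assoc1[symmetric] m_comm)
  also have "\<dots> = t \<odot>\<^bsub>M\<^esub> p \<oplus>\<^bsub>M\<^esub> (t \<otimes> b) \<odot>\<^bsub>M\<^esub> s"
    unfolding pb(3) using t pb(2) s pM by (simp add: M.smult_r_distr M.smult_assoc1)
  finally have "w \<odot>\<^bsub>M\<^esub> s = t \<odot>\<^bsub>M\<^esub> p"
    using w(1) t pb(2) s pM by (simp add: M.add.right_cancel)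
  then have ws: "w \<odot>\<^bsub>M\<^esub> s \<in> P" using submodD(4)[OF M P t pb(1)] by simp
  have "(w \<otimes> z) \<odot>\<^bsub>M\<^esub> x \<in> P" if x: "x \<in> carrier M" for x
  proof -
    obtain p' b' where pb': "p' \<in> P" "b' \<in> carrier R" "z \<odot>\<^bsub>M\<^esub> x = p' \<oplus>\<^bsub>M\<^esub> b' \<odot>\<^bsub>M\<^esub> s"
      using z(4)[OF x] by (auto simp: mem_set_add)
    have pM': "p' \<in> carrier M" using pb'(1) submodD(1)[OF M P] by auto
    have "(w \<otimes> z) \<odot>\<^bsub>M\<^esub> x = w \<odot>\<^bsub>M\<^esub> (z \<odot>\<^bsub>M\<^esub> x)" by (rule M.smult_assoc1[OF w(1) z(1) x])
    also have "\<dots> = w \<odot>\<^bsub>M\<^esub> p' \<oplus>\<^bsub>M\<^esub> w \<odot>\<^bsub>M\<^esub> (b' \<odot>\<^bsub>M\<^esub> s)"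
      unfolding pb'(3) using w(1) pb'(2) s pM' by (simp add: M.smult_r_distr)
    also have "w \<odot>\<^bsub>M\<^esub> (b' \<odot>\<^bsub>M\<^esub> s) = b' \<odot>\<^bsub>M\<^esub> (w \<odot>\<^bsub>M\<^esub> s)"
      using w(1) pb'(2) s by (simp add: M.smult_assoc1[symmetric] m_comm)
    finally show ?thesis
      using submodD(3)[OF M P submodD(4)[OF M P w(1) pb'(1)] submodD(4)[OF M P pb'(2) ws]] by simp
  qed
  \<comment> \<open>Modulo \<open>t\<close>, the element \<open>w z\<close> is \<open>z r z\<close>, which is \<open>r\<close> to the power \<open>n + 1 + n\<close>.\<close>
  moreover have "r [^] (n + n + 1) = w \<otimes> z \<oplus> t \<otimes> (b \<otimes> z \<oplus> r \<otimes> z \<otimes> c \<oplus> r \<otimes> c \<otimes> z \<oplus> r \<otimes> t \<otimes> c \<otimes> c)"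
  proof -
    have "r [^] (n + n + 1) = r [^] n \<otimes> r [^] n \<otimes> r" using r by (simp add: nat_pow_mult[symmetric])
    also have "\<dots> = (z \<otimes> r) \<otimes> z \<oplus> t \<otimes> (r \<otimes> z \<otimes> c \<oplus> r \<otimes> c \<otimes> z \<oplus> r \<otimes> t \<otimes> c \<otimes> c)"
      unfolding z(3) using z(1,2) r t by (simp add: l_distr r_distr m_ac a_ac)
    also have "\<dots> = w \<otimes> z \<oplus> t \<otimes> (b \<otimes> z \<oplus> r \<otimes> z \<otimes> c \<oplus> r \<otimes> c \<otimes> z \<oplus> r \<otimes> t \<otimes> c \<otimes> c)"
      unfolding w(2) using z(1,2) w(1) pb(2) r t by (simp add: l_distr r_distr m_ac a_ac)
    finally show ?thesis .
  qed
  moreover have "w \<otimes> z \<in> carrier R"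
    "b \<otimes> z \<oplus> r \<otimes> z \<otimes> c \<oplus> r \<otimes> c \<otimes> z \<oplus> r \<otimes> t \<otimes> c \<otimes> c \<in> carrier R"
    using z(1,2) w(1) pb(2) r t by simp_all
  ultimately show ?case by blast
qed

text \<open>
  For \<open>t\<close> in the role of the ideal: an element \<open>r\<close> with \<open>r M \<subseteq> t M\<close> has a power in \<open>(t) + Ann M\<close>.
\<close>

lemma nakayama_power:
  assumes "module R M" "fin_gen R M (carrier M)" "r \<in> carrier R" "t \<in> carrier R"
    "\<And>x. x \<in> carrier M \<Longrightarrow> \<exists>y\<in>carrier M. r \<odot>\<^bsub>M\<^esub> x = t \<odot>\<^bsub>M\<^esub> y"
  obtains n z c where "z \<in> annihilator R M" "c \<in> carrier R" "r [^] (n::nat) = z \<oplus> t \<otimes> c"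
proof -
  interpret M: module R M by fact
  obtain S where S: "finite S" "S \<subseteq> carrier M" "carrier M = module_span R M S"
    using assms(2) unfolding fin_gen_def by auto
  have "carrier M \<subseteq> {\<zero>\<^bsub>M\<^esub>} <+>\<^bsub>M\<^esub> module_span R M S"
    using submod_sum(3)[OF assms(1) submod_zero[OF assms(1)] span_submod[OF assms(1) S(2)]] S(3) by simp
  from nakayama_modulo[OF assms(1,3,4,5) S(1,2) submod_zero[OF assms(1)] this]
  obtain n z c where "z \<in> carrier R" "c \<in> carrier R" "r [^] (n::nat) = z \<oplus> t \<otimes> c"
    "\<forall>x\<in>carrier M. z \<odot>\<^bsub>M\<^esub> x \<in> {\<zero>\<^bsub>M\<^esub>}" by blast
  then show thesis using that[of z c n] unfolding annihilator_def by simp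
qed

lemma iterate_divisible:
  assumes "module R Q" "r \<in> carrier R" "t \<in> carrier R"
    "\<And>x. x \<in> carrier Q \<Longrightarrow> \<exists>y\<in>carrier Q. r \<odot>\<^bsub>Q\<^esub> x = t \<odot>\<^bsub>Q\<^esub> y"
  shows "x \<in> carrier Q \<Longrightarrow> \<exists>y\<in>carrier Q. r [^] (n::nat) \<odot>\<^bsub>Q\<^esub> x = t [^] n \<odot>\<^bsub>Q\<^esub> y"
proof (induction n arbitrary: x)
  interpret Q: module R Q by fact
  case 0 then show ?case by auto
next
  interpret Q: module R Q by fact
  case (Suc n)
  obtain y where y: "y \<in> carrier Q" "r \<odot>\<^bsub>Q\<^esub> x = t \<odot>\<^bsub>Q\<^esub> y" using assms(4)[OF Suc.prems] by blast
  obtain y' where y': "y' \<in> carrier Q" "r [^] n \<odot>\<^bsub>Q\<^esub> y = t [^] n \<odot>\<^bsub>Q\<^esub> y'" using Suc.IH[OF y(1)] by blast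
  have "r [^] Suc n \<odot>\<^bsub>Q\<^esub> x = r [^] n \<odot>\<^bsub>Q\<^esub> (t \<odot>\<^bsub>Q\<^esub> y)"
    using assms(2) Suc.prems y(2) by (simp add: Q.smult_assoc1)
  also have "\<dots> = t \<odot>\<^bsub>Q\<^esub> (t [^] n \<odot>\<^bsub>Q\<^esub> y')"
    using assms(2,3) y(1) y'(2) by (metis Q.smult_assoc1 m_comm nat_pow_closed)
  also have "\<dots> = t [^] Suc n \<odot>\<^bsub>Q\<^esub> y'"
    using assms(3) y'(1) by (simp add: Q.smult_assoc1[symmetric] m_comm)
  finally show ?case using y'(1) by blast
qed

lemma power_smult_eq_on:
  assumes "module R A" "submodule N R A" "r \<in> carrier R" "s \<in> carrier R"
    "\<And>x. x \<in> N \<Longrightarrow> r \<odot>\<^bsub>A\<^esub> x = s \<odot>\<^bsub>A\<^esub> x"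
  shows "x \<in> N \<Longrightarrow> r [^] (k::nat) \<odot>\<^bsub>A\<^esub> x = s [^] k \<odot>\<^bsub>A\<^esub> x"
proof (induction k arbitrary: x)
  interpret A: module R A by fact
  case (Suc k)
  have x: "x \<in> carrier A" using submodD(1)[OF assms(1,2)] Suc.prems by auto
  have "r [^] Suc k \<odot>\<^bsub>A\<^esub> x = r [^] k \<odot>\<^bsub>A\<^esub> (s \<odot>\<^bsub>A\<^esub> x)"
    using A.smult_assoc1[of "r [^] k" r x] assms(3,5) Suc.prems x by simp
  also have "\<dots> = s [^] k \<odot>\<^bsub>A\<^esub> (s \<odot>\<^bsub>A\<^esub> x)"
    by (rule Suc.IH[OF submodD(4)[OF assms(1,2,4) Suc.prems]])
  also have "\<dots> = s [^] Suc k \<odot>\<^bsub>A\<^esub> x"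
    using A.smult_assoc1[of "s [^] k" s x] assms(4) x by simp
  finally show ?case .
qed simp

end

context coherent
begin

text \<open>A finite intersection of kernels of multiplications.\<close>

lemma killed_part_in_class:
  assumes AC: "abelian_class R C" and A: "in_class R C A" and "finite S"
  shows "S \<subseteq> carrier R \<Longrightarrow> in_class R C (A\<lparr>carrier := {x \<in> carrier A. \<forall>i\<in>S. i \<odot>\<^bsub>A\<^esub> x = \<zero>\<^bsub>A\<^esub>}\<rparr>) \<and>
    submodule {x \<in> carrier A. \<forall>i\<in>S. i \<odot>\<^bsub>A\<^esub> x = \<zero>\<^bsub>A\<^esub>} R A"
  using \<open>finite S\<close>
proof (induction S rule: finite_induct)
  case empty
  then show ?case using A submod_carrier[OF in_class_module[OF AC A]] by simp
next
  case (insert i S)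
  have Am: "module R A" by (rule in_class_module[OF AC A])
  let ?N = "{x \<in> carrier A. \<forall>i\<in>S. i \<odot>\<^bsub>A\<^esub> x = \<zero>\<^bsub>A\<^esub>}"
  have N: "in_class R C (A\<lparr>carrier := ?N\<rparr>)" "submodule ?N R A" and i: "i \<in> carrier R"
    using insert by auto
  note hi = smult_hom[OF Am i]
  have h: "(\<lambda>x. i \<odot>\<^bsub>A\<^esub> x) \<in> module_hom R (A\<lparr>carrier := ?N\<rparr>) A"
    by (rule module_hom_restrict[OF hi]) auto
  have e: "{x \<in> carrier A. \<forall>i\<in>insert i S. i \<odot>\<^bsub>A\<^esub> x = \<zero>\<^bsub>A\<^esub>} = a_kernel (A\<lparr>carrier := ?N\<rparr>) A (\<lambda>x. i \<odot>\<^bsub>A\<^esub> x)"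
    by (auto simp: mem_a_kernel)
  show ?case
    unfolding e using in_class_kernel[OF AC N(1) A h]
      submod_trans[OF Am N(2) submod_kernel[OF submod_module[OF Am N(2)] Am h]] by simp
qed

text \<open>
  The ideal is the annihilator of the class of \<open>e\<close> in the cyclic module \<open>(R e + T) / T\<close>.
\<close>

lemma cyclic_in_transporter:
  assumes AC: "abelian_class R C" and Qm: "module R Q" and e: "e \<in> carrier Q" and T: "submodule T R Q"
    and Tc: "in_class R C (Q\<lparr>carrier := T\<rparr>)"
    and Lc: "in_class R C (Q\<lparr>carrier := (\<lambda>r. r \<odot>\<^bsub>Q\<^esub> e) ` carrier R <+>\<^bsub>Q\<^esub> T\<rparr>)"
  shows "cyclic_in R C {r \<in> carrier R. r \<odot>\<^bsub>Q\<^esub> e \<in> T}"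
proof -
  interpret Q: module R Q by fact
  let ?Re = "(\<lambda>r. r \<odot>\<^bsub>Q\<^esub> e) ` carrier R" and ?H = "{r \<in> carrier R. r \<odot>\<^bsub>Q\<^esub> e \<in> T}"
  let ?L = "?Re <+>\<^bsub>Q\<^esub> T"
  note L = submod_sum[OF Qm submod_orbit[OF Qm e] T]
  let ?X = "Q\<lparr>carrier := ?L\<rparr>"
  let ?Y = "quotient_module ?X T"
  have Xm: "module R ?X" by (rule submod_module[OF Qm L(1)])
  have TX: "submodule T R ?X" by (rule submod_restrict[OF Qm L(1) T L(3)])
  have Yc: "in_class R C ?Y" using in_class_quotient_iff[OF AC Lc TX] Tc by simp
  have Ym: "module R ?Y" by (rule quotient_is_module[OF Xm TX])
  have "e \<in> ?Re" using e by (intro image_eqI[of _ _ \<one>]) auto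
  then have eL: "e \<in> ?L" using L(2) by blast
  let ?e = "T +>\<^bsub>?X\<^esub> e"
  have eY: "?e \<in> carrier ?Y" using eL by (auto simp: quotient_carrier)
  have sm: "r \<odot>\<^bsub>?Y\<^esub> ?e = T +>\<^bsub>?X\<^esub> (r \<odot>\<^bsub>Q\<^esub> e)" if "r \<in> carrier R" for r
    using quotient_smult[OF Xm TX that, of e] eL by simp
  have onto: "(\<lambda>r. r \<odot>\<^bsub>?Y\<^esub> ?e) ` carrier R = carrier ?Y"
  proof (intro equalityI subsetI)
    fix y assume "y \<in> carrier ?Y"
    then obtain x where x: "x \<in> ?L" "y = T +>\<^bsub>?X\<^esub> x" by (auto simp: quotient_carrier)
    then obtain r w where r: "r \<in> carrier R" "w \<in> T" "x = r \<odot>\<^bsub>Q\<^esub> e \<oplus>\<^bsub>Q\<^esub> w" by (auto simp: mem_set_add)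
    have wQ: "w \<in> carrier Q" using r(2) submodD(1)[OF Qm T] by auto
    have reL: "r \<odot>\<^bsub>Q\<^esub> e \<in> ?L" by (rule submodD(4)[OF Qm L(1) r(1) eL])
    have wL: "w \<in> ?L" using r(2) L(3) by blast
    have w0: "T +>\<^bsub>?X\<^esub> w = \<zero>\<^bsub>?Y\<^esub>" using quotient_eq_zero_iff[OF Xm TX, of w] wL r(2) by simp
    interpret Y: module R ?Y by (rule Ym)
    have "y = (T +>\<^bsub>?X\<^esub> (r \<odot>\<^bsub>Q\<^esub> e)) \<oplus>\<^bsub>?Y\<^esub> (T +>\<^bsub>?X\<^esub> w)"
      using quotient_add[OF Xm TX, of "r \<odot>\<^bsub>Q\<^esub> e" w] reL wL x(2) r(3) by simp
    also have "\<dots> = r \<odot>\<^bsub>?Y\<^esub> ?e" using w0 sm[OF r(1)] Y.smult_closed[OF r(1) eY] by simp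
    finally show "y \<in> (\<lambda>r. r \<odot>\<^bsub>?Y\<^esub> ?e) ` carrier R" using r(1) by (rule image_eqI)
  next
    fix y assume "y \<in> (\<lambda>r. r \<odot>\<^bsub>?Y\<^esub> ?e) ` carrier R"
    then show "y \<in> carrier ?Y" using module.smult_closed[OF Ym _ eY] by auto
  qed
  have "{r \<in> carrier R. r \<odot>\<^bsub>?Y\<^esub> ?e = \<zero>\<^bsub>?Y\<^esub>} = ?H"
    using sm quotient_eq_zero_iff[OF Xm TX] submodD(4)[OF Qm L(1) _ eL] by auto
  then show ?thesis using cyclic_in_iff[OF AC Ym eY onto] Yc by simp
qed

text \<open>
  The submodule \<open>K e\<close> is killed by \<open>H\<close> and the image of \<open>R e\<close> in \<open>Q / K e\<close> is killed by \<open>K\<close>. Both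
  lie in the class, and \<open>R e\<close> is the preimage in \<open>Q\<close> of the second one.
\<close>

lemma orbit_in_class_of_product:
  assumes AC: "abelian_class R C" and Q: "in_class R C Q" and e: "e \<in> carrier Q"
    and Hs: "submodule H R (regular_module R)" and H: "cyclic_in R C H"
    and Ks: "submodule K R (regular_module R)" and K: "cyclic_in R C K"
    and HK: "\<And>h k. h \<in> H \<Longrightarrow> k \<in> K \<Longrightarrow> (h \<otimes> k) \<odot>\<^bsub>Q\<^esub> e = \<zero>\<^bsub>Q\<^esub>"
  shows "in_class R C (Q\<lparr>carrier := (\<lambda>r. r \<odot>\<^bsub>Q\<^esub> e) ` carrier R\<rparr>)"
proof -
  note rm = regular_is_module
  have Qm: "module R Q" by (rule in_class_module[OF AC Q])
  interpret Q: module R Q by fact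
  have HR: "h \<in> carrier R" if "h \<in> H" for h using submodD(1)[OF rm Hs] that by auto
  have KR: "k \<in> carrier R" if "k \<in> K" for k using submodD(1)[OF rm Ks] that by auto
  let ?Re = "(\<lambda>r. r \<odot>\<^bsub>Q\<^esub> e) ` carrier R"
  have Re: "submodule ?Re R Q" by (rule submod_orbit[OF Qm e])
  let ?Ke = "(\<lambda>r. r \<odot>\<^bsub>Q\<^esub> e) ` K"
  have Kfg: "fin_gen R Q ?Ke"
    by (rule fin_gen_image[OF rm Qm orbit_hom[OF Qm e] cyclic_in_fin_gen[OF AC Ks K]])
  have Ke: "submodule ?Ke R Q" by (rule fin_gen_submod[OF Qm Kfg])
  have Kec: "in_class R C (Q\<lparr>carrier := ?Ke\<rparr>)"
  proof (rule killed_in_class[OF AC Hs H fp_submodule[OF in_class_fp[OF AC Q] Kfg]])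
    fix h x assume h: "h \<in> H" and "x \<in> carrier (Q\<lparr>carrier := ?Ke\<rparr>)"
    then obtain k where k: "k \<in> K" "x = k \<odot>\<^bsub>Q\<^esub> e" by auto
    have hR: "h \<in> carrier R" and kR: "k \<in> carrier R" using HR[OF h] KR[OF k(1)] .
    have "h \<odot>\<^bsub>Q\<^esub> x = (h \<otimes> k) \<odot>\<^bsub>Q\<^esub> e" unfolding k(2) using hR kR e by (simp add: Q.smult_assoc1)
    then show "h \<odot>\<^bsub>Q\<lparr>carrier := ?Ke\<rparr>\<^esub> x = \<zero>\<^bsub>Q\<lparr>carrier := ?Ke\<rparr>\<^esub>" using HK[OF h k(1)] by simp
  qed
  let ?X = "quotient_module Q ?Ke"
  have Xc: "in_class R C ?X" using in_class_quotient_iff[OF AC Q Ke] Kec by simp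
  have Xm: "module R ?X" by (rule quotient_is_module[OF Qm Ke])
  interpret X: module R ?X by fact
  let ?e = "?Ke +>\<^bsub>Q\<^esub> e"
  have eX: "?e \<in> carrier ?X" using e by (auto simp: quotient_carrier)
  let ?Rx = "(\<lambda>r. r \<odot>\<^bsub>?X\<^esub> ?e) ` carrier R"
  have Rx: "submodule ?Rx R ?X" by (rule submod_orbit[OF Xm eX])
  have Rxc: "in_class R C (?X\<lparr>carrier := ?Rx\<rparr>)"
  proof (rule killed_in_class[OF AC Ks K fp_submodule[OF in_class_fp[OF AC Xc] fin_gen_orbit[OF Xm eX]]])
    fix k x assume k: "k \<in> K" and "x \<in> carrier (?X\<lparr>carrier := ?Rx\<rparr>)"
    then obtain r where r: "r \<in> carrier R" "x = r \<odot>\<^bsub>?X\<^esub> ?e" by auto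
    have kR: "k \<in> carrier R" by (rule KR[OF k])
    have "k \<odot>\<^bsub>Q\<^esub> e \<in> ?Ke" using k by simp
    then have "k \<odot>\<^bsub>?X\<^esub> ?e = \<zero>\<^bsub>?X\<^esub>"
      using quotient_smult[OF Qm Ke kR e] quotient_eq_zero_iff[OF Qm Ke, of "k \<odot>\<^bsub>Q\<^esub> e"] kR e by simp
    then have "k \<odot>\<^bsub>?X\<^esub> x = \<zero>\<^bsub>?X\<^esub>"
      unfolding r(2) using X.smult_assoc1[OF kR r(1) eX] X.smult_assoc1[OF r(1) kR eX] m_comm[OF kR r(1)] r(1) by simp
    then show "k \<odot>\<^bsub>?X\<lparr>carrier := ?Rx\<rparr>\<^esub> x = \<zero>\<^bsub>?X\<lparr>carrier := ?Rx\<rparr>\<^esub>" by simp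
  qed
  have "{x \<in> carrier Q. ?Ke +>\<^bsub>Q\<^esub> x \<in> ?Rx} = ?Re"
  proof (intro equalityI subsetI)
    fix x assume "x \<in> {x \<in> carrier Q. ?Ke +>\<^bsub>Q\<^esub> x \<in> ?Rx}"
    then obtain r where x: "x \<in> carrier Q" and r: "r \<in> carrier R" "?Ke +>\<^bsub>Q\<^esub> x = r \<odot>\<^bsub>?X\<^esub> ?e" by auto
    have re: "r \<odot>\<^bsub>Q\<^esub> e \<in> carrier Q" using r e by simp
    have "x \<ominus>\<^bsub>Q\<^esub> r \<odot>\<^bsub>Q\<^esub> e \<in> ?Ke"
      using r quotient_smult[OF Qm Ke r(1) e] coset_eq_iff[OF Qm Ke x re] by simp
    then have 1: "x \<ominus>\<^bsub>Q\<^esub> r \<odot>\<^bsub>Q\<^esub> e \<in> ?Re" using KR by auto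
    have "r \<odot>\<^bsub>Q\<^esub> e \<in> ?Re" using r(1) by simp
    then have "(x \<ominus>\<^bsub>Q\<^esub> r \<odot>\<^bsub>Q\<^esub> e) \<oplus>\<^bsub>Q\<^esub> r \<odot>\<^bsub>Q\<^esub> e \<in> ?Re" using submodD(3)[OF Qm Re 1] by simp
    then show "x \<in> ?Re" using module_minus_add[OF Qm x re] by simp
  next
    fix x assume "x \<in> ?Re"
    then obtain r where "r \<in> carrier R" "x = r \<odot>\<^bsub>Q\<^esub> e" by auto
    then show "x \<in> {x \<in> carrier Q. ?Ke +>\<^bsub>Q\<^esub> x \<in> ?Rx}" using quotient_smult[OF Qm Ke _ e] e by auto
  qed
  then show ?thesis
    using in_class_preimage[OF AC Q Xc quotient_hom[OF Qm Ke] Rx Rxc] by simp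
qed

text \<open>
  The hypotheses on \<open>A\<close> say that \<open>R/I\<close> lies in the class after \<open>t\<close> is inverted;
  those on \<open>G\<close> that \<open>R/J\<close> lies in it, for an ideal \<open>J = (G)\<close> with \<open>J Q \<subseteq> t Q\<close>.
  Nilpotence of \<open>J\<close> on \<open>A'/Ra\<close>, for the part \<open>A'\<close> of \<open>A\<close> killed by \<open>I\<close>, gives \<open>R/K\<close> for the
  annihilator \<open>K\<close> of \<open>a\<close>. Nilpotence of \<open>J\<close> on \<open>Q/(Re + t\<^sup>n Q)\<close> gives \<open>R/H\<close> for the ideal \<open>H\<close> of
  all \<open>r\<close> with \<open>r e \<in> t\<^sup>n Q\<close>, and \<open>H K e = 0\<close> because \<open>t\<^sup>n K \<subseteq> I\<close>. This suffices for
  \<open>R e \<cong> R/I\<close>.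
\<close>

lemma cyclic_in_glue:
  assumes AC: "abelian_class R C" and t: "t \<in> carrier R"
    and Q: "in_class R C Q" and e: "e \<in> carrier Q"
    and I: "I = {r \<in> carrier R. r \<odot>\<^bsub>Q\<^esub> e = \<zero>\<^bsub>Q\<^esub>}"
    and IQ: "\<And>i x. i \<in> I \<Longrightarrow> x \<in> carrier Q \<Longrightarrow> i \<odot>\<^bsub>Q\<^esub> x = \<zero>\<^bsub>Q\<^esub>"
    and G: "finite G" "G \<subseteq> carrier R" and J: "cyclic_in R C (module_span R (regular_module R) G)"
    and JQ: "\<And>r x. r \<in> G \<Longrightarrow> x \<in> carrier Q \<Longrightarrow> \<exists>y\<in>carrier Q. r \<odot>\<^bsub>Q\<^esub> x = t \<odot>\<^bsub>Q\<^esub> y"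
    and A: "in_class R C A" and a: "a \<in> carrier A"
    and tA: "\<And>x. x \<in> carrier A \<Longrightarrow> \<exists>r\<in>carrier R. t [^] (n::nat) \<odot>\<^bsub>A\<^esub> x = r \<odot>\<^bsub>A\<^esub> a"
    and tK: "\<And>r. r \<in> carrier R \<Longrightarrow> r \<odot>\<^bsub>A\<^esub> a = \<zero>\<^bsub>A\<^esub> \<Longrightarrow> t [^] n \<otimes> r \<in> I"
    and Ia: "\<And>i. i \<in> I \<Longrightarrow> i \<odot>\<^bsub>A\<^esub> a = \<zero>\<^bsub>A\<^esub>"
  shows "cyclic_in R C I"
proof -
  note rm = regular_is_module
  have Am: "module R A" and Qm: "module R Q" using in_class_module[OF AC] A Q by auto
  interpret A: module R A by fact
  interpret Q: module R Q by fact
  have tn: "t [^] n \<in> carrier R" using t by simp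
  have Is: "submodule I R (regular_module R)" unfolding I by (rule submod_element_annihilator[OF Qm e])
  have IR: "I \<subseteq> carrier R" unfolding I by auto
  have GR: "r \<in> carrier R" if "r \<in> G" for r using that G(2) by auto
  have "fin_gen R (regular_module R) I"
    using fp_kernel(2)[OF fp_regular in_class_fp[OF AC Q] orbit_hom[OF Qm e]]
    by (simp add: I a_kernel_def kernel_def)
  then obtain S where S: "finite S" "S \<subseteq> carrier R" "I = module_span R (regular_module R) S"
    unfolding fin_gen_def by auto
  let ?A = "{x \<in> carrier A. \<forall>i\<in>S. i \<odot>\<^bsub>A\<^esub> x = \<zero>\<^bsub>A\<^esub>}"
  note kp = killed_part_in_class[OF AC A S(1,2)]
  have kill: "i \<odot>\<^bsub>A\<^esub> x = \<zero>\<^bsub>A\<^esub>" if x: "x \<in> ?A" and i: "i \<in> I" for i x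
  proof -
    have xA: "x \<in> carrier A" using x by simp
    have "module_span R (regular_module R) S \<subseteq> {r \<in> carrier R. r \<odot>\<^bsub>A\<^esub> x = \<zero>\<^bsub>A\<^esub>}"
      by (rule span_least[OF submod_element_annihilator[OF Am xA]]) (use x S(2) in auto)
    then show ?thesis using i S(3) by auto
  qed
  let ?Ra = "(\<lambda>r. r \<odot>\<^bsub>A\<^esub> a) ` carrier R"
  have "S \<subseteq> I" using span_superset[of S "regular_module R"] S(3) by simp
  then have aA: "a \<in> ?A" using a Ia by auto
  have RaA: "?Ra \<subseteq> ?A"
  proof
    fix x assume "x \<in> ?Ra"
    then obtain r where "r \<in> carrier R" "x = r \<odot>\<^bsub>A\<^esub> a" by auto
    then show "x \<in> ?A" using submodD(4)[OF Am conjunct2[OF kp] _ aA] by simp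
  qed
  \<comment> \<open>By Nakayama, every generator of \<open>J\<close> has a power in \<open>(t) + I\<close>, so it is nilpotent on \<open>A'/Ra\<close>.\<close>
  have "\<forall>r\<in>G. \<exists>m. \<forall>x\<in>?A. r [^] (m::nat) \<odot>\<^bsub>A\<^esub> x \<in> ?Ra"
  proof
    fix r assume r: "r \<in> G"
    obtain m z c where z: "z \<in> annihilator R Q" "c \<in> carrier R" "r [^] (m::nat) = z \<oplus> t \<otimes> c"
      by (rule nakayama_power[OF Qm fp_fin_gen[OF in_class_fp[OF AC Q]] GR[OF r] t JQ[OF r]])
    have zI: "z \<in> I" "z \<in> carrier R" using z(1) e unfolding I annihilator_def by auto
    have tc: "t \<otimes> c \<in> carrier R" using t z(2) by simp
    have step: "r [^] m \<odot>\<^bsub>A\<^esub> x = (t \<otimes> c) \<odot>\<^bsub>A\<^esub> x" if "x \<in> ?A" for x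
      using kill[OF that zI(1)] that z(2) zI(2) t unfolding z(3) by (simp add: A.smult_l_distr)
    note iter = power_smult_eq_on[OF Am conjunct2[OF kp] nat_pow_closed[OF GR[OF r]] tc step]
    have "r [^] (m * n) \<odot>\<^bsub>A\<^esub> x \<in> ?Ra" if x: "x \<in> ?A" for x
    proof -
      have xA: "x \<in> carrier A" using x by simp
      have "r [^] (m * n) \<odot>\<^bsub>A\<^esub> x = (t \<otimes> c) [^] n \<odot>\<^bsub>A\<^esub> x"
        using iter[OF _ x, of n] nat_pow_pow[OF GR[OF r]] by simp
      also have "\<dots> = t [^] n \<odot>\<^bsub>A\<^esub> (c [^] n \<odot>\<^bsub>A\<^esub> x)"
        using t z(2) xA by (simp add: nat_pow_distrib A.smult_assoc1)
      finally show ?thesis using tA[of "c [^] n \<odot>\<^bsub>A\<^esub> x"] z(2) xA by auto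
    qed
    then show "\<exists>m. \<forall>x\<in>?A. r [^] (m::nat) \<odot>\<^bsub>A\<^esub> x \<in> ?Ra" by (intro exI[of _ "m * n"] ballI)
  qed
  then obtain m where mm: "\<forall>r\<in>G. \<forall>x\<in>?A. r [^] (m r :: nat) \<odot>\<^bsub>A\<^esub> x \<in> ?Ra"
    by (rule bchoice[THEN exE])
  have m: "r [^] (m r) \<odot>\<^bsub>A\<^esub> x \<in> ?Ra" if "r \<in> G" "x \<in> ?A" for r x
    by (rule bspec[OF bspec[OF mm that(1)] that(2)])
  have "in_class R C (A\<lparr>carrier := ?Ra\<rparr>)"
    by (rule nilpotent_quotient_in_class[OF AC Am G J conjunct1[OF kp] conjunct2[OF kp] fin_gen_orbit[OF Am a] RaA m])
  let ?K = "{r \<in> carrier R. r \<odot>\<^bsub>A\<^esub> a = \<zero>\<^bsub>A\<^esub>}"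
  have K: "cyclic_in R C ?K" using cyclic_in_orbit_iff[OF AC Am a] \<open>in_class R C (A\<lparr>carrier := ?Ra\<rparr>)\<close> by simp
  have Ks: "submodule ?K R (regular_module R)" by (rule submod_element_annihilator[OF Am a])
  let ?T = "(\<lambda>x. t [^] n \<odot>\<^bsub>Q\<^esub> x) ` carrier Q" and ?Re = "(\<lambda>r. r \<odot>\<^bsub>Q\<^esub> e) ` carrier R"
  note Th = smult_hom[OF Qm tn]
  have T: "submodule ?T R Q" by (rule submod_image[OF Qm Qm Th submod_carrier[OF Qm]])
  have Tc: "in_class R C (Q\<lparr>carrier := ?T\<rparr>)" by (rule in_class_image[OF AC Q Q Th])
  have Re: "submodule ?Re R Q" by (rule submod_orbit[OF Qm e])
  let ?L = "?Re <+>\<^bsub>Q\<^esub> ?T"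
  note L = submod_sum[OF Qm Re T]
  have Lc: "in_class R C (Q\<lparr>carrier := ?L\<rparr>)"
  proof (rule nilpotent_quotient_in_class[OF AC Qm G J, where N = "carrier Q" and e = "\<lambda>_. n"])
    show "in_class R C (Q\<lparr>carrier := carrier Q\<rparr>)" using Q by simp
    show "fin_gen R Q ?L"
      by (intro fin_gen_sum[OF Qm] fin_gen_orbit[OF Qm e] fin_gen_image[OF Qm Qm Th] fp_fin_gen[OF in_class_fp[OF AC Q]])
    show "?L \<subseteq> carrier Q" by (rule submodD(1)[OF Qm L(1)])
    fix r x assume "r \<in> G" "x \<in> carrier Q"
    then have "\<exists>y\<in>carrier Q. r [^] n \<odot>\<^bsub>Q\<^esub> x = t [^] n \<odot>\<^bsub>Q\<^esub> y"
      using iterate_divisible[OF Qm GR t JQ] by blast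
    then show "r [^] n \<odot>\<^bsub>Q\<^esub> x \<in> ?L" using L(3) by auto
  qed (rule submod_carrier[OF Qm])
  define H where "H = {r \<in> carrier R. r \<odot>\<^bsub>Q\<^esub> e \<in> ?T}"
  have Hs: "submodule H R (regular_module R)"
    using submod_preimage[OF rm Qm orbit_hom[OF Qm e] T] unfolding H_def by simp
  have H: "cyclic_in R C H" unfolding H_def by (rule cyclic_in_transporter[OF AC Qm e T Tc Lc])
  have HK: "(h \<otimes> k) \<odot>\<^bsub>Q\<^esub> e = \<zero>\<^bsub>Q\<^esub>" if h: "h \<in> H" and k: "k \<in> ?K" for h k
  proof -
    have R: "h \<in> carrier R" "k \<in> carrier R" using h k unfolding H_def by auto
    obtain y where y: "y \<in> carrier Q" "h \<odot>\<^bsub>Q\<^esub> e = t [^] n \<odot>\<^bsub>Q\<^esub> y" using h unfolding H_def by auto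
    have "(h \<otimes> k) \<odot>\<^bsub>Q\<^esub> e = k \<odot>\<^bsub>Q\<^esub> (t [^] n \<odot>\<^bsub>Q\<^esub> y)"
      using Q.smult_assoc1[OF R(2,1) e] y(2) R by (simp add: m_comm)
    also have "\<dots> = (t [^] n \<otimes> k) \<odot>\<^bsub>Q\<^esub> y" using Q.smult_assoc1[OF R(2) tn y(1)] R tn by (simp add: m_comm)
    also have "\<dots> = \<zero>\<^bsub>Q\<^esub>" using IQ[OF tK y(1), of k] k by simp
    finally show ?thesis .
  qed
  have "in_class R C (Q\<lparr>carrier := ?Re\<rparr>)" by (rule orbit_in_class_of_product[OF AC Q e Hs H Ks K HK])
  then show ?thesis using cyclic_in_orbit_iff[OF AC Qm e] unfolding I by simp
qed

end

section \<open>Inverting an element\<close>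

text \<open>
  The maps \<open>f\<close> and \<open>g\<close> become mutually inverse, up to the unit \<open>s\<close>, once \<open>s\<close> is inverted.
\<close>

definition equiv_up_to ::
  "('a, 'c) ring_scheme \<Rightarrow> 'a \<Rightarrow> ('a, 'm, 'd) module_scheme \<Rightarrow> ('a, 'n, 'e) module_scheme \<Rightarrow>
    ('m \<Rightarrow> 'n) \<Rightarrow> ('n \<Rightarrow> 'm) \<Rightarrow> bool"
where
  "equiv_up_to R s X A f g \<longleftrightarrow> f \<in> module_hom R X A \<and> g \<in> module_hom R A X \<and>
     (\<forall>x\<in>carrier X. g (f x) = s \<odot>\<^bsub>X\<^esub> x) \<and> (\<forall>a\<in>carrier A. f (g a) = s \<odot>\<^bsub>A\<^esub> a)"

text \<open>
  The modules that become isomorphic to members of \<open>C\<close> once \<open>t\<close> is inverted. They are again modules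
  over \<open>R\<close> itself, so results about classes over one coherent ring apply to them.
\<close>

definition inverted_class ::
  "('a, 'c) ring_scheme \<Rightarrow> (('a, (nat \<Rightarrow> 'a) set) module \<Rightarrow> bool) \<Rightarrow> 'a \<Rightarrow>
    ('a, (nat \<Rightarrow> 'a) set) module \<Rightarrow> bool"
where
  "inverted_class R C t X \<longleftrightarrow> finitely_presented R X \<and>
     (\<exists>A f g n. C A \<and> equiv_up_to R (t [^]\<^bsub>R\<^esub> (n::nat)) X A f g)"

lemma equiv_up_toD:
  assumes "equiv_up_to R s X A f g"
  shows "f \<in> module_hom R X A" "g \<in> module_hom R A X"
    and "\<And>x. x \<in> carrier X \<Longrightarrow> g (f x) = s \<odot>\<^bsub>X\<^esub> x" and "\<And>a. a \<in> carrier A \<Longrightarrow> f (g a) = s \<odot>\<^bsub>A\<^esub> a"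
  using assms unfolding equiv_up_to_def by auto

lemma equiv_up_toI:
  assumes "f \<in> module_hom R X A" "g \<in> module_hom R A X"
    and "\<And>x. x \<in> carrier X \<Longrightarrow> g (f x) = s \<odot>\<^bsub>X\<^esub> x" and "\<And>a. a \<in> carrier A \<Longrightarrow> f (g a) = s \<odot>\<^bsub>A\<^esub> a"
  shows "equiv_up_to R s X A f g"
  using assms unfolding equiv_up_to_def by auto

context cring
begin

lemma hom_lift_injective:
  assumes "module R X" "module R Z" "module R A" "k \<in> module_hom R Z A" "inj_on k (carrier Z)"
    "\<phi> \<in> module_hom R X A" "\<And>x. x \<in> carrier X \<Longrightarrow> \<phi> x \<in> k ` carrier Z"
  obtains \<psi> where "\<psi> \<in> module_hom R X Z" "\<And>x. x \<in> carrier X \<Longrightarrow> k (\<psi> x) = \<phi> x"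
proof -
  let ?K = "A\<lparr>carrier := k ` carrier Z\<rparr>"
  have K: "module R ?K" by (rule submod_module[OF assms(3) submod_image[OF assms(2,3,4) submod_carrier[OF assms(2)]]])
  have kK: "k \<in> module_hom R Z ?K" by (rule module_hom_corestrict[OF assms(4) order_refl])
  have "bij_betw k (carrier Z) (carrier ?K)" using assms(5) by (simp add: bij_betw_def)
  then obtain l where l: "l \<in> module_hom R ?K Z" "\<And>y. y \<in> carrier ?K \<Longrightarrow> k (l y) = y"
    using bij_hom_inverse[OF assms(2) K kK] by blast
  have pK: "\<phi> \<in> module_hom R X ?K" using assms(7) by (intro module_hom_corestrict[OF assms(6)]) auto
  show thesis using that[OF module_hom_comp[OF pK l(1)]] l(2) assms(7) by simp
qed

text \<open>
  The map \<open>h\<close> corresponds to \<open>fB \<circ> h \<circ> gA\<close>, up to a factor. The map \<open>fA\<close> restricts to kernels,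
  but \<open>gA\<close> does so only after multiplication by \<open>u\<close>, because \<open>fB\<close> need not be injective. This is
  why the scalar of the result is a product.
\<close>

lemma equiv_up_to_kernel:
  assumes m: "module R A" "module R B" "module R A'" "module R B'" "module R X" "module R Z"
    and su: "s \<in> carrier R" "u \<in> carrier R"
    and a: "equiv_up_to R s A A' fA gA" and b: "equiv_up_to R u B B' fB gB"
    and h: "h \<in> module_hom R A B"
    and i: "i \<in> module_hom R X A" "inj_on i (carrier X)" "i ` carrier X = a_kernel A B h"
    and k: "k \<in> module_hom R Z A'" "inj_on k (carrier Z)" "k ` carrier Z = a_kernel A' B' (\<lambda>x. fB (h (gA x)))"
  shows "\<exists>f g. equiv_up_to R (s \<otimes> u) X Z f g"
proof -
  note a = equiv_up_toD[OF a] and b = equiv_up_toD[OF b]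
  interpret A: module R A by fact
  interpret A': module R A' by fact
  interpret X: module R X by fact
  interpret Z: module R Z by fact
  note ih = module_homD[OF i(1)] and kh = module_homD[OF k(1)] and hh = module_homD[OF h]
  note fA = module_homD[OF a(1)] and gA = module_homD[OF a(2)]
  note fB = module_homD[OF b(1)] and gB = module_homD[OF b(2)]
  have ker: "h (i x) = \<zero>\<^bsub>B\<^esub>" if "x \<in> carrier X" for x
    using i(3) that by (auto simp: mem_a_kernel set_eq_iff)
  have kker: "fB (h (gA (k z))) = \<zero>\<^bsub>B'\<^esub>" if "z \<in> carrier Z" for z
    using k(3) that by (auto simp: mem_a_kernel set_eq_iff)
  obtain f where f: "f \<in> module_hom R X Z" "\<And>x. x \<in> carrier X \<Longrightarrow> k (f x) = fA (i x)"
  proof (rule hom_lift_injective[OF m(5,6,3) k(1,2) module_hom_comp[OF i(1) a(1)]])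
    fix x assume x: "x \<in> carrier X"
    have "h (gA (fA (i x))) = s \<odot>\<^bsub>B\<^esub> h (i x)" using a(3)[OF ih(1)[OF x]] hh(3)[OF su(1) ih(1)[OF x]] by simp
    then have "fB (h (gA (fA (i x)))) = \<zero>\<^bsub>B'\<^esub>"
      using ker[OF x] module.smult_r_null[OF m(2) su(1)] module_hom_zero[OF m(2,4) b(1)] by simp
    then show "fA (i x) \<in> k ` carrier Z" unfolding k(3) mem_a_kernel using fA(1)[OF ih(1)[OF x]] by simp
  qed blast
  have ug: "(\<lambda>z. u \<odot>\<^bsub>A\<^esub> gA (k z)) \<in> module_hom R Z A"
    by (rule module_hom_comp[OF module_hom_comp[OF k(1) a(2)] smult_hom[OF m(1) su(2)]])
  obtain g where g: "g \<in> module_hom R Z X" "\<And>z. z \<in> carrier Z \<Longrightarrow> i (g z) = u \<odot>\<^bsub>A\<^esub> gA (k z)"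
  proof (rule hom_lift_injective[OF m(6,5,1) i(1,2) ug])
    fix z assume z: "z \<in> carrier Z"
    have y: "gA (k z) \<in> carrier A" by (rule gA(1)[OF kh(1)[OF z]])
    have "h (u \<odot>\<^bsub>A\<^esub> gA (k z)) = gB (fB (h (gA (k z))))" using hh(3)[OF su(2) y] b(3)[OF hh(1)[OF y]] by simp
    also have "\<dots> = \<zero>\<^bsub>B\<^esub>" using kker[OF z] module_hom_zero[OF m(4,2) b(2)] by simp
    finally show "u \<odot>\<^bsub>A\<^esub> gA (k z) \<in> i ` carrier X" unfolding i(3) mem_a_kernel using y su(2) by simp
  qed blast
  note fh = module_homD[OF f(1)] and gh = module_homD[OF g(1)]
  have suR: "s \<otimes> u \<in> carrier R" using su by simp
  have "g (f x) = (s \<otimes> u) \<odot>\<^bsub>X\<^esub> x" if x: "x \<in> carrier X" for x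
  proof (rule inj_onD[OF i(2)])
    have "i (g (f x)) = u \<odot>\<^bsub>A\<^esub> (s \<odot>\<^bsub>A\<^esub> i x)" using g(2)[OF fh(1)[OF x]] f(2)[OF x] a(3)[OF ih(1)[OF x]] by simp
    also have "\<dots> = (s \<otimes> u) \<odot>\<^bsub>A\<^esub> i x" using su ih(1)[OF x] by (simp add: A.smult_assoc1[symmetric] m_comm)
    also have "\<dots> = i ((s \<otimes> u) \<odot>\<^bsub>X\<^esub> x)" using ih(3)[OF suR x] by simp
    finally show "i (g (f x)) = i ((s \<otimes> u) \<odot>\<^bsub>X\<^esub> x)" .
  qed (use x suR fh(1) gh(1) in auto)
  moreover have "f (g z) = (s \<otimes> u) \<odot>\<^bsub>Z\<^esub> z" if z: "z \<in> carrier Z" for z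
  proof (rule inj_onD[OF k(2)])
    have y: "gA (k z) \<in> carrier A" by (rule gA(1)[OF kh(1)[OF z]])
    have "k (f (g z)) = fA (u \<odot>\<^bsub>A\<^esub> gA (k z))" using f(2)[OF gh(1)[OF z]] g(2)[OF z] by simp
    also have "\<dots> = u \<odot>\<^bsub>A'\<^esub> (s \<odot>\<^bsub>A'\<^esub> k z)" using fA(3)[OF su(2) y] a(4)[OF kh(1)[OF z]] by simp
    also have "\<dots> = (s \<otimes> u) \<odot>\<^bsub>A'\<^esub> k z" using su kh(1)[OF z] by (simp add: A'.smult_assoc1[symmetric] m_comm)
    also have "\<dots> = k ((s \<otimes> u) \<odot>\<^bsub>Z\<^esub> z)" using kh(3)[OF suR z] by simp
    finally show "k (f (g z)) = k ((s \<otimes> u) \<odot>\<^bsub>Z\<^esub> z)" .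
  qed (use z suR fh(1) gh(1) in auto)
  ultimately show ?thesis using equiv_up_toI[OF f(1) g(1)] by blast
qed

text \<open>
  Dual to the case of kernels; here it is \<open>fB\<close> that has to be multiplied by \<open>s\<close> before it maps
  the image of \<open>h\<close> into the image of \<open>fB \<circ> h \<circ> gA\<close>.
\<close>

lemma equiv_up_to_cokernel:
  assumes m: "module R A" "module R B" "module R A'" "module R B'" "module R X" "module R Z"
    and su: "s \<in> carrier R" "u \<in> carrier R"
    and a: "equiv_up_to R s A A' fA gA" and b: "equiv_up_to R u B B' fB gB"
    and h: "h \<in> module_hom R A B"
    and p: "p \<in> module_hom R B X" "p ` carrier B = carrier X" "a_kernel B X p = h ` carrier A"
    and k: "k \<in> module_hom R B' Z" "k ` carrier B' = carrier Z" "a_kernel B' Z k = (\<lambda>x. fB (h (gA x))) ` carrier A'"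
  shows "\<exists>f g. equiv_up_to R (s \<otimes> u) X Z f g"
proof -
  note a = equiv_up_toD[OF a] and b = equiv_up_toD[OF b]
  interpret B: module R B by fact
  interpret B': module R B' by fact
  interpret X: module R X by fact
  interpret Z: module R Z by fact
  note ph = module_homD[OF p(1)] and kh = module_homD[OF k(1)] and hh = module_homD[OF h]
  note fA = module_homD[OF a(1)] and gA = module_homD[OF a(2)]
  note fB = module_homD[OF b(1)] and gB = module_homD[OF b(2)]
  have sf: "(\<lambda>x. k (s \<odot>\<^bsub>B'\<^esub> fB x)) \<in> module_hom R B Z"
    by (rule module_hom_comp[OF module_hom_comp[OF b(1) smult_hom[OF m(4) su(1)]] k(1)])
  obtain f where f: "f \<in> module_hom R X Z" "\<And>x. x \<in> carrier B \<Longrightarrow> f (p x) = k (s \<odot>\<^bsub>B'\<^esub> fB x)"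
  proof (rule hom_factor[OF m(2,5,6) p(1,2) sf])
    fix x assume "x \<in> carrier B" "p x = \<zero>\<^bsub>X\<^esub>"
    then have "x \<in> h ` carrier A" unfolding p(3)[symmetric] mem_a_kernel by simp
    then obtain y where y: "y \<in> carrier A" "x = h y" by auto
    have "s \<odot>\<^bsub>B'\<^esub> fB x = fB (h (gA (fA y)))"
      unfolding a(3)[OF y(1)] hh(3)[OF su(1) y(1)] fB(3)[OF su(1) hh(1)[OF y(1)]] y(2) ..
    also have "\<dots> \<in> a_kernel B' Z k" unfolding k(3) using fA(1)[OF y(1)] by simp
    finally show "k (s \<odot>\<^bsub>B'\<^esub> fB x) = \<zero>\<^bsub>Z\<^esub>" unfolding mem_a_kernel by simp
  qed blast
  obtain g where g: "g \<in> module_hom R Z X" "\<And>x. x \<in> carrier B' \<Longrightarrow> g (k x) = p (gB x)"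
  proof (rule hom_factor[OF m(4,6,5) k(1,2) module_hom_comp[OF b(2) p(1)]])
    fix x assume "x \<in> carrier B'" "k x = \<zero>\<^bsub>Z\<^esub>"
    then have "x \<in> (\<lambda>x. fB (h (gA x))) ` carrier A'" unfolding k(3)[symmetric] mem_a_kernel by simp
    then obtain y where y: "y \<in> carrier A'" "x = fB (h (gA y))" by auto
    have gy: "gA y \<in> carrier A" by (rule gA(1)[OF y(1)])
    have "gB x = h (u \<odot>\<^bsub>A\<^esub> gA y)" unfolding y(2) b(3)[OF hh(1)[OF gy]] hh(3)[OF su(2) gy] ..
    also have "\<dots> \<in> a_kernel B X p" unfolding p(3) using module.smult_closed[OF m(1) su(2) gy] by simp
    finally show "p (gB x) = \<zero>\<^bsub>X\<^esub>" unfolding mem_a_kernel by simp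
  qed blast
  have suR: "s \<otimes> u \<in> carrier R" using su by simp
  have "g (f x) = (s \<otimes> u) \<odot>\<^bsub>X\<^esub> x" if x: "x \<in> carrier X" for x
  proof -
    obtain y where y: "y \<in> carrier B" "x = p y" using surjD[OF p(2) x] by blast
    have "g (f x) = p (gB (s \<odot>\<^bsub>B'\<^esub> fB y))" using f(2)[OF y(1)] g(2) fB(1)[OF y(1)] su(1) y(2) by simp
    also have "gB (s \<odot>\<^bsub>B'\<^esub> fB y) = (s \<otimes> u) \<odot>\<^bsub>B\<^esub> y"
      using gB(3)[OF su(1) fB(1)[OF y(1)]] b(3)[OF y(1)] su y(1) by (simp add: B.smult_assoc1)
    finally show ?thesis using ph(3)[OF suR y(1)] y(2) by simp
  qed
  moreover have "f (g z) = (s \<otimes> u) \<odot>\<^bsub>Z\<^esub> z" if z: "z \<in> carrier Z" for z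
  proof -
    obtain y where y: "y \<in> carrier B'" "z = k y" using surjD[OF k(2) z] by blast
    have "f (g z) = k (s \<odot>\<^bsub>B'\<^esub> fB (gB y))" using g(2)[OF y(1)] f(2)[OF gB(1)[OF y(1)]] y(2) by simp
    also have "s \<odot>\<^bsub>B'\<^esub> fB (gB y) = (s \<otimes> u) \<odot>\<^bsub>B'\<^esub> y"
      using b(4)[OF y(1)] su y(1) by (simp add: B'.smult_assoc1)
    finally show ?thesis using kh(3)[OF suR y(1)] y(2) by simp
  qed
  ultimately show ?thesis using equiv_up_toI[OF f(1) g(1)] by blast
qed

text \<open>The two components have to be brought to the same scalar \<open>s u\<close>.\<close>

lemma equiv_up_to_sum:
  assumes m: "module R A" "module R B" "module R A'" "module R B'" "module R X" "module R Z"
    and su: "s \<in> carrier R" "u \<in> carrier R"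
    and a: "equiv_up_to R s A A' fA gA" and b: "equiv_up_to R u B B' fB gB"
    and p: "p \<in> module_hom R X A" "p' \<in> module_hom R X B" "bij_betw (\<lambda>x. (p x, p' x)) (carrier X) (carrier A \<times> carrier B)"
    and k: "k \<in> module_hom R (direct_sum A' B') Z" "l \<in> module_hom R Z (direct_sum A' B')"
      "\<And>x. x \<in> carrier (direct_sum A' B') \<Longrightarrow> l (k x) = x" "\<And>z. z \<in> carrier Z \<Longrightarrow> k (l z) = z"
  shows "\<exists>f g. equiv_up_to R (s \<otimes> u) X Z f g"
proof -
  note a = equiv_up_toD[OF a] and b = equiv_up_toD[OF b]
  interpret A: module R A by fact
  interpret B: module R B by fact
  interpret A': module R A' by fact
  interpret B': module R B' by fact
  note fA = module_homD[OF a(1)] and gA = module_homD[OF a(2)]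
  note fB = module_homD[OF b(1)] and gB = module_homD[OF b(2)]
  let ?D = "direct_sum A B" and ?D' = "direct_sum A' B'"
  have D: "module R ?D" "module R ?D'" by (intro direct_sum_is_module m)+
  have c: "(\<lambda>x. (p x, p' x)) \<in> module_hom R X ?D" by (rule hom_into_direct_sum[OF p(1,2)])
  have bij: "bij_betw (\<lambda>x. (p x, p' x)) (carrier X) (carrier ?D)" using p(3) by simp
  obtain q where q: "q \<in> module_hom R ?D X" "\<And>x. x \<in> carrier X \<Longrightarrow> q (p x, p' x) = x"
    "\<And>y. y \<in> carrier ?D \<Longrightarrow> (p (q y), p' (q y)) = y"
    using bij_hom_inverse[OF m(5) D(1) c bij] by blast
  define F where "F z = (u \<odot>\<^bsub>A'\<^esub> fA (fst z), s \<odot>\<^bsub>B'\<^esub> fB (snd z))" for z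
  define G where "G z = (gA (fst z), gB (snd z))" for z
  have F: "F \<in> module_hom R ?D ?D'"
    unfolding F_def
    by (intro hom_into_direct_sum module_hom_comp[OF module_hom_comp[OF fst_hom a(1)] smult_hom[OF m(3) su(2)]]
       module_hom_comp[OF module_hom_comp[OF snd_hom b(1)] smult_hom[OF m(4) su(1)]])
  have G: "G \<in> module_hom R ?D' ?D"
    unfolding G_def by (intro hom_into_direct_sum module_hom_comp[OF fst_hom a(2)] module_hom_comp[OF snd_hom b(2)])
  have suR: "s \<otimes> u \<in> carrier R" using su by simp
  have GF: "G (F z) = (s \<otimes> u) \<odot>\<^bsub>?D\<^esub> z" if "z \<in> carrier ?D" for z
  proof -
    obtain x y where z: "z = (x, y)" "x \<in> carrier A" "y \<in> carrier B" using \<open>z \<in> carrier ?D\<close> by auto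
    have "gA (u \<odot>\<^bsub>A'\<^esub> fA x) = (s \<otimes> u) \<odot>\<^bsub>A\<^esub> x"
      using gA(3)[OF su(2) fA(1)[OF z(2)]] a(3)[OF z(2)] su z(2) by (simp add: A.smult_assoc1[symmetric] m_comm)
    moreover have "gB (s \<odot>\<^bsub>B'\<^esub> fB y) = (s \<otimes> u) \<odot>\<^bsub>B\<^esub> y"
      using gB(3)[OF su(1) fB(1)[OF z(3)]] b(3)[OF z(3)] su z(3) by (simp add: B.smult_assoc1)
    ultimately show ?thesis unfolding F_def G_def z(1) by simp
  qed
  have FG: "F (G z) = (s \<otimes> u) \<odot>\<^bsub>?D'\<^esub> z" if "z \<in> carrier ?D'" for z
  proof -
    obtain x y where z: "z = (x, y)" "x \<in> carrier A'" "y \<in> carrier B'" using \<open>z \<in> carrier ?D'\<close> by auto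
    show ?thesis unfolding F_def G_def z(1)
      using a(4)[OF z(2)] b(4)[OF z(3)] su z(2,3)
      by (simp add: A'.smult_assoc1[symmetric] B'.smult_assoc1[symmetric] m_comm)
  qed
  note qh = module_homD[OF q(1)] and kh = module_homD[OF k(1)] and lh = module_homD[OF k(2)]
  have "equiv_up_to R (s \<otimes> u) X Z (\<lambda>x. k (F (p x, p' x))) (\<lambda>z. q (G (l z)))"
  proof (rule equiv_up_toI)
    show "(\<lambda>x. k (F (p x, p' x))) \<in> module_hom R X Z" by (rule module_hom_comp[OF module_hom_comp[OF c F] k(1)])
    show "(\<lambda>z. q (G (l z))) \<in> module_hom R Z X" by (rule module_hom_comp[OF module_hom_comp[OF k(2) G] q(1)])
    fix x assume x: "x \<in> carrier X"
    note cx = module_homD(1)[OF c x]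
    show "q (G (l (k (F (p x, p' x))))) = (s \<otimes> u) \<odot>\<^bsub>X\<^esub> x"
      unfolding k(3)[OF module_homD(1)[OF F cx]] GF[OF cx] qh(3)[OF suR cx] q(2)[OF x] ..
  next
    fix z assume z: "z \<in> carrier Z"
    note Gz = module_homD(1)[OF G lh(1)[OF z]]
    show "k (F (p (q (G (l z))), p' (q (G (l z))))) = (s \<otimes> u) \<odot>\<^bsub>Z\<^esub> z"
      unfolding q(3)[OF Gz] FG[OF lh(1)[OF z]] kh(3)[OF suR lh(1)[OF z]] k(4)[OF z] ..
  qed
  then show ?thesis by blast
qed

end

context coherent
begin

lemma abelian_class_inverted:
  assumes AC: "abelian_class R C" and t: "t \<in> carrier R"
  shows "abelian_class R (inverted_class R C t)"
proof -
  let ?C = "inverted_class R C t"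
  have pw: "t [^] (n::nat) \<in> carrier R" for n using t by simp
  have mult: "t [^] (n::nat) \<otimes> t [^] (m::nat) = t [^] (n + m)" for n m using t by (rule nat_pow_mult)
  have fp: "finitely_presented R Y" if "?C Y" for Y using that unfolding inverted_class_def by simp
  note FP = abelian_classD[OF abelian_class_fp]
  have obt: "\<exists>A f g n. C A \<and> equiv_up_to R (t [^] (n::nat)) Y A f g" if "?C Y" for Y
    using that unfolding inverted_class_def by simp
  have wit: "?C Y" if "finitely_presented R Y" "C A" "equiv_up_to R (t [^] (n::nat) \<otimes> t [^] (m::nat)) Y A f g" for Y A f g n m
    using that unfolding inverted_class_def mult by blast
  have zero: "?C Y" if "finitely_presented R Y" "is_zero_module Y" for Y
  proof (rule wit[of _ _ 0 0])
    show "C Y" using abelian_classD(2)[OF AC that] .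
    interpret Y: module R Y by (rule fp_module[OF that(1)])
    show "equiv_up_to R (t [^] (0::nat) \<otimes> t [^] (0::nat)) Y Y (\<lambda>x. x) (\<lambda>x. x)"
      by (intro equiv_up_toI module_hom_id) simp_all
  qed fact
  have sum: "?C X" if c: "?C A" "?C B" and X: "module R X" and h: "f \<in> module_hom R X A" "g \<in> module_hom R X B"
    "bij_betw (\<lambda>x. (f x, g x)) (carrier X) (carrier A \<times> carrier B)" for A B X :: "('a, (nat \<Rightarrow> 'a) set) module" and f g
  proof -
    obtain A' fA gA n where a: "C A'" "equiv_up_to R (t [^] (n::nat)) A A' fA gA"
      using obt[OF c(1)] by blast
    obtain B' fB gB m where b: "C B'" "equiv_up_to R (t [^] (m::nat)) B B' fB gB"
      using obt[OF c(2)] by blast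
    note md = fp_module[OF fp[OF c(1)]] fp_module[OF fp[OF c(2)]] class_module[OF AC a(1)] class_module[OF AC b(1)]
    have ic: "in_class R C (direct_sum A' B')"
      by (rule in_class_sum[OF AC in_class_self[OF AC a(1)] in_class_self[OF AC b(1)]
            direct_sum_is_module[OF md(3,4)] fst_hom snd_hom]) (simp add: bij_betw_def)
    obtain Z k l where Z: "C Z" "module R Z" "k \<in> module_hom R (direct_sum A' B') Z" "l \<in> module_hom R Z (direct_sum A' B')"
      "\<And>x. x \<in> carrier (direct_sum A' B') \<Longrightarrow> l (k x) = x" "\<And>y. y \<in> carrier Z \<Longrightarrow> k (l y) = y"
      using in_classE[OF AC ic] by blast
    obtain F G where "equiv_up_to R (t [^] n \<otimes> t [^] m) X Z F G"
      using equiv_up_to_sum[OF md X Z(2) pw pw a(2) b(2) h Z(3-6)] by blast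
    then show ?thesis by (rule wit[OF FP(3)[OF fp[OF c(1)] fp[OF c(2)] X h] Z(1)])
  qed
  have ker: "?C X" if c: "?C A" "?C B" and X: "module R X" and h: "f \<in> module_hom R A B" "g \<in> module_hom R X A"
    "inj_on g (carrier X)" "g ` carrier X = a_kernel A B f" for A B X :: "('a, (nat \<Rightarrow> 'a) set) module" and f g
  proof -
    obtain A' fA gA n where a: "C A'" "equiv_up_to R (t [^] (n::nat)) A A' fA gA"
      using obt[OF c(1)] by blast
    obtain B' fB gB m where b: "C B'" "equiv_up_to R (t [^] (m::nat)) B B' fB gB"
      using obt[OF c(2)] by blast
    note md = fp_module[OF fp[OF c(1)]] fp_module[OF fp[OF c(2)]] class_module[OF AC a(1)] class_module[OF AC b(1)]
    let ?h = "\<lambda>x. fB (f (gA x))"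
    let ?Z = "A'\<lparr>carrier := a_kernel A' B' ?h\<rparr>"
    have hh: "?h \<in> module_hom R A' B'"
      by (rule module_hom_comp[OF module_hom_comp[OF equiv_up_toD(2)[OF a(2)] h(1)] equiv_up_toD(1)[OF b(2)]])
    have "in_class R C ?Z" by (rule in_class_kernel[OF AC in_class_self[OF AC a(1)] in_class_self[OF AC b(1)] hh])
    then have Z: "C ?Z" using class_iff_in_class[OF AC] by simp
    have k: "(\<lambda>x. x) \<in> module_hom R ?Z A'" by (rule module_hom_restrict[OF module_hom_id]) (auto simp: mem_a_kernel)
    have "\<exists>F G. equiv_up_to R (t [^] n \<otimes> t [^] m) X ?Z F G"
      by (rule equiv_up_to_kernel[OF md X class_module[OF AC Z] pw pw a(2) b(2) h k]) simp_all
    then show ?thesis using wit[OF FP(4)[OF fp[OF c(1)] fp[OF c(2)] X h] Z] by blast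
  qed
  have coker: "?C X" if c: "?C A" "?C B" and X: "module R X" and h: "f \<in> module_hom R A B" "g \<in> module_hom R B X"
    "g ` carrier B = carrier X" "a_kernel B X g = f ` carrier A" for A B X :: "('a, (nat \<Rightarrow> 'a) set) module" and f g
  proof -
    obtain A' fA gA n where a: "C A'" "equiv_up_to R (t [^] (n::nat)) A A' fA gA"
      using obt[OF c(1)] by blast
    obtain B' fB gB m where b: "C B'" "equiv_up_to R (t [^] (m::nat)) B B' fB gB"
      using obt[OF c(2)] by blast
    note md = fp_module[OF fp[OF c(1)]] fp_module[OF fp[OF c(2)]] class_module[OF AC a(1)] class_module[OF AC b(1)]
    let ?h = "\<lambda>x. fB (f (gA x))"
    have hh: "?h \<in> module_hom R A' B'"
      by (rule module_hom_comp[OF module_hom_comp[OF equiv_up_toD(2)[OF a(2)] h(1)] equiv_up_toD(1)[OF b(2)]])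
    note icA = in_class_self[OF AC a(1)] and icB = in_class_self[OF AC b(1)]
    have im: "submodule (?h ` carrier A') R B'" by (rule submod_image[OF md(3,4) hh submod_carrier[OF md(3)]])
    obtain Z k where Z: "C Z" "module R Z" "k \<in> module_hom R B' Z" "k ` carrier B' = carrier Z"
      "\<And>x. x \<in> carrier B' \<Longrightarrow> k x = \<zero>\<^bsub>Z\<^esub> \<longleftrightarrow> x \<in> ?h ` carrier A'"
      by (rule class_quotientE[OF AC icB im in_class_image[OF AC icA icB hh]]) (rule that, assumption+)
    have kk: "a_kernel B' Z k = ?h ` carrier A'"
      using Z(5) submodD(1)[OF md(4) im] unfolding set_eq_iff mem_a_kernel by blast
    obtain F G where "equiv_up_to R (t [^] n \<otimes> t [^] m) X Z F G"
      using equiv_up_to_cokernel[OF md X Z(2) pw pw a(2) b(2) h Z(3,4) kk] by blast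
    then show ?thesis by (rule wit[OF FP(5)[OF fp[OF c(1)] fp[OF c(2)] X h] Z(1)])
  qed
  show ?thesis
    unfolding abelian_class_def
  proof (intro conjI)
    show "\<forall>Y. ?C Y \<longrightarrow> finitely_presented R Y" using fp by simp
    show "\<forall>Y. finitely_presented R Y \<longrightarrow> is_zero_module Y \<longrightarrow> ?C Y" using zero by simp
  qed (intro allI impI, (rule sum ker coker; assumption))+
qed


section \<open>The ring modulo the annihilator of a module\<close>

lemma annihilator_submod:
  assumes "module R M"
  shows "submodule (annihilator R M) R (regular_module R)"
proof -
  interpret M: module R M by fact
  show ?thesis
    by (rule submodI[OF regular_is_module]) (auto simp: annihilator_def M.smult_l_distr M.smult_assoc1)
qed

lemma annihilator_iso:
  assumes "module R M" "module R N" "f \<in> module_hom R M N" "g \<in> module_hom R N M"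
    "\<And>x. x \<in> carrier M \<Longrightarrow> g (f x) = x" "\<And>y. y \<in> carrier N \<Longrightarrow> f (g y) = y"
  shows "annihilator R M = annihilator R N"
proof -
  note f = module_homD[OF assms(3)] and g = module_homD[OF assms(4)]
  have "r \<odot>\<^bsub>N\<^esub> y = \<zero>\<^bsub>N\<^esub>" if r: "r \<in> annihilator R M" and y: "y \<in> carrier N" for r y
  proof -
    have rR: "r \<in> carrier R" and rg: "r \<odot>\<^bsub>M\<^esub> g y = \<zero>\<^bsub>M\<^esub>" using r g(1)[OF y] by (simp_all add: annihilator_def)
    show ?thesis
      using f(3)[OF rR g(1)[OF y]] module_hom_zero[OF assms(1-3)] unfolding rg assms(6)[OF y] by simp
  qed
  moreover have "r \<odot>\<^bsub>M\<^esub> y = \<zero>\<^bsub>M\<^esub>" if r: "r \<in> annihilator R N" and y: "y \<in> carrier M" for r y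
  proof -
    have rR: "r \<in> carrier R" and rg: "r \<odot>\<^bsub>N\<^esub> f y = \<zero>\<^bsub>N\<^esub>" using r f(1)[OF y] by (simp_all add: annihilator_def)
    show ?thesis
      using g(3)[OF rR f(1)[OF y]] module_hom_zero[OF assms(2,1,4)] unfolding rg assms(5)[OF y] by simp
  qed
  ultimately show ?thesis unfolding annihilator_def by auto
qed

text \<open>
  A power of \<open>M\<close> contains an element, the tuple \<open>y\<close>, that is annihilated only by those scalars
  that annihilate all the \<open>y b\<close>. The last two clauses are properties that \<open>Q\<close> inherits from \<open>M\<close> as
  such a power.
\<close>

lemma faithful_element_in_power:
  assumes AC: "abelian_class R C" and M: "C M" and "finite (B :: 'i set)"
  shows "(\<And>b. b \<in> B \<Longrightarrow> y b \<in> carrier M) \<Longrightarrow> \<exists>Q e. C Q \<and> e \<in> carrier Q \<and>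
    (\<forall>r\<in>carrier R. r \<odot>\<^bsub>Q\<^esub> e = \<zero>\<^bsub>Q\<^esub> \<longleftrightarrow> (\<forall>b\<in>B. r \<odot>\<^bsub>M\<^esub> y b = \<zero>\<^bsub>M\<^esub>)) \<and>
    (\<forall>i\<in>annihilator R M. \<forall>x\<in>carrier Q. i \<odot>\<^bsub>Q\<^esub> x = \<zero>\<^bsub>Q\<^esub>) \<and>
    (\<forall>r\<in>carrier R. \<forall>t\<in>carrier R. (\<forall>x\<in>carrier M. \<exists>z\<in>carrier M. r \<odot>\<^bsub>M\<^esub> x = t \<odot>\<^bsub>M\<^esub> z) \<longrightarrow>
      (\<forall>x\<in>carrier Q. \<exists>z\<in>carrier Q. r \<odot>\<^bsub>Q\<^esub> x = t \<odot>\<^bsub>Q\<^esub> z))" (is "PROP _ \<Longrightarrow> \<exists>Q e. ?P B Q e")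
  using \<open>finite B\<close>
proof (induction B rule: finite_induct)
  case empty
  interpret M: module R M by (rule class_module[OF AC M])
  have "?P {} M \<zero>\<^bsub>M\<^esub>" using M by (auto simp: annihilator_def)
  then show ?case by (intro exI)
next
  case (insert b B)
  have Mm: "module R M" by (rule class_module[OF AC M])
  interpret M: module R M by fact
  have "\<exists>Q e. ?P B Q e" by (rule insert.IH) (use insert.prems in simp)
  then obtain Q e where P: "?P B Q e" by (elim exE)
  have Q: "C Q" "e \<in> carrier Q"
    "\<And>r. r \<in> carrier R \<Longrightarrow> r \<odot>\<^bsub>Q\<^esub> e = \<zero>\<^bsub>Q\<^esub> \<longleftrightarrow> (\<forall>b\<in>B. r \<odot>\<^bsub>M\<^esub> y b = \<zero>\<^bsub>M\<^esub>)"
    "\<And>i x. i \<in> annihilator R M \<Longrightarrow> x \<in> carrier Q \<Longrightarrow> i \<odot>\<^bsub>Q\<^esub> x = \<zero>\<^bsub>Q\<^esub>"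
    using P by simp_all
  have Qd: "\<exists>z\<in>carrier Q. r \<odot>\<^bsub>Q\<^esub> x = t \<odot>\<^bsub>Q\<^esub> z" if "r \<in> carrier R" "t \<in> carrier R"
    "\<forall>x\<in>carrier M. \<exists>z\<in>carrier M. r \<odot>\<^bsub>M\<^esub> x = t \<odot>\<^bsub>M\<^esub> z" "x \<in> carrier Q" for r t x
    using P[THEN conjunct2, THEN conjunct2, THEN conjunct2, THEN conjunct2] that by simp
  have Qm: "module R Q" by (rule class_module[OF AC Q(1)])
  let ?D = "direct_sum M Q"
  have Dm: "module R ?D" by (rule direct_sum_is_module[OF Mm Qm])
  have ic: "in_class R C ?D"
    by (rule in_class_sum[OF AC in_class_self[OF AC M] in_class_self[OF AC Q(1)] Dm fst_hom snd_hom])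
      (simp add: bij_betw_def)
  obtain Z k l where Z: "C Z" "module R Z" "k \<in> module_hom R ?D Z" "l \<in> module_hom R Z ?D"
    "\<And>x. x \<in> carrier ?D \<Longrightarrow> l (k x) = x" "\<And>y. y \<in> carrier Z \<Longrightarrow> k (l y) = y"
    using in_classE[OF AC ic] by blast
  note kh = module_homD[OF Z(3)] and lh = module_homD[OF Z(4)]
  have yb: "y b \<in> carrier M" using insert.prems by simp
  have eD: "(y b, e) \<in> carrier ?D" using yb Q(2) by simp
  have "?P (insert b B) Z (k (y b, e))"
  proof (intro conjI ballI impI)
    show "C Z" by fact
    show "k (y b, e) \<in> carrier Z" by (rule kh(1)[OF eD])
  next
    fix r assume r: "r \<in> carrier R"
    have rD: "r \<odot>\<^bsub>?D\<^esub> (y b, e) \<in> carrier ?D" using r eD module.smult_closed[OF Dm] by blast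
    have "r \<odot>\<^bsub>Z\<^esub> k (y b, e) = \<zero>\<^bsub>Z\<^esub> \<longleftrightarrow> k (r \<odot>\<^bsub>?D\<^esub> (y b, e)) = \<zero>\<^bsub>Z\<^esub>" using kh(3)[OF r eD] by simp
    also have "\<dots> \<longleftrightarrow> r \<odot>\<^bsub>?D\<^esub> (y b, e) = \<zero>\<^bsub>?D\<^esub>"
      using Z(5)[OF rD] module_hom_zero[OF Dm Z(2,3)] module_hom_zero[OF Z(2) Dm Z(4)] by metis
    also have "\<dots> \<longleftrightarrow> (\<forall>b\<in>insert b B. r \<odot>\<^bsub>M\<^esub> y b = \<zero>\<^bsub>M\<^esub>)" using Q(3)[OF r] by simp
    finally show "r \<odot>\<^bsub>Z\<^esub> k (y b, e) = \<zero>\<^bsub>Z\<^esub> \<longleftrightarrow> (\<forall>b\<in>insert b B. r \<odot>\<^bsub>M\<^esub> y b = \<zero>\<^bsub>M\<^esub>)" .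
  next
    fix i x assume i: "i \<in> annihilator R M" and x: "x \<in> carrier Z"
    have iR: "i \<in> carrier R" using i by (simp add: annihilator_def)
    obtain u v where uv: "l x = (u, v)" "u \<in> carrier M" "v \<in> carrier Q" using lh(1)[OF x] by auto
    have "i \<odot>\<^bsub>?D\<^esub> l x = \<zero>\<^bsub>?D\<^esub>" unfolding uv(1) using Q(4)[OF i uv(3)] i uv(2) by (simp add: annihilator_def)
    then have "k (i \<odot>\<^bsub>?D\<^esub> l x) = \<zero>\<^bsub>Z\<^esub>" using module_hom_zero[OF Dm Z(2,3)] by simp
    then show "i \<odot>\<^bsub>Z\<^esub> x = \<zero>\<^bsub>Z\<^esub>" using kh(3)[OF iR lh(1)[OF x]] Z(6)[OF x] by simp
  next
    fix r t x assume rt: "r \<in> carrier R" "t \<in> carrier R"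
      and d: "\<forall>x\<in>carrier M. \<exists>z\<in>carrier M. r \<odot>\<^bsub>M\<^esub> x = t \<odot>\<^bsub>M\<^esub> z" and x: "x \<in> carrier Z"
    obtain u v where uv: "l x = (u, v)" "u \<in> carrier M" "v \<in> carrier Q" using lh(1)[OF x] by auto
    obtain u' where u': "u' \<in> carrier M" "r \<odot>\<^bsub>M\<^esub> u = t \<odot>\<^bsub>M\<^esub> u'" using d uv(2) by blast
    obtain v' where v': "v' \<in> carrier Q" "r \<odot>\<^bsub>Q\<^esub> v = t \<odot>\<^bsub>Q\<^esub> v'" using Qd[OF rt d uv(3)] by blast
    have D': "(u', v') \<in> carrier ?D" using u' v' by simp
    have "r \<odot>\<^bsub>Z\<^esub> x = k (r \<odot>\<^bsub>?D\<^esub> l x)" using kh(3)[OF rt(1) lh(1)[OF x]] Z(6)[OF x] by simp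
    also have "r \<odot>\<^bsub>?D\<^esub> l x = t \<odot>\<^bsub>?D\<^esub> (u', v')" unfolding uv(1) using u' v' by simp
    also have "k (t \<odot>\<^bsub>?D\<^esub> (u', v')) = t \<odot>\<^bsub>Z\<^esub> k (u', v')" by (rule kh(3)[OF rt(2) D'])
    finally show "\<exists>z\<in>carrier Z. r \<odot>\<^bsub>Z\<^esub> x = t \<odot>\<^bsub>Z\<^esub> z" using kh(1)[OF D'] by (intro bexI[of _ "k (u', v')"])
  qed
  then show ?case by (intro exI)
qed

lemma generators_annihilator:
  assumes "module R M" "finite B" "\<pi> \<in> module_hom R (free_module R B) M" "\<pi> ` (B \<rightarrow>\<^sub>E carrier R) = carrier M"
    "r \<in> carrier R"
  shows "r \<in> annihilator R M \<longleftrightarrow> (\<forall>b\<in>B. r \<odot>\<^bsub>M\<^esub> \<pi> (basis_vector R B b) = \<zero>\<^bsub>M\<^esub>)"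
proof
  assume "r \<in> annihilator R M"
  then show "\<forall>b\<in>B. r \<odot>\<^bsub>M\<^esub> \<pi> (basis_vector R B b) = \<zero>\<^bsub>M\<^esub>"
    using module_homD(1)[OF assms(3) basis_vector_closed[folded free_simps(1)]] by (simp add: annihilator_def)
next
  assume *: "\<forall>b\<in>B. r \<odot>\<^bsub>M\<^esub> \<pi> (basis_vector R B b) = \<zero>\<^bsub>M\<^esub>"
  have "(\<lambda>b. \<pi> (basis_vector R B b)) ` B \<subseteq> a_kernel M M (\<lambda>x. r \<odot>\<^bsub>M\<^esub> x)"
    using * module_homD(1)[OF assms(3) basis_vector_closed[folded free_simps(1)]] by (auto simp: mem_a_kernel)
  then have "carrier M \<subseteq> a_kernel M M (\<lambda>x. r \<odot>\<^bsub>M\<^esub> x)"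
    using span_least[OF submod_kernel[OF assms(1,1) smult_hom[OF assms(1,5)]]]
      free_hom_image[OF assms(1-3)] assms(4) by simp
  then show "r \<in> annihilator R M" using assms(5) by (auto simp: annihilator_def mem_a_kernel)
qed

text \<open>
  Up to a power of \<open>t\<close>, a member \<open>A\<close> of \<open>C\<close> that agrees with \<open>R/I\<close> once \<open>t\<close> is inverted is generated by
  one element \<open>a\<close> with annihilator \<open>I\<close>. This is the form in which the gluing step uses it.
\<close>

lemma cyclic_in_invertedD:
  assumes AC: "abelian_class R C" and t: "t \<in> carrier R" and I: "submodule I R (regular_module R)"
    and c: "cyclic_in R (inverted_class R C t) I"
  shows "\<exists>A a (n::nat). in_class R C A \<and> a \<in> carrier (A :: ('a, (nat \<Rightarrow> 'a) set) module) \<and>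
    (\<forall>x\<in>carrier A. \<exists>r\<in>carrier R. t [^] n \<odot>\<^bsub>A\<^esub> x = r \<odot>\<^bsub>A\<^esub> a) \<and>
    (\<forall>r\<in>carrier R. r \<odot>\<^bsub>A\<^esub> a = \<zero>\<^bsub>A\<^esub> \<longrightarrow> t [^] n \<otimes> r \<in> I) \<and> (\<forall>i\<in>I. i \<odot>\<^bsub>A\<^esub> a = \<zero>\<^bsub>A\<^esub>)"
proof -
  let ?Q = "quotient_module (regular_module R) I"
  note rm = regular_is_module
  note ACt = abelian_class_inverted[OF AC t]
  have Qm: "module R ?Q" by (rule ideal_quotient_module[OF I])
  obtain Y k l where Y: "inverted_class R C t Y" "module R Y" "k \<in> module_hom R ?Q Y" "l \<in> module_hom R Y ?Q"
    "\<And>x. x \<in> carrier ?Q \<Longrightarrow> l (k x) = x" "\<And>y. y \<in> carrier Y \<Longrightarrow> k (l y) = y"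
    using in_classE[OF ACt c[unfolded cyclic_in_def]] by blast
  obtain A f g n where A: "C A" "equiv_up_to R (t [^] (n::nat)) Y A f g"
    using Y(1) unfolding inverted_class_def by blast
  have Am: "module R A" by (rule class_module[OF AC A(1)])
  interpret Y: module R Y by (rule Y(2))
  note fg = equiv_up_toD[OF A(2)]
  have tn: "t [^] n \<in> carrier R" using t by simp
  let ?u = "\<lambda>r. I +>\<^bsub>regular_module R\<^esub> r"
  define y where "y = k (?u \<one>)"
  have u: "?u \<one> \<in> carrier ?Q" by (simp add: quotient_carrier)
  have y: "y \<in> carrier Y" unfolding y_def by (rule module_homD(1)[OF Y(3) u])
  have ry: "r \<odot>\<^bsub>Y\<^esub> y = k (?u r)" if r: "r \<in> carrier R" for r
    unfolding y_def using module_homD(3)[OF Y(3) r u] quotient_smult[OF rm I r, of \<one>] r by simp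
  have ry0: "r \<odot>\<^bsub>Y\<^esub> y = \<zero>\<^bsub>Y\<^esub> \<longleftrightarrow> r \<in> I" if r: "r \<in> carrier R" for r
  proof -
    have ur: "?u r \<in> carrier ?Q" using r by (simp add: quotient_carrier)
    have "k (?u r) = \<zero>\<^bsub>Y\<^esub> \<longleftrightarrow> ?u r = \<zero>\<^bsub>?Q\<^esub>"
      using Y(5)[OF ur] module_hom_zero[OF Qm Y(2,3)] module_hom_zero[OF Y(2) Qm Y(4)] by metis
    then show ?thesis using ry[OF r] coset_zero_iff_mem[OF I r] by simp
  qed
  have fy: "f y \<in> carrier A" by (rule module_homD(1)[OF fg(1) y])
  have "\<exists>r\<in>carrier R. t [^] n \<odot>\<^bsub>A\<^esub> x = r \<odot>\<^bsub>A\<^esub> f y" if x: "x \<in> carrier A" for x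
  proof -
    have gx: "g x \<in> carrier Y" by (rule module_homD(1)[OF fg(2) x])
    obtain r where r: "r \<in> carrier R" "l (g x) = ?u r"
      using module_homD(1)[OF Y(4) gx] by (auto simp: quotient_carrier)
    have "g x = r \<odot>\<^bsub>Y\<^esub> y" using Y(6)[OF gx] r ry[OF r(1)] by simp
    then have "t [^] n \<odot>\<^bsub>A\<^esub> x = r \<odot>\<^bsub>A\<^esub> f y" using fg(4)[OF x] module_homD(3)[OF fg(1) r(1) y] by simp
    then show ?thesis using r(1) by blast
  qed
  moreover have "t [^] n \<otimes> r \<in> I" if r: "r \<in> carrier R" "r \<odot>\<^bsub>A\<^esub> f y = \<zero>\<^bsub>A\<^esub>" for r
  proof -
    have "(t [^] n \<otimes> r) \<odot>\<^bsub>Y\<^esub> y = g (f (r \<odot>\<^bsub>Y\<^esub> y))" using fg(3) r(1) tn y by (simp add: Y.smult_assoc1)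
    also have "\<dots> = \<zero>\<^bsub>Y\<^esub>" using module_homD(3)[OF fg(1) r(1) y] r(2) module_hom_zero[OF Am Y(2) fg(2)] by simp
    finally show ?thesis using ry0 tn r(1) by simp
  qed
  moreover have "i \<odot>\<^bsub>A\<^esub> f y = \<zero>\<^bsub>A\<^esub>" if i: "i \<in> I" for i
  proof -
    have iR: "i \<in> carrier R" using i submodD(1)[OF rm I] by auto
    show ?thesis using module_homD(3)[OF fg(1) iR y] ry0[OF iR] i module_hom_zero[OF Y(2) Am fg(1)] by simp
  qed
  ultimately show ?thesis using in_class_self[OF AC A(1)] fy by (intro exI[of _ A] exI[of _ "f y"] exI[of _ n]) simp
qed


text \<open>
  If all coefficients of relations between the generators \<open>\<pi> b\<close> kill \<open>M\<close>, then \<open>M\<close> is free over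
  \<open>R/I\<close>, and projecting away one coordinate is an endomorphism of \<open>M\<close> with cokernel \<open>R/I\<close>.
\<close>

lemma cyclic_in_annihilator_of_free:
  fixes B :: "'i set"
  assumes AC: "abelian_class R C" and M: "C M"
    and p: "\<pi> \<in> module_hom R (free_module R B) M" "\<pi> ` (B \<rightarrow>\<^sub>E carrier R) = carrier M"
    and relI: "\<And>c i. c \<in> B \<rightarrow>\<^sub>E carrier R \<Longrightarrow> \<pi> c = \<zero>\<^bsub>M\<^esub> \<Longrightarrow> i \<in> B \<Longrightarrow> c i \<in> annihilator R M"
  shows "cyclic_in R C (annihilator R M)"
proof -
  have Mm: "module R M" by (rule class_module[OF AC M])
  interpret M: module R M by fact
  let ?I = "annihilator R M" and ?F = "free_module R B"
  let ?Q = "quotient_module (regular_module R) ?I"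
  interpret F: module R ?F by (rule free_is_module)
  note rm = regular_is_module and I = annihilator_submod[OF Mm]
  have Qm: "module R ?Q" by (rule ideal_quotient_module[OF I])
  show ?thesis
  proof (cases "B = {}")
    case True
    then have "carrier M = {\<pi> (\<lambda>_. undefined)}" using p(2) by simp
    then have Mz: "x = \<zero>\<^bsub>M\<^esub>" if "x \<in> carrier M" for x using that M.zero_closed by auto
    have "(\<lambda>r. r \<odot>\<^bsub>M\<^esub> \<zero>\<^bsub>M\<^esub>) ` carrier R = carrier M"
      using Mz by (auto intro!: image_eqI[of _ _ \<zero>])
    then have "cyclic_in R C {r \<in> carrier R. r \<odot>\<^bsub>M\<^esub> \<zero>\<^bsub>M\<^esub> = \<zero>\<^bsub>M\<^esub>}"
      using cyclic_in_iff[OF AC Mm M.zero_closed] in_class_self[OF AC M] by simp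
    moreover have "{r \<in> carrier R. r \<odot>\<^bsub>M\<^esub> \<zero>\<^bsub>M\<^esub> = \<zero>\<^bsub>M\<^esub>} = ?I"
      unfolding annihilator_def by (auto dest: Mz)
    ultimately show ?thesis by simp
  next
    case False
    then obtain i where i: "i \<in> B" by blast
    let ?u = "\<lambda>r. ?I +>\<^bsub>regular_module R\<^esub> r"
    define \<phi> where "\<phi> c = (\<lambda>b\<in>B. if b = i then \<zero> else c b)" for c :: "'i \<Rightarrow> 'a"
    have phi: "\<phi> \<in> module_hom R ?F ?F"
      unfolding \<phi>_def by (rule module_homI) (auto simp: fun_eq_iff PiE_iff)
    have split: "\<pi> c = \<pi> (\<phi> c) \<oplus>\<^bsub>M\<^esub> c i \<odot>\<^bsub>M\<^esub> \<pi> (basis_vector R B i)" if c: "c \<in> B \<rightarrow>\<^sub>E carrier R" for c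
    proof -
      have ci: "c i \<in> carrier R" using c i by auto
      have bi: "basis_vector R B i \<in> carrier ?F" by simp
      have pc: "\<phi> c \<in> carrier ?F" using module_homD(1)[OF phi, of c] c by simp
      have "c = \<phi> c \<oplus>\<^bsub>?F\<^esub> c i \<odot>\<^bsub>?F\<^esub> basis_vector R B i"
        using c i ci by (auto simp: fun_eq_iff \<phi>_def basis_vector_def PiE_iff extensional_def)
      then have "\<pi> c = \<pi> (\<phi> c \<oplus>\<^bsub>?F\<^esub> c i \<odot>\<^bsub>?F\<^esub> basis_vector R B i)" by (rule arg_cong)
      then show ?thesis
        by (simp only: module_homD(2)[OF p(1) pc F.smult_closed[OF ci bi]] module_homD(3)[OF p(1) ci bi])
    qed
    have killI: "r \<odot>\<^bsub>M\<^esub> x = \<zero>\<^bsub>M\<^esub>" if "r \<in> ?I" "x \<in> carrier M" for r x using that by (simp add: annihilator_def)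
    have pb: "\<pi> (basis_vector R B i) \<in> carrier M" using module_homD(1)[OF p(1)] by simp
    have same: "\<pi> c = \<pi> (\<phi> c)" if c: "c \<in> B \<rightarrow>\<^sub>E carrier R" "c i \<in> ?I" for c
      using split[OF c(1)] killI[OF c(2) pb] module_homD(1)[OF p(1)] module_homD(1)[OF phi, of c] c(1) by simp
    have surj: "\<pi> ` carrier ?F = carrier M" using p(2) by simp
    obtain e where e: "e \<in> module_hom R M M" "\<And>c. c \<in> carrier ?F \<Longrightarrow> e (\<pi> c) = \<pi> (\<phi> c)"
    proof (rule hom_factor[OF F.module_axioms Mm Mm p(1) surj module_hom_comp[OF phi p(1)]])
      fix c assume "c \<in> carrier ?F" "\<pi> c = \<zero>\<^bsub>M\<^esub>"
      then show "\<pi> (\<phi> c) = \<zero>\<^bsub>M\<^esub>" using same[of c] relI[of c i] i by simp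
    qed blast
    have co: "(\<lambda>c. ?u (c i)) \<in> module_hom R ?F ?Q"
      by (rule module_hom_comp[OF free_coord_hom[OF i] quotient_hom[OF rm I]])
    obtain h where h: "h \<in> module_hom R M ?Q" "\<And>c. c \<in> carrier ?F \<Longrightarrow> h (\<pi> c) = ?u (c i)"
    proof (rule hom_factor[OF F.module_axioms Mm Qm p(1) surj co])
      fix c assume c: "c \<in> carrier ?F" "\<pi> c = \<zero>\<^bsub>M\<^esub>"
      then have "c i \<in> carrier R" using i by auto
      then show "?u (c i) = \<zero>\<^bsub>?Q\<^esub>" using coset_zero_iff_mem[OF I] relI[of c i] c i by simp
    qed blast
    show ?thesis
      unfolding cyclic_in_def
    proof (rule in_class_cokernel[OF AC in_class_self[OF AC M] in_class_self[OF AC M] Qm e(1) h(1)])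
      show "h ` carrier M = carrier ?Q"
      proof (rule hom_onto[OF h(1)])
        fix y assume "y \<in> carrier ?Q"
        then obtain r where r: "r \<in> carrier R" "y = ?u r" by (auto simp: quotient_carrier)
        have c: "(\<lambda>b\<in>B. r) \<in> carrier ?F" using r(1) by simp
        have "h (\<pi> (\<lambda>b\<in>B. r)) = y" using h(2)[OF c] r(2) i by simp
        then show "\<exists>x\<in>carrier M. h x = y"
          using module_homD(1)[OF p(1) c] by (rule bexI[of _ "\<pi> (\<lambda>b\<in>B. r)"])
      qed
      show "a_kernel M ?Q h = e ` carrier M"
      proof (intro equalityI subsetI)
        fix x assume "x \<in> a_kernel M ?Q h"
        then have x: "x \<in> carrier M" "h x = \<zero>\<^bsub>?Q\<^esub>" by (simp_all add: mem_a_kernel)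
        obtain c where c: "c \<in> carrier ?F" "x = \<pi> c" using surjD[OF surj x(1)] by blast
        have ci: "c i \<in> carrier R" using c(1) i by auto
        have "c i \<in> ?I" using x(2) h(2)[OF c(1)] c(2) coset_zero_iff_mem[OF I ci] by simp
        then have "x = e x" using same[of c] c e(2)[OF c(1)] by simp
        then show "x \<in> e ` carrier M" using x(1) by (rule image_eqI)
      next
        fix x assume "x \<in> e ` carrier M"
        then obtain y where y: "y \<in> carrier M" "x = e y" by auto
        obtain c where c: "c \<in> carrier ?F" "y = \<pi> c" using surjD[OF surj y(1)] by blast
        have pc: "\<phi> c \<in> carrier ?F" by (rule module_homD(1)[OF phi c(1)])
        have "h x = ?u (\<phi> c i)" using h(2)[OF pc] e(2)[OF c(1)] y(2) c(2) by simp
        also have "\<dots> = \<zero>\<^bsub>?Q\<^esub>"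
          using coset_zero_iff_mem[OF I, of \<zero>] submodD(2)[OF rm I] i by (simp add: \<phi>_def)
        finally show "x \<in> a_kernel M ?Q h" using y module_homD(1)[OF e(1)] by (simp add: mem_a_kernel)
      qed
    qed
  qed
qed

text \<open>
  A relation between the generators of \<open>M/tM\<close> is a relation in \<open>M\<close> up to a vector in \<open>t R\<^sup>B\<close>. So the
  coefficients of relations modulo \<open>t\<close> stay in the ideal \<open>H\<close>.
\<close>

lemma relation_coefficients_modulo:
  assumes Mm: "module R M" and p: "\<pi> \<in> module_hom R (free_module R B) M"
    and surj: "\<pi> ` carrier (free_module R B) = carrier M"
    and H: "submodule H R (regular_module R)" and t: "t \<in> carrier R" and tH: "t \<in> H"
    and rel: "\<And>c i. c \<in> B \<rightarrow>\<^sub>E carrier R \<Longrightarrow> \<pi> c = \<zero>\<^bsub>M\<^esub> \<Longrightarrow> i \<in> B \<Longrightarrow> c i \<in> H"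
    and c: "c \<in> B \<rightarrow>\<^sub>E carrier R" and x: "x \<in> carrier M" "\<pi> c = t \<odot>\<^bsub>M\<^esub> x" and i: "i \<in> B"
  shows "c i \<in> H"
proof -
  interpret M: module R M by fact
  let ?F = "free_module R B"
  interpret F: module R ?F by (rule free_is_module)
  have cF: "c \<in> carrier ?F" using c by simp
  obtain b where b: "b \<in> carrier ?F" "x = \<pi> b" using surjD[OF surj x(1)] by blast
  have tb: "t \<odot>\<^bsub>?F\<^esub> b \<in> carrier ?F" by (rule F.smult_closed[OF t b(1)])
  have "\<pi> (c \<ominus>\<^bsub>?F\<^esub> t \<odot>\<^bsub>?F\<^esub> b) = \<pi> c \<ominus>\<^bsub>M\<^esub> \<pi> (t \<odot>\<^bsub>?F\<^esub> b)"
    by (rule module_hom_minus[OF F.module_axioms Mm p cF tb])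
  also have "\<pi> (t \<odot>\<^bsub>?F\<^esub> b) = \<pi> c" 
    by (simp only: module_homD(3)[OF p t b(1)] x(2) b(2)[symmetric])
  also have "\<pi> c \<ominus>\<^bsub>M\<^esub> \<pi> c = \<zero>\<^bsub>M\<^esub>" using module_minus_zero_iff[OF Mm] module_homD(1)[OF p cF] by blast
  finally have z: "\<pi> (c \<ominus>\<^bsub>?F\<^esub> t \<odot>\<^bsub>?F\<^esub> b) = \<zero>\<^bsub>M\<^esub>" .
  have d: "c \<ominus>\<^bsub>?F\<^esub> t \<odot>\<^bsub>?F\<^esub> b \<in> B \<rightarrow>\<^sub>E carrier R" using F.minus_closed[OF cF tb] by simp
  have 1: "(c \<ominus>\<^bsub>?F\<^esub> t \<odot>\<^bsub>?F\<^esub> b) i \<in> H" by (rule rel[OF d z i])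
  have 2: "b i \<otimes> t \<in> H" using submodD(4)[OF regular_is_module H, of "b i" t] tH b(1) i by auto
  have "c = (c \<ominus>\<^bsub>?F\<^esub> t \<odot>\<^bsub>?F\<^esub> b) \<oplus>\<^bsub>?F\<^esub> t \<odot>\<^bsub>?F\<^esub> b" using module_minus_add[OF F.module_axioms cF tb] by simp
  then have "c i = ((c \<ominus>\<^bsub>?F\<^esub> t \<odot>\<^bsub>?F\<^esub> b) \<oplus>\<^bsub>?F\<^esub> t \<odot>\<^bsub>?F\<^esub> b) i" by (rule arg_cong)
  also have "\<dots> = (c \<ominus>\<^bsub>?F\<^esub> t \<odot>\<^bsub>?F\<^esub> b) i \<oplus> b i \<otimes> t"
    using i t b(1) by (auto simp: m_comm[of t "b i"] PiE_iff)
  finally show ?thesis using submodD(3)[OF regular_is_module H 1 2] by simp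
qed

text \<open>
  If \<open>x\<close> is given by the vector \<open>b\<close>, then \<open>t x\<close> is given by \<open>t b - b\<^sub>i c\<close>, in which the generator \<open>i\<close>
  has coefficient 0.
\<close>

lemma multiple_in_span_of_other_generators:
  assumes Mm: "module R M" and p: "\<pi> \<in> module_hom R (free_module R B) M"
    and surj: "\<pi> ` carrier (free_module R B) = carrier M"
    and c: "c \<in> B \<rightarrow>\<^sub>E carrier R" "\<pi> c = \<zero>\<^bsub>M\<^esub>" "i \<in> B" "c i = t" and t: "t \<in> carrier R"
    and x: "x \<in> carrier M"
  shows "t \<odot>\<^bsub>M\<^esub> x \<in> (\<lambda>d. \<pi> (\<lambda>b\<in>B. if b \<in> B - {i} then d b else \<zero>)) ` (B - {i} \<rightarrow>\<^sub>E carrier R)"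
proof -
  interpret M: module R M by fact
  let ?F = "free_module R B" and ?B = "B - {i}"
  interpret F: module R ?F by (rule free_is_module)
  obtain b where b: "b \<in> carrier ?F" "x = \<pi> b" using surjD[OF surj x] by blast
  have bi: "b i \<in> carrier R" using b(1) c(3) by auto
  let ?d = "t \<odot>\<^bsub>?F\<^esub> b \<ominus>\<^bsub>?F\<^esub> b i \<odot>\<^bsub>?F\<^esub> c"
  have cF: "c \<in> carrier ?F" using c(1) by simp
  have tb: "t \<odot>\<^bsub>?F\<^esub> b \<in> carrier ?F" "b i \<odot>\<^bsub>?F\<^esub> c \<in> carrier ?F"
    using F.smult_closed[OF t b(1)] F.smult_closed[OF bi cF] by simp_all
  have d: "?d \<in> carrier ?F" by (rule F.minus_closed[OF tb])
  have "\<pi> ?d = \<pi> (t \<odot>\<^bsub>?F\<^esub> b) \<ominus>\<^bsub>M\<^esub> \<pi> (b i \<odot>\<^bsub>?F\<^esub> c)" by (rule module_hom_minus[OF F.module_axioms Mm p tb])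
  also have "\<pi> (b i \<odot>\<^bsub>?F\<^esub> c) = \<zero>\<^bsub>M\<^esub>" 
    by (simp only: module_homD(3)[OF p bi cF] c(2) M.smult_r_null[OF bi])
  also have "\<pi> (t \<odot>\<^bsub>?F\<^esub> b) \<ominus>\<^bsub>M\<^esub> \<zero>\<^bsub>M\<^esub> = t \<odot>\<^bsub>M\<^esub> x"
    by (simp only: module_homD(3)[OF p t b(1)] b(2)[symmetric] module_minus_zero[OF Mm M.smult_closed[OF t x]])
  finally have 1: "\<pi> ?d = t \<odot>\<^bsub>M\<^esub> x" .
  have "t \<odot>\<^bsub>?F\<^esub> b = ?d \<oplus>\<^bsub>?F\<^esub> b i \<odot>\<^bsub>?F\<^esub> c" using module_minus_add[OF F.module_axioms tb] by simp
  then have "(t \<odot>\<^bsub>?F\<^esub> b) i = (?d \<oplus>\<^bsub>?F\<^esub> b i \<odot>\<^bsub>?F\<^esub> c) i" by (rule arg_cong)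
  then have "t \<otimes> b i = ?d i \<oplus> b i \<otimes> t" using c(3,4) by simp
  moreover have di: "?d i \<in> carrier R" using d c(3) by auto
  ultimately have "?d i = \<zero>" using t bi by (simp add: m_comm[of t "b i"])
  then have "(\<lambda>b\<in>B. if b \<in> ?B then restrict ?d ?B b else \<zero>) = ?d"
    using d c(3) by (auto simp: fun_eq_iff PiE_iff extensional_def)
  moreover have "restrict ?d ?B \<in> ?B \<rightarrow>\<^sub>E carrier R" using d by auto
  ultimately show ?thesis using 1 by (intro image_eqI[of _ _ "restrict ?d ?B"]) simp_all
qed

text \<open>
  The set \<open>T0\<close> consists of coefficients of relations between the
  generators \<open>\<pi> b\<close>, and every such coefficient lies in the ideal \<open>(T0)\<close>. The elements of \<open>T0\<close>
  that do not yet kill \<open>M\<close> are removed one by one. If \<open>t\<close> is the coefficient of the generator \<open>i\<close> in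
  a relation, then the other generators span a submodule that contains \<open>t M\<close>. So fewer generators
  suffice once \<open>t\<close> is inverted, while \<open>M/tM\<close> has fewer bad coefficients.
\<close>

lemma cyclic_in_annihilator_step:
  fixes B :: "nat set"
  assumes AC: "abelian_class R C" and B: "finite B"
    and IH: "\<And>B' C' M' \<pi>'. B' \<subset> B \<Longrightarrow> abelian_class R C' \<Longrightarrow> C' M' \<Longrightarrow>
      \<pi>' \<in> module_hom R (free_module R B') M' \<Longrightarrow> \<pi>' ` (B' \<rightarrow>\<^sub>E carrier R) = carrier M' \<Longrightarrow>
      cyclic_in R C' (annihilator R M')"
    and T0: "T0 \<subseteq> carrier R" and "finite T"
  shows "C M \<Longrightarrow> \<pi> \<in> module_hom R (free_module R B) M \<Longrightarrow> \<pi> ` (B \<rightarrow>\<^sub>E carrier R) = carrier M \<Longrightarrow>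
    (\<And>t. t \<in> T0 \<Longrightarrow> \<exists>c\<in>B \<rightarrow>\<^sub>E carrier R. \<pi> c = \<zero>\<^bsub>M\<^esub> \<and> (\<exists>i\<in>B. c i = t)) \<Longrightarrow>
    (\<And>c i. c \<in> B \<rightarrow>\<^sub>E carrier R \<Longrightarrow> \<pi> c = \<zero>\<^bsub>M\<^esub> \<Longrightarrow> i \<in> B \<Longrightarrow> c i \<in> module_span R (regular_module R) T0) \<Longrightarrow>
    T \<subseteq> T0 \<Longrightarrow> (\<And>t x. t \<in> T0 - T \<Longrightarrow> x \<in> carrier M \<Longrightarrow> t \<odot>\<^bsub>M\<^esub> x = \<zero>\<^bsub>M\<^esub>) \<Longrightarrow>
    cyclic_in R C (annihilator R M)"
  using \<open>finite T\<close>
proof (induction T arbitrary: M \<pi> rule: finite_induct)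
  case empty
  note M = empty.prems(1) and p = empty.prems(2,3) and rel = empty.prems(5)
  have Mm: "module R M" by (rule class_module[OF AC M])
  have "T0 \<subseteq> annihilator R M" using T0 empty.prems(7) by (auto simp: annihilator_def)
  then have "module_span R (regular_module R) T0 \<subseteq> annihilator R M" by (rule span_least[OF annihilator_submod[OF Mm]])
  then show ?case using rel by (intro cyclic_in_annihilator_of_free[OF AC M p]) blast
next
  case (insert t T)
  note M = insert.prems(1) and p = insert.prems(2,3) and coeff = insert.prems(4) and rel = insert.prems(5)
  have tT: "t \<in> T0" "T \<subseteq> T0" using insert.prems(6) by auto
  have t: "t \<in> carrier R" using tT T0 by auto
  have Mm: "module R M" by (rule class_module[OF AC M])
  interpret M: module R M by fact
  let ?I = "annihilator R M" and ?F = "free_module R B"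
  interpret F: module R ?F by (rule free_is_module)
  note rm = regular_is_module and I = annihilator_submod[OF Mm]
  have surj: "\<pi> ` carrier ?F = carrier M" using p(2) by simp
  let ?tM = "(\<lambda>x. t \<odot>\<^bsub>M\<^esub> x) ` carrier M"
  have tM: "submodule ?tM R M" by (rule submod_smult_image(1)[OF Mm t submod_carrier[OF Mm]])
  obtain Y \<kappa> where Y: "C Y" "module R Y" and kh: "\<kappa> \<in> module_hom R M Y" and konto: "\<kappa> ` carrier M = carrier Y"
    and k0: "\<And>x. x \<in> carrier M \<Longrightarrow> \<kappa> x = \<zero>\<^bsub>Y\<^esub> \<longleftrightarrow> x \<in> ?tM"
    by (rule class_quotientE[OF AC in_class_self[OF AC M] tM
          in_class_image[OF AC in_class_self[OF AC M] in_class_self[OF AC M] smult_hom[OF Mm t]]]) (rule that, assumption+)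
  have Jc: "cyclic_in R C (annihilator R Y)"
  proof (rule insert.IH[OF Y(1) module_hom_comp[OF p(1) kh]])
    show "(\<lambda>x. \<kappa> (\<pi> x)) ` (B \<rightarrow>\<^sub>E carrier R) = carrier Y"
      by (simp only: image_image[symmetric, of \<kappa> \<pi>] p(2) konto)
  next
    fix s assume "s \<in> T0"
    then obtain c where c: "c \<in> B \<rightarrow>\<^sub>E carrier R" "\<pi> c = \<zero>\<^bsub>M\<^esub>" "\<exists>i\<in>B. c i = s" using coeff by blast
    then show "\<exists>c\<in>B \<rightarrow>\<^sub>E carrier R. \<kappa> (\<pi> c) = \<zero>\<^bsub>Y\<^esub> \<and> (\<exists>i\<in>B. c i = s)"
      using module_hom_zero[OF Mm Y(2) kh] by (intro bexI[of _ c]) simp_all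
  next
    fix c i assume c: "c \<in> B \<rightarrow>\<^sub>E carrier R" "\<kappa> (\<pi> c) = \<zero>\<^bsub>Y\<^esub>" and i: "i \<in> B"
    have "\<pi> c \<in> ?tM" using k0[of "\<pi> c"] module_homD(1)[OF p(1), of c] c by simp
    then obtain x where x: "x \<in> carrier M" "\<pi> c = t \<odot>\<^bsub>M\<^esub> x" by auto
    have "submodule (module_span R (regular_module R) T0) R (regular_module R)"
      by (rule span_submod[OF rm]) (use T0 in simp)
    moreover have "t \<in> module_span R (regular_module R) T0"
      using tT(1) span_superset[of T0 "regular_module R"] by blast
    ultimately show "c i \<in> module_span R (regular_module R) T0"
      using relation_coefficients_modulo[OF Mm p(1) surj _ t _ _ c(1) x i] rel by blast
  next
    fix s y assume s: "s \<in> T0 - T" and y: "y \<in> carrier Y"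
    have sR: "s \<in> carrier R" using s T0 by auto
    obtain x where x: "x \<in> carrier M" "y = \<kappa> x" using surjD[OF konto y] by blast
    have "s \<odot>\<^bsub>M\<^esub> x \<in> ?tM"
    proof (cases "s = t")
      case True then show ?thesis using x(1) by simp
    next
      case False
      then have "s \<odot>\<^bsub>M\<^esub> x = \<zero>\<^bsub>M\<^esub>" using insert.prems(7)[of s x] s x(1) by simp
      then show ?thesis using submodD(2)[OF Mm tM] by simp
    qed
    then have "\<kappa> (s \<odot>\<^bsub>M\<^esub> x) = \<zero>\<^bsub>Y\<^esub>" using k0[of "s \<odot>\<^bsub>M\<^esub> x"] sR x(1) by simp
    then show "s \<odot>\<^bsub>Y\<^esub> y = \<zero>\<^bsub>Y\<^esub>" using module_homD(3)[OF kh sR x(1)] x(2) by simp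
  qed (rule tT(2))
  obtain G where G: "finite G" "G \<subseteq> carrier R" "annihilator R Y = module_span R (regular_module R) G"
    using fp_annihilator_fin_gen[OF abelian_classD(1)[OF AC Y(1)]] unfolding fin_gen_def by auto
  have GM: "\<exists>z\<in>carrier M. r \<odot>\<^bsub>M\<^esub> x = t \<odot>\<^bsub>M\<^esub> z" if r: "r \<in> G" and x: "x \<in> carrier M" for r x
  proof -
    have rR: "r \<in> carrier R" using r G(2) by auto
    have "r \<in> annihilator R Y" using r span_superset[of G "regular_module R"] G(3) by auto
    then have "r \<odot>\<^bsub>Y\<^esub> \<kappa> x = \<zero>\<^bsub>Y\<^esub>" using module_homD(1)[OF kh x] by (simp add: annihilator_def)
    then have "r \<odot>\<^bsub>M\<^esub> x \<in> ?tM" using k0[of "r \<odot>\<^bsub>M\<^esub> x"] module_homD(3)[OF kh rR x] rR x by simp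
    then show ?thesis by auto
  qed
  \<comment> \<open>Inverting \<open>t\<close>: the generators other than \<open>i\<close> span a submodule that contains \<open>t M\<close>.\<close>
  obtain c i where c: "c \<in> B \<rightarrow>\<^sub>E carrier R" "\<pi> c = \<zero>\<^bsub>M\<^esub>" "i \<in> B" "c i = t" using coeff[OF tT(1)] by blast
  let ?B = "B - {i}"
  define \<epsilon> where "\<epsilon> d = (\<lambda>b\<in>B. if b \<in> ?B then d b else \<zero>)" for d :: "nat \<Rightarrow> 'a"
  have eps: "\<epsilon> \<in> module_hom R (free_module R ?B) ?F" unfolding \<epsilon>_def by (rule free_extend_hom) auto
  have pe: "(\<lambda>d. \<pi> (\<epsilon> d)) \<in> module_hom R (free_module R ?B) M" by (rule module_hom_comp[OF eps p(1)])
  define N where "N = (\<lambda>d. \<pi> (\<epsilon> d)) ` (?B \<rightarrow>\<^sub>E carrier R)"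
  have Nfg: "fin_gen R M N" unfolding N_def by (rule free_hom_fin_gen[OF Mm _ pe]) (use B in simp)
  have N: "submodule N R M" by (rule fin_gen_submod[OF Mm Nfg])
  have NM: "N \<subseteq> carrier M" by (rule submodD(1)[OF Mm N])
  let ?N = "M\<lparr>carrier := N\<rparr>"
  have Nm: "module R ?N" by (rule submod_module[OF Mm N])
  have tN: "t \<odot>\<^bsub>M\<^esub> x \<in> N" if x: "x \<in> carrier M" for x
    unfolding N_def \<epsilon>_def by (rule multiple_in_span_of_other_generators[OF Mm p(1) surj c t x])
  note ACt = abelian_class_inverted[OF AC t]
  have invN: "inverted_class R C t ?N"
    unfolding inverted_class_def
  proof (intro conjI exI)
    show "finitely_presented R ?N" by (rule fp_submodule[OF abelian_classD(1)[OF AC M] Nfg])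
    show "C M" by (rule M)
    show "equiv_up_to R (t [^] (1::nat)) ?N M (\<lambda>x. x) (\<lambda>x. t \<odot>\<^bsub>M\<^esub> x)"
    proof (rule equiv_up_toI)
      show "(\<lambda>x. x) \<in> module_hom R ?N M" by (rule module_hom_restrict[OF module_hom_id NM])
      show "(\<lambda>x. t \<odot>\<^bsub>M\<^esub> x) \<in> module_hom R M ?N"
        using tN by (intro module_hom_corestrict[OF smult_hom[OF Mm t]]) auto
    qed (use t in simp_all)
  qed
  have "cyclic_in R (inverted_class R C t) (annihilator R ?N)"
  proof (rule IH[where C' = "inverted_class R C t", OF _ ACt invN])
    show "?B \<subset> B" using c(3) by auto
    show "(\<lambda>d. \<pi> (\<epsilon> d)) \<in> module_hom R (free_module R ?B) ?N"
      by (rule module_hom_corestrict[OF pe]) (simp add: N_def)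
  qed (simp add: N_def)
  from cyclic_in_invertedD[OF AC t annihilator_submod[OF Nm] this]
  obtain A a n where A: "in_class R C A" "a \<in> carrier (A :: ('a, (nat \<Rightarrow> 'a) set) module)"
    "\<forall>x\<in>carrier A. \<exists>r\<in>carrier R. t [^] (n::nat) \<odot>\<^bsub>A\<^esub> x = r \<odot>\<^bsub>A\<^esub> a"
    "\<forall>r\<in>carrier R. r \<odot>\<^bsub>A\<^esub> a = \<zero>\<^bsub>A\<^esub> \<longrightarrow> t [^] n \<otimes> r \<in> annihilator R ?N"
    "\<forall>i\<in>annihilator R ?N. i \<odot>\<^bsub>A\<^esub> a = \<zero>\<^bsub>A\<^esub>"
    by (elim exE conjE)
  have Am: "module R A" by (rule in_class_module[OF AC A(1)])
  interpret A: module R A by fact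
  let ?y = "\<lambda>b. \<pi> (basis_vector R B b)"
  have "?y b \<in> carrier M" for b using module_homD(1)[OF p(1)] by simp
  from faithful_element_in_power[OF AC M B, of ?y, OF this]
  obtain Q e where Q: "C Q" "e \<in> carrier Q"
    "\<forall>r\<in>carrier R. r \<odot>\<^bsub>Q\<^esub> e = \<zero>\<^bsub>Q\<^esub> \<longleftrightarrow> (\<forall>b\<in>B. r \<odot>\<^bsub>M\<^esub> ?y b = \<zero>\<^bsub>M\<^esub>)"
    "\<forall>i\<in>?I. \<forall>x\<in>carrier Q. i \<odot>\<^bsub>Q\<^esub> x = \<zero>\<^bsub>Q\<^esub>"
    "\<forall>r\<in>carrier R. \<forall>t\<in>carrier R. (\<forall>x\<in>carrier M. \<exists>z\<in>carrier M. r \<odot>\<^bsub>M\<^esub> x = t \<odot>\<^bsub>M\<^esub> z) \<longrightarrow>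
      (\<forall>x\<in>carrier Q. \<exists>z\<in>carrier Q. r \<odot>\<^bsub>Q\<^esub> x = t \<odot>\<^bsub>Q\<^esub> z)"
    by (elim exE conjE)
  have IR: "?I \<subseteq> carrier R" unfolding annihilator_def by auto
  \<comment> \<open>The exponent is \<open>n + 1\<close> because passing from \<open>N\<close> to \<open>M\<close> costs one more factor \<open>t\<close>.\<close>
  show ?case
  proof (rule cyclic_in_glue[OF AC t in_class_self[OF AC Q(1)] Q(2) _ _ G(1,2) _ _ A(1,2), of _ "Suc n"])
    show "?I = {r \<in> carrier R. r \<odot>\<^bsub>Q\<^esub> e = \<zero>\<^bsub>Q\<^esub>}"
    proof -
      have 1: "r \<in> ?I \<longleftrightarrow> r \<odot>\<^bsub>Q\<^esub> e = \<zero>\<^bsub>Q\<^esub>" if "r \<in> carrier R" for r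
        using bspec[OF Q(3) that] generators_annihilator[OF Mm B p that] by (simp only:)
      show ?thesis
      proof (rule Set.set_eqI)
        fix r show "r \<in> ?I \<longleftrightarrow> r \<in> {r \<in> carrier R. r \<odot>\<^bsub>Q\<^esub> e = \<zero>\<^bsub>Q\<^esub>}"
          using 1[of r] subsetD[OF IR, of r] by (simp only: mem_Collect_eq) argo
      qed
    qed
    show "cyclic_in R C (module_span R (regular_module R) G)" using Jc G(3) by simp
  next
    fix i x assume "i \<in> ?I" "x \<in> carrier Q"
    then show "i \<odot>\<^bsub>Q\<^esub> x = \<zero>\<^bsub>Q\<^esub>" using Q(4) by simp
  next
    fix r x assume r: "r \<in> G" and x: "x \<in> carrier Q"
    have "r \<in> carrier R" using r G(2) by auto
    then show "\<exists>y\<in>carrier Q. r \<odot>\<^bsub>Q\<^esub> x = t \<odot>\<^bsub>Q\<^esub> y" using Q(5) t GM[OF r] x by simp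
  next
    fix x assume x: "x \<in> carrier A"
    then obtain r where r: "r \<in> carrier R" "t [^] n \<odot>\<^bsub>A\<^esub> x = r \<odot>\<^bsub>A\<^esub> a" using A(3) by blast
    have "t [^] Suc n \<odot>\<^bsub>A\<^esub> x = t \<odot>\<^bsub>A\<^esub> (t [^] n \<odot>\<^bsub>A\<^esub> x)"
      using t x by (simp add: A.smult_assoc1[symmetric] m_comm)
    also have "\<dots> = (t \<otimes> r) \<odot>\<^bsub>A\<^esub> a" unfolding r(2) using t r(1) A(2) by (simp add: A.smult_assoc1)
    finally show "\<exists>r\<in>carrier R. t [^] Suc n \<odot>\<^bsub>A\<^esub> x = r \<odot>\<^bsub>A\<^esub> a" using t r(1) by (intro bexI[of _ "t \<otimes> r"]) simp_all
  next
    fix r assume r: "r \<in> carrier R" "r \<odot>\<^bsub>A\<^esub> a = \<zero>\<^bsub>A\<^esub>"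
    then have tr: "t [^] n \<otimes> r \<in> annihilator R ?N" using A(4) by simp
    have trR: "t [^] n \<otimes> r \<in> carrier R" using t r(1) by simp
    have "(t [^] Suc n \<otimes> r) \<odot>\<^bsub>M\<^esub> x = \<zero>\<^bsub>M\<^esub>" if x: "x \<in> carrier M" for x
    proof -
      have "t [^] Suc n \<otimes> r = (t [^] n \<otimes> r) \<otimes> t" using t r(1) by (simp add: m_ac)
      then have "(t [^] Suc n \<otimes> r) \<odot>\<^bsub>M\<^esub> x = (t [^] n \<otimes> r) \<odot>\<^bsub>M\<^esub> (t \<odot>\<^bsub>M\<^esub> x)"
        using M.smult_assoc1[OF trR t x] by simp
      also have "\<dots> = \<zero>\<^bsub>M\<^esub>" using tr tN[OF x] by (simp add: annihilator_def)
      finally show ?thesis .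
    qed
    then show "t [^] Suc n \<otimes> r \<in> ?I" using t r(1) by (simp add: annihilator_def)
  next
    fix i assume "i \<in> ?I"
    then have "i \<in> annihilator R ?N" using NM by (auto simp: annihilator_def)
    then show "i \<odot>\<^bsub>A\<^esub> a = \<zero>\<^bsub>A\<^esub>" using A(5) by simp
  qed
qed

text \<open>
  Induction on the number of generators. The set \<open>T0\<close> of the step is taken to be the finite set
  of all coefficients of a finite generating set of relations.
\<close>

lemma cyclic_in_annihilator_of_generated:
  fixes B :: "nat set"
  assumes "finite B"
  shows "abelian_class R C \<Longrightarrow> C M \<Longrightarrow> \<pi> \<in> module_hom R (free_module R B) M \<Longrightarrow>
    \<pi> ` (B \<rightarrow>\<^sub>E carrier R) = carrier M \<Longrightarrow> cyclic_in R C (annihilator R M)"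
  using assms
proof (induction B arbitrary: C M \<pi> rule: finite_psubset_induct)
  case (psubset B)
  note AC = psubset.prems(1) and M = psubset.prems(2) and p = psubset.prems(3,4)
  let ?F = "free_module R B"
  have Mm: "module R M" by (rule class_module[OF AC M])
  have "fin_gen R ?F (carrier ?F)" using free_fin_gen[OF psubset.hyps(1)] by simp
  moreover have "\<pi> ` carrier ?F = carrier M" using p(2) by simp
  ultimately have "fin_gen R ?F (a_kernel ?F M \<pi>)"
    by (rule fp_kernel_fin_gen[OF abelian_classD(1)[OF AC M] free_is_module _ p(1)])
  then obtain D where D: "finite D" "D \<subseteq> carrier ?F" "a_kernel ?F M \<pi> = module_span R ?F D"
    unfolding fin_gen_def by auto
  define T where "T = (\<lambda>(d, b). d b) ` (D \<times> B)"
  have T: "finite T" "T \<subseteq> carrier R" unfolding T_def using D(1,2) psubset.hyps(1) by auto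
  have DK: "D \<subseteq> a_kernel ?F M \<pi>" using span_superset[of D ?F] D(3) by simp
  show ?case
  proof (rule cyclic_in_annihilator_step[OF AC psubset.hyps(1) psubset.IH T(2,1) M p _ _ order_refl])
    fix t assume "t \<in> T"
    then obtain d b where d: "d \<in> D" "b \<in> B" "t = d b" unfolding T_def by auto
    have "d \<in> a_kernel ?F M \<pi>" using DK d(1) by blast
    then show "\<exists>c\<in>B \<rightarrow>\<^sub>E carrier R. \<pi> c = \<zero>\<^bsub>M\<^esub> \<and> (\<exists>i\<in>B. c i = t)"
      using d(2,3) by (intro bexI[of _ d]) (auto simp: mem_a_kernel)
  next
    fix c i assume c: "c \<in> B \<rightarrow>\<^sub>E carrier R" "\<pi> c = \<zero>\<^bsub>M\<^esub>" and i: "i \<in> B"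
    then have "c \<in> module_span R ?F D" unfolding D(3)[symmetric] by (simp add: mem_a_kernel)
    then have "c i \<in> (\<lambda>c. c i) ` module_span R ?F D" by (rule imageI)
    also have "\<dots> = module_span R (regular_module R) ((\<lambda>c. c i) ` D)"
      by (rule span_image[OF free_is_module regular_is_module free_coord_hom[OF i] D(2)])
    also have "\<dots> \<subseteq> module_span R (regular_module R) T"
      by (rule span_mono) (use i in \<open>force simp: T_def\<close>)
    finally show "c i \<in> module_span R (regular_module R) T" .
  qed simp_all
qed

theorem cyclic_in_annihilator:
  assumes AC: "abelian_class R C" and M: "in_class R C M"
  shows "cyclic_in R C (annihilator R M)"
proof -
  obtain Y k l where Y: "C Y" "module R Y" "k \<in> module_hom R M Y" "l \<in> module_hom R Y M"
    "\<And>x. x \<in> carrier M \<Longrightarrow> l (k x) = x" "\<And>y. y \<in> carrier Y \<Longrightarrow> k (l y) = y"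
    using in_classE[OF AC M] by blast
  obtain q \<pi> where "\<pi> \<in> module_hom R (free_module R {..<q::nat}) Y" "\<pi> ` ({..<q} \<rightarrow>\<^sub>E carrier R) = carrier Y"
    by (rule fpE[OF abelian_classD(1)[OF AC Y(1)]])
  then have "cyclic_in R C (annihilator R Y)"
    by (rule cyclic_in_annihilator_of_generated[OF finite_lessThan AC Y(1)])
  then show ?thesis using annihilator_iso[OF in_class_module[OF AC M] Y(2-6)] by simp
qed

end

section \<open>Matrices of based complexes\<close>

definition mat_prod ::
  "('a, 'c) ring_scheme \<Rightarrow> 'b set \<Rightarrow> ('x \<Rightarrow> 'b \<Rightarrow> 'a) \<Rightarrow> ('b \<Rightarrow> 'y \<Rightarrow> 'a) \<Rightarrow> 'x \<Rightarrow> 'y \<Rightarrow> 'a"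
where
  "mat_prod R B X Y a c = (\<Oplus>\<^bsub>R\<^esub>b\<in>B. X a b \<otimes>\<^bsub>R\<^esub> Y b c)"

text \<open>
  The matrix of \<open>X \<otimes> 1 + 1 \<otimes> Y\<close>. The second factor may depend on the basis element \<open>b\<close> of the first,
  to allow for the sign \<open>(-1)^(deg b)\<close>.
\<close>

definition tensor_mat ::
  "('a, 'c) ring_scheme \<Rightarrow> ('b \<Rightarrow> 'b \<Rightarrow> 'a) \<Rightarrow> ('b \<Rightarrow> 'd \<Rightarrow> 'd \<Rightarrow> 'a) \<Rightarrow> 'b \<times> 'd \<Rightarrow> 'b \<times> 'd \<Rightarrow> 'a"
where
  "tensor_mat R X Y = (\<lambda>(b, c) (b', c').
     (if c = c' then X b b' else \<zero>\<^bsub>R\<^esub>) \<oplus>\<^bsub>R\<^esub> (if b = b' then Y b c c' else \<zero>\<^bsub>R\<^esub>))"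

definition signed :: "('a, 'c) ring_scheme \<Rightarrow> int \<Rightarrow> 'a \<Rightarrow> 'a" where
  "signed R n x = (if even n then x else \<ominus>\<^bsub>R\<^esub> x)"

text \<open>The matrix of the differential on the sum of all degrees.\<close>

definition diff_mat :: "('a, 'c) ring_scheme \<Rightarrow> ('a, 'b) based_cplx \<Rightarrow> 'b \<Rightarrow> 'b \<Rightarrow> 'a" where
  "diff_mat R F b c = (if deg F c = deg F b - 1 then entry F b c else \<zero>\<^bsub>R\<^esub>)"

definition based_complex :: "('a, 'c) ring_scheme \<Rightarrow> ('a, 'b) based_cplx \<Rightarrow> bool" where
  "based_complex R F \<longleftrightarrow> finite (basis F) \<and> (\<forall>b\<in>basis F. \<forall>c\<in>basis F. entry F b c \<in> carrier R) \<and>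
     (\<forall>a\<in>basis F. \<forall>c\<in>basis F. mat_prod R (basis F) (diff_mat R F) (diff_mat R F) a c = \<zero>\<^bsub>R\<^esub>)"

text \<open>
  Multiplication by \<open>r\<close> is \<open>\<partial> H + H \<partial>\<close> for a map \<open>H\<close> of degree 1. Matrices act on rows from
  the right, so the first product below stands for \<open>\<partial> H\<close>.
\<close>

definition null_homotopy ::
  "('a, 'c) ring_scheme \<Rightarrow> ('a, 'b) based_cplx \<Rightarrow> 'a \<Rightarrow> ('b \<Rightarrow> 'b \<Rightarrow> 'a) \<Rightarrow> bool"
where
  "null_homotopy R F r H \<longleftrightarrow>
     (\<forall>b\<in>basis F. \<forall>c\<in>basis F. H b c \<in> carrier R \<and> (deg F c \<noteq> deg F b + 1 \<longrightarrow> H b c = \<zero>\<^bsub>R\<^esub>)) \<and>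
     (\<forall>b\<in>basis F. \<forall>c\<in>basis F.
        mat_prod R (basis F) H (diff_mat R F) b c \<oplus>\<^bsub>R\<^esub> mat_prod R (basis F) (diff_mat R F) H b c =
        (if b = c then r else \<zero>\<^bsub>R\<^esub>))"

text \<open>
  A Koszul complex is a tensor product with its basis of pairs renamed to lists; \<open>\<psi>\<close> is the inverse
  of the renaming \<open>\<phi>\<close>.
\<close>

definition relabel :: "('b \<Rightarrow> 'd) \<Rightarrow> ('d \<Rightarrow> 'b) \<Rightarrow> ('a, 'b) based_cplx \<Rightarrow> ('a, 'd) based_cplx" where
  "relabel \<phi> \<psi> F = \<lparr>basis = \<phi> ` basis F, deg = (\<lambda>x. deg F (\<psi> x)), entry = (\<lambda>x y. entry F (\<psi> x) (\<psi> y))\<rparr>"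

context cring
begin

lemma finsum_swap:
  assumes "finite A" "finite B" "\<And>a b. a \<in> A \<Longrightarrow> b \<in> B \<Longrightarrow> f a b \<in> carrier R"
  shows "(\<Oplus>a\<in>A. \<Oplus>b\<in>B. f a b) = (\<Oplus>b\<in>B. \<Oplus>a\<in>A. f a b)"
  using assms(1,3)
proof (induction A rule: finite_induct)
  case empty then show ?case by simp
next
  case (insert a A)
  have "(\<Oplus>b\<in>B. \<Oplus>a\<in>insert a A. f a b) = (\<Oplus>b\<in>B. f a b \<oplus> (\<Oplus>a\<in>A. f a b))"
    using insert by (intro finsum_cong') (auto simp: Pi_iff)
  also have "\<dots> = (\<Oplus>b\<in>B. f a b) \<oplus> (\<Oplus>b\<in>B. \<Oplus>a\<in>A. f a b)"
    using insert by (intro finsum_addf) (auto simp: Pi_iff)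
  also have "\<dots> = (\<Oplus>b\<in>B. f a b) \<oplus> (\<Oplus>a\<in>A. \<Oplus>b\<in>B. f a b)" using insert by simp
  finally show ?case using insert by (simp add: Pi_iff)
qed

lemma finsum_Times:
  assumes "finite A" "finite B" "\<And>a b. a \<in> A \<Longrightarrow> b \<in> B \<Longrightarrow> f (a, b) \<in> carrier R"
  shows "(\<Oplus>p\<in>A \<times> B. f p) = (\<Oplus>a\<in>A. \<Oplus>b\<in>B. f (a, b))"
  using assms(1,3)
proof (induction A rule: finite_induct)
  case empty then show ?case by simp
next
  case (insert a A)
  have "insert a A \<times> B = Pair a ` B \<union> A \<times> B" by auto
  then have "(\<Oplus>p\<in>insert a A \<times> B. f p) = (\<Oplus>p\<in>Pair a ` B. f p) \<oplus> (\<Oplus>p\<in>A \<times> B. f p)"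
    using insert assms(2) by (simp only:) (intro finsum_Un_disjoint, auto)
  also have "(\<Oplus>p\<in>Pair a ` B. f p) = (\<Oplus>b\<in>B. f (a, b))"
    using insert.prems by (intro finsum_reindex) (auto simp: inj_on_def)
  finally show ?case using insert by (simp add: Pi_iff)
qed

lemma finsum_if_left:
  assumes "finite A" "i \<in> A" "f \<in> A \<rightarrow> carrier R"
  shows "(\<Oplus>j\<in>A. if i = j then f j else \<zero>) = f i" "(\<Oplus>j\<in>A. if j = i then f j else \<zero>) = f i"
proof -
  show 1: "(\<Oplus>j\<in>A. if i = j then f j else \<zero>) = f i" using assms by (intro finsum_singleton)
  show "(\<Oplus>j\<in>A. if j = i then f j else \<zero>) = f i" using 1 by (simp add: eq_commute)
qed

lemma mat_prod_closed:
  assumes "\<And>b. b \<in> B \<Longrightarrow> X a b \<in> carrier R" "\<And>b. b \<in> B \<Longrightarrow> Y b c \<in> carrier R"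
  shows "mat_prod R B X Y a c \<in> carrier R"
  unfolding mat_prod_def using assms by (intro finsum_closed) auto

lemma mat_prod_assoc:
  assumes "finite B" "finite D" "\<And>b. b \<in> B \<Longrightarrow> X a b \<in> carrier R"
    "\<And>b d. b \<in> B \<Longrightarrow> d \<in> D \<Longrightarrow> Y b d \<in> carrier R" "\<And>d. d \<in> D \<Longrightarrow> Z d e \<in> carrier R"
  shows "mat_prod R D (mat_prod R B X Y) Z a e = mat_prod R B X (mat_prod R D Y Z) a e"
proof -
  have "mat_prod R D (mat_prod R B X Y) Z a e = (\<Oplus>d\<in>D. \<Oplus>b\<in>B. X a b \<otimes> Y b d \<otimes> Z d e)"
    unfolding mat_prod_def
    using assms by (intro finsum_cong') (auto intro!: finsum_ldistr finsum_closed simp: Pi_iff)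
  also have "\<dots> = (\<Oplus>b\<in>B. \<Oplus>d\<in>D. X a b \<otimes> Y b d \<otimes> Z d e)"
    using assms by (intro finsum_swap) auto
  also have "\<dots> = mat_prod R B X (mat_prod R D Y Z) a e"
    unfolding mat_prod_def
  proof (rule finsum_cong'[OF refl])
    fix b assume b: "b \<in> B"
    have "X a b \<otimes> (\<Oplus>d\<in>D. Y b d \<otimes> Z d e) = (\<Oplus>d\<in>D. X a b \<otimes> (Y b d \<otimes> Z d e))"
      using assms b by (intro finsum_rdistr) auto
    also have "\<dots> = (\<Oplus>d\<in>D. X a b \<otimes> Y b d \<otimes> Z d e)"
      using assms b by (intro finsum_cong') (auto simp: m_assoc)
    finally show "(\<Oplus>d\<in>D. X a b \<otimes> Y b d \<otimes> Z d e) = X a b \<otimes> (\<Oplus>d\<in>D. Y b d \<otimes> Z d e)" by simp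
  qed (use assms in \<open>auto intro!: finsum_closed\<close>)
  finally show ?thesis .
qed

lemma tensor_mat_closed:
  assumes "\<And>b b'. b \<in> P \<Longrightarrow> b' \<in> P \<Longrightarrow> X b b' \<in> carrier R"
    "\<And>b c c'. b \<in> P \<Longrightarrow> c \<in> Q \<Longrightarrow> c' \<in> Q \<Longrightarrow> Y b c c' \<in> carrier R"
    "p \<in> P \<times> Q" "p' \<in> P \<times> Q"
  shows "tensor_mat R X Y p p' \<in> carrier R"
  using assms by (auto simp: tensor_mat_def)

text \<open>
  The four terms are the products of the pure parts, which stay on one factor, and the two mixed
  terms.
\<close>

lemma tensor_mat_prod:
  assumes fin: "finite P" "finite Q"
    and X: "\<And>b b'. b \<in> P \<Longrightarrow> b' \<in> P \<Longrightarrow> X b b' \<in> carrier R" "\<And>b b'. b \<in> P \<Longrightarrow> b' \<in> P \<Longrightarrow> X' b b' \<in> carrier R"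
    and Y: "\<And>b c c'. b \<in> P \<Longrightarrow> c \<in> Q \<Longrightarrow> c' \<in> Q \<Longrightarrow> Y b c c' \<in> carrier R"
      "\<And>b c c'. b \<in> P \<Longrightarrow> c \<in> Q \<Longrightarrow> c' \<in> Q \<Longrightarrow> Y' b c c' \<in> carrier R"
    and b: "b \<in> P" "c \<in> Q" "b'' \<in> P" "c'' \<in> Q"
  shows "mat_prod R (P \<times> Q) (tensor_mat R X Y) (tensor_mat R X' Y') (b, c) (b'', c'') =
    ((if c = c'' then mat_prod R P X X' b b'' else \<zero>) \<oplus> X b b'' \<otimes> Y' b'' c c'') \<oplus>
    (Y b c c'' \<otimes> X' b b'' \<oplus> (if b = b'' then mat_prod R Q (Y b) (Y' b) c c'' else \<zero>))"
proof -
  let ?Z = "\<lambda>b' c'. tensor_mat R X' Y' (b', c') (b'', c'')"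
  have Z: "?Z b' c' \<in> carrier R" if "b' \<in> P" "c' \<in> Q" for b' c'
    using that b by (intro tensor_mat_closed[of P _ Q] X Y) auto
  have T: "tensor_mat R X Y (b, c) p \<in> carrier R" if "p \<in> P \<times> Q" for p
    using that b by (intro tensor_mat_closed[of P _ Q] X Y) auto
  have "mat_prod R (P \<times> Q) (tensor_mat R X Y) (tensor_mat R X' Y') (b, c) (b'', c'') =
    (\<Oplus>b'\<in>P. \<Oplus>c'\<in>Q. tensor_mat R X Y (b, c) (b', c') \<otimes> ?Z b' c')"
    unfolding mat_prod_def using fin Z T by (intro finsum_Times) auto
  also have "\<dots> = (\<Oplus>b'\<in>P. (\<Oplus>c'\<in>Q. if c = c' then X b b' \<otimes> ?Z b' c' else \<zero>) \<oplus>
      (\<Oplus>c'\<in>Q. if b = b' then Y b c c' \<otimes> ?Z b' c' else \<zero>))"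
  proof (rule finsum_cong'[OF refl])
    fix b' assume b': "b' \<in> P"
    have "(\<Oplus>c'\<in>Q. tensor_mat R X Y (b, c) (b', c') \<otimes> ?Z b' c') =
      (\<Oplus>c'\<in>Q. (if c = c' then X b b' \<otimes> ?Z b' c' else \<zero>) \<oplus> (if b = b' then Y b c c' \<otimes> ?Z b' c' else \<zero>))"
    proof (rule finsum_cong'[OF refl])
      fix c' assume c': "c' \<in> Q"
      show "tensor_mat R X Y (b, c) (b', c') \<otimes> ?Z b' c' =
        (if c = c' then X b b' \<otimes> ?Z b' c' else \<zero>) \<oplus> (if b = b' then Y b c c' \<otimes> ?Z b' c' else \<zero>)"
        using Z[OF b' c'] X(1)[OF b(1) b'] Y(1)[OF b(1,2) c']
        unfolding tensor_mat_def[of R X Y] by (auto simp: l_distr)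
    qed (use b b' X Y Z in auto)
    also have "\<dots> = (\<Oplus>c'\<in>Q. if c = c' then X b b' \<otimes> ?Z b' c' else \<zero>) \<oplus>
      (\<Oplus>c'\<in>Q. if b = b' then Y b c c' \<otimes> ?Z b' c' else \<zero>)"
      using b b' X Y Z by (intro finsum_addf) auto
    finally show "(\<Oplus>c'\<in>Q. tensor_mat R X Y (b, c) (b', c') \<otimes> ?Z b' c') =
      (\<Oplus>c'\<in>Q. if c = c' then X b b' \<otimes> ?Z b' c' else \<zero>) \<oplus>
      (\<Oplus>c'\<in>Q. if b = b' then Y b c c' \<otimes> ?Z b' c' else \<zero>)" .
  qed (use b X Y Z in \<open>auto intro!: finsum_closed a_closed\<close>)
  also have "\<dots> = (\<Oplus>b'\<in>P. X b b' \<otimes> ?Z b' c) \<oplus> (\<Oplus>b'\<in>P. if b = b' then (\<Oplus>c'\<in>Q. Y b c c' \<otimes> ?Z b' c') else \<zero>)"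
  proof -
    have "(\<Oplus>b'\<in>P. (\<Oplus>c'\<in>Q. if c = c' then X b b' \<otimes> ?Z b' c' else \<zero>) \<oplus>
      (\<Oplus>c'\<in>Q. if b = b' then Y b c c' \<otimes> ?Z b' c' else \<zero>)) =
      (\<Oplus>b'\<in>P. X b b' \<otimes> ?Z b' c \<oplus> (if b = b' then (\<Oplus>c'\<in>Q. Y b c c' \<otimes> ?Z b' c') else \<zero>))"
    proof (rule finsum_cong'[OF refl])
      fix b' assume b': "b' \<in> P"
      have "(\<Oplus>c'\<in>Q. if c = c' then X b b' \<otimes> ?Z b' c' else \<zero>) = X b b' \<otimes> ?Z b' c"
        using b b' X Z fin by (intro finsum_if_left(1)) auto
      then show "(\<Oplus>c'\<in>Q. if c = c' then X b b' \<otimes> ?Z b' c' else \<zero>) \<oplus>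
        (\<Oplus>c'\<in>Q. if b = b' then Y b c c' \<otimes> ?Z b' c' else \<zero>) =
        X b b' \<otimes> ?Z b' c \<oplus> (if b = b' then (\<Oplus>c'\<in>Q. Y b c c' \<otimes> ?Z b' c') else \<zero>)" by simp
    qed (use b X Y Z in \<open>auto intro!: finsum_closed\<close>)
    also have "\<dots> = (\<Oplus>b'\<in>P. X b b' \<otimes> ?Z b' c) \<oplus> (\<Oplus>b'\<in>P. if b = b' then (\<Oplus>c'\<in>Q. Y b c c' \<otimes> ?Z b' c') else \<zero>)"
      using b X Y Z by (intro finsum_addf) (auto intro!: finsum_closed)
    finally show ?thesis .
  qed
  also have "(\<Oplus>b'\<in>P. if b = b' then (\<Oplus>c'\<in>Q. Y b c c' \<otimes> ?Z b' c') else \<zero>) = (\<Oplus>c'\<in>Q. Y b c c' \<otimes> ?Z b c')"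
    using b Y Z fin by (intro finsum_if_left(1)) (auto intro!: finsum_closed)
  also have "(\<Oplus>b'\<in>P. X b b' \<otimes> ?Z b' c) =
    (if c = c'' then mat_prod R P X X' b b'' else \<zero>) \<oplus> X b b'' \<otimes> Y' b'' c c''"
  proof -
    have "(\<Oplus>b'\<in>P. X b b' \<otimes> ?Z b' c) =
      (\<Oplus>b'\<in>P. (if c = c'' then X b b' \<otimes> X' b' b'' else \<zero>) \<oplus> (if b' = b'' then X b b' \<otimes> Y' b' c c'' else \<zero>))"
      using b X Y by (intro finsum_cong') (auto simp: tensor_mat_def r_distr)
    also have "\<dots> = (\<Oplus>b'\<in>P. if c = c'' then X b b' \<otimes> X' b' b'' else \<zero>) \<oplus>
      (\<Oplus>b'\<in>P. if b' = b'' then X b b' \<otimes> Y' b' c c'' else \<zero>)"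
      using b X Y by (intro finsum_addf) auto
    also have "(\<Oplus>b'\<in>P. if b' = b'' then X b b' \<otimes> Y' b' c c'' else \<zero>) = X b b'' \<otimes> Y' b'' c c''"
      using b X Y fin by (intro finsum_if_left(2)) auto
    finally show ?thesis by (simp add: mat_prod_def)
  qed
  also have "(\<Oplus>c'\<in>Q. Y b c c' \<otimes> ?Z b c') =
    Y b c c'' \<otimes> X' b b'' \<oplus> (if b = b'' then mat_prod R Q (Y b) (Y' b) c c'' else \<zero>)"
  proof -
    have "(\<Oplus>c'\<in>Q. Y b c c' \<otimes> ?Z b c') =
      (\<Oplus>c'\<in>Q. (if c' = c'' then Y b c c' \<otimes> X' b b'' else \<zero>) \<oplus> (if b = b'' then Y b c c' \<otimes> Y' b c' c'' else \<zero>))"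
      using b X Y by (intro finsum_cong') (auto simp: tensor_mat_def r_distr)
    also have "\<dots> = (\<Oplus>c'\<in>Q. if c' = c'' then Y b c c' \<otimes> X' b b'' else \<zero>) \<oplus>
      (\<Oplus>c'\<in>Q. if b = b'' then Y b c c' \<otimes> Y' b c' c'' else \<zero>)"
      using b X Y by (intro finsum_addf) auto
    also have "(\<Oplus>c'\<in>Q. if c' = c'' then Y b c c' \<otimes> X' b b'' else \<zero>) = Y b c c'' \<otimes> X' b b''"
      using b X Y fin by (intro finsum_if_left(2)) auto
    finally show ?thesis by (simp add: mat_prod_def)
  qed
  finally show ?thesis .
qed

lemma signed_simps [simp]:
  "signed R n \<zero> = \<zero>" "x \<in> carrier R \<Longrightarrow> signed R n x \<in> carrier R"
  by (simp_all add: signed_def)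

lemma signed_shift: "x \<in> carrier R \<Longrightarrow> signed R (n - 1) x = \<ominus> signed R n x"
  "x \<in> carrier R \<Longrightarrow> signed R (n + 1) x = \<ominus> signed R n x"
  by (auto simp: signed_def)

lemma signed_mult: "x \<in> carrier R \<Longrightarrow> y \<in> carrier R \<Longrightarrow> signed R n x \<otimes> signed R n y = x \<otimes> y"
  by (auto simp: signed_def l_minus r_minus)

lemma mat_prod_signed:
  assumes "\<And>b. b \<in> B \<Longrightarrow> X a b \<in> carrier R" "\<And>b. b \<in> B \<Longrightarrow> Y b c \<in> carrier R"
  shows "mat_prod R B (\<lambda>b c. signed R n (X b c)) (\<lambda>b c. signed R n (Y b c)) a c = mat_prod R B X Y a c"
  unfolding mat_prod_def using assms by (intro finsum_cong') (auto simp: signed_mult)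

lemma diff_mat_closed: "based_complex R F \<Longrightarrow> b \<in> basis F \<Longrightarrow> c \<in> basis F \<Longrightarrow> diff_mat R F b c \<in> carrier R"
  by (auto simp: based_complex_def diff_mat_def)

lemma diff_mat_tensor:
  assumes "based_complex R F" "based_complex R G" "p \<in> basis F \<times> basis G" "p' \<in> basis F \<times> basis G"
  shows "diff_mat R (tensor_cplx R F G) p p' =
    tensor_mat R (diff_mat R F) (\<lambda>b c c'. signed R (deg F b) (diff_mat R G c c')) p p'"
proof -
  obtain b c b' c' where p: "p = (b, c)" "p' = (b', c')" "b \<in> basis F" "b' \<in> basis F" "c \<in> basis G" "c' \<in> basis G"
    using assms(3,4) by auto
  have "entry F b b' \<in> carrier R" "entry G c c' \<in> carrier R"
    using assms(1,2) p unfolding based_complex_def by auto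
  then show ?thesis
    unfolding p(1,2) by (auto simp: diff_mat_def tensor_cplx_def tensor_mat_def signed_def)
qed

lemma mat_prod_cong:
  assumes "\<And>b. b \<in> B \<Longrightarrow> X a b = X' a b" "\<And>b. b \<in> B \<Longrightarrow> Y b c = Y' b c"
    "\<And>b. b \<in> B \<Longrightarrow> X' a b \<in> carrier R" "\<And>b. b \<in> B \<Longrightarrow> Y' b c \<in> carrier R"
  shows "mat_prod R B X Y a c = mat_prod R B X' Y' a c"
  unfolding mat_prod_def using assms by (intro finsum_cong') auto

text \<open>The two mixed terms have opposite signs, because a matrix of odd degree changes the parity.\<close>

lemma mixed_terms_cancel:
  assumes "x \<in> carrier R" "y \<in> carrier R" "x = \<zero> \<or> m = n - 1 \<or> m = n + 1"
  shows "x \<otimes> signed R m y \<oplus> signed R n y \<otimes> x = \<zero>"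
proof -
  have c: "signed R n y \<in> carrier R" using assms by simp
  consider "x = \<zero>" | "m = n - 1" | "m = n + 1" using assms(3) by blast
  then show ?thesis
  proof cases
    case 1 then show ?thesis using assms(2) by simp
  next
    case 2
    then have "signed R m y = \<ominus> signed R n y" using signed_shift assms(2) by simp
    then show ?thesis using assms(1) c by (simp add: r_minus m_comm[OF c] l_neg)
  next
    case 3
    then have "signed R m y = \<ominus> signed R n y" using signed_shift assms(2) by simp
    then show ?thesis using assms(1) c by (simp add: r_minus m_comm[OF c] l_neg)
  qed
qed

lemma based_complex_tensor:
  assumes F: "based_complex R F" and G: "based_complex R G"
  shows "based_complex R (tensor_cplx R F G)"
proof -
  let ?T = "tensor_cplx R F G" and ?D = "tensor_mat R (diff_mat R F) (\<lambda>b c c'. signed R (deg F b) (diff_mat R G c c'))"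
  have bT: "basis ?T = basis F \<times> basis G" by (simp add: tensor_cplx_def)
  have fin: "finite (basis F)" "finite (basis G)" using F G unfolding based_complex_def by auto
  note cF = diff_mat_closed[OF F] and cG = diff_mat_closed[OF G]
  note cY = signed_simps(2)[OF cG]
  have "mat_prod R (basis ?T) (diff_mat R ?T) (diff_mat R ?T) p q = \<zero>" if p: "p \<in> basis ?T" and q: "q \<in> basis ?T" for p q
  proof -
    obtain b c b' c' where pq: "p = (b, c)" "q = (b', c')" "b \<in> basis F" "b' \<in> basis F" "c \<in> basis G" "c' \<in> basis G"
      using p q unfolding bT by auto
    have "mat_prod R (basis ?T) (diff_mat R ?T) (diff_mat R ?T) p q = mat_prod R (basis F \<times> basis G) ?D ?D p q"
      unfolding bT
      using p q unfolding bT
      by (intro mat_prod_cong diff_mat_tensor[OF F G] tensor_mat_closed[of "basis F" _ "basis G"] cF cY)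
    also have "\<dots> = ((if c = c' then mat_prod R (basis F) (diff_mat R F) (diff_mat R F) b b' else \<zero>) \<oplus>
        diff_mat R F b b' \<otimes> signed R (deg F b') (diff_mat R G c c')) \<oplus>
      (signed R (deg F b) (diff_mat R G c c') \<otimes> diff_mat R F b b' \<oplus>
       (if b = b' then mat_prod R (basis G) (\<lambda>c c'. signed R (deg F b) (diff_mat R G c c'))
          (\<lambda>c c'. signed R (deg F b) (diff_mat R G c c')) c c' else \<zero>))"
      unfolding pq(1,2) by (rule tensor_mat_prod[OF fin cF cF cY cY pq(3,5,4,6)])
    also have "mat_prod R (basis F) (diff_mat R F) (diff_mat R F) b b' = \<zero>"
      using F pq(3,4) unfolding based_complex_def by blast
    also have "mat_prod R (basis G) (\<lambda>c c'. signed R (deg F b) (diff_mat R G c c'))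
          (\<lambda>c c'. signed R (deg F b) (diff_mat R G c c')) c c' = \<zero>"
    proof -
      have "mat_prod R (basis G) (\<lambda>c c'. signed R (deg F b) (diff_mat R G c c'))
          (\<lambda>c c'. signed R (deg F b) (diff_mat R G c c')) c c' = mat_prod R (basis G) (diff_mat R G) (diff_mat R G) c c'"
        by (rule mat_prod_signed) (use cG pq in auto)
      also have "\<dots> = \<zero>" using G pq(5,6) unfolding based_complex_def by blast
      finally show ?thesis .
    qed
    finally have "mat_prod R (basis ?T) (diff_mat R ?T) (diff_mat R ?T) p q =
      diff_mat R F b b' \<otimes> signed R (deg F b') (diff_mat R G c c') \<oplus>
      signed R (deg F b) (diff_mat R G c c') \<otimes> diff_mat R F b b'"
      using cF[OF pq(3,4)] cG[OF pq(5,6)] by simp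
    also have "\<dots> = \<zero>"
      by (rule mixed_terms_cancel[OF cF[OF pq(3,4)] cG[OF pq(5,6)]]) (auto simp: diff_mat_def)
    finally show ?thesis .
  qed
  moreover have "entry ?T p q \<in> carrier R" if "p \<in> basis ?T" "q \<in> basis ?T" for p q
    using that F G unfolding bT based_complex_def by (auto simp: tensor_cplx_def)
  ultimately show ?thesis using fin unfolding based_complex_def by (simp add: bT)
qed

text \<open>
  The homotopy \<open>H \<otimes> 1\<close>. Its mixed terms with \<open>1 \<otimes> \<partial>\<close> cancel by the sign rule.
\<close>

lemma null_homotopy_tensor_left:
  assumes F: "based_complex R F" and G: "based_complex R G" and r: "r \<in> carrier R" and H: "null_homotopy R F r H"
  shows "null_homotopy R (tensor_cplx R F G) r (tensor_mat R H (\<lambda>_ _ _. \<zero>))"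
proof -
  let ?T = "tensor_cplx R F G" and ?D = "tensor_mat R (diff_mat R F) (\<lambda>b c c'. signed R (deg F b) (diff_mat R G c c'))"
  let ?H = "tensor_mat R H (\<lambda>_ _ _. \<zero>)"
  have bT: "basis ?T = basis F \<times> basis G" by (simp add: tensor_cplx_def)
  have fin: "finite (basis F)" "finite (basis G)" using F G unfolding based_complex_def by auto
  note cF = diff_mat_closed[OF F] and cG = diff_mat_closed[OF G]
  note cY = signed_simps(2)[OF cG]
  have cH: "H b c \<in> carrier R" if "b \<in> basis F" "c \<in> basis F" for b c using H that unfolding null_homotopy_def by blast
  have dH: "H b c = \<zero> \<or> deg F c = deg F b + 1" if "b \<in> basis F" "c \<in> basis F" for b c
    using H that unfolding null_homotopy_def by blast
  have "mat_prod R (basis ?T) ?H (diff_mat R ?T) p q \<oplus> mat_prod R (basis ?T) (diff_mat R ?T) ?H p q =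
      (if p = q then r else \<zero>)" if p: "p \<in> basis ?T" and q: "q \<in> basis ?T" for p q
  proof -
    obtain b c b' c' where pq: "p = (b, c)" "q = (b', c')" "b \<in> basis F" "b' \<in> basis F" "c \<in> basis G" "c' \<in> basis G"
      using p q unfolding bT by auto
    let ?x = "H b b' \<otimes> signed R (deg F b') (diff_mat R G c c')"
    let ?y = "signed R (deg F b) (diff_mat R G c c') \<otimes> H b b'"
    let ?u = "mat_prod R (basis F) H (diff_mat R F) b b'" and ?v = "mat_prod R (basis F) (diff_mat R F) H b b'"
    have z0: "mat_prod R (basis G) (\<lambda>_ _. \<zero>) Z c c' = \<zero>" "mat_prod R (basis G) Z (\<lambda>_ _. \<zero>) c c' = \<zero>"
      if "\<And>a a'. a \<in> basis G \<Longrightarrow> a' \<in> basis G \<Longrightarrow> Z a a' \<in> carrier R" for Z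
    proof -
      show "mat_prod R (basis G) (\<lambda>_ _. \<zero>) Z c c' = \<zero>" "mat_prod R (basis G) Z (\<lambda>_ _. \<zero>) c c' = \<zero>"
        unfolding mat_prod_def using that pq(5,6) by (auto intro!: add.finprod_one_eqI)
    qed
    have uv: "?u \<in> carrier R" "?v \<in> carrier R" using cF cH pq by (auto intro!: mat_prod_closed)
    have xy: "?x \<in> carrier R" "?y \<in> carrier R" using cH cG pq by auto
    have uxy: "(if c = c' then ?u else \<zero>) \<oplus> ?x \<in> carrier R" "(if c = c' then ?v else \<zero>) \<in> carrier R"
      using uv xy by auto
    have 1: "mat_prod R (basis ?T) ?H (diff_mat R ?T) p q = (if c = c' then ?u else \<zero>) \<oplus> ?x"
    proof -
      have "mat_prod R (basis ?T) ?H (diff_mat R ?T) p q = mat_prod R (basis F \<times> basis G) ?H ?D p q"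
        using p q unfolding bT
        by (intro mat_prod_cong refl diff_mat_tensor[OF F G] tensor_mat_closed[of "basis F" _ "basis G"] cF cY cH zero_closed)
      also have "\<dots> = ((if c = c' then ?u else \<zero>) \<oplus> ?x) \<oplus> (\<zero> \<otimes> diff_mat R F b b' \<oplus>
        (if b = b' then mat_prod R (basis G) (\<lambda>_ _. \<zero>) (\<lambda>c c'. signed R (deg F b) (diff_mat R G c c')) c c' else \<zero>))"
        unfolding pq(1,2) by (rule tensor_mat_prod[OF fin cH cF zero_closed cY pq(3,5,4,6)])
      also have "\<dots> = (if c = c' then ?u else \<zero>) \<oplus> ?x"
        using cF[OF pq(3,4)] uxy(1) by (simp only: z0(1)[OF cY] if_cancel l_null l_zero r_zero zero_closed)
      finally show ?thesis .
    qed
    have 2: "mat_prod R (basis ?T) (diff_mat R ?T) ?H p q = (if c = c' then ?v else \<zero>) \<oplus> ?y"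
    proof -
      have "mat_prod R (basis ?T) (diff_mat R ?T) ?H p q = mat_prod R (basis F \<times> basis G) ?D ?H p q"
        using p q unfolding bT
        by (intro mat_prod_cong refl diff_mat_tensor[OF F G] tensor_mat_closed[of "basis F" _ "basis G"] cF cY cH zero_closed)
      also have "\<dots> = ((if c = c' then ?v else \<zero>) \<oplus> diff_mat R F b b' \<otimes> \<zero>) \<oplus> (?y \<oplus>
        (if b = b' then mat_prod R (basis G) (\<lambda>c c'. signed R (deg F b) (diff_mat R G c c')) (\<lambda>_ _. \<zero>) c c' else \<zero>))"
        unfolding pq(1,2) by (rule tensor_mat_prod[OF fin cF cH cY zero_closed pq(3,5,4,6)])
      also have "\<dots> = (if c = c' then ?v else \<zero>) \<oplus> ?y"
        using cF[OF pq(3,4)] uxy(2) xy by (simp only: z0(2)[OF cY] if_cancel r_null l_zero r_zero zero_closed)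
      finally show ?thesis .
    qed
    have 3: "?x \<oplus> ?y = \<zero>"
      by (rule mixed_terms_cancel[OF cH[OF pq(3,4)] cG[OF pq(5,6)]]) (use dH[OF pq(3,4)] in auto)
    have 4: "?u \<oplus> ?v = (if b = b' then r else \<zero>)" using H pq(3,4) unfolding null_homotopy_def by blast
    have 5: "(w \<oplus> ?x) \<oplus> (w' \<oplus> ?y) = (w \<oplus> w') \<oplus> (?x \<oplus> ?y)" if "w \<in> carrier R" "w' \<in> carrier R" for w w'
      using that xy by (simp add: a_ac)
    show ?thesis
    proof (cases "c = c'")
      case True
      then show ?thesis unfolding 1 2 using 5[OF uv] 3 4 uv pq(1,2) r by simp
    next
      case False
      then show ?thesis unfolding 1 2 using 5[of \<zero> \<zero>] 3 pq(1,2) by simp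
    qed
  qed
  moreover have "?H p q \<in> carrier R \<and> (deg ?T q \<noteq> deg ?T p + 1 \<longrightarrow> ?H p q = \<zero>)" if "p \<in> basis ?T" "q \<in> basis ?T" for p q
  proof -
    obtain b c b' c' where pq: "p = (b, c)" "q = (b', c')" "b \<in> basis F" "b' \<in> basis F" "c \<in> basis G" "c' \<in> basis G"
      using \<open>p \<in> basis ?T\<close> \<open>q \<in> basis ?T\<close> unfolding bT by auto
    show ?thesis
      unfolding pq(1,2) using cH[OF pq(3,4)] dH[OF pq(3,4)] by (auto simp: tensor_mat_def tensor_cplx_def)
  qed
  ultimately show ?thesis unfolding null_homotopy_def by blast
qed


text \<open>
  The homotopy \<open>1 \<otimes> H\<close>, with the sign that makes its mixed terms with \<open>\<partial> \<otimes> 1\<close> cancel.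
\<close>

lemma null_homotopy_tensor_right:
  assumes F: "based_complex R F" and G: "based_complex R G" and r: "r \<in> carrier R" and H: "null_homotopy R G r H"
  shows "null_homotopy R (tensor_cplx R F G) r (tensor_mat R (\<lambda>_ _. \<zero>) (\<lambda>b c c'. signed R (deg F b) (H c c')))"
proof -
  let ?S = "\<lambda>b c c'. signed R (deg F b) (diff_mat R G c c')" and ?S' = "\<lambda>b c c'. signed R (deg F b) (H c c')"
  let ?T = "tensor_cplx R F G" and ?D = "tensor_mat R (diff_mat R F) ?S"
  let ?H = "tensor_mat R (\<lambda>_ _. \<zero>) ?S'"
  have bT: "basis ?T = basis F \<times> basis G" by (simp add: tensor_cplx_def)
  have fin: "finite (basis F)" "finite (basis G)" using F G unfolding based_complex_def by auto
  note cF = diff_mat_closed[OF F] and cG = diff_mat_closed[OF G]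
  note cY = signed_simps(2)[OF cG]
  have cH: "H b c \<in> carrier R" if "b \<in> basis G" "c \<in> basis G" for b c using H that unfolding null_homotopy_def by blast
  have dH: "H b c = \<zero> \<or> deg G c = deg G b + 1" if "b \<in> basis G" "c \<in> basis G" for b c
    using H that unfolding null_homotopy_def by blast
  note cS' = signed_simps(2)[OF cH]
  have "mat_prod R (basis ?T) ?H (diff_mat R ?T) p q \<oplus> mat_prod R (basis ?T) (diff_mat R ?T) ?H p q =
      (if p = q then r else \<zero>)" if p: "p \<in> basis ?T" and q: "q \<in> basis ?T" for p q
  proof -
    obtain b c b' c' where pq: "p = (b, c)" "q = (b', c')" "b \<in> basis F" "b' \<in> basis F" "c \<in> basis G" "c' \<in> basis G"
      using p q unfolding bT by auto
    let ?x = "diff_mat R F b b' \<otimes> signed R (deg F b') (H c c')"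
    let ?y = "signed R (deg F b) (H c c') \<otimes> diff_mat R F b b'"
    let ?u = "mat_prod R (basis G) H (diff_mat R G) c c'" and ?v = "mat_prod R (basis G) (diff_mat R G) H c c'"
    have z0: "mat_prod R (basis F) (\<lambda>_ _. \<zero>) (diff_mat R F) b b' = \<zero>"
      "mat_prod R (basis F) (diff_mat R F) (\<lambda>_ _. \<zero>) b b' = \<zero>"
      unfolding mat_prod_def using cF pq(3,4) by (auto intro!: add.finprod_one_eqI)
    have uv: "?u \<in> carrier R" "?v \<in> carrier R" using cG cH pq by (auto intro!: mat_prod_closed)
    have xy: "?x \<in> carrier R" "?y \<in> carrier R" using cH cF pq by auto
    have uxy: "?y \<oplus> (if b = b' then ?u else \<zero>) \<in> carrier R" "(if b = b' then ?v else \<zero>) \<in> carrier R"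
      using uv xy by auto
    have s: "mat_prod R (basis G) (?S' b) (?S b) c c' = ?u" "mat_prod R (basis G) (?S b) (?S' b) c c' = ?v"
      by (rule mat_prod_signed; use cG cH pq in simp)+
    have 1: "mat_prod R (basis ?T) ?H (diff_mat R ?T) p q = ?y \<oplus> (if b = b' then ?u else \<zero>)"
    proof -
      have "mat_prod R (basis ?T) ?H (diff_mat R ?T) p q = mat_prod R (basis F \<times> basis G) ?H ?D p q"
        using p q unfolding bT
        by (intro mat_prod_cong refl diff_mat_tensor[OF F G] tensor_mat_closed[of "basis F" _ "basis G"] cF cY cS' zero_closed)
      also have "\<dots> = ((if c = c' then mat_prod R (basis F) (\<lambda>_ _. \<zero>) (diff_mat R F) b b' else \<zero>) \<oplus>
          \<zero> \<otimes> signed R (deg F b') (diff_mat R G c c')) \<oplus> (?y \<oplus>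
        (if b = b' then mat_prod R (basis G) (?S' b) (?S b) c c' else \<zero>))"
        unfolding pq(1,2) by (rule tensor_mat_prod[OF fin zero_closed cF cS' cY pq(3,5,4,6)])
      also have "\<dots> = ?y \<oplus> (if b = b' then ?u else \<zero>)"
        using cY[OF pq(5,6)] uxy(1) by (simp only: z0(1) s(1) if_cancel l_null l_zero r_zero zero_closed)
      finally show ?thesis .
    qed
    have 2: "mat_prod R (basis ?T) (diff_mat R ?T) ?H p q = ?x \<oplus> (if b = b' then ?v else \<zero>)"
    proof -
      have "mat_prod R (basis ?T) (diff_mat R ?T) ?H p q = mat_prod R (basis F \<times> basis G) ?D ?H p q"
        using p q unfolding bT
        by (intro mat_prod_cong refl diff_mat_tensor[OF F G] tensor_mat_closed[of "basis F" _ "basis G"] cF cY cS' zero_closed)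
      also have "\<dots> = ((if c = c' then mat_prod R (basis F) (diff_mat R F) (\<lambda>_ _. \<zero>) b b' else \<zero>) \<oplus> ?x) \<oplus>
        (signed R (deg F b) (diff_mat R G c c') \<otimes> \<zero> \<oplus>
        (if b = b' then mat_prod R (basis G) (?S b) (?S' b) c c' else \<zero>))"
        unfolding pq(1,2) by (rule tensor_mat_prod[OF fin cF zero_closed cY cS' pq(3,5,4,6)])
      also have "\<dots> = ?x \<oplus> (if b = b' then ?v else \<zero>)"
        using cY[OF pq(5,6)] uxy(2) xy by (simp only: z0(2) s(2) if_cancel r_null l_zero r_zero zero_closed)
      finally show ?thesis .
    qed
    have 3: "?x \<oplus> ?y = \<zero>"
      by (rule mixed_terms_cancel[OF cF[OF pq(3,4)] cH[OF pq(5,6)]]) (auto simp: diff_mat_def)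
    have 4: "?u \<oplus> ?v = (if c = c' then r else \<zero>)" using H pq(5,6) unfolding null_homotopy_def by blast
    have 5: "(?y \<oplus> w) \<oplus> (?x \<oplus> w') = (w \<oplus> w') \<oplus> (?x \<oplus> ?y)" if "w \<in> carrier R" "w' \<in> carrier R" for w w'
      using that xy by (simp add: a_ac)
    show ?thesis
    proof (cases "b = b'")
      case True
      then show ?thesis unfolding 1 2 using 5[OF uv] 3 4 uv pq(1,2) r by simp
    next
      case False
      then show ?thesis unfolding 1 2 using 5[of \<zero> \<zero>] 3 pq(1,2) by simp
    qed
  qed
  moreover have "?H p q \<in> carrier R \<and> (deg ?T q \<noteq> deg ?T p + 1 \<longrightarrow> ?H p q = \<zero>)" if "p \<in> basis ?T" "q \<in> basis ?T" for p q
  proof -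
    obtain b c b' c' where pq: "p = (b, c)" "q = (b', c')" "b \<in> basis F" "b' \<in> basis F" "c \<in> basis G" "c' \<in> basis G"
      using \<open>p \<in> basis ?T\<close> \<open>q \<in> basis ?T\<close> unfolding bT by auto
    show ?thesis
      unfolding pq(1,2) using cS'[OF pq(5,6)] dH[OF pq(5,6)] by (auto simp: tensor_mat_def tensor_cplx_def)
  qed
  ultimately show ?thesis unfolding null_homotopy_def by blast
qed

subsection \<open>Relabelling a basis\<close>

lemma mat_prod_relabel:
  assumes "\<And>b. \<psi> (\<phi> b) = b" "\<And>b. b \<in> B \<Longrightarrow> X a b \<in> carrier R" "\<And>b. b \<in> B \<Longrightarrow> Y b c \<in> carrier R"
  shows "mat_prod R (\<phi> ` B) (\<lambda>x y. X (\<psi> x) (\<psi> y)) (\<lambda>x y. Y (\<psi> x) (\<psi> y)) (\<phi> a) (\<phi> c) = mat_prod R B X Y a c"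
proof -
  have "inj_on \<phi> B" by (rule inj_on_inverseI[of _ \<psi>]) (rule assms(1))
  then show ?thesis
    unfolding mat_prod_def using assms by (subst finsum_reindex) (auto simp: assms(1))
qed

lemma diff_mat_relabel: "diff_mat R (relabel \<phi> \<psi> F) = (\<lambda>x y. diff_mat R F (\<psi> x) (\<psi> y))"
  by (simp add: fun_eq_iff diff_mat_def relabel_def)

lemma relabel_basis: "basis (relabel \<phi> \<psi> F) = \<phi> ` basis F"
  by (simp add: relabel_def)

lemma based_complex_relabel:
  assumes F: "based_complex R F" and inv: "\<And>b. \<psi> (\<phi> b) = b"
  shows "based_complex R (relabel \<phi> \<psi> F)"
proof -
  have "mat_prod R (\<phi> ` basis F) (\<lambda>x y. diff_mat R F (\<psi> x) (\<psi> y)) (\<lambda>x y. diff_mat R F (\<psi> x) (\<psi> y)) (\<phi> b) (\<phi> c) = \<zero>"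
    if "b \<in> basis F" "c \<in> basis F" for b c
  proof -
    have "mat_prod R (\<phi> ` basis F) (\<lambda>x y. diff_mat R F (\<psi> x) (\<psi> y)) (\<lambda>x y. diff_mat R F (\<psi> x) (\<psi> y)) (\<phi> b) (\<phi> c) =
      mat_prod R (basis F) (diff_mat R F) (diff_mat R F) b c"
      by (rule mat_prod_relabel[where \<psi> = \<psi> and \<phi> = \<phi>]) (use inv diff_mat_closed[OF F] that in auto)
    then show ?thesis using F that unfolding based_complex_def by simp
  qed
  then show ?thesis
    using F unfolding based_complex_def diff_mat_relabel relabel_basis by (auto simp: relabel_def inv)
qed

lemma null_homotopy_relabel:
  assumes F: "based_complex R F" and inv: "\<And>b. \<psi> (\<phi> b) = b" and H: "null_homotopy R F r H"
  shows "null_homotopy R (relabel \<phi> \<psi> F) r (\<lambda>x y. H (\<psi> x) (\<psi> y))"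
proof -
  have cH: "H b c \<in> carrier R" if "b \<in> basis F" "c \<in> basis F" for b c using H that unfolding null_homotopy_def by blast
  have inj: "\<phi> b = \<phi> c \<longleftrightarrow> b = c" for b c using inv by metis
  have "mat_prod R (\<phi> ` basis F) (\<lambda>x y. H (\<psi> x) (\<psi> y)) (\<lambda>x y. diff_mat R F (\<psi> x) (\<psi> y)) (\<phi> b) (\<phi> c) \<oplus>
      mat_prod R (\<phi> ` basis F) (\<lambda>x y. diff_mat R F (\<psi> x) (\<psi> y)) (\<lambda>x y. H (\<psi> x) (\<psi> y)) (\<phi> b) (\<phi> c) =
      (if \<phi> b = \<phi> c then r else \<zero>)" if bc: "b \<in> basis F" "c \<in> basis F" for b c
  proof -
    have "mat_prod R (\<phi> ` basis F) (\<lambda>x y. H (\<psi> x) (\<psi> y)) (\<lambda>x y. diff_mat R F (\<psi> x) (\<psi> y)) (\<phi> b) (\<phi> c) =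
      mat_prod R (basis F) H (diff_mat R F) b c"
      by (rule mat_prod_relabel[where \<psi> = \<psi> and \<phi> = \<phi>]) (use inv diff_mat_closed[OF F] cH bc in auto)
    moreover have "mat_prod R (\<phi> ` basis F) (\<lambda>x y. diff_mat R F (\<psi> x) (\<psi> y)) (\<lambda>x y. H (\<psi> x) (\<psi> y)) (\<phi> b) (\<phi> c) =
      mat_prod R (basis F) (diff_mat R F) H b c"
      by (rule mat_prod_relabel[where \<psi> = \<psi> and \<phi> = \<phi>]) (use inv diff_mat_closed[OF F] cH bc in auto)
    ultimately show ?thesis using H bc unfolding null_homotopy_def inj by simp
  qed
  moreover have "H b c \<in> carrier R \<and> (deg F c \<noteq> deg F b + 1 \<longrightarrow> H b c = \<zero>)" if "b \<in> basis F" "c \<in> basis F" for b c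
    using H that unfolding null_homotopy_def by blast
  ultimately show ?thesis
    unfolding null_homotopy_def diff_mat_relabel relabel_basis by (auto simp: relabel_def inv)
qed

subsection \<open>Koszul complexes\<close>

lemma koszul_Nil: "koszul R [] = \<lparr>basis = {[]}, deg = (\<lambda>_. 0), entry = (\<lambda>_ _. \<zero>)\<rparr>"
  by (simp add: koszul_def)

lemma koszul_Cons:
  "koszul R (a # as) = relabel (\<lambda>(b, bs). b # bs) (\<lambda>bs. (hd bs, tl bs)) (tensor_cplx R (koszul_factor R a) (koszul R as))"
  by (simp add: koszul_def relabel_def Let_def)

lemma based_complex_koszul_factor:
  assumes "a \<in> carrier R"
  shows "based_complex R (koszul_factor R a)"
  using assms unfolding based_complex_def mat_prod_def by (auto simp: koszul_factor_def diff_mat_def)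

text \<open>
  On \<open>R \<rightarrow> R\<close>, multiplication by \<open>a\<close>, the homotopy is the identity from degree 0 to degree 1.
\<close>

lemma null_homotopy_koszul_factor:
  assumes "a \<in> carrier R"
  shows "null_homotopy R (koszul_factor R a) a (\<lambda>i j. if i = 0 \<and> j = 1 then \<one> else \<zero>)"
  using assms unfolding null_homotopy_def mat_prod_def by (auto simp: koszul_factor_def diff_mat_def)

lemma based_complex_koszul: "set as \<subseteq> carrier R \<Longrightarrow> based_complex R (koszul R as)"
proof (induction as)
  case Nil then show ?case by (simp add: koszul_Nil based_complex_def mat_prod_def diff_mat_def)
next
  case (Cons a as)
  then show ?case unfolding koszul_Cons
    by (intro based_complex_relabel based_complex_tensor based_complex_koszul_factor) (simp_all add: split_def)
qed

text \<open>
  The element \<open>r\<close> belongs to one tensor factor, and the homotopy on this factor extends to the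
  tensor product.
\<close>

lemma null_homotopy_koszul:
  "set as \<subseteq> carrier R \<Longrightarrow> r \<in> set as \<Longrightarrow> \<exists>H. null_homotopy R (koszul R as) r H"
proof (induction as)
  case Nil then show ?case by simp
next
  case (Cons a as)
  have a: "a \<in> carrier R" and as: "set as \<subseteq> carrier R" and r: "r \<in> carrier R" using Cons.prems by auto
  note F = based_complex_koszul_factor[OF a] and G = based_complex_koszul[OF as]
  have "\<exists>H. null_homotopy R (tensor_cplx R (koszul_factor R a) (koszul R as)) r H"
  proof (cases "r = a")
    case True
    show ?thesis unfolding True
      using null_homotopy_tensor_left[OF F G a null_homotopy_koszul_factor[OF a]] by blast
  next
    case False
    then obtain H where "null_homotopy R (koszul R as) r H" using Cons.IH[OF as] Cons.prems(2) by auto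
    then show ?thesis using null_homotopy_tensor_right[OF F G r] by blast
  qed
  then obtain H where H: "null_homotopy R (tensor_cplx R (koszul_factor R a) (koszul R as)) r H" by blast
  show ?case unfolding koszul_Cons
    by (rule exI, rule null_homotopy_relabel[OF based_complex_tensor[OF F G] _ H]) (simp add: split_def)
qed

lemma koszul_basis: "basis (koszul R as) = {bs. length bs = length as \<and> set bs \<subseteq> {0, 1}}"
proof (induction as)
  case Nil then show ?case by (auto simp: koszul_Nil)
next
  case (Cons a as)
  have "basis (koszul R (a # as)) = (\<lambda>(b, bs). b # bs) ` ({0, 1} \<times> {bs. length bs = length as \<and> set bs \<subseteq> {0, 1}})"
    unfolding koszul_Cons relabel_basis Cons.IH[symmetric] by (simp add: tensor_cplx_def koszul_factor_def)
  also have "\<dots> = {bs. length bs = length (a # as) \<and> set bs \<subseteq> {0, 1}}"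
    by (auto simp: length_Suc_conv image_iff)
  finally show ?case .
qed

lemma koszul_deg: "length bs = length as \<Longrightarrow> deg (koszul R as) bs = sum_list bs"
proof (induction as arbitrary: bs)
  case Nil then show ?case by (simp add: koszul_Nil)
next
  case (Cons a as)
  then obtain b bs' where "bs = b # bs'" "length bs' = length as" by (cases bs) auto
  then show ?case using Cons.IH by (simp add: koszul_Cons relabel_def tensor_cplx_def koszul_factor_def)
qed

text \<open>Up to sign, every entry of the Koszul differential is 0 or an element of the sequence.\<close>

lemma koszul_entry_in_ideal:
  assumes "ideal I R" "set as \<subseteq> I"
  shows "entry (koszul R as) bs cs \<in> I"
  using assms(2)
proof (induction as arbitrary: bs cs)
  case Nil
  interpret ideal I R by fact
  show ?case by (simp add: koszul_Nil)
next
  case (Cons a as)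
  interpret ideal I R by fact
  have "entry (koszul R as) (tl bs) (tl cs) \<in> I" using Cons by simp
  then show ?case using Cons.prems
    by (auto simp: koszul_Cons relabel_def tensor_cplx_def koszul_factor_def)
qed

end

section \<open>The complex of a based complex\<close>

context cring
begin

lemma cplx_of_obj [simp]: "obj (cplx_of R F) n = free_module R (basis_in F n)"
  by (simp add: cplx_of_def)

lemma cplx_of_dif:
  "dif (cplx_of R F) n = (\<lambda>x. \<lambda>c\<in>basis_in F (n - 1). \<Oplus>b\<in>basis_in F n. x b \<otimes> entry F b c)"
  by (simp add: cplx_of_def)

lemmas cplx_of_simps = cplx_of_obj cplx_of_dif

lemma basis_in_facts:
  assumes "based_complex R F"
  shows "finite (basis_in F n)" "basis_in F n \<subseteq> basis F" "\<And>b. b \<in> basis_in F n \<Longrightarrow> deg F b = n"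
    "\<And>b c. b \<in> basis_in F n \<Longrightarrow> c \<in> basis_in F m \<Longrightarrow> entry F b c \<in> carrier R"
    "\<And>b c. b \<in> basis_in F n \<Longrightarrow> c \<in> basis_in F m \<Longrightarrow> diff_mat R F b c \<in> carrier R"
  using assms unfolding based_complex_def basis_in_def by (auto simp: diff_mat_def)

lemma cplx_dif_hom:
  assumes F: "based_complex R F"
  shows "dif (cplx_of R F) n \<in> module_hom R (obj (cplx_of R F) n) (obj (cplx_of R F) (n - 1))"
proof -
  note B = basis_in_facts[OF F]
  let ?B = "basis_in F n" and ?B' = "basis_in F (n - 1)"
  have cl: "(\<lambda>b. x b \<otimes> entry F b c) \<in> ?B \<rightarrow> carrier R" if "x \<in> ?B \<rightarrow>\<^sub>E carrier R" "c \<in> ?B'" for x c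
    using that B(4) by (auto simp: PiE_iff)
  show ?thesis
    unfolding cplx_of_simps
  proof (rule module_homI)
    fix x assume "x \<in> carrier (free_module R ?B)"
    then show "(\<lambda>c\<in>?B'. \<Oplus>b\<in>?B. x b \<otimes> entry F b c) \<in> carrier (free_module R ?B')"
      using cl by (auto intro!: finsum_closed)
  next
    fix x y assume "x \<in> carrier (free_module R ?B)" "y \<in> carrier (free_module R ?B)"
    then have xy: "x \<in> ?B \<rightarrow>\<^sub>E carrier R" "y \<in> ?B \<rightarrow>\<^sub>E carrier R" by simp_all
    have "(\<Oplus>b\<in>?B. (\<lambda>b\<in>?B. x b \<oplus> y b) b \<otimes> entry F b c) =
      (\<Oplus>b\<in>?B. x b \<otimes> entry F b c) \<oplus> (\<Oplus>b\<in>?B. y b \<otimes> entry F b c)" if c: "c \<in> ?B'" for c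
    proof -
      have "(\<Oplus>b\<in>?B. (\<lambda>b\<in>?B. x b \<oplus> y b) b \<otimes> entry F b c) =
        (\<Oplus>b\<in>?B. x b \<otimes> entry F b c \<oplus> y b \<otimes> entry F b c)"
        using xy c B(4) by (intro finsum_cong') (auto simp: l_distr PiE_iff)
      then show ?thesis using finsum_addf[OF cl[OF xy(1) c] cl[OF xy(2) c]] by simp
    qed
    then show "(\<lambda>c\<in>?B'. \<Oplus>b\<in>?B. (x \<oplus>\<^bsub>free_module R ?B\<^esub> y) b \<otimes> entry F b c) =
       (\<lambda>c\<in>?B'. \<Oplus>b\<in>?B. x b \<otimes> entry F b c) \<oplus>\<^bsub>free_module R ?B'\<^esub> (\<lambda>c\<in>?B'. \<Oplus>b\<in>?B. y b \<otimes> entry F b c)"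
      unfolding free_simps by (intro restrict_ext) simp
  next
    fix r x assume r: "r \<in> carrier R" and "x \<in> carrier (free_module R ?B)"
    then have x: "x \<in> ?B \<rightarrow>\<^sub>E carrier R" by simp
    have "(\<Oplus>b\<in>?B. (\<lambda>b\<in>?B. r \<otimes> x b) b \<otimes> entry F b c) = r \<otimes> (\<Oplus>b\<in>?B. x b \<otimes> entry F b c)" if c: "c \<in> ?B'" for c
    proof -
      have "(\<Oplus>b\<in>?B. (\<lambda>b\<in>?B. r \<otimes> x b) b \<otimes> entry F b c) = (\<Oplus>b\<in>?B. r \<otimes> (x b \<otimes> entry F b c))"
        using r x c B(4) by (intro finsum_cong') (auto simp: m_assoc PiE_iff)
      then show ?thesis using finsum_rdistr[OF B(1) r cl[OF x c]] by simp
    qed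
    then show "(\<lambda>c\<in>?B'. \<Oplus>b\<in>?B. (r \<odot>\<^bsub>free_module R ?B\<^esub> x) b \<otimes> entry F b c) =
       r \<odot>\<^bsub>free_module R ?B'\<^esub> (\<lambda>c\<in>?B'. \<Oplus>b\<in>?B. x b \<otimes> entry F b c)"
      unfolding free_simps by (intro restrict_ext) simp
  qed
qed

text \<open>
  Elements of a free module are treated as matrices with one row, so that the associative law of
  the matrix product applies to them.
\<close>

lemma cplx_dif_mat:
  assumes F: "based_complex R F" and x: "x \<in> basis_in F n \<rightarrow>\<^sub>E carrier R" and c: "c \<in> basis_in F (n - 1)"
  shows "dif (cplx_of R F) n x c = mat_prod R (basis_in F n) (\<lambda>_::unit. x) (diff_mat R F) () c"
proof -
  note B = basis_in_facts[OF F]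
  show ?thesis
    unfolding cplx_of_simps mat_prod_def using c x B(3,4)
    by (auto intro!: finsum_cong' simp: diff_mat_def PiE_iff)
qed

lemma mat_prod_restrict:
  assumes "finite B" "B' \<subseteq> B" "\<And>b. b \<in> B \<Longrightarrow> X a b \<in> carrier R" "\<And>b. b \<in> B \<Longrightarrow> Y b c \<in> carrier R"
    "\<And>b. b \<in> B - B' \<Longrightarrow> X a b = \<zero>"
  shows "mat_prod R B' X Y a c = mat_prod R B X Y a c"
  unfolding mat_prod_def using assms by (intro add.finprod_mono_neutral_cong_left) auto

lemma mat_prod_zero_right:
  assumes "\<And>b. b \<in> B \<Longrightarrow> X a b \<in> carrier R" "\<And>b. b \<in> B \<Longrightarrow> Y b c = \<zero>"
  shows "mat_prod R B X Y a c = \<zero>"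
  unfolding mat_prod_def using assms by (intro add.finprod_one_eqI) auto

lemma mat_prod_zero_left:
  assumes "\<And>b. b \<in> B \<Longrightarrow> Y b c \<in> carrier R" "\<And>b. b \<in> B \<Longrightarrow> X a b = \<zero>"
  shows "mat_prod R B X Y a c = \<zero>"
  unfolding mat_prod_def using assms by (intro add.finprod_one_eqI) auto

lemma diff_mat_square_degreewise:
  assumes F: "based_complex R F" and a: "a \<in> basis_in F n" and c: "c \<in> basis F"
  shows "mat_prod R (basis_in F (n - 1)) (diff_mat R F) (diff_mat R F) a c = \<zero>"
proof -
  note B = basis_in_facts[OF F]
  have aF: "a \<in> basis F" using a B(2) by auto
  have "mat_prod R (basis_in F (n - 1)) (diff_mat R F) (diff_mat R F) a c =
    mat_prod R (basis F) (diff_mat R F) (diff_mat R F) a c"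
  proof (rule mat_prod_restrict[OF _ B(2)])
    show "finite (basis F)" using F unfolding based_complex_def by blast
    fix b assume "b \<in> basis F - basis_in F (n - 1)"
    then show "diff_mat R F a b = \<zero>" using B(3)[OF a] by (simp add: basis_in_def diff_mat_def)
  qed (use diff_mat_closed[OF F] aF c in auto)
  also have "\<dots> = \<zero>" using F aF c unfolding based_complex_def by blast
  finally show ?thesis .
qed

lemma is_complex_cplx_of:
  assumes F: "based_complex R F"
  shows "is_complex R (cplx_of R F)"
  unfolding is_complex_def
proof (intro allI conjI ballI)
  fix n
  note B = basis_in_facts[OF F]
  show "module R (obj (cplx_of R F) n)" by (simp add: free_is_module)
  show "dif (cplx_of R F) n \<in> module_hom R (obj (cplx_of R F) n) (obj (cplx_of R F) (n - 1))"
    by (rule cplx_dif_hom[OF F])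
  fix x assume xn: "x \<in> carrier (obj (cplx_of R F) n)"
  then have x: "x \<in> basis_in F n \<rightarrow>\<^sub>E carrier R" by simp
  let ?y = "dif (cplx_of R F) n x"
  have y: "?y \<in> basis_in F (n - 1) \<rightarrow>\<^sub>E carrier R" using module_homD(1)[OF cplx_dif_hom[OF F] xn] by simp
  have z: "dif (cplx_of R F) (n - 1) ?y \<in> basis_in F (n - 1 - 1) \<rightarrow>\<^sub>E carrier R"
    using module_homD(1)[OF cplx_dif_hom[OF F, of "n - 1"], of ?y] y by simp
  show "dif (cplx_of R F) (n - 1) ?y = \<zero>\<^bsub>obj (cplx_of R F) (n - 1 - 1)\<^esub>"
  proof (rule PiE_ext[OF z])
    show "\<zero>\<^bsub>obj (cplx_of R F) (n - 1 - 1)\<^esub> \<in> basis_in F (n - 1 - 1) \<rightarrow>\<^sub>E carrier R" by auto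
    fix e assume e: "e \<in> basis_in F (n - 1 - 1)"
    have eF: "e \<in> basis F" using e B(2) by auto
    have "dif (cplx_of R F) (n - 1) ?y e = mat_prod R (basis_in F (n - 1)) (\<lambda>_::unit. ?y) (diff_mat R F) () e"
      by (rule cplx_dif_mat[OF F y e])
    also have "\<dots> = mat_prod R (basis_in F (n - 1)) (mat_prod R (basis_in F n) (\<lambda>_::unit. x) (diff_mat R F)) (diff_mat R F) () e"
    proof (rule mat_prod_cong)
      fix b assume b: "b \<in> basis_in F (n - 1)"
      show "?y b = mat_prod R (basis_in F n) (\<lambda>_::unit. x) (diff_mat R F) () b" by (rule cplx_dif_mat[OF F x b])
      show "mat_prod R (basis_in F n) (\<lambda>_::unit. x) (diff_mat R F) () b \<in> carrier R"
        using x B(5) b by (intro mat_prod_closed) auto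
    qed (use B(5) e in auto)
    also have "\<dots> = mat_prod R (basis_in F n) (\<lambda>_::unit. x) (mat_prod R (basis_in F (n - 1)) (diff_mat R F) (diff_mat R F)) () e"
      by (rule mat_prod_assoc) (use B(1,5) e x in auto)
    also have "\<dots> = \<zero>"
      by (rule mat_prod_zero_right) (use x diff_mat_square_degreewise[OF F _ eF] in auto)
    finally show "dif (cplx_of R F) (n - 1) ?y e = \<zero>\<^bsub>obj (cplx_of R F) (n - 1 - 1)\<^esub> e" using e by simp
  qed
qed

text \<open>
  For a cycle \<open>x\<close> the homotopy gives \<open>r x = \<partial> (H x) + H (\<partial> x) = \<partial> (H x)\<close>.
\<close>

lemma null_homotopy_kills_cycles:
  assumes F: "based_complex R F" and H: "null_homotopy R F r H" and r: "r \<in> carrier R"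
    and x: "x \<in> cycles (cplx_of R F) n"
  shows "r \<odot>\<^bsub>obj (cplx_of R F) n\<^esub> x \<in> boundaries (cplx_of R F) n"
proof -
  note B = basis_in_facts[OF F]
  let ?X = "\<lambda>_::unit. x" and ?D = "diff_mat R F"
  have xn: "x \<in> carrier (obj (cplx_of R F) n)" and x0: "dif (cplx_of R F) n x = \<zero>\<^bsub>obj (cplx_of R F) (n - 1)\<^esub>"
    using x unfolding cycles_def mem_a_kernel by blast+
  have xP: "x \<in> basis_in F n \<rightarrow>\<^sub>E carrier R" using xn by simp
  have cH: "H b c \<in> carrier R" if "b \<in> basis F" "c \<in> basis F" for b c using H that unfolding null_homotopy_def by blast
  have dH: "H b c = \<zero>" if "b \<in> basis F" "c \<in> basis F" "deg F c \<noteq> deg F b + 1" for b c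
    using H that unfolding null_homotopy_def by blast
  have bF: "b \<in> basis F" if "b \<in> basis_in F m" for b m using that B(2) by auto
  define y where "y = (\<lambda>e\<in>basis_in F (n + 1). mat_prod R (basis_in F n) ?X H () e)"
  have yP: "y \<in> basis_in F (n + 1) \<rightarrow>\<^sub>E carrier R"
    unfolding y_def using xP cH bF by (auto intro!: mat_prod_closed)
  have fin: "finite (basis F)" using F unfolding based_complex_def by blast
  have "dif (cplx_of R F) (n + 1) y c = r \<otimes> x c" if c: "c \<in> basis_in F n" for c
  proof -
    have cF: "c \<in> basis F" using c B(2) by auto
    have c': "c \<in> basis_in F (n + 1 - 1)" using c by simp
    let ?HD = "mat_prod R (basis F) H ?D" and ?DH = "mat_prod R (basis F) ?D H"
    have HD: "?HD b c \<in> carrier R" "?DH b c \<in> carrier R" if "b \<in> basis_in F n" for b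
      using cH diff_mat_closed[OF F] cF bF[OF that] by (auto intro!: mat_prod_closed)
    have "dif (cplx_of R F) (n + 1) y c = mat_prod R (basis_in F (n + 1)) (\<lambda>_::unit. y) ?D () c"
      by (rule cplx_dif_mat[OF F yP c'])
    also have "\<dots> = mat_prod R (basis_in F (n + 1)) (mat_prod R (basis_in F n) ?X H) ?D () c"
      by (rule mat_prod_cong) (use bF B(5) cH c xP in \<open>auto simp: y_def intro!: mat_prod_closed\<close>)
    also have "\<dots> = mat_prod R (basis_in F n) ?X (mat_prod R (basis_in F (n + 1)) H ?D) () c"
      by (rule mat_prod_assoc) (use B(1,5) bF cH c xP in auto)
    also have "\<dots> = mat_prod R (basis_in F n) ?X ?HD () c"
    proof (rule mat_prod_cong)
      fix b assume b: "b \<in> basis_in F n"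
      then have bF': "b \<in> basis F" by (rule bF)
      show "mat_prod R (basis_in F (n + 1)) H ?D b c = ?HD b c"
      proof (rule mat_prod_restrict[OF fin])
        fix e assume "e \<in> basis F - basis_in F (n + 1)"
        then show "H b e = \<zero>" using dH[OF bF', of e] B(3)[OF b] by (auto simp: basis_in_def)
      qed (use bF cH diff_mat_closed[OF F] bF' cF in auto)
    qed (use HD xP in auto)
    finally have 1: "dif (cplx_of R F) (n + 1) y c = mat_prod R (basis_in F n) ?X ?HD () c" .
    have 2: "mat_prod R (basis_in F n) ?X ?DH () c = \<zero>"
    proof -
      have "mat_prod R (basis_in F n) ?X ?DH () c =
        mat_prod R (basis_in F n) ?X (mat_prod R (basis_in F (n - 1)) ?D H) () c"
      proof (rule mat_prod_cong)
        fix b assume b: "b \<in> basis_in F n"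
        then have bF': "b \<in> basis F" by (rule bF)
        show "?DH b c = mat_prod R (basis_in F (n - 1)) ?D H b c"
        proof (rule mat_prod_restrict[symmetric, OF fin])
          fix e assume "e \<in> basis F - basis_in F (n - 1)"
          then show "?D b e = \<zero>" using B(3)[OF b] by (auto simp: basis_in_def diff_mat_def)
        qed (use bF cH diff_mat_closed[OF F] bF' cF in auto)
        show "mat_prod R (basis_in F (n - 1)) ?D H b c \<in> carrier R"
          using bF B(5) b cH cF by (intro mat_prod_closed) auto
      qed (use xP in auto)
      also have "\<dots> = mat_prod R (basis_in F (n - 1)) (mat_prod R (basis_in F n) ?X ?D) H () c"
        by (rule mat_prod_assoc[symmetric]) (use B(1,5) bF cH cF xP in auto)
      also have "\<dots> = \<zero>"
      proof (rule mat_prod_zero_left)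
        fix e assume e: "e \<in> basis_in F (n - 1)"
        show "H e c \<in> carrier R" using bF[OF e] cH cF by auto
        have "mat_prod R (basis_in F n) ?X ?D () e = dif (cplx_of R F) n x e" by (rule cplx_dif_mat[OF F xP e, symmetric])
        also have "\<dots> = \<zero>" unfolding x0 using e by simp
        finally show "mat_prod R (basis_in F n) ?X ?D () e = \<zero>" .
      qed
      finally show ?thesis .
    qed
    have "mat_prod R (basis_in F n) ?X ?HD () c \<oplus> mat_prod R (basis_in F n) ?X ?DH () c =
      (\<Oplus>b\<in>basis_in F n. x b \<otimes> ?HD b c \<oplus> x b \<otimes> ?DH b c)"
      unfolding mat_prod_def[of R "basis_in F n"] using HD xP by (intro finsum_addf[symmetric]) auto
    also have "\<dots> = (\<Oplus>b\<in>basis_in F n. if b = c then r \<otimes> x b else \<zero>)"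
    proof (rule finsum_cong'[OF refl])
      fix b assume b: "b \<in> basis_in F n"
      then have bF': "b \<in> basis F" and xb: "x b \<in> carrier R" using bF xP by auto
      have "x b \<otimes> ?HD b c \<oplus> x b \<otimes> ?DH b c = x b \<otimes> (?HD b c \<oplus> ?DH b c)" using xb HD[OF b] by (simp add: r_distr)
      also have "?HD b c \<oplus> ?DH b c = (if b = c then r else \<zero>)" using H bF' cF unfolding null_homotopy_def by blast
      finally show "x b \<otimes> ?HD b c \<oplus> x b \<otimes> ?DH b c = (if b = c then r \<otimes> x b else \<zero>)"
        using m_comm[OF xb r] xb by (cases "b = c") auto
    qed (use PiE_mem[OF xP] r in auto)
    also have "\<dots> = r \<otimes> x c" using B(1) c PiE_mem[OF xP] r by (intro finsum_if_left(2)) auto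
    finally have "mat_prod R (basis_in F n) ?X ?HD () c \<oplus> \<zero> = r \<otimes> x c" using 2 by simp
    moreover have "mat_prod R (basis_in F n) ?X ?HD () c \<in> carrier R" 
      by (rule mat_prod_closed) (use HD xP in auto)
    ultimately show ?thesis using 1 by simp
  qed
  moreover have yn: "y \<in> carrier (obj (cplx_of R F) (n + 1))" using yP by simp
  moreover have "dif (cplx_of R F) (n + 1) y \<in> basis_in F n \<rightarrow>\<^sub>E carrier R"
    using module_homD(1)[OF cplx_dif_hom[OF F] yn] by simp
  ultimately have "dif (cplx_of R F) (n + 1) y = r \<odot>\<^bsub>obj (cplx_of R F) n\<^esub> x"
    by (auto simp: fun_eq_iff PiE_iff extensional_def)
  then show ?thesis unfolding boundaries_def using yn by (metis imageI)
qed

lemma free_module_iso_of_bij: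
  assumes "bij_betw h A B"
  shows "module_iso R (free_module R A) (free_module R B)"
proof -
  let ?g = "inv_into A h"
  have h: "h a \<in> B" "?g (h a) = a" if "a \<in> A" for a
    using that assms by (auto simp: bij_betw_def inv_into_f_f)
  have g: "?g b \<in> A" "h (?g b) = b" if "b \<in> B" for b
    using that assms inv_into_into[of b h A] f_inv_into_f[of b h A] by (simp_all add: bij_betw_def)
  show ?thesis
  proof (rule module_isoI[of "\<lambda>x. \<lambda>b\<in>B. x (?g b)" _ _ "\<lambda>x. \<lambda>a\<in>A. x (h a)"])
    show "(\<lambda>x. \<lambda>b\<in>B. x (?g b)) \<in> module_hom R (free_module R A) (free_module R B)"
      by (rule module_homI) (use g in \<open>auto simp: fun_eq_iff PiE_iff\<close>)
    show "(\<lambda>x. \<lambda>a\<in>A. x (h a)) \<in> module_hom R (free_module R B) (free_module R A)"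
      by (rule module_homI) (use h in \<open>auto simp: fun_eq_iff PiE_iff\<close>)
  qed (use h g in \<open>auto simp: fun_eq_iff PiE_iff extensional_def\<close>)
qed

lemma bounded_finite_free_cplx_of:
  assumes F: "based_complex R F"
  shows "is_bounded_finite_free R (cplx_of R F)"
  unfolding is_bounded_finite_free_def
proof (intro conjI allI)
  show "is_complex R (cplx_of R F)" by (rule is_complex_cplx_of[OF F])
  fix n
  obtain h where "bij_betw h {0..<card (basis_in F n)} (basis_in F n)"
    using ex_bij_betw_nat_finite[OF basis_in_facts(1)[OF F]] by blast
  then have "module_iso R (free_module R {..<card (basis_in F n)}) (obj (cplx_of R F) n)"
    unfolding cplx_of_simps lessThan_atLeast0 by (rule free_module_iso_of_bij)
  then show "\<exists>k. module_iso R (free_module R {..<k::nat}) (obj (cplx_of R F) n)" by blast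
next
  let ?S = "deg F ` basis F"
  have fin: "finite ?S" using F unfolding based_complex_def by blast
  \<comment> \<open>The 0 makes the set of degrees nonempty.\<close>
  show "\<exists>l u. \<forall>n. n < l \<or> u < n \<longrightarrow> is_zero_module (obj (cplx_of R F) n)"
  proof (intro exI allI impI)
    fix n assume n: "n < Min (insert 0 ?S) \<or> Max (insert 0 ?S) < n"
    have "basis_in F n = {}"
    proof (rule ccontr)
      assume "basis_in F n \<noteq> {}"
      then have "n \<in> insert 0 ?S" unfolding basis_in_def by auto
      then show False using n fin Min_le[of "insert 0 ?S" n] Max_ge[of "insert 0 ?S" n] by auto
    qed
    then show "is_zero_module (obj (cplx_of R F) n)" unfolding is_zero_module_def by (simp add: fun_eq_iff)
  qed
qed

section \<open>Homology\<close>

lemma boundaries_submod: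
  assumes "is_complex R C"
  shows "module R (obj C n)" "submodule (cycles C n) R (obj C n)" "submodule (boundaries C n) R (obj C n)"
    "boundaries C n \<subseteq> cycles C n" "dif C n \<in> module_hom R (obj C n) (obj C (n - 1))"
    "dif C (n + 1) \<in> module_hom R (obj C (n + 1)) (obj C n)"
proof -
  have m: "module R (obj C k)" for k using assms unfolding is_complex_def by blast
  have d: "dif C k \<in> module_hom R (obj C k) (obj C (k - 1))" for k using assms unfolding is_complex_def by blast
  have dd: "dif C (k - 1) (dif C k x) = \<zero>\<^bsub>obj C (k - 1 - 1)\<^esub>" if "x \<in> carrier (obj C k)" for k x
    using assms that unfolding is_complex_def by blast
  show "module R (obj C n)" by (rule m)
  show "submodule (cycles C n) R (obj C n)" unfolding cycles_def by (rule submod_kernel[OF m m d])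
  show d1: "dif C (n + 1) \<in> module_hom R (obj C (n + 1)) (obj C n)" using d[of "n + 1"] by simp
  show "submodule (boundaries C n) R (obj C n)"
    unfolding boundaries_def by (rule submod_image[OF m m d1 submod_carrier[OF m]])
  show "boundaries C n \<subseteq> cycles C n"
    using dd[of _ "n + 1"] module_homD(1)[OF d1] by (auto simp: boundaries_def cycles_def mem_a_kernel)
  show "dif C n \<in> module_hom R (obj C n) (obj C (n - 1))" by (rule d)
qed

lemma homology_facts:
  assumes "is_complex R C"
  shows "module R ((obj C n)\<lparr>carrier := cycles C n\<rparr>)"
    "submodule (boundaries C n) R ((obj C n)\<lparr>carrier := cycles C n\<rparr>)"
    "module R (homology C n)"
proof -
  note b = boundaries_submod[OF assms, of n]
  show 1: "module R ((obj C n)\<lparr>carrier := cycles C n\<rparr>)" by (rule submod_module[OF b(1,2)])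
  show 2: "submodule (boundaries C n) R ((obj C n)\<lparr>carrier := cycles C n\<rparr>)" by (rule submod_restrict[OF b(1-4)])
  show "module R (homology C n)" unfolding homology_def by (rule quotient_is_module[OF 1 2])
qed

lemma homology_killed:
  assumes C: "is_complex R C" and r: "r \<in> carrier R"
    and k: "\<And>x. x \<in> cycles C n \<Longrightarrow> r \<odot>\<^bsub>obj C n\<^esub> x \<in> boundaries C n" and X: "X \<in> carrier (homology C n)"
  shows "r \<odot>\<^bsub>homology C n\<^esub> X = \<zero>\<^bsub>homology C n\<^esub>"
proof -
  let ?Z = "(obj C n)\<lparr>carrier := cycles C n\<rparr>"
  note h = homology_facts[OF C, of n] and b = boundaries_submod[OF C, of n]
  obtain x where x: "x \<in> cycles C n" "X = boundaries C n +>\<^bsub>?Z\<^esub> x"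
    using X unfolding homology_def by (auto simp: quotient_carrier)
  have "r \<odot>\<^bsub>homology C n\<^esub> X = boundaries C n +>\<^bsub>?Z\<^esub> (r \<odot>\<^bsub>obj C n\<^esub> x)"
    unfolding homology_def x(2) using quotient_smult[OF h(1,2) r, of x] x(1) by simp
  also have "\<dots> = \<zero>\<^bsub>homology C n\<^esub>"
    unfolding homology_def using quotient_eq_zero_iff[OF h(1,2), of "r \<odot>\<^bsub>obj C n\<^esub> x"] k[OF x(1)] b(4) by auto
  finally show ?thesis .
qed

end

context coherent
begin

lemma homology_fp:
  assumes C: "is_complex R C" and fp: "\<And>n. finitely_presented R (obj C n)"
  shows "finitely_presented R (homology C n)"
proof -
  let ?Z = "(obj C n)\<lparr>carrier := cycles C n\<rparr>"
  note h = homology_facts[OF C, of n] and b = boundaries_submod[OF C, of n]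
  have Z: "finitely_presented R ?Z" unfolding cycles_def by (rule fp_kernel[OF fp fp b(5)])
  have "fin_gen R (obj C n) (boundaries C n)"
    unfolding boundaries_def
    by (rule fin_gen_image[OF fp_module[OF fp] b(1) b(6) fp_fin_gen[OF fp]])
  then have fg: "fin_gen R ?Z (boundaries C n)" using fin_gen_restrict[OF b(1,2,4)] by simp
  have "a_kernel ?Z (homology C n) (\<lambda>x. boundaries C n +>\<^bsub>?Z\<^esub> x) = boundaries C n"
    using quotient_eq_zero_iff[OF h(1,2)] b(4) unfolding homology_def by (auto simp: mem_a_kernel)
  then show ?thesis
    using fp_quotient[OF Z h(3), of "\<lambda>x. boundaries C n +>\<^bsub>?Z\<^esub> x"] quotient_hom[OF h(1,2)] fg
    unfolding homology_def by (simp add: quotient_carrier)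
qed

end

section \<open>Localization\<close>

lemma mem_frac:
  "(n, t) \<in> frac S M m s \<longleftrightarrow> m \<in> carrier M \<and> n \<in> carrier M \<and> s \<in> S \<and> t \<in> S \<and>
     (\<exists>u\<in>S. u \<odot>\<^bsub>M\<^esub> (t \<odot>\<^bsub>M\<^esub> m) = u \<odot>\<^bsub>M\<^esub> (s \<odot>\<^bsub>M\<^esub> n))"
  by (simp add: frac_def frac_rel_def)

context cring
begin

context
  fixes S
  assumes SR: "S \<subseteq> carrier R" and S1: "\<one> \<in> S" and SS: "\<And>s t. s \<in> S \<Longrightarrow> t \<in> S \<Longrightarrow> s \<otimes> t \<in> S"
begin

lemma SRD: "s \<in> S \<Longrightarrow> s \<in> carrier R"
  using SR by auto

text \<open>
  For transitivity, the witness is the product of both witnesses and the middle denominator.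
\<close>

lemma frac_rel_equiv:
  assumes "module R M"
  shows "equiv (carrier M \<times> S) (frac_rel S M)"
proof (rule equivI)
  interpret M: module R M by fact
  show "frac_rel S M \<subseteq> (carrier M \<times> S) \<times> carrier M \<times> S" by (auto simp: frac_rel_def)
  show "refl_on (carrier M \<times> S) (frac_rel S M)" using S1 by (auto simp: refl_on_def frac_rel_def)
  show "sym (frac_rel S M)" by (rule symI) (auto simp: frac_rel_def intro: sym)
  show "trans (frac_rel S M)"
  proof (rule transI)
    fix x y z assume "(x, y) \<in> frac_rel S M" "(y, z) \<in> frac_rel S M"
    then obtain m s n t k r u v where h: "x = (m, s)" "y = (n, t)" "z = (k, r)"
      "m \<in> carrier M" "n \<in> carrier M" "k \<in> carrier M" "s \<in> S" "t \<in> S" "r \<in> S" "u \<in> S" "v \<in> S"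
      "u \<odot>\<^bsub>M\<^esub> (t \<odot>\<^bsub>M\<^esub> m) = u \<odot>\<^bsub>M\<^esub> (s \<odot>\<^bsub>M\<^esub> n)" "v \<odot>\<^bsub>M\<^esub> (r \<odot>\<^bsub>M\<^esub> n) = v \<odot>\<^bsub>M\<^esub> (t \<odot>\<^bsub>M\<^esub> k)"
      by (auto simp: frac_rel_def)
    note c = SRD[OF h(7)] SRD[OF h(8)] SRD[OF h(9)] SRD[OF h(10)] SRD[OF h(11)]
    let ?w = "u \<otimes> v \<otimes> t"
    have "?w \<odot>\<^bsub>M\<^esub> (r \<odot>\<^bsub>M\<^esub> m) = (v \<otimes> r) \<odot>\<^bsub>M\<^esub> (u \<odot>\<^bsub>M\<^esub> (t \<odot>\<^bsub>M\<^esub> m))"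
      using c h(4) by (simp add: M.smult_assoc1[symmetric] m_ac)
    also have "\<dots> = (u \<otimes> s) \<odot>\<^bsub>M\<^esub> (v \<odot>\<^bsub>M\<^esub> (r \<odot>\<^bsub>M\<^esub> n))"
      unfolding h(12) using c h(5) by (simp add: M.smult_assoc1[symmetric] m_ac)
    also have "\<dots> = ?w \<odot>\<^bsub>M\<^esub> (s \<odot>\<^bsub>M\<^esub> k)"
      unfolding h(13) using c h(6) by (simp add: M.smult_assoc1[symmetric] m_ac)
    finally show "(x, z) \<in> frac_rel S M"
      unfolding h(1,3) frac_rel_def using h(4,6,7,9) SS[OF SS[OF h(10,11)] h(8)] by auto
  qed
qed

lemma frac_eq_iff:
  assumes "module R M" "m \<in> carrier M" "n \<in> carrier M" "s \<in> S" "t \<in> S"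
  shows "frac S M m s = frac S M n t \<longleftrightarrow> (\<exists>u\<in>S. u \<odot>\<^bsub>M\<^esub> (t \<odot>\<^bsub>M\<^esub> m) = u \<odot>\<^bsub>M\<^esub> (s \<odot>\<^bsub>M\<^esub> n))"
  using eq_equiv_class_iff[OF frac_rel_equiv[OF assms(1)], of "(m, s)" "(n, t)"] assms(2-5)
  by (simp add: frac_def frac_rel_def)

lemma frac_self: "module R M \<Longrightarrow> m \<in> carrier M \<Longrightarrow> s \<in> S \<Longrightarrow> (m, s) \<in> frac S M m s"
  using S1 by (auto simp: mem_frac)

lemma frac_eqI:
  assumes "module R M" "m \<in> carrier M" "n \<in> carrier M" "s \<in> S" "t \<in> S" "t \<odot>\<^bsub>M\<^esub> m = s \<odot>\<^bsub>M\<^esub> n"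
  shows "frac S M m s = frac S M n t"
  using assms S1 by (auto simp: frac_eq_iff)

lemma localized_carrier: "carrier (localized_module R S M) = {frac S M m s | m s. m \<in> carrier M \<and> s \<in> S}"
  by (auto simp: localized_module_def quotient_def frac_def)

lemma localized_simps:
  "\<zero>\<^bsub>localized_module R S M\<^esub> = frac S M \<zero>\<^bsub>M\<^esub> \<one>"
  "X \<oplus>\<^bsub>localized_module R S M\<^esub> Y = frac_add R S M X Y"
  by (simp_all add: localized_module_def)

lemma localized_map_frac:
  assumes "module R M" "module R N" "f \<in> module_hom R M N" "m \<in> carrier M" "s \<in> S"
  shows "localized_map S N f (frac S M m s) = frac S N (f m) s"
proof -
  note f = module_homD[OF assms(3)]
  interpret M: module R M by fact
  have "frac S N (f n) t = frac S N (f m) s" if nt: "(n, t) \<in> frac S M m s" for n t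
  proof -
    obtain u where h: "n \<in> carrier M" "t \<in> S" "u \<in> S" "u \<odot>\<^bsub>M\<^esub> (t \<odot>\<^bsub>M\<^esub> m) = u \<odot>\<^bsub>M\<^esub> (s \<odot>\<^bsub>M\<^esub> n)"
      using nt by (auto simp: mem_frac)
    have "u \<odot>\<^bsub>N\<^esub> (t \<odot>\<^bsub>N\<^esub> f m) = f (u \<odot>\<^bsub>M\<^esub> (t \<odot>\<^bsub>M\<^esub> m))"
      using f(3) h(1-3) assms(4,5) SRD by simp
    also have "\<dots> = u \<odot>\<^bsub>N\<^esub> (s \<odot>\<^bsub>N\<^esub> f n)"
      unfolding h(4) using f(3) h(1-3) assms(4,5) SRD by simp
    finally have "\<exists>u\<in>S. u \<odot>\<^bsub>N\<^esub> (t \<odot>\<^bsub>N\<^esub> f m) = u \<odot>\<^bsub>N\<^esub> (s \<odot>\<^bsub>N\<^esub> f n)" using h(3) by (rule bexI)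
    then have "frac S N (f m) s = frac S N (f n) t"
      by (simp only: frac_eq_iff[OF assms(2) f(1)[OF assms(4)] f(1)[OF h(1)] assms(5) h(2)])
    then show ?thesis by simp
  qed
  moreover have "(m, s) \<in> frac S M m s" by (rule frac_self[OF assms(1,4,5)])
  ultimately show ?thesis unfolding localized_map_def by blast
qed

lemma frac_add_frac:
  assumes "module R M" "m \<in> carrier M" "n \<in> carrier M" "s \<in> S" "t \<in> S"
  shows "frac_add R S M (frac S M m s) (frac S M n t) = frac S M (t \<odot>\<^bsub>M\<^esub> m \<oplus>\<^bsub>M\<^esub> s \<odot>\<^bsub>M\<^esub> n) (s \<otimes> t)"
proof -
  interpret M: module R M by fact
  have "frac S M (t' \<odot>\<^bsub>M\<^esub> m' \<oplus>\<^bsub>M\<^esub> s' \<odot>\<^bsub>M\<^esub> n') (s' \<otimes> t') = frac S M (t \<odot>\<^bsub>M\<^esub> m \<oplus>\<^bsub>M\<^esub> s \<odot>\<^bsub>M\<^esub> n) (s \<otimes> t)"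
    if ms: "(m', s') \<in> frac S M m s" and nt: "(n', t') \<in> frac S M n t" for m' s' n' t'
  proof -
    obtain u where u: "m' \<in> carrier M" "s' \<in> S" "u \<in> S" "u \<odot>\<^bsub>M\<^esub> (s' \<odot>\<^bsub>M\<^esub> m) = u \<odot>\<^bsub>M\<^esub> (s \<odot>\<^bsub>M\<^esub> m')"
      using ms by (auto simp: mem_frac)
    obtain v where v: "n' \<in> carrier M" "t' \<in> S" "v \<in> S" "v \<odot>\<^bsub>M\<^esub> (t' \<odot>\<^bsub>M\<^esub> n) = v \<odot>\<^bsub>M\<^esub> (t \<odot>\<^bsub>M\<^esub> n')"
      using nt by (auto simp: mem_frac)
    note c = SRD[OF u(2)] SRD[OF u(3)] SRD[OF v(2)] SRD[OF v(3)] SRD[OF assms(4)] SRD[OF assms(5)]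
    have "(u \<otimes> v) \<odot>\<^bsub>M\<^esub> ((s' \<otimes> t') \<odot>\<^bsub>M\<^esub> (t \<odot>\<^bsub>M\<^esub> m \<oplus>\<^bsub>M\<^esub> s \<odot>\<^bsub>M\<^esub> n)) =
      (v \<otimes> t' \<otimes> t) \<odot>\<^bsub>M\<^esub> (u \<odot>\<^bsub>M\<^esub> (s' \<odot>\<^bsub>M\<^esub> m)) \<oplus>\<^bsub>M\<^esub> (u \<otimes> s' \<otimes> s) \<odot>\<^bsub>M\<^esub> (v \<odot>\<^bsub>M\<^esub> (t' \<odot>\<^bsub>M\<^esub> n))"
      using c assms(2,3) by (simp add: M.smult_r_distr M.smult_assoc1[symmetric] m_ac)
    also have "\<dots> = (v \<otimes> t' \<otimes> t) \<odot>\<^bsub>M\<^esub> (u \<odot>\<^bsub>M\<^esub> (s \<odot>\<^bsub>M\<^esub> m')) \<oplus>\<^bsub>M\<^esub> (u \<otimes> s' \<otimes> s) \<odot>\<^bsub>M\<^esub> (v \<odot>\<^bsub>M\<^esub> (t \<odot>\<^bsub>M\<^esub> n'))"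
      by (simp only: u(4) v(4))
    also have "\<dots> = (u \<otimes> v) \<odot>\<^bsub>M\<^esub> ((s \<otimes> t) \<odot>\<^bsub>M\<^esub> (t' \<odot>\<^bsub>M\<^esub> m' \<oplus>\<^bsub>M\<^esub> s' \<odot>\<^bsub>M\<^esub> n'))"
      using c u(1) v(1) by (simp add: M.smult_r_distr M.smult_assoc1[symmetric] m_ac)
    finally have e: "(u \<otimes> v) \<odot>\<^bsub>M\<^esub> ((s' \<otimes> t') \<odot>\<^bsub>M\<^esub> (t \<odot>\<^bsub>M\<^esub> m \<oplus>\<^bsub>M\<^esub> s \<odot>\<^bsub>M\<^esub> n)) =
      (u \<otimes> v) \<odot>\<^bsub>M\<^esub> ((s \<otimes> t) \<odot>\<^bsub>M\<^esub> (t' \<odot>\<^bsub>M\<^esub> m' \<oplus>\<^bsub>M\<^esub> s' \<odot>\<^bsub>M\<^esub> n'))" .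
    have "t \<odot>\<^bsub>M\<^esub> m \<oplus>\<^bsub>M\<^esub> s \<odot>\<^bsub>M\<^esub> n \<in> carrier M" "t' \<odot>\<^bsub>M\<^esub> m' \<oplus>\<^bsub>M\<^esub> s' \<odot>\<^bsub>M\<^esub> n' \<in> carrier M"
      using c u(1) v(1) assms(2,3) by simp_all
    from frac_eq_iff[OF assms(1) this SS[OF assms(4,5)] SS[OF u(2) v(2)]] e SS[OF u(3) v(3)]
    show ?thesis by auto
  qed
  then show ?thesis
    unfolding frac_add_def using frac_self[OF assms(1,2,4)] frac_self[OF assms(1,3,5)] by blast
qed

lemma frac_add_common:
  assumes "module R M" "m \<in> carrier M" "n \<in> carrier M" "s \<in> S"
  shows "frac_add R S M (frac S M m s) (frac S M n s) = frac S M (m \<oplus>\<^bsub>M\<^esub> n) s"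
proof -
  interpret M: module R M by fact
  note s = SRD[OF assms(4)]
  show ?thesis
    unfolding frac_add_frac[OF assms(1-4) assms(4)]
    by (rule frac_eqI) (use assms s SS in \<open>auto simp: M.smult_r_distr[symmetric] M.smult_assoc1\<close>)
qed

lemma frac_common_denominator:
  assumes "module R M" "m \<in> carrier M" "s \<in> S" "t \<in> S"
  shows "frac S M m s = frac S M (t \<odot>\<^bsub>M\<^esub> m) (s \<otimes> t)"
proof -
  interpret M: module R M by fact
  show ?thesis
    by (rule frac_eqI) (use assms SRD SS in \<open>auto simp: M.smult_assoc1\<close>)
qed

lemma localized_abelian_group:
  assumes "module R M"
  shows "abelian_group (localized_module R S M)"
proof -
  interpret M: module R M by fact
  let ?L = "localized_module R S M"
  have el: "\<exists>m s. m \<in> carrier M \<and> s \<in> S \<and> X = frac S M m s" if "X \<in> carrier ?L" for X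
    using that unfolding localized_carrier by blast
  have cl: "frac S M m s \<in> carrier ?L" if "m \<in> carrier M" "s \<in> S" for m s
    using that unfolding localized_carrier by blast
  show ?thesis
  proof (rule abelian_groupI)
    fix X Y assume "X \<in> carrier ?L" "Y \<in> carrier ?L"
    then obtain m s n t where h: "m \<in> carrier M" "s \<in> S" "n \<in> carrier M" "t \<in> S" "X = frac S M m s" "Y = frac S M n t"
      using el by metis
    note c = SRD[OF h(2)] SRD[OF h(4)]
    show "X \<oplus>\<^bsub>?L\<^esub> Y \<in> carrier ?L"
      unfolding localized_simps h(5,6) frac_add_frac[OF assms h(1,3,2,4)] using c h SS by (intro cl) auto
    show "X \<oplus>\<^bsub>?L\<^esub> Y = Y \<oplus>\<^bsub>?L\<^esub> X"
      unfolding localized_simps h(5,6) frac_add_frac[OF assms h(1,3,2,4)] frac_add_frac[OF assms h(3,1,4,2)]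
      using c h by (simp add: M.a_comm m_comm)
  next
    show "\<zero>\<^bsub>?L\<^esub> \<in> carrier ?L" unfolding localized_simps using S1 by (intro cl) auto
  next
    fix X Y Z assume "X \<in> carrier ?L" "Y \<in> carrier ?L" "Z \<in> carrier ?L"
    then obtain m s n t k r where h: "m \<in> carrier M" "s \<in> S" "n \<in> carrier M" "t \<in> S" "k \<in> carrier M" "r \<in> S"
      "X = frac S M m s" "Y = frac S M n t" "Z = frac S M k r"
      using el by metis
    note c = SRD[OF h(2)] SRD[OF h(4)] SRD[OF h(6)]
    note st = SS[OF h(2,4)] and tr = SS[OF h(4,6)]
    have "t \<odot>\<^bsub>M\<^esub> m \<oplus>\<^bsub>M\<^esub> s \<odot>\<^bsub>M\<^esub> n \<in> carrier M" "r \<odot>\<^bsub>M\<^esub> n \<oplus>\<^bsub>M\<^esub> t \<odot>\<^bsub>M\<^esub> k \<in> carrier M" using c h by simp_all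
    then show "X \<oplus>\<^bsub>?L\<^esub> Y \<oplus>\<^bsub>?L\<^esub> Z = X \<oplus>\<^bsub>?L\<^esub> (Y \<oplus>\<^bsub>?L\<^esub> Z)"
      unfolding localized_simps h(7-9) frac_add_frac[OF assms h(1,3,2,4)] frac_add_frac[OF assms h(3,5,4,6)]
      using c h(1,3,5) st tr h(2,6)
      by (simp add: frac_add_frac[OF assms] M.smult_r_distr M.smult_assoc1[symmetric] m_ac M.a_ac)
  next
    fix X assume "X \<in> carrier ?L"
    then obtain m s where h: "m \<in> carrier M" "s \<in> S" "X = frac S M m s" using el by blast
    note c = SRD[OF h(2)]
    show "\<zero>\<^bsub>?L\<^esub> \<oplus>\<^bsub>?L\<^esub> X = X"
      unfolding localized_simps h(3) frac_add_frac[OF assms M.zero_closed h(1) S1 h(2)] using c h by simp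
    have "frac S M (\<ominus>\<^bsub>M\<^esub> m) s \<oplus>\<^bsub>?L\<^esub> X = frac S M \<zero>\<^bsub>M\<^esub> s"
      unfolding localized_simps h(3) using frac_add_common[OF assms _ h(1,2), of "\<ominus>\<^bsub>M\<^esub> m"] h(1) by (simp add: M.l_neg)
    also have "\<dots> = \<zero>\<^bsub>?L\<^esub>" unfolding localized_simps by (rule frac_eqI) (use assms h S1 c in auto)
    finally show "\<exists>Y\<in>carrier ?L. Y \<oplus>\<^bsub>?L\<^esub> X = \<zero>\<^bsub>?L\<^esub>"
      using cl[of "\<ominus>\<^bsub>M\<^esub> m" s] h by (intro bexI[of _ "frac S M (\<ominus>\<^bsub>M\<^esub> m) s"]) auto
  qed
qed

text \<open>
  A fraction \<open>m / s\<close> is zero iff some \<open>u\<close> in \<open>S\<close> kills \<open>m\<close>.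
\<close>

lemma localized_is_zero_iff:
  assumes "module R M"
  shows "is_zero_module (localized_module R S M) \<longleftrightarrow> (\<forall>m\<in>carrier M. \<exists>u\<in>S. u \<odot>\<^bsub>M\<^esub> m = \<zero>\<^bsub>M\<^esub>)"
proof -
  interpret M: module R M by fact
  have e: "frac S M m s = frac S M \<zero>\<^bsub>M\<^esub> \<one> \<longleftrightarrow> (\<exists>u\<in>S. u \<odot>\<^bsub>M\<^esub> m = \<zero>\<^bsub>M\<^esub>)" if "m \<in> carrier M" "s \<in> S" for m s
    using frac_eq_iff[OF assms that(1) M.zero_closed that(2) S1] that SRD by simp
  show ?thesis
  proof
    assume z: "is_zero_module (localized_module R S M)"
    show "\<forall>m\<in>carrier M. \<exists>u\<in>S. u \<odot>\<^bsub>M\<^esub> m = \<zero>\<^bsub>M\<^esub>"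
    proof
      fix m assume m: "m \<in> carrier M"
      then have "frac S M m \<one> \<in> carrier (localized_module R S M)" using S1 unfolding localized_carrier by blast
      then have "frac S M m \<one> = frac S M \<zero>\<^bsub>M\<^esub> \<one>" using z unfolding is_zero_module_def localized_simps by auto
      then show "\<exists>u\<in>S. u \<odot>\<^bsub>M\<^esub> m = \<zero>\<^bsub>M\<^esub>" using e[OF m S1] by simp
    qed
  next
    assume z: "\<forall>m\<in>carrier M. \<exists>u\<in>S. u \<odot>\<^bsub>M\<^esub> m = \<zero>\<^bsub>M\<^esub>"
    have "carrier (localized_module R S M) \<subseteq> {frac S M \<zero>\<^bsub>M\<^esub> \<one>}"
      unfolding localized_carrier using e z by auto
    moreover have "frac S M \<zero>\<^bsub>M\<^esub> \<one> \<in> carrier (localized_module R S M)"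
      using M.zero_closed S1 unfolding localized_carrier by blast
    ultimately show "is_zero_module (localized_module R S M)"
      unfolding is_zero_module_def localized_simps by blast
  qed
qed

lemma localized_cplx_simps:
  "obj (localized_cplx R S C) n = localized_module R S (obj C n)"
  "dif (localized_cplx R S C) n = localized_map S (obj C (n - 1)) (dif C n)"
  by (simp_all add: localized_cplx_def)

lemma localized_boundaries:
  assumes "is_complex R C"
  shows "boundaries (localized_cplx R S C) n =
    {frac S (obj C n) (dif C (n + 1) y) t | y t. y \<in> carrier (obj C (n + 1)) \<and> t \<in> S}"
proof -
  note b = boundaries_submod[OF assms]
  have "localized_map S (obj C n) (dif C (n + 1)) (frac S (obj C (n + 1)) y t) = frac S (obj C n) (dif C (n + 1) y) t"
    if "y \<in> carrier (obj C (n + 1))" "t \<in> S" for y t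
    by (rule localized_map_frac[OF b(1,1,6) that])
  then show ?thesis
    unfolding boundaries_def localized_cplx_simps localized_carrier by (auto simp: image_iff) metis+
qed

lemma localized_cycles:
  assumes "is_complex R C"
  shows "cycles (localized_cplx R S C) n =
    {frac S (obj C n) x s | x s. x \<in> carrier (obj C n) \<and> s \<in> S \<and> (\<exists>u\<in>S. u \<odot>\<^bsub>obj C n\<^esub> x \<in> cycles C n)}"
proof -
  note b = boundaries_submod[OF assms]
  have e: "localized_map S (obj C (n - 1)) (dif C n) (frac S (obj C n) x s) = frac S (obj C (n - 1)) \<zero>\<^bsub>obj C (n - 1)\<^esub> \<one> \<longleftrightarrow>
      (\<exists>u\<in>S. u \<odot>\<^bsub>obj C n\<^esub> x \<in> cycles C n)" if x: "x \<in> carrier (obj C n)" and s: "s \<in> S" for x s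
  proof -
    interpret M: module R "obj C n" by (rule b(1))
    interpret N: module R "obj C (n - 1)" by (rule b(1))
    have dx: "dif C n x \<in> carrier (obj C (n - 1))" by (rule module_homD(1)[OF b(5) x])
    have "u \<odot>\<^bsub>obj C (n - 1)\<^esub> dif C n x = dif C n (u \<odot>\<^bsub>obj C n\<^esub> x)" if "u \<in> S" for u
      using module_homD(3)[OF b(5) SRD[OF that] x] by simp
    then have "(\<exists>u\<in>S. u \<odot>\<^bsub>obj C (n - 1)\<^esub> dif C n x = \<zero>\<^bsub>obj C (n - 1)\<^esub>) \<longleftrightarrow> (\<exists>u\<in>S. u \<odot>\<^bsub>obj C n\<^esub> x \<in> cycles C n)"
      unfolding cycles_def mem_a_kernel using x SRD by auto
    then show ?thesis
      unfolding localized_map_frac[OF b(1,1,5) x s]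
      using frac_eq_iff[OF b(1) dx N.zero_closed s S1] dx s SRD by simp
  qed
  have k: "X \<in> cycles (localized_cplx R S C) n \<longleftrightarrow> X \<in> carrier (localized_module R S (obj C n)) \<and>
      localized_map S (obj C (n - 1)) (dif C n) X = frac S (obj C (n - 1)) \<zero>\<^bsub>obj C (n - 1)\<^esub> \<one>" for X
    unfolding cycles_def[of "localized_cplx R S C"] localized_cplx_simps mem_a_kernel localized_simps ..
  show ?thesis
  proof (rule Set.set_eqI, rule iffI)
    fix X assume X: "X \<in> cycles (localized_cplx R S C) n"
    then obtain x s where "x \<in> carrier (obj C n)" "s \<in> S" "X = frac S (obj C n) x s"
      unfolding k localized_carrier by blast
    then show "X \<in> {frac S (obj C n) x s | x s. x \<in> carrier (obj C n) \<and> s \<in> S \<and> (\<exists>u\<in>S. u \<odot>\<^bsub>obj C n\<^esub> x \<in> cycles C n)}"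
      using X e unfolding k by blast
  next
    fix X assume "X \<in> {frac S (obj C n) x s | x s. x \<in> carrier (obj C n) \<and> s \<in> S \<and> (\<exists>u\<in>S. u \<odot>\<^bsub>obj C n\<^esub> x \<in> cycles C n)}"
    then show "X \<in> cycles (localized_cplx R S C) n"
      using e unfolding k localized_carrier by blast
  qed
qed

text \<open>Clear denominators.\<close>

lemma localized_exact_iff:
  assumes C: "is_complex R C"
  shows "cycles (localized_cplx R S C) n \<subseteq> boundaries (localized_cplx R S C) n \<longleftrightarrow>
    (\<forall>x\<in>cycles C n. \<exists>u\<in>S. u \<odot>\<^bsub>obj C n\<^esub> x \<in> boundaries C n)"
proof
  note b = boundaries_submod[OF C]
  interpret M: module R "obj C n" by (rule b(1))
  interpret M': module R "obj C (n + 1)" by (rule b(1))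
  note d = module_homD[OF b(6)]
  {
    assume sub: "cycles (localized_cplx R S C) n \<subseteq> boundaries (localized_cplx R S C) n"
    show "\<forall>x\<in>cycles C n. \<exists>u\<in>S. u \<odot>\<^bsub>obj C n\<^esub> x \<in> boundaries C n"
    proof
      fix x assume x: "x \<in> cycles C n"
      then have xM: "x \<in> carrier (obj C n)" by (simp add: cycles_def mem_a_kernel)
      have "\<one> \<odot>\<^bsub>obj C n\<^esub> x \<in> cycles C n" using x xM by simp
      then have "frac S (obj C n) x \<one> \<in> cycles (localized_cplx R S C) n"
        unfolding localized_cycles[OF C] using xM S1 by blast
      then obtain y t where y: "y \<in> carrier (obj C (n + 1))" "t \<in> S"
        "frac S (obj C n) x \<one> = frac S (obj C n) (dif C (n + 1) y) t"
        using sub unfolding localized_boundaries[OF C] by blast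
      then obtain v where v: "v \<in> S" "v \<odot>\<^bsub>obj C n\<^esub> (t \<odot>\<^bsub>obj C n\<^esub> x) = v \<odot>\<^bsub>obj C n\<^esub> (\<one> \<odot>\<^bsub>obj C n\<^esub> dif C (n + 1) y)"
        using frac_eq_iff[OF b(1) xM d(1)[OF y(1)] S1 y(2)] by auto
      have "(v \<otimes> t) \<odot>\<^bsub>obj C n\<^esub> x = dif C (n + 1) (v \<odot>\<^bsub>obj C (n + 1)\<^esub> y)"
        using v SRD[OF v(1)] SRD[OF y(2)] xM d(1)[OF y(1)] d(3)[OF _ y(1)] by (simp add: M.smult_assoc1)
      then have "(v \<otimes> t) \<odot>\<^bsub>obj C n\<^esub> x \<in> boundaries C n"
        unfolding boundaries_def using SRD[OF v(1)] y(1) by auto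
      then show "\<exists>u\<in>S. u \<odot>\<^bsub>obj C n\<^esub> x \<in> boundaries C n" using SS[OF v(1) y(2)] by blast
    qed
  next
    assume h: "\<forall>x\<in>cycles C n. \<exists>u\<in>S. u \<odot>\<^bsub>obj C n\<^esub> x \<in> boundaries C n"
    show "cycles (localized_cplx R S C) n \<subseteq> boundaries (localized_cplx R S C) n"
    proof
      fix X assume "X \<in> cycles (localized_cplx R S C) n"
      then obtain x s u where x: "x \<in> carrier (obj C n)" "s \<in> S" "u \<in> S" "u \<odot>\<^bsub>obj C n\<^esub> x \<in> cycles C n"
        "X = frac S (obj C n) x s"
        unfolding localized_cycles[OF C] by blast
      obtain v y where y: "v \<in> S" "y \<in> carrier (obj C (n + 1))" "v \<odot>\<^bsub>obj C n\<^esub> (u \<odot>\<^bsub>obj C n\<^esub> x) = dif C (n + 1) y"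
        using h x(4) unfolding boundaries_def by blast
      note c = SRD[OF x(2)] SRD[OF x(3)] SRD[OF y(1)]
      have "X = frac S (obj C n) (dif C (n + 1) y) (s \<otimes> (v \<otimes> u))"
        unfolding x(5) y(3)[symmetric]
        using frac_common_denominator[OF b(1) x(1,2) SS[OF y(1) x(3)]] c x(1) by (simp add: M.smult_assoc1)
      then show "X \<in> boundaries (localized_cplx R S C) n"
        unfolding localized_boundaries[OF C] using y(2) SS[OF x(2) SS[OF y(1) x(3)]] by blast
    qed
  }
qed

lemma localized_boundaries_subgroup:
  assumes C: "is_complex R C"
  shows "subgroup (boundaries (localized_cplx R S C) n) (add_monoid (localized_module R S (obj C n)))"
proof -
  note b = boundaries_submod[OF C]
  let ?M = "obj C n" and ?N = "obj C (n + 1)" and ?d = "dif C (n + 1)"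
  interpret M: module R ?M by (rule b(1))
  interpret N: module R ?N by (rule b(1))
  interpret L: abelian_group "localized_module R S ?M" by (rule localized_abelian_group[OF b(1)])
  note d = module_homD[OF b(6)]
  show ?thesis
  proof (rule L.add.subgroupI)
    show "boundaries (localized_cplx R S C) n \<subseteq> carrier (localized_module R S ?M)"
      unfolding localized_boundaries[OF C] localized_carrier using d(1) by blast
    show "boundaries (localized_cplx R S C) n \<noteq> {}"
      unfolding localized_boundaries[OF C] using N.zero_closed S1 by blast
  next
    fix X assume "X \<in> boundaries (localized_cplx R S C) n"
    then obtain y t where y: "y \<in> carrier ?N" "t \<in> S" "X = frac S ?M (?d y) t"
      unfolding localized_boundaries[OF C] by blast
    have "?d (\<ominus>\<^bsub>?N\<^esub> y) = \<ominus>\<^bsub>?M\<^esub> ?d y"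
      using d(3)[of "\<ominus> \<one>" y] y(1) d(1)[OF y(1)] by (simp add: module_neg_smult[OF b(1)])
    then have "frac S ?M (?d (\<ominus>\<^bsub>?N\<^esub> y)) t \<oplus>\<^bsub>localized_module R S ?M\<^esub> X = frac S ?M \<zero>\<^bsub>?M\<^esub> t"
      unfolding localized_simps y(3) using frac_add_common[OF b(1) _ d(1)[OF y(1)] y(2), of "\<ominus>\<^bsub>?M\<^esub> ?d y"] d(1)[OF y(1)]
      by (simp add: M.l_neg)
    also have "\<dots> = \<zero>\<^bsub>localized_module R S ?M\<^esub>"
      unfolding localized_simps by (rule frac_eqI) (use b(1) y(2) S1 SRD in auto)
    finally have "\<ominus>\<^bsub>localized_module R S ?M\<^esub> X = frac S ?M (?d (\<ominus>\<^bsub>?N\<^esub> y)) t"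
      by (rule L.minus_equality)
        (use y d(1) N.a_inv_closed[OF y(1)] in \<open>unfold localized_carrier, blast+\<close>)
    then show "\<ominus>\<^bsub>localized_module R S ?M\<^esub> X \<in> boundaries (localized_cplx R S C) n"
      unfolding localized_boundaries[OF C] using N.a_inv_closed[OF y(1)] y(2) by blast
  next
    fix X Y assume "X \<in> boundaries (localized_cplx R S C) n" "Y \<in> boundaries (localized_cplx R S C) n"
    then obtain y t z s where y: "y \<in> carrier ?N" "t \<in> S" "X = frac S ?M (?d y) t"
      and z: "z \<in> carrier ?N" "s \<in> S" "Y = frac S ?M (?d z) s"
      unfolding localized_boundaries[OF C] by blast
    note c = SRD[OF y(2)] SRD[OF z(2)]
    have "X \<oplus>\<^bsub>localized_module R S ?M\<^esub> Y = frac S ?M (?d (s \<odot>\<^bsub>?N\<^esub> y \<oplus>\<^bsub>?N\<^esub> t \<odot>\<^bsub>?N\<^esub> z)) (t \<otimes> s)"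
      unfolding localized_simps y(3) z(3) frac_add_frac[OF b(1) d(1)[OF y(1)] d(1)[OF z(1)] y(2) z(2)]
      using c y(1) z(1) d(2,3) by simp
    then show "X \<oplus>\<^bsub>localized_module R S ?M\<^esub> Y \<in> boundaries (localized_cplx R S C) n"
      unfolding localized_boundaries[OF C] using y(1) z(1) c SS[OF y(2) z(2)] by blast
  qed
qed

text \<open>
  A map to the zero complex is bijective on homology iff all cycles are boundaries; for the
  localized complex this becomes a condition on numerators.
\<close>

lemma localized_derived_zero_iff:
  assumes C: "is_complex R C"
  shows "derived_zero (localized_ring R S) (localized_cplx R S C) \<longleftrightarrow>
    (\<forall>n. \<forall>x\<in>cycles C n. \<exists>u\<in>S. u \<odot>\<^bsub>obj C n\<^esub> x \<in> boundaries C n)"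
proof -
  let ?D = "localized_cplx R S C" and ?Z = "zero_cplx :: (('a \<times> 'a) set, unit) cplx"
  note b = boundaries_submod[OF C]
  have cm: "chain_map (localized_ring R S) ?D ?Z (\<lambda>_ _. ())"
    unfolding chain_map_def by (auto intro!: module_homI simp: zero_cplx_def zero_module_def)
  have zh: "carrier (homology ?Z n) = {{()}}" for n
    by (auto simp: homology_def quotient_carrier boundaries_def cycles_def zero_cplx_def zero_module_def
        a_kernel_def kernel_def a_r_coset_def')
  have step: "bij_betw (homology_map ?Z (\<lambda>_ _. ()) n) (carrier (homology ?D n)) (carrier (homology ?Z n))
    \<longleftrightarrow> cycles ?D n \<subseteq> boundaries ?D n" for n
  proof -
    let ?L = "localized_module R S (obj C n)"
    interpret L: abelian_group ?L by (rule localized_abelian_group[OF b(1)])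
    interpret M: module R "obj C n" by (rule b(1))
    note sg = localized_boundaries_subgroup[OF C, of n]
    have BL: "boundaries ?D n \<subseteq> carrier ?L" using subgroup.subset[OF sg] by simp
    have CL: "cycles ?D n \<subseteq> carrier ?L" unfolding localized_cycles[OF C] localized_carrier by blast
    have cos: "boundaries ?D n +>\<^bsub>?L\<lparr>carrier := cycles ?D n\<rparr>\<^esub> x = boundaries ?D n +>\<^bsub>?L\<^esub> x" for x
      by (simp add: a_r_coset_def')
    have car: "carrier (homology ?D n) = (\<lambda>x. boundaries ?D n +>\<^bsub>?L\<^esub> x) ` cycles ?D n"
      unfolding homology_def quotient_carrier localized_cplx_simps cos by simp
    have zB: "\<zero>\<^bsub>?L\<^esub> \<in> boundaries ?D n" using subgroup.one_closed[OF sg] by simp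
    have zC: "\<zero>\<^bsub>?L\<^esub> \<in> cycles ?D n"
    proof -
      have "\<one> \<odot>\<^bsub>obj C n\<^esub> \<zero>\<^bsub>obj C n\<^esub> \<in> cycles C n" using submodD(2)[OF b(1,2)] by simp
      then show ?thesis unfolding localized_cycles[OF C] localized_simps using S1 M.zero_closed by blast
    qed
    have self: "x \<in> boundaries ?D n +>\<^bsub>?L\<^esub> x" if "x \<in> carrier ?L" for x
    proof -
      have "x = \<zero>\<^bsub>?L\<^esub> \<oplus>\<^bsub>?L\<^esub> x" using that by simp
      then show ?thesis unfolding mem_coset using zB by blast
    qed
    show ?thesis
    proof
      assume bij: "bij_betw (homology_map ?Z (\<lambda>_ _. ()) n) (carrier (homology ?D n)) (carrier (homology ?Z n))"
      show "cycles ?D n \<subseteq> boundaries ?D n"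
      proof
        fix x assume x: "x \<in> cycles ?D n"
        have "boundaries ?D n +>\<^bsub>?L\<^esub> x = boundaries ?D n +>\<^bsub>?L\<^esub> \<zero>\<^bsub>?L\<^esub>"
        proof (rule inj_onD[OF bij_betw_imp_inj_on[OF bij]])
          show 1: "boundaries ?D n +>\<^bsub>?L\<^esub> x \<in> carrier (homology ?D n)"
            "boundaries ?D n +>\<^bsub>?L\<^esub> \<zero>\<^bsub>?L\<^esub> \<in> carrier (homology ?D n)" unfolding car using x zC by blast+
          show "homology_map ?Z (\<lambda>_ _. ()) n (boundaries ?D n +>\<^bsub>?L\<^esub> x) =
            homology_map ?Z (\<lambda>_ _. ()) n (boundaries ?D n +>\<^bsub>?L\<^esub> \<zero>\<^bsub>?L\<^esub>)"
            using bij_betwE[OF bij] 1 unfolding zh by simp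
        qed
        also have "\<dots> = boundaries ?D n" by (rule L.a_coset_add_zero[OF BL])
        finally show "x \<in> boundaries ?D n" using self[of x] x CL by auto
      qed
    next
      assume sub: "cycles ?D n \<subseteq> boundaries ?D n"
      have "boundaries ?D n +>\<^bsub>?L\<^esub> x = boundaries ?D n" if "x \<in> cycles ?D n" for x
        using that sub CL by (intro L.a_coset_join2[OF _ sg]) auto
      then have "carrier (homology ?D n) = {boundaries ?D n}" unfolding car using zC by auto
      moreover have "homology_map ?Z (\<lambda>_ _. ()) n (boundaries ?D n) = {()}"
      proof -
        have "boundaries ?Z n = {()}" by (auto simp: boundaries_def zero_cplx_def zero_module_def)
        then show ?thesis
          using zB by (auto simp: homology_map_def zero_cplx_def zero_module_def a_r_coset_def')
      qed
      ultimately show "bij_betw (homology_map ?Z (\<lambda>_ _. ()) n) (carrier (homology ?D n)) (carrier (homology ?Z n))"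
        unfolding zh by (simp add: bij_betw_def)
    qed
  qed
  show ?thesis
    unfolding derived_zero_def quasi_isomorphism_def using cm step localized_exact_iff[OF C] by simp
qed

end

lemma prime_complement:
  assumes "primeideal P R"
  shows "carrier R - P \<subseteq> carrier R" "\<one> \<in> carrier R - P"
    "\<And>s t. s \<in> carrier R - P \<Longrightarrow> t \<in> carrier R - P \<Longrightarrow> s \<otimes> t \<in> carrier R - P"
proof -
  interpret primeideal P R by fact
  show "carrier R - P \<subseteq> carrier R" by auto
  show "\<one> \<in> carrier R - P" using one_imp_carrier I_notcarr by auto
  show "\<And>s t. s \<in> carrier R - P \<Longrightarrow> t \<in> carrier R - P \<Longrightarrow> s \<otimes> t \<in> carrier R - P" using I_prime by auto
qed

lemma mem_module_support:
  assumes "module R M"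
  shows "P \<in> module_support R M \<longleftrightarrow> primeideal P R \<and> \<not> (\<forall>m\<in>carrier M. \<exists>u\<in>carrier R - P. u \<odot>\<^bsub>M\<^esub> m = \<zero>\<^bsub>M\<^esub>)"
  using localized_is_zero_iff[OF prime_complement assms] unfolding module_support_def by auto

lemma mem_cplx_support:
  assumes "is_complex R C"
  shows "P \<in> cplx_support R C \<longleftrightarrow> primeideal P R \<and>
    \<not> (\<forall>n. \<forall>x\<in>cycles C n. \<exists>u\<in>carrier R - P. u \<odot>\<^bsub>obj C n\<^esub> x \<in> boundaries C n)"
  using localized_derived_zero_iff[OF prime_complement assms] unfolding cplx_support_def by auto

end

section \<open>The abelian subcategory generated by a module\<close>

context coherent
begin

text \<open>
  The rules that generate the category produce objects up to isomorphism; a module with maps that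
  exhibit it as a sum, kernel or cokernel is isomorphic to the standard one.
\<close>

lemma abelian_class_ab: "abelian_class R (ab_representative R M)"
proof -
  let ?C = "ab_representative R M"
  note FP = abelian_classD[OF abelian_class_fp]
  have fp: "finitely_presented R Y" if "?C Y" for Y using that by cases
  have sum: "?C X" if c: "?C A" "?C B" "module R X" "f \<in> module_hom R X A" "g \<in> module_hom R X B"
    "bij_betw (\<lambda>x. (f x, g x)) (carrier X) (carrier A \<times> carrier B)"
    for A B X :: "('a, (nat \<Rightarrow> 'a) set) module" and f g
  proof (rule ab_representative.sum[OF c(1,2)])
    show "finitely_presented R X" by (rule FP(3)[OF fp[OF c(1)] fp[OF c(2)] c(3-6)])
    have "module_iso R X (direct_sum A B)"
      unfolding module_iso_def using hom_into_direct_sum[OF c(4,5)] c(6) by auto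
    then show "module_iso R (direct_sum A B) X"
      by (rule module_iso_sym[OF c(3) direct_sum_is_module[OF fp_module[OF fp[OF c(1)]] fp_module[OF fp[OF c(2)]]]])
  qed
  have ker: "?C X" if c: "?C A" "?C B" "module R X"
    "f \<in> module_hom R A B" "g \<in> module_hom R X A" "inj_on g (carrier X)" "g ` carrier X = a_kernel A B f"
    for A B X :: "('a, (nat \<Rightarrow> 'a) set) module" and f g
  proof (rule ab_representative.kernel[OF c(1,2,4)])
    show "finitely_presented R X" by (rule FP(4)[OF fp[OF c(1)] fp[OF c(2)] c(3-7)])
    have "module_iso R X (A\<lparr>carrier := a_kernel A B f\<rparr>)"
      unfolding module_iso_def using module_hom_corestrict[OF c(5), of "a_kernel A B f"] c(6,7)
      by (intro bexI[of _ g]) (auto simp: bij_betw_def)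
    then show "module_iso R (A\<lparr>carrier := a_kernel A B f\<rparr>) X"
      by (rule module_iso_sym[OF c(3) fp_module[OF fp_kernel(1)[OF fp[OF c(1)] fp[OF c(2)] c(4)]]])
  qed
  have coker: "?C X" if c: "?C A" "?C B" "module R X"
    "f \<in> module_hom R A B" "g \<in> module_hom R B X" "g ` carrier B = carrier X" "a_kernel B X g = f ` carrier A"
    for A B X :: "('a, (nat \<Rightarrow> 'a) set) module" and f g
  proof (rule ab_representative.cokernel[OF c(1,2,4)])
    show "finitely_presented R X" by (rule FP(5)[OF fp[OF c(1)] fp[OF c(2)] c(3-7)])
    note md = fp_module[OF fp[OF c(1)]] fp_module[OF fp[OF c(2)]]
    have im: "submodule (f ` carrier A) R B" by (rule submod_image[OF md c(4) submod_carrier[OF md(1)]])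
    have "g x = \<zero>\<^bsub>X\<^esub> \<longleftrightarrow> x \<in> f ` carrier A" if "x \<in> carrier B" for x
      unfolding c(7)[symmetric] mem_a_kernel using that by simp
    then show "module_iso R (quotient_module B (f ` carrier A)) X"
      by (intro iso_of_surj_same_kernel[OF md(2) quotient_is_module[OF md(2) im] c(3) quotient_hom[OF md(2) im] _ c(5,6)])
        (simp_all add: quotient_carrier quotient_eq_zero_iff[OF md(2) im])
  qed
  show ?thesis
    unfolding abelian_class_def using fp ab_representative.zero sum ker coker by blast
qed

lemma in_ab_iff_in_class: "in_ab R M X \<longleftrightarrow> in_class R (ab_representative R M) X"
proof
  assume "in_ab R M X"
  then show "in_class R (ab_representative R M) X"
    unfolding in_ab_def in_class_def using fp_module by blast
next
  assume h: "in_class R (ab_representative R M) X"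
  then show "in_ab R M X"
    using in_class_fp[OF abelian_class_ab h] unfolding in_ab_def in_class_def by blast
qed

text \<open>
  Since \<open>R / Ann M\<close> lies in the category, so does every finitely presented module over this ring.
\<close>

lemma in_ab_of_killed:
  assumes M: "finitely_presented R M" and X: "finitely_presented R X"
    and k: "\<And>r x. r \<in> annihilator R M \<Longrightarrow> x \<in> carrier X \<Longrightarrow> r \<odot>\<^bsub>X\<^esub> x = \<zero>\<^bsub>X\<^esub>"
  shows "in_ab R M X"
proof -
  obtain Y :: "('a, (nat \<Rightarrow> 'a) set) module" where Y: "finitely_presented R Y" "module_iso R M Y"
    using fp_copy[OF M] by blast
  then have "in_class R (ab_representative R M) M"
    unfolding in_class_def using fp_module[OF M] ab_representative.generator by blast
  then have "cyclic_in R (ab_representative R M) (annihilator R M)"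
    by (rule cyclic_in_annihilator[OF abelian_class_ab])
  then show ?thesis
    unfolding in_ab_iff_in_class
    using killed_in_class[OF abelian_class_ab annihilator_submod[OF fp_module[OF M]] _ X k] by blast
qed

end

section \<open>The complex attached to a presentation\<close>

context cring
begin

lemma cplx_dif_basis_vector:
  assumes F: "based_complex R F" and b: "b \<in> basis_in F n"
  shows "dif (cplx_of R F) n (basis_vector R (basis_in F n) b) = (\<lambda>c\<in>basis_in F (n - 1). entry F b c)"
  unfolding cplx_of_dif
proof (rule restrict_ext)
  note B = basis_in_facts[OF F]
  fix c assume c: "c \<in> basis_in F (n - 1)"
  have "(\<Oplus>b'\<in>basis_in F n. basis_vector R (basis_in F n) b b' \<otimes> entry F b' c) =
    (\<Oplus>b'\<in>basis_in F n. if b' = b then entry F b' c else \<zero>)"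
    using B(4)[OF _ c] by (intro finsum_cong') (auto simp: basis_vector_def)
  also have "\<dots> = entry F b c"
    using B(4)[OF _ c] by (intro finsum_if_left(2)[OF B(1) b]) auto
  finally show "(\<Oplus>b'\<in>basis_in F n. basis_vector R (basis_in F n) b b' \<otimes> entry F b' c) = entry F b c" .
qed

lemma based_complex_two_term:
  assumes d: "d \<in> module_hom R (free_module R {..<p}) (free_module R {..<q})"
  shows "based_complex R (two_term_cplx R p q d)"
proof -
  let ?E = "two_term_cplx R p q d"
  have "d (basis_vector R {..<p} i) \<in> {..<q} \<rightarrow>\<^sub>E carrier R" for i
    using module_homD(1)[OF d] by simp
  then have "d (basis_vector R {..<p} i) j \<in> carrier R" if "j < q" for i j
    using that by (auto elim!: PiE_E)
  then have e: "entry ?E b c \<in> carrier R" if "b \<in> basis ?E" "c \<in> basis ?E" for b c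
    using that by (auto simp: two_term_cplx_def)
  have alt: "diff_mat R ?E a b = \<zero> \<or> diff_mat R ?E b c = \<zero>" for a b c
    by (auto simp: diff_mat_def two_term_cplx_def split: prod.splits)
  have "diff_mat R ?E a b \<otimes> diff_mat R ?E b c = \<zero>"
    if "a \<in> basis ?E" "b \<in> basis ?E" "c \<in> basis ?E" for a b c
  proof -
    have "diff_mat R ?E a b \<in> carrier R" "diff_mat R ?E b c \<in> carrier R"
      using e that unfolding diff_mat_def by auto
    then show ?thesis using alt[of a b c] by auto
  qed
  then have "mat_prod R (basis ?E) (diff_mat R ?E) (diff_mat R ?E) a c = \<zero>"
    if "a \<in> basis ?E" "c \<in> basis ?E" for a c
    unfolding mat_prod_def using that by (simp add: finsum_zero cong: finsum_cong)
  moreover have "finite (basis ?E)" by (simp add: two_term_cplx_def)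
  ultimately show ?thesis unfolding based_complex_def using e by blast
qed

text \<open>The scalars that move \<open>x\<close> into the boundaries form an ideal.\<close>

lemma cycles_killed_by_span:
  assumes C: "is_complex R C" and A: "A \<subseteq> carrier R"
    and k: "\<And>r x. r \<in> A \<Longrightarrow> x \<in> cycles C n \<Longrightarrow> r \<odot>\<^bsub>obj C n\<^esub> x \<in> boundaries C n"
    and r: "r \<in> Idl A" and x: "x \<in> cycles C n"
  shows "r \<odot>\<^bsub>obj C n\<^esub> x \<in> boundaries C n"
proof -
  note b = boundaries_submod[OF C, of n]
  note B = submodD[OF b(1,3)]
  interpret N: module R "obj C n" by (rule b(1))
  have xM: "x \<in> carrier (obj C n)" using x by (simp add: cycles_def mem_a_kernel)
  let ?K = "{r \<in> carrier R. r \<odot>\<^bsub>obj C n\<^esub> x \<in> boundaries C n}"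
  have "submodule ?K R (regular_module R)"
    by (rule submodI[OF regular_is_module])
      (use xM B(2-4) in \<open>auto simp: N.smult_l_distr N.smult_assoc1\<close>)
  moreover have "A \<subseteq> ?K" using A k x by auto
  ultimately have "module_span R (regular_module R) A \<subseteq> ?K" by (rule span_least)
  then show ?thesis using r unfolding genideal_eq_span by auto
qed

lemma free_homs_eqI:
  assumes "module R N" "finite B" "f \<in> module_hom R (free_module R B) N" "g \<in> module_hom R (free_module R B) N"
    and e: "\<And>b. b \<in> B \<Longrightarrow> f (basis_vector R B b) = g (basis_vector R B b)" and c: "c \<in> B \<rightarrow>\<^sub>E carrier R"
  shows "f c = g c"
proof -
  interpret N: module R N by fact
  have "(\<Oplus>\<^bsub>N\<^esub>b\<in>B. c b \<odot>\<^bsub>N\<^esub> f (basis_vector R B b)) = (\<Oplus>\<^bsub>N\<^esub>b\<in>B. c b \<odot>\<^bsub>N\<^esub> g (basis_vector R B b))"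
  proof (rule N.finsum_cong')
    have "g (basis_vector R B b) \<in> carrier N" for b using module_homD(1)[OF assms(4)] by simp
    then show "(\<lambda>b. c b \<odot>\<^bsub>N\<^esub> g (basis_vector R B b)) \<in> B \<rightarrow> carrier N" using c by (auto simp: PiE_iff)
  qed (use e in simp_all)
  then show ?thesis using free_hom_expand[OF assms(1-3) c] free_hom_expand[OF assms(1,2,4) c] by simp
qed

end

context coherent
begin

context
  fixes M :: "('a, 'm, 'e) module_scheme" and p q d \<pi> as
  assumes M: "finitely_presented R M" and as: "set as \<subseteq> carrier R" and ann: "Idl (set as) = annihilator R M"
    and pres: "is_presentation R M p q d \<pi>"
begin

abbreviation "T \<equiv> tensor_cplx R (two_term_cplx R p q d) (koszul R as)"
abbreviation "X \<equiv> X_cplx R p q d as"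
abbreviation "z \<equiv> replicate (length as) (0::int)"

lemma pres_facts:
  "module R M" "d \<in> module_hom R (free_module R {..<p}) (free_module R {..<q})"
  "\<pi> \<in> module_hom R (free_module R {..<q}) M" "\<pi> ` ({..<q} \<rightarrow>\<^sub>E carrier R) = carrier M"
  "\<And>y. y \<in> {..<q} \<rightarrow>\<^sub>E carrier R \<Longrightarrow> \<pi> y = \<zero>\<^bsub>M\<^esub> \<longleftrightarrow> y \<in> d ` ({..<p} \<rightarrow>\<^sub>E carrier R)"
proof -
  have "a_kernel (free_module R {..<q}) M \<pi> = d ` ({..<p} \<rightarrow>\<^sub>E carrier R)"
    using pres unfolding is_presentation_def by simp
  then show "\<pi> y = \<zero>\<^bsub>M\<^esub> \<longleftrightarrow> y \<in> d ` ({..<p} \<rightarrow>\<^sub>E carrier R)" if "y \<in> {..<q} \<rightarrow>\<^sub>E carrier R" for y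
    using that mem_a_kernel[of y "free_module R {..<q}" M \<pi>] by simp
qed (use pres fp_module[OF M] in \<open>simp_all add: is_presentation_def\<close>)

lemma based_complex_T: "based_complex R T"
  by (rule based_complex_tensor[OF based_complex_two_term[OF pres_facts(2)] based_complex_koszul[OF as]])

lemma complex_X: "is_complex R X"
  unfolding X_cplx_def by (rule is_complex_cplx_of[OF based_complex_T])

lemma bounded_X: "is_bounded_finite_free R X"
  unfolding X_cplx_def by (rule bounded_finite_free_cplx_of[OF based_complex_T])

lemma annihilator_kills_cycles:
  assumes "r \<in> annihilator R M" "x \<in> cycles X n"
  shows "r \<odot>\<^bsub>obj X n\<^esub> x \<in> boundaries X n"
proof (rule cycles_killed_by_span[OF complex_X as _ assms(1)[folded ann] assms(2)])
  fix a y assume a: "a \<in> set as" and y: "y \<in> cycles X n"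
  have aR: "a \<in> carrier R" using a as by auto
  obtain H where "null_homotopy R (koszul R as) a H" using null_homotopy_koszul[OF as a] by blast
  from null_homotopy_tensor_right[OF based_complex_two_term[OF pres_facts(2)] based_complex_koszul[OF as] aR this]
  show "a \<odot>\<^bsub>obj X n\<^esub> y \<in> boundaries X n"
    using null_homotopy_kills_cycles[OF based_complex_T _ aR] y unfolding X_cplx_def by blast
qed

lemma homology_in_ab: "in_ab R M (homology X n)"
proof (rule in_ab_of_killed[OF M])
  have "finitely_presented R (obj X n)" for n
    unfolding X_cplx_def cplx_of_obj by (rule fp_free[OF basis_in_facts(1)[OF based_complex_T]])
  then show "finitely_presented R (homology X n)" by (rule homology_fp[OF complex_X])
next
  fix r Y assume r: "r \<in> annihilator R M" and Y: "Y \<in> carrier (homology X n)"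
  have "r \<in> carrier R" using r by (simp add: annihilator_def)
  then show "r \<odot>\<^bsub>homology X n\<^esub> Y = \<zero>\<^bsub>homology X n\<^esub>"
    using homology_killed[OF complex_X _ _ Y] annihilator_kills_cycles[OF r] by blast
qed

text \<open>
  Degrees of basis elements of either factor are nonnegative, and in the Koszul complex only the
  tuple of zeros has degree 0.
\<close>

lemma basis_in_T:
  "basis_in T 0 = {((0, j), z) | j. j < q}" "basis_in T (-1) = {}"
  "basis_in T 1 = {((1, i), z) | i. i < p} \<union> {((0, j), bs) | j bs. j < q \<and> bs \<in> basis (koszul R as) \<and> sum_list bs = 1}"
proof -
  have nonneg: "0 \<le> sum_list bs" if "bs \<in> basis (koszul R as)" for bs
    using that unfolding koszul_basis by (auto intro!: sum_list_nonneg)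
  have zero: "bs = z" if "bs \<in> basis (koszul R as)" "sum_list bs = 0" for bs
  proof -
    have "\<forall>b\<in>set bs. b = 0"
      using that sum_list_nonneg_eq_0_iff[of bs] unfolding koszul_basis by force
    then show ?thesis using that(1) unfolding koszul_basis by (auto intro: replicate_eqI)
  qed
  have z: "z \<in> basis (koszul R as)" "sum_list z = 0" unfolding koszul_basis by (auto simp: sum_list_replicate)
  have deg: "deg (koszul R as) bs = sum_list bs" if "bs \<in> basis (koszul R as)" for bs
    using that koszul_deg unfolding koszul_basis by blast
  have mem: "((m, i), bs) \<in> basis_in T n \<longleftrightarrow> (m = 1 \<and> i < p \<or> m = 0 \<and> i < q) \<and> bs \<in> basis (koszul R as) \<and> m + sum_list bs = n"
    for m i bs n
    using deg[of bs] by (auto simp: basis_in_def tensor_cplx_def two_term_cplx_def)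
  show "basis_in T 0 = {((0, j), z) | j. j < q}"
  proof (rule Set.set_eqI)
    fix x :: "(int \<times> nat) \<times> int list"
    obtain m i bs where x: "x = ((m, i), bs)" by (metis surj_pair)
    show "x \<in> basis_in T 0 \<longleftrightarrow> x \<in> {((0, j), z) | j. j < q}"
      unfolding x mem using nonneg[of bs] zero[of bs] z by auto
  qed
  show "basis_in T (-1) = {}"
  proof (rule Set.set_eqI)
    fix x :: "(int \<times> nat) \<times> int list"
    obtain m i bs where x: "x = ((m, i), bs)" by (metis surj_pair)
    show "x \<in> basis_in T (-1) \<longleftrightarrow> x \<in> {}"
      unfolding x mem using nonneg[of bs] by auto
  qed
  show "basis_in T 1 = {((1, i), z) | i. i < p} \<union> {((0, j), bs) | j bs. j < q \<and> bs \<in> basis (koszul R as) \<and> sum_list bs = 1}"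
  proof (rule Set.set_eqI)
    fix x :: "(int \<times> nat) \<times> int list"
    obtain m i bs where x: "x = ((m, i), bs)" by (metis surj_pair)
    show "x \<in> basis_in T 1 \<longleftrightarrow> x \<in> {((1, i), z) | i. i < p} \<union> {((0, j), bs) | j bs. j < q \<and> bs \<in> basis (koszul R as) \<and> sum_list bs = 1}"
      unfolding x mem using zero[of bs] z by auto
  qed
qed

text \<open>
  The degree 0 part of \<open>X\<^sub>M\<close> is \<open>R\<^sup>q\<close>; only the indices of the basis elements differ.
\<close>

definition coords :: "((int \<times> nat) \<times> int list \<Rightarrow> 'a) \<Rightarrow> nat \<Rightarrow> 'a" where
  "coords x = (\<lambda>j\<in>{..<q}. x ((0, j), z))"

lemma coords_hom: "coords \<in> module_hom R (obj X 0) (free_module R {..<q})"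
  unfolding X_cplx_def cplx_of_obj basis_in_T(1)
  by (rule module_homI) (auto simp: coords_def PiE_iff intro!: restrict_ext)

lemma coords_inj:
  assumes "x \<in> carrier (obj X 0)" "y \<in> carrier (obj X 0)" "coords x = coords y"
  shows "x = y"
proof -
  have e: "x ((0, j), z) = y ((0, j), z)" if "j < q" for j
    using fun_cong[OF assms(3), of j] that by (simp add: coords_def)
  have "x \<in> basis_in T 0 \<rightarrow>\<^sub>E carrier R" "y \<in> basis_in T 0 \<rightarrow>\<^sub>E carrier R"
    using assms(1,2) unfolding X_cplx_def cplx_of_obj free_simps by blast+
  then show ?thesis
  proof (rule PiE_ext)
    fix b assume "b \<in> basis_in T 0"
    then show "x b = y b" using e unfolding basis_in_T(1) by auto
  qed
qed

lemma coords_onto: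
  assumes "y \<in> {..<q} \<rightarrow>\<^sub>E carrier R"
  shows "\<exists>x\<in>carrier (obj X 0). coords x = y"
proof (rule bexI)
  let ?x = "\<lambda>b\<in>basis_in T 0. y (snd (fst b))"
  have "y (snd (fst b)) \<in> carrier R" if "b \<in> basis_in T 0" for b
    using that assms unfolding basis_in_T(1) by (auto simp: PiE_iff)
  then show "?x \<in> carrier (obj X 0)"
    unfolding X_cplx_def cplx_of_obj free_simps restrict_PiE_iff by blast
  have "((0, j), z) \<in> basis_in T 0" if "j < q" for j
    unfolding basis_in_T(1) using that by blast
  then have "coords ?x = restrict y {..<q}"
    unfolding coords_def by (intro restrict_ext) simp
  also have "\<dots> = y"
    by (rule extensional_restrict) (use assms in \<open>simp add: PiE_iff\<close>)
  finally show "coords ?x = y" .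
qed

text \<open>
  A basis element of degree 1 comes from degree 1 in the presentation or from degree 1 in the
  Koszul complex. Its boundary is \<open>d e\<^sub>i\<close> in the first case and \<open>r e\<^sub>j\<close> with \<open>r \<in> Ann M\<close> in the
  second.
\<close>

lemma coords_dif_basis_vector:
  shows "i < p \<Longrightarrow> coords (dif X 1 (basis_vector R (basis_in T 1) ((1, i), z))) = d (basis_vector R {..<p} i)"
    and "((0, j), bs) \<in> basis_in T 1 \<Longrightarrow> \<exists>r\<in>annihilator R M.
      coords (dif X 1 (basis_vector R (basis_in T 1) ((0, j), bs))) = r \<odot>\<^bsub>free_module R {..<q}\<^esub> basis_vector R {..<q} j"
proof -
  have dif: "coords (dif X 1 (basis_vector R (basis_in T 1) b)) = (\<lambda>k\<in>{..<q}. entry T b ((0, k), z))"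
    if b: "b \<in> basis_in T 1" for b
    unfolding X_cplx_def cplx_dif_basis_vector[OF based_complex_T b] coords_def
    by (intro restrict_ext) (simp add: basis_in_T(1))
  {
    assume i: "i < p"
    then have b: "((1, i), z) \<in> basis_in T 1" unfolding basis_in_T(3) by blast
    have di: "d (basis_vector R {..<p} i) \<in> {..<q} \<rightarrow>\<^sub>E carrier R"
      using module_homD(1)[OF pres_facts(2)] by simp
    have "entry T ((1, i), z) ((0, k), z) = d (basis_vector R {..<p} i) k" if "k < q" for k
    proof -
      have "d (basis_vector R {..<p} i) k \<in> carrier R" using di that by (auto elim!: PiE_E)
      then show ?thesis by (simp add: tensor_cplx_def two_term_cplx_def)
    qed
    then have "(\<lambda>k\<in>{..<q}. entry T ((1, i), z) ((0, k), z)) = restrict (d (basis_vector R {..<p} i)) {..<q}"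
      by (intro restrict_ext) simp
    also have "\<dots> = d (basis_vector R {..<p} i)"
      by (rule extensional_restrict) (use di in \<open>simp add: PiE_iff\<close>)
    finally show "coords (dif X 1 (basis_vector R (basis_in T 1) ((1, i), z))) = d (basis_vector R {..<p} i)"
      using dif[OF b] by simp
  }
  {
    assume b: "((0, j), bs) \<in> basis_in T 1"
    let ?r = "entry (koszul R as) bs z"
    have r: "?r \<in> annihilator R M"
      using koszul_entry_in_ideal[OF genideal_ideal[OF as] genideal_self[OF as]] unfolding ann .
    then have rR: "?r \<in> carrier R" by (simp add: annihilator_def)
    have "entry T ((0, j), bs) ((0, k), z) = ?r \<otimes> basis_vector R {..<q} j k" if "k < q" for k
      using that rR by (simp add: tensor_cplx_def two_term_cplx_def basis_vector_def)
    then have "(\<lambda>k\<in>{..<q}. entry T ((0, j), bs) ((0, k), z)) = ?r \<odot>\<^bsub>free_module R {..<q}\<^esub> basis_vector R {..<q} j"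
      unfolding free_simps by (intro restrict_ext) simp
    then show "\<exists>r\<in>annihilator R M. coords (dif X 1 (basis_vector R (basis_in T 1) ((0, j), bs))) =
        r \<odot>\<^bsub>free_module R {..<q}\<^esub> basis_vector R {..<q} j"
      using dif[OF b] r by auto
  }
qed

lemma dif_X_hom: "dif X 1 \<in> module_hom R (free_module R (basis_in T 1)) (obj X 0)"
  using boundaries_submod(6)[OF complex_X, of 0] by (simp add: X_cplx_def)

lemma boundaries_X_0: "boundaries X 0 = dif X 1 ` (basis_in T 1 \<rightarrow>\<^sub>E carrier R)"
  unfolding boundaries_def by (simp add: X_cplx_def)

lemma cycles_X_0: "cycles X 0 = carrier (obj X 0)"
proof -
  have "dif X 0 x = \<zero>\<^bsub>obj X (0 - 1)\<^esub>" for x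
    unfolding X_cplx_def cplx_of_simps by (simp add: basis_in_T(2) restrict_def)
  then show ?thesis unfolding cycles_def by (auto simp: mem_a_kernel)
qed

lemma augmentation_hom: "(\<lambda>x. \<pi> (coords x)) \<in> module_hom R (obj X 0) M"
  by (rule module_hom_comp[OF coords_hom pres_facts(3)])

lemma augmentation_onto: "(\<lambda>x. \<pi> (coords x)) ` carrier (obj X 0) = carrier M"
proof
  show "(\<lambda>x. \<pi> (coords x)) ` carrier (obj X 0) \<subseteq> carrier M" using module_homD(1)[OF augmentation_hom] by blast
  show "carrier M \<subseteq> (\<lambda>x. \<pi> (coords x)) ` carrier (obj X 0)"
  proof
    fix m assume "m \<in> carrier M"
    then obtain y where y: "y \<in> {..<q} \<rightarrow>\<^sub>E carrier R" "m = \<pi> y" using pres_facts(4) by blast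
    then show "m \<in> (\<lambda>x. \<pi> (coords x)) ` carrier (obj X 0)" using coords_onto[OF y(1)] by blast
  qed
qed

text \<open>
  A boundary comes from \<open>d\<close> or from \<open>Ann M\<close>, and \<open>\<pi>\<close> vanishes on both parts. Conversely, the kernel
  of \<open>\<pi>\<close> is the image of \<open>d\<close>, and \<open>\<eta>\<close> places the source of \<open>d\<close> into degree 1 of \<open>X\<^sub>M\<close>.
\<close>

lemma augmentation_kernel:
  assumes x: "x \<in> carrier (obj X 0)"
  shows "\<pi> (coords x) = \<zero>\<^bsub>M\<^esub> \<longleftrightarrow> x \<in> boundaries X 0"
proof
  note P = pres_facts and fin = basis_in_facts(1)[OF based_complex_T]
  interpret N: module R M by (rule P(1))
  interpret Q: module R "free_module R {..<q}" by (rule free_is_module)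
  {
    assume "\<pi> (coords x) = \<zero>\<^bsub>M\<^esub>"
    moreover have "coords x \<in> {..<q} \<rightarrow>\<^sub>E carrier R" using module_homD(1)[OF coords_hom x] by simp
    ultimately obtain y where y: "y \<in> {..<p} \<rightarrow>\<^sub>E carrier R" "coords x = d y" using P(5) by blast
    have bv: "(\<lambda>i. basis_vector R (basis_in T 1) ((1, i), z)) \<in> {..<p} \<rightarrow> carrier (free_module R (basis_in T 1))" by simp
    obtain \<eta> where \<eta>: "\<eta> \<in> module_hom R (free_module R {..<p}) (free_module R (basis_in T 1))"
      "\<And>i. i \<in> {..<p} \<Longrightarrow> \<eta> (basis_vector R {..<p} i) = basis_vector R (basis_in T 1) ((1, i), z)"
      by (rule free_hom_of_basis[OF free_is_module finite_lessThan bv]) (rule that)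
    have \<eta>y: "\<eta> y \<in> basis_in T 1 \<rightarrow>\<^sub>E carrier R" using module_homD(1)[OF \<eta>(1), of y] y(1) by simp
    have "coords (dif X 1 (\<eta> y)) = d y"
    proof (rule free_homs_eqI[OF free_is_module finite_lessThan _ P(2) _ y(1)])
      show "(\<lambda>y. coords (dif X 1 (\<eta> y))) \<in> module_hom R (free_module R {..<p}) (free_module R {..<q})"
        by (rule module_hom_comp[OF \<eta>(1) module_hom_comp[OF dif_X_hom coords_hom]])
    qed (use \<eta>(2) coords_dif_basis_vector(1) in simp)
    moreover have "dif X 1 (\<eta> y) \<in> carrier (obj X 0)" using module_homD(1)[OF dif_X_hom] \<eta>y by simp
    ultimately have "x = dif X 1 (\<eta> y)" using coords_inj[OF x] y(2) by simp
    then show "x \<in> boundaries X 0" unfolding boundaries_X_0 using \<eta>y by blast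
  next
    assume "x \<in> boundaries X 0"
    then obtain c where c: "c \<in> basis_in T 1 \<rightarrow>\<^sub>E carrier R" "x = dif X 1 c" unfolding boundaries_X_0 by blast
    have "\<pi> (coords (dif X 1 c)) = (\<lambda>_. \<zero>\<^bsub>M\<^esub>) c"
    proof (rule free_homs_eqI[OF P(1) fin _ _ _ c(1)])
      show "(\<lambda>c. \<pi> (coords (dif X 1 c))) \<in> module_hom R (free_module R (basis_in T 1)) M"
        by (rule module_hom_comp[OF dif_X_hom augmentation_hom])
      show "(\<lambda>_. \<zero>\<^bsub>M\<^esub>) \<in> module_hom R (free_module R (basis_in T 1)) M" by (rule module_homI) auto
    next
      fix b assume b: "b \<in> basis_in T 1"
      then consider (presentation) i where "i < p" "b = ((1, i), z)" | (koszul) j bs where "j < q" "b = ((0, j), bs)"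
        unfolding basis_in_T(3) by blast
      then show "\<pi> (coords (dif X 1 (basis_vector R (basis_in T 1) b))) = \<zero>\<^bsub>M\<^esub>"
      proof cases
        case presentation
        have "d (basis_vector R {..<p} i) \<in> {..<q} \<rightarrow>\<^sub>E carrier R" using module_homD(1)[OF P(2)] by simp
        then show ?thesis
          unfolding presentation(2) coords_dif_basis_vector(1)[OF presentation(1)]
          by (rule P(5)[THEN iffD2]) (rule imageI, rule basis_vector_closed)
      next
        case koszul
        obtain r where r: "r \<in> annihilator R M" "coords (dif X 1 (basis_vector R (basis_in T 1) b)) =
            r \<odot>\<^bsub>free_module R {..<q}\<^esub> basis_vector R {..<q} j"
          using coords_dif_basis_vector(2)[OF b[unfolded koszul(2)]] unfolding koszul(2) by blast
        have e: "basis_vector R {..<q} j \<in> carrier (free_module R {..<q})" by simp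
        have "r \<in> carrier R" using r(1) by (simp add: annihilator_def)
        then have "\<pi> (coords (dif X 1 (basis_vector R (basis_in T 1) b))) = r \<odot>\<^bsub>M\<^esub> \<pi> (basis_vector R {..<q} j)"
          unfolding r(2) using module_homD(3)[OF P(3) _ e] by blast
        also have "\<dots> = \<zero>\<^bsub>M\<^esub>" using r(1) module_homD(1)[OF P(3) e] by (simp add: annihilator_def)
        finally show ?thesis .
      qed
    qed
    then show "\<pi> (coords x) = \<zero>\<^bsub>M\<^esub>" unfolding c(2) .
  }
qed

lemma homology_0_iso: "module_iso R (homology X 0) M"
proof -
  let ?Z = "(obj X 0)\<lparr>carrier := cycles X 0\<rparr>"
  note h = homology_facts[OF complex_X, of 0]
  have "(\<lambda>x. \<pi> (coords x)) \<in> module_hom R ?Z M"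
    by (rule module_hom_restrict[OF augmentation_hom]) (simp add: cycles_X_0)
  moreover have "boundaries X 0 +>\<^bsub>?Z\<^esub> x = \<zero>\<^bsub>homology X 0\<^esub> \<longleftrightarrow> \<pi> (coords x) = \<zero>\<^bsub>M\<^esub>" if "x \<in> carrier ?Z" for x
    using quotient_eq_zero_iff[OF h(1,2) that] augmentation_kernel[of x] that cycles_X_0
    unfolding homology_def by simp
  ultimately show ?thesis
    using iso_of_surj_same_kernel[OF h(1) h(3) pres_facts(1) quotient_hom[OF h(1,2), folded homology_def]]
      augmentation_onto cycles_X_0 quotient_carrier[of ?Z "boundaries X 0", folded homology_def] by simp
qed

text \<open>
  If \<open>M\<close> vanishes at \<open>P\<close>, multiply elements outside \<open>P\<close> that kill the single generators of \<open>M\<close>. The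
  product lies in \<open>Ann M\<close> but not in \<open>P\<close>, and it kills the homology. The converse needs degree 0
  only, where the homology is \<open>M\<close>.
\<close>

lemma support_X: "cplx_support R X = module_support R M"
proof (rule Set.set_eqI)
  fix P
  note F = pres_facts
  interpret N: module R M by (rule F(1))
  have "(\<forall>n. \<forall>x\<in>cycles X n. \<exists>u\<in>carrier R - P. u \<odot>\<^bsub>obj X n\<^esub> x \<in> boundaries X n) \<longleftrightarrow>
      (\<forall>m\<in>carrier M. \<exists>u\<in>carrier R - P. u \<odot>\<^bsub>M\<^esub> m = \<zero>\<^bsub>M\<^esub>)" if P: "primeideal P R"
  proof
    assume a: "\<forall>n. \<forall>x\<in>cycles X n. \<exists>u\<in>carrier R - P. u \<odot>\<^bsub>obj X n\<^esub> x \<in> boundaries X n"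
    show "\<forall>m\<in>carrier M. \<exists>u\<in>carrier R - P. u \<odot>\<^bsub>M\<^esub> m = \<zero>\<^bsub>M\<^esub>"
    proof
      fix m assume "m \<in> carrier M"
      then obtain x where x: "x \<in> carrier (obj X 0)" "m = \<pi> (coords x)" using augmentation_onto by blast
      obtain u where u: "u \<in> carrier R - P" "u \<odot>\<^bsub>obj X 0\<^esub> x \<in> boundaries X 0"
        using a x(1) unfolding cycles_X_0[symmetric] by blast
      have uR: "u \<in> carrier R" using u(1) by simp
      have ux: "u \<odot>\<^bsub>obj X 0\<^esub> x \<in> carrier (obj X 0)"
        using u(2) boundaries_submod(4)[OF complex_X, of 0] cycles_X_0 by blast
      have "u \<odot>\<^bsub>M\<^esub> m = \<zero>\<^bsub>M\<^esub>"
        using augmentation_kernel[OF ux] u(2) module_homD(3)[OF augmentation_hom uR x(1)] x(2) by simp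
      then show "\<exists>u\<in>carrier R - P. u \<odot>\<^bsub>M\<^esub> m = \<zero>\<^bsub>M\<^esub>" using u(1) by blast
    qed
  next
    assume a: "\<forall>m\<in>carrier M. \<exists>u\<in>carrier R - P. u \<odot>\<^bsub>M\<^esub> m = \<zero>\<^bsub>M\<^esub>"
    have fin: "\<exists>u\<in>carrier R - P. \<forall>m\<in>G. u \<odot>\<^bsub>M\<^esub> m = \<zero>\<^bsub>M\<^esub>" if "finite G" "G \<subseteq> carrier M" for G
      using that
    proof (induction G rule: finite_induct)
      case empty
      then show ?case using prime_complement(2)[OF P] by blast
    next
      case (insert g G)
      obtain u where u: "u \<in> carrier R - P" "\<And>m. m \<in> G \<Longrightarrow> u \<odot>\<^bsub>M\<^esub> m = \<zero>\<^bsub>M\<^esub>" using insert by auto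
      obtain v where v: "v \<in> carrier R - P" "v \<odot>\<^bsub>M\<^esub> g = \<zero>\<^bsub>M\<^esub>" using a insert.prems by blast
      have c: "u \<in> carrier R" "v \<in> carrier R" using u(1) v(1) by auto
      have "(u \<otimes> v) \<odot>\<^bsub>M\<^esub> m = \<zero>\<^bsub>M\<^esub>" if m: "m \<in> insert g G" for m
      proof (cases "m = g")
        case True
        then show ?thesis using c v(2) insert.prems by (simp add: N.smult_assoc1)
      next
        case False
        then have "m \<in> G" "m \<in> carrier M" using m insert.prems by auto
        then show ?thesis using c u(2)[of m] by (simp add: m_comm[of u v] N.smult_assoc1)
      qed
      then show ?case using prime_complement(3)[OF P u(1) v(1)] by blast
    qed
    have im: "(\<lambda>j. \<pi> (basis_vector R {..<q} j)) ` {..<q} \<subseteq> carrier M"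
      using module_homD(1)[OF F(3)] by auto
    obtain u where u: "u \<in> carrier R - P" "\<And>j. j < q \<Longrightarrow> u \<odot>\<^bsub>M\<^esub> \<pi> (basis_vector R {..<q} j) = \<zero>\<^bsub>M\<^esub>"
      using fin[OF finite_imageI[OF finite_lessThan] im] by blast
    then have "u \<in> annihilator R M" using generators_annihilator[OF F(1) finite_lessThan F(3,4), of u] by simp
    then show "\<forall>n. \<forall>x\<in>cycles X n. \<exists>u\<in>carrier R - P. u \<odot>\<^bsub>obj X n\<^esub> x \<in> boundaries X n"
      using annihilator_kills_cycles u(1) by blast
  qed
  then show "P \<in> cplx_support R X \<longleftrightarrow> P \<in> module_support R M"
    unfolding mem_cplx_support[OF complex_X] mem_module_support[OF F(1)] by blast
qed

end

section \<open>The zero complex\<close>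

lemma zero_module_is_module: "module R (zero_module :: ('a, unit) module)"
  by (intro moduleI abelian_groupI is_cring) (auto simp: zero_module_def)

lemma zero_module_fp: "finitely_presented R (zero_module :: ('a, unit) module)"
proof (rule fpI[OF zero_module_is_module, of "\<lambda>_. ()" 0])
  show "fin_gen R (free_module R {..<0}) (a_kernel (free_module R {..<0::nat}) (zero_module :: ('a, unit) module) (\<lambda>_. ()))"
    using free_fin_gen[of "{..<0::nat}"] by (simp add: a_kernel_def' zero_module_def)
qed (auto simp: module_hom_def zero_module_def)

lemma zero_cplx_is_complex: "is_complex R (zero_cplx :: ('a, unit) cplx)"
  unfolding is_complex_def zero_cplx_def cplx.simps
  using zero_module_is_module by (auto simp: module_hom_def zero_module_def)

lemma zero_cplx_bounded: "is_bounded_finite_free R (zero_cplx :: ('a, unit) cplx)"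
proof -
  have "module_iso R (free_module R {..<0::nat}) (zero_module :: ('a, unit) module)"
    by (rule module_isoI[of "\<lambda>_. ()" _ _ "\<lambda>_ _. undefined"]) (auto simp: module_hom_def zero_module_def)
  moreover have "is_zero_module (zero_module :: ('a, unit) module)" by (simp add: is_zero_module_def zero_module_def)
  ultimately show ?thesis
    unfolding is_bounded_finite_free_def using zero_cplx_is_complex
    by (metis (no_types, lifting) cplx.select_convs(1) zero_cplx_def)
qed

lemma zero_cplx_cycles:
  "cycles (zero_cplx :: ('a, unit) cplx) n = UNIV" "boundaries (zero_cplx :: ('a, unit) cplx) n = UNIV"
  by (auto simp: cycles_def boundaries_def mem_a_kernel zero_cplx_def zero_module_def)

lemma zero_cplx_homology:
  shows "is_zero_module (homology (zero_cplx :: ('a, unit) cplx) n)"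
    and "finitely_presented R (homology (zero_cplx :: ('a, unit) cplx) n)"
proof -
  show "is_zero_module (homology (zero_cplx :: ('a, unit) cplx) n)"
    unfolding is_zero_module_def homology_def quotient_carrier zero_cplx_cycles
    by (auto simp: quotient_module_def a_r_coset_def')
  show "finitely_presented R (homology (zero_cplx :: ('a, unit) cplx) n)"
    by (rule homology_fp[OF zero_cplx_is_complex]) (simp add: zero_cplx_def zero_module_fp)
qed

lemma zero_modules_iso:
  assumes "module R A" "module R B" "is_zero_module A" "is_zero_module B"
  shows "module_iso R A B"
proof -
  interpret A: module R A by fact
  interpret B: module R B by fact
  show ?thesis
    by (rule module_isoI[of "\<lambda>_. \<zero>\<^bsub>B\<^esub>" _ _ "\<lambda>_. \<zero>\<^bsub>A\<^esub>"])
      (use assms(3,4) in \<open>auto simp: module_hom_def is_zero_module_def\<close>)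
qed

lemma zero_cplx_support:
  assumes "module R M" "is_zero_module M"
  shows "cplx_support R (zero_cplx :: ('a, unit) cplx) = module_support R M"
proof (rule Set.set_eqI)
  fix P
  interpret M: module R M by fact
  have "\<one> \<in> carrier R - P" if "primeideal P R" by (rule prime_complement(2)[OF that])
  then show "P \<in> cplx_support R (zero_cplx :: ('a, unit) cplx) \<longleftrightarrow> P \<in> module_support R M"
    unfolding mem_cplx_support[OF zero_cplx_is_complex] mem_module_support[OF assms(1)] zero_cplx_cycles
    using assms(2) unfolding is_zero_module_def by auto
qed

lemma zero_cplx_in_ab: "in_ab R M (homology (zero_cplx :: ('a, unit) cplx) n)"
  unfolding in_ab_iff_in_class
  by (rule in_class_zero[OF abelian_class_ab zero_cplx_homology(2) zero_cplx_homology(1)])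

end

section \<open>Homology and support of \<open>X\<^sub>M\<close>\<close>

theorem theorem3p1:
  fixes R :: "('a, 'c) ring_scheme"
    and M :: "('a, 'm, 'e) module_scheme"
    and as :: "'a list"
    and p q :: nat
    and d :: "(nat \<Rightarrow> 'a) \<Rightarrow> (nat \<Rightarrow> 'a)"
    and \<pi> :: "(nat \<Rightarrow> 'a) \<Rightarrow> 'm"
  assumes "coherent_ring R"
    and "finitely_presented R M"
    and "set as \<subseteq> carrier R"
    and "Idl\<^bsub>R\<^esub> (set as) = annihilator R M"
    and "is_presentation R M p q d \<pi>"
  shows "(is_bounded_finite_free R (X_cplx R p q d as) \<and>
          module_iso R (homology (X_cplx R p q d as) 0) M \<and>
          (\<forall>j::int. in_ab R M (homology (X_cplx R p q d as) j)) \<and>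
          cplx_support R (X_cplx R p q d as) = module_support R M) \<and>
         (is_zero_module M \<longrightarrow>
          is_bounded_finite_free R (zero_cplx :: ('a, unit) cplx) \<and>
          module_iso R (homology (zero_cplx :: ('a, unit) cplx) 0) M \<and>
          (\<forall>j::int. in_ab R M (homology (zero_cplx :: ('a, unit) cplx) j)) \<and>
          cplx_support R (zero_cplx :: ('a, unit) cplx) = module_support R M)"
proof -
  have "cring R" using assms(1) unfolding coherent_ring_def by blast
  then interpret coherent R using assms(1) by (intro coherent.intro coherent_axioms.intro)
  note h = assms(2-5)
  have "module_iso R (homology (zero_cplx :: ('a, unit) cplx) 0) M" if "is_zero_module M"
    using zero_modules_iso[OF fp_module[OF zero_cplx_homology(2)] fp_module[OF h(1)] zero_cplx_homology(1) that] .
  then show ?thesis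
    using bounded_X[OF h] homology_0_iso[OF h] homology_in_ab[OF h] support_X[OF h]
      zero_cplx_bounded zero_cplx_in_ab zero_cplx_support[OF fp_module[OF h(1)]] by blast
qed

end
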